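(* Let $\mathcal{H}$ be the set of points of $\Lambda_\Gamma$ which are not fixed by a parabolic element of $\Gamma$. Then: (i) for every $\theta\in\mathcal{H}$, the directional foliation $\mathcal{F}_\theta$ of the Disco surface $\Sigma$ is not dynamically trivial; (ii) for every $\theta\in\Lambda_\Gamma\setminus\mathcal{H}$, the directional foliation $\mathcal{F}_\theta$ of $\Sigma$ is totally periodic.
   Context: Disco surface. Let $\Sigma$ be the surface obtained from the rectangle $[0,6]\times[0,1]\subset\mathbb{R}^2\simeq\mathbb{C}$ by gluing the left side to the right side by translation, and gluing top sides to bottom sides as follows: $[0,1]\times\{1\}$ to $[1,3]\times\{0\}$, $[1,3]\times\{1\}$ to $[0,1]\times\{0\}$, $[3,5]\times\{1\}$ to $[5,6]\times\{0\}$, $[5,6]\times\{1\}$ to $[3,5]\times\{0\}$, each by the unique map $z\mapsto az+b$ with $a>0$, $b\in\mathbb{C}$, sending one side to the other. It is a closed genus $2$ surface, with a set $S$ of two singular points (the images of the points $(k,0),(k,1)$, $k\in\{0,1,3,5,6\}$), each of angle $4\pi$; on $\Sigma\setminus S$ there is an atlas with transition maps locally of the form $z\mapsto az+b$, $a>0$, $b\in\mathbb{C}$. Foliations. For $\theta\in S^1$, $\mathcal{F}_\theta$ is the oriented singular foliation of $\Sigma$ given in the charts by straight lines in the direction $\theta$ (with saddle-like singularities at $S$). A leaf is regular if it does not meet a singular point. A closed leaf is attracting (resp. repulsing) if its first return (holonomy) map on a transversal has derivative $<1$ (resp. $>1$) at the leaf. $\mathcal{F}_\theta$ is dynamically trivial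 if it has a closed attracting leaf $F^+$ and a unique repulsing leaf $F^-$, and every regular leaf different from $F^-$ accumulates on $F^+$. $\mathcal{F}_\theta$ is totally periodic if all its regular leaves are closed and $\Sigma$ decomposes, along saddle connections in the direction $\theta$ (leaves joining singular points), into flat cylinders (a flat cylinder being the surface obtained by gluing two opposite sides of a Euclidean rectangle by translation). Group. $\Gamma<\mathrm{PSL}(2,\mathbb{R})$ is the group generated by the classes of $\begin{pmatrix}1&6\\0&1\end{pmatrix}$ and $\begin{pmatrix}1&0\\ \frac32&1\end{pmatrix}$. It acts on the hyperbolic plane $\mathbb{H}^2$ and its limit set $\Lambda_\Gamma\subset\partial\mathbb{H}^2=\mathbb{RP}^1$ is the set of accumulation points of any orbit $\Gamma\cdot z_0$, $z_0\in\mathbb{H}^2$. Directions $\theta\in S^1$ are considered modulo $-\mathrm{Id}$, i.e. as points $[x:y]$ of $\mathbb{RP}^1$ (the line spanned by the vector $(x,y)$), on which $\Gamma$ acts linearly; the point $[x:y]$ corresponds to $x/y\in\mathbb{R}\cup\{\infty\}=\partial\mathbb{H}^2$ in the upper half-plane model. *)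

theory Defs
  imports "HOL-Analysis.Analysis" "HOL-Algebra.Generated_Groups"
begin

section \<open>The Disco surface\<close>

definition disco_rect :: "complex set" where
  "disco_rect = {z. 0 \<le> Re z \<and> Re z \<le> 6 \<and> 0 \<le> Im z \<and> Im z \<le> 1}"

text \<open>The pairs identified when the segment from \<open>p\<close> to \<open>q\<close> is glued affinely onto the segment
  from \<open>p'\<close> to \<open>q'\<close>. When \<open>q' - p'\<close> is a positive multiple of \<open>q - p\<close>, as in all cases below, this
  is the graph of the unique \<open>z \<mapsto> a z + b\<close> with \<open>a > 0\<close> sending one side to the other.\<close>

definition glue_sides :: "complex \<Rightarrow> complex \<Rightarrow> complex \<Rightarrow> complex \<Rightarrow> (complex \<times> complex) set" where
  "glue_sides p q p' q' = (\<lambda>t. (linepath p q t, linepath p' q' t)) ` {0..1}"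

definition disco_glue :: "(complex \<times> complex) set" where
  "disco_glue =
     glue_sides (Complex 0 0) (Complex 0 1) (Complex 6 0) (Complex 6 1) \<union>
     glue_sides (Complex 0 1) (Complex 1 1) (Complex 1 0) (Complex 3 0) \<union>
     glue_sides (Complex 1 1) (Complex 3 1) (Complex 0 0) (Complex 1 0) \<union>
     glue_sides (Complex 3 1) (Complex 5 1) (Complex 5 0) (Complex 6 0) \<union>
     glue_sides (Complex 5 1) (Complex 6 1) (Complex 3 0) (Complex 5 0)"

definition disco_rel :: "(complex \<times> complex) set" where
  "disco_rel = (disco_glue \<union> disco_glue\<inverse>)\<^sup>* \<inter> disco_rect \<times> disco_rect"

definition disco_surface :: "complex set set" where
  "disco_surface = disco_rect // disco_rel"

definition disco_proj :: "complex \<Rightarrow> complex set" where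
  "disco_proj z = disco_rel `` {z}"

definition disco_top :: "complex set topology" where
  "disco_top = topology (\<lambda>U. U \<subseteq> disco_surface \<and>
     openin (top_of_set disco_rect) {z \<in> disco_rect. disco_proj z \<in> U})"

lemma istopology_disco:
  "istopology (\<lambda>U. U \<subseteq> disco_surface \<and>
     openin (top_of_set disco_rect) {z \<in> disco_rect. disco_proj z \<in> U})"
proof -
  have inter: "{z \<in> disco_rect. disco_proj z \<in> U \<inter> V} =
      {z \<in> disco_rect. disco_proj z \<in> U} \<inter> {z \<in> disco_rect. disco_proj z \<in> V}" for U V
    by (simp add: set_eq_iff) fast
  have union: "{z \<in> disco_rect. disco_proj z \<in> \<Union>K} =
      \<Union>((\<lambda>U. {z \<in> disco_rect. disco_proj z \<in> U}) ` K)" for K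
    by (simp add: set_eq_iff)
  show ?thesis
    unfolding istopology_def inter union
    by (simp add: openin_Int Ball_def Sup_le_iff le_infI1)
      (intro allI impI openin_Union, clarsimp)
qed

lemma openin_disco_top:
  "openin disco_top U \<longleftrightarrow> U \<subseteq> disco_surface \<and>
     openin (top_of_set disco_rect) {z \<in> disco_rect. disco_proj z \<in> U}"
  unfolding disco_top_def by (simp only: topology_inverse'[OF istopology_disco])

definition disco_sing :: "complex set set" where
  "disco_sing = (\<lambda>(x, y). disco_proj (Complex x y)) ` ({0, 1, 3, 5, 6} \<times> {0, 1})"

text \<open>Charts of the maximal dilation atlas on the complement of the singular points: local
  coordinates which, read in the rectangle, are locally of the form \<open>z \<mapsto> a z + b\<close> with \<open>a > 0\<close>.
  At a point of a glued side, \<open>a\<close> and \<open>b\<close> may differ from one preimage to the other.\<close>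

definition disco_chart :: "complex set set \<Rightarrow> (complex set \<Rightarrow> complex) \<Rightarrow> bool" where
  "disco_chart U \<phi> \<longleftrightarrow>
     openin disco_top U \<and> U \<inter> disco_sing = {} \<and> open (\<phi> ` U) \<and>
     homeomorphic_map (subtopology disco_top U) (top_of_set (\<phi> ` U)) \<phi> \<and>
     (\<forall>z\<in>disco_rect. disco_proj z \<in> U \<longrightarrow>
        (\<exists>a>0. \<exists>b. \<exists>e>0. \<forall>w\<in>disco_rect \<inter> ball z e.
           disco_proj w \<in> U \<and> \<phi> (disco_proj w) = of_real a * w + b))"


section \<open>Directional foliations\<close>

text \<open>A direction is a complex number \<open>\<theta>\<close> of modulus 1. A straight path runs along the oriented
  foliation in direction \<open>\<theta>\<close>; it avoids the singular points except possibly at its endpoints (the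
  existence of a chart at each interior point excludes them there).\<close>

definition straight_path :: "complex \<Rightarrow> (real \<Rightarrow> complex set) \<Rightarrow> bool" where
  "straight_path \<theta> g \<longleftrightarrow>
     continuous_map (top_of_set {0..1}) disco_top g \<and>
     (\<forall>t\<in>{0<..<1}. \<exists>U \<phi>. disco_chart U \<phi> \<and>
        (\<exists>e>0. \<forall>s\<in>{0<..<1} \<inter> ball t e. g s \<in> U \<and>
           (\<forall>s'\<in>{0<..<1} \<inter> ball t e. s < s' \<longrightarrow>
              (\<exists>r>0. \<phi> (g s') - \<phi> (g s) = of_real r * \<theta>))))"

definition forward_leaf :: "complex \<Rightarrow> complex set \<Rightarrow> complex set set" where
  "forward_leaf \<theta> p = insert p {q. \<exists>g. straight_path \<theta> g \<and> g 0 = p \<and> g 1 = q}"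

definition backward_leaf :: "complex \<Rightarrow> complex set \<Rightarrow> complex set set" where
  "backward_leaf \<theta> p = insert p {q. \<exists>g. straight_path \<theta> g \<and> g 0 = q \<and> g 1 = p}"

text \<open>A leaf which runs into (or emanates from) a singular point contains that point.\<close>

definition leaves :: "complex \<Rightarrow> complex set set set" where
  "leaves \<theta> = (\<lambda>p. forward_leaf \<theta> p \<union> backward_leaf \<theta> p) ` (disco_surface - disco_sing)"

definition regular_leaf :: "complex \<Rightarrow> complex set set \<Rightarrow> bool" where
  "regular_leaf \<theta> L \<longleftrightarrow> L \<in> leaves \<theta> \<and> L \<inter> disco_sing = {}"

definition closed_leaf :: "complex \<Rightarrow> complex set set \<Rightarrow> bool" where
  "closed_leaf \<theta> L \<longleftrightarrow> L \<in> leaves \<theta> \<and>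
     (\<exists>g. straight_path \<theta> g \<and> g 0 = g 1 \<and> g 0 \<notin> disco_sing \<and> L = g ` {0..1})"

definition first_return :: "complex \<Rightarrow> complex set set \<Rightarrow> complex set \<Rightarrow> complex set \<Rightarrow> bool" where
  "first_return \<theta> T q q' \<longleftrightarrow> q \<in> T \<and> q' \<in> T \<and>
     (\<exists>g. straight_path \<theta> g \<and> g 0 = q \<and> g 1 = q' \<and> (\<forall>t\<in>{0<..<1}. g t \<notin> T))"

text \<open>The transversal is the segment \<open>\<tau>\<close> orthogonal to \<open>\<theta>\<close> in a chart, centred at a point
  \<open>p = \<tau> 0\<close> of the leaf, and \<open>f\<close> is its first return map near \<open>p\<close>, which fixes \<open>p\<close>.\<close>

definition has_holonomy_derivative :: "complex \<Rightarrow> complex set set \<Rightarrow> real \<Rightarrow> bool" where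
  "has_holonomy_derivative \<theta> L d \<longleftrightarrow>
     (\<exists>U \<phi> \<epsilon> \<tau> f \<delta>. disco_chart U \<phi> \<and> 0 < \<epsilon> \<and> 0 < \<delta> \<and> \<delta> \<le> \<epsilon> \<and>
        \<tau> 0 \<in> L \<and>
        (\<forall>s\<in>{-\<epsilon><..<\<epsilon>}. \<tau> s \<in> U \<and> \<phi> (\<tau> s) = \<phi> (\<tau> 0) + of_real s * (\<i> * \<theta>)) \<and>
        (\<forall>s\<in>{-\<delta><..<\<delta>}. f s \<in> {-\<epsilon><..<\<epsilon>} \<and>
           first_return \<theta> (\<tau> ` {-\<epsilon><..<\<epsilon>}) (\<tau> s) (\<tau> (f s))) \<and>
        f 0 = 0 \<and> (f has_real_derivative d) (at 0))"

definition attracting_leaf :: "complex \<Rightarrow> complex set set \<Rightarrow> bool" where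
  "attracting_leaf \<theta> L \<longleftrightarrow> closed_leaf \<theta> L \<and> (\<exists>d<1. has_holonomy_derivative \<theta> L d)"

definition repulsing_leaf :: "complex \<Rightarrow> complex set set \<Rightarrow> bool" where
  "repulsing_leaf \<theta> L \<longleftrightarrow> closed_leaf \<theta> L \<and> (\<exists>d>1. has_holonomy_derivative \<theta> L d)"

definition omega_limit :: "complex \<Rightarrow> complex set set \<Rightarrow> complex set set" where
  "omega_limit \<theta> L = (\<Inter>p\<in>L. disco_top closure_of forward_leaf \<theta> p)"

definition dynamically_trivial :: "complex \<Rightarrow> bool" where
  "dynamically_trivial \<theta> \<longleftrightarrow>
     (\<exists>Fp Fm. attracting_leaf \<theta> Fp \<and>
        repulsing_leaf \<theta> Fm \<and> (\<forall>L. repulsing_leaf \<theta> L \<longrightarrow> L = Fm) \<and>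
        (\<forall>L. regular_leaf \<theta> L \<and> L \<noteq> Fm \<longrightarrow> Fp \<subseteq> omega_limit \<theta> L))"

definition saddle_connections :: "complex \<Rightarrow> complex set set set" where
  "saddle_connections \<theta> =
     {g ` {0..1} |g. straight_path \<theta> g \<and> g 0 \<in> disco_sing \<and> g 1 \<in> disco_sing}"

definition saddle_graph :: "complex \<Rightarrow> complex set set" where
  "saddle_graph \<theta> = disco_sing \<union> \<Union>(saddle_connections \<theta>)"

text \<open>The cylinder obtained by gluing two opposite sides of the rectangle \<open>[0,l] \<times> [0,h]\<close> by
  translation is the strip \<open>0 \<le> Im z \<le> h\<close> modulo \<open>z \<mapsto> z + l\<close>. It is mapped to the surface with
  its core curves in direction \<open>\<theta>\<close>, hence the factor \<open>\<theta>\<close> in charts, and \<open>C\<close> is the image of its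
  interior. The boundary of the cylinder goes to the saddle connections, where identifications may
  occur.\<close>

definition flat_cylinder :: "complex \<Rightarrow> complex set set \<Rightarrow> bool" where
  "flat_cylinder \<theta> C \<longleftrightarrow>
     (\<exists>l>0. \<exists>h>0. \<exists>\<Psi>.
        continuous_map (top_of_set {z. 0 \<le> Im z \<and> Im z \<le> h}) disco_top \<Psi> \<and>
        C = \<Psi> ` {z. 0 < Im z \<and> Im z < h} \<and>
        \<Psi> ` {z. Im z = 0 \<or> Im z = h} \<subseteq> saddle_graph \<theta> \<and>
        (\<forall>z\<in>{z. 0 < Im z \<and> Im z < h}. \<forall>w\<in>{z. 0 < Im z \<and> Im z < h}.
           \<Psi> z = \<Psi> w \<longleftrightarrow> (\<exists>n::int. w - z = of_int n * of_real l)) \<and>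
        (\<forall>z\<in>{z. 0 < Im z \<and> Im z < h}. \<exists>U \<phi>. disco_chart U \<phi> \<and>
           (\<exists>a>0. \<exists>b. \<exists>e>0. \<forall>w\<in>ball z e.
              \<Psi> w \<in> U \<and> \<phi> (\<Psi> w) = of_real a * \<theta> * w + b)))"

definition totally_periodic :: "complex \<Rightarrow> bool" where
  "totally_periodic \<theta> \<longleftrightarrow>
     (\<forall>L. regular_leaf \<theta> L \<longrightarrow> closed_leaf \<theta> L) \<and>
     (\<exists>\<C>. finite \<C> \<and> disjoint \<C> \<and> (\<forall>C\<in>\<C>. flat_cylinder \<theta> C) \<and>
        \<Union>\<C> = disco_surface - saddle_graph \<theta>)"


section \<open>The group and its limit set\<close>

definition SL2 :: "(real^2^2) monoid" where
  "SL2 = \<lparr>carrier = {M. det M = 1}, mult = (**), one = mat 1\<rparr>"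

definition PSL2 :: "(real^2^2) set monoid" where
  "PSL2 = SL2 Mod {mat 1, - mat 1}"

definition psl_class :: "real^2^2 \<Rightarrow> (real^2^2) set" where
  "psl_class M = {mat 1, - mat 1} #>\<^bsub>SL2\<^esub> M"

definition disco_group :: "(real^2^2) set set" where
  "disco_group = generate PSL2
     {psl_class (vector [vector [1, 6], vector [0, 1]]),
      psl_class (vector [vector [1, 0], vector [3/2, 1]])}"

text \<open>Elements of \<open>PSL2\<close> are classes \<open>{M, -M}\<close>; whatever is said below of a member of such a class
  does not depend on its choice.\<close>

definition parabolic :: "(real^2^2) set \<Rightarrow> bool" where
  "parabolic X \<longleftrightarrow> X \<in> carrier PSL2 \<and> X \<noteq> \<one>\<^bsub>PSL2\<^esub> \<and> (\<exists>M\<in>X. \<bar>trace M\<bar> = 2)"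

definition moebius :: "real^2^2 \<Rightarrow> complex \<Rightarrow> complex" where
  "moebius M z = (of_real (M$1$1) * z + of_real (M$1$2)) / (of_real (M$2$1) * z + of_real (M$2$2))"

definition hyp_orbit :: "(real^2^2) set set \<Rightarrow> complex \<Rightarrow> complex set" where
  "hyp_orbit G z0 = {moebius M z0 |M X. X \<in> G \<and> M \<in> X}"

text \<open>Points of the real projective line are the lines \<open>span {v}\<close> with \<open>v\<close> a nonzero vector. The
  line \<open>[x:y]\<close> is the boundary point \<open>x/y\<close> of the upper half-plane; the following filter describes its
  punctured neighbourhoods in the Riemann sphere.\<close>

definition boundary_filter :: "real^2 \<Rightarrow> complex filter" where
  "boundary_filter v = (if v$2 = 0 then at_infinity else at (of_real (v$1 / v$2)))"

definition limit_set :: "(real^2^2) set set \<Rightarrow> complex \<Rightarrow> (real^2) set set" where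
  "limit_set G z0 = {span {v} |v. v \<noteq> 0 \<and> (\<exists>\<^sub>F z in boundary_filter v. z \<in> hyp_orbit G z0)}"

definition fixes_line :: "(real^2^2) set \<Rightarrow> (real^2) set \<Rightarrow> bool" where
  "fixes_line X l \<longleftrightarrow> (\<exists>M\<in>X. (\<lambda>v. M *v v) ` l = l)"

definition nonparabolic_limit_set :: "(real^2^2) set set \<Rightarrow> complex \<Rightarrow> (real^2) set set" where
  "nonparabolic_limit_set G z0 =
     {l \<in> limit_set G z0. \<not> (\<exists>X\<in>G. parabolic X \<and> fixes_line X l)}"

definition direction_line :: "complex \<Rightarrow> (real^2) set" where
  "direction_line \<theta> = span {vector [Re \<theta>, Im \<theta>]}"

end

theory Submission
  imports Defs
begin

text \<open>Let \<open>hshear m\<close> and \<open>vshear m\<close> be the linear maps with matrices \<open>(1, 6m; 0, 1)\<close> and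
  \<open>(1, 0; 3m/2, 1)\<close>. The surface is one horizontal cylinder of height 1 and length 6, and also two
  vertical cylinders of width 1 and length 3/2, which a half turn exchanges, so both maps are realised
  by affine homeomorphisms: Dehn twists along these cylinders. Hence they preserve the set of totally
  periodic directions. Ping-pong shows that every parabolic element fixes the image of the horizontal
  or of the vertical direction, both of which are totally periodic; this is (ii).

  An attracting closed leaf develops to a closed curve with scaling \<open>c \<noteq> 1\<close>. It persists as a closed
  leaf with the same scaling in all nearby directions, so none of these is totally periodic.
  But near every limit direction there are parabolic ones, which are totally periodic; this is (i).\<close>

section \<open>The quotient topology\<close>

text \<open>Charts come from a maximal atlas, but computations need explicit coordinates; the proof
  therefore works with parametrizations, maps from the plane to the surface that are affine when
  read in a chart. The vertical length is 3/2 = 1 + 1/2 because the second rectangle is twice as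
  wide and enters at half scale; both vertical cylinders have the same modulus, so twisting both
  gives one linear part. The delicate point of (i) is that c \<noteq> 1: the hypothesis only says
  that some first return map, realised by unspecified paths, has derivative below 1 at one point. It
  is shown that c = 1 would make this map the identity near that point. For a perturbed direction
  the closed leaf starts at the fixed point of the affine return map; a parallel curve at distance y
  comes back at distance c y, whereas heights are constant in a flat cylinder. For (ii), the
  rescaling x = 2 x' turns both families into shears by multiples of 3, which makes ping-pong
  symmetric: alternating words of even length expand, and those of odd length shorten by
  conjugation.\<close>

lemma mem_disco_rect: "z \<in> disco_rect \<longleftrightarrow> 0 \<le> Re z \<and> Re z \<le> 6 \<and> 0 \<le> Im z \<and> Im z \<le> 1"
  by (simp add: disco_rect_def)

lemma glue_sides_horizontal:
  assumes "a < b"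
  shows "(z, w) \<in> glue_sides (Complex a y) (Complex b y) (Complex c y') (Complex d y') \<longleftrightarrow>
    Im z = y \<and> Im w = y' \<and> a \<le> Re z \<and> Re z \<le> b \<and> Re w = c + (d - c) * ((Re z - a) / (b - a))"
    (is "?L \<longleftrightarrow> ?R")
proof
  assume ?L
  then obtain t where t: "0 \<le> t" "t \<le> 1" "z = linepath (Complex a y) (Complex b y) t"
      "w = linepath (Complex c y') (Complex d y') t"
    by (auto simp: glue_sides_def)
  have "Re z = a + t * (b - a)" "Im z = y" "Re w = c + t * (d - c)" "Im w = y'"
    unfolding t(3,4) by (simp_all add: linepath_def algebra_simps)
  moreover have "a + t * (b - a) \<le> b"
    using mult_left_le_one_le[of "b - a" t] t(1,2) assms by linarith
  moreover have "(a + t * (b - a) - a) / (b - a) = t" using assms by simp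
  ultimately show ?R using t(1,2) assms by (simp add: mult.commute)
next
  assume R: ?R
  let ?t = "(Re z - a) / (b - a)"
  have "?t \<in> {0..1}" using R assms by (auto simp: field_simps)
  moreover have "Re (linepath (Complex p q) (Complex p' q) s) = p + (p' - p) * s"
    "Im (linepath (Complex p q) (Complex p' q) s) = q" for p q p' s
    by (simp_all add: linepath_def algebra_simps)
  then have "z = linepath (Complex a y) (Complex b y) ?t" "w = linepath (Complex c y') (Complex d y') ?t"
    using R assms by (simp_all add: complex_eq_iff)
  ultimately show ?L unfolding glue_sides_def by blast
qed

lemma glue_sides_vertical:
  "(z, w) \<in> glue_sides (Complex 0 0) (Complex 0 1) (Complex 6 0) (Complex 6 1) \<longleftrightarrow>
    Re z = 0 \<and> Re w = 6 \<and> 0 \<le> Im z \<and> Im z \<le> 1 \<and> Im w = Im z"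
    (is "?L \<longleftrightarrow> ?R")
proof
  assume R: ?R
  then have "z = linepath (Complex 0 0) (Complex 0 1) (Im z)"
     "w = linepath (Complex 6 0) (Complex 6 1) (Im z)" "Im z \<in> {0..1}"
    by (simp_all add: linepath_def complex_eq_iff algebra_simps)
  then show ?L unfolding glue_sides_def by blast
qed (auto simp: glue_sides_def linepath_def algebra_simps)

lemma mem_disco_glue:
  "(z, w) \<in> disco_glue \<longleftrightarrow>
    Re z = 0 \<and> Re w = 6 \<and> 0 \<le> Im z \<and> Im z \<le> 1 \<and> Im w = Im z \<or>
    Im z = 1 \<and> Im w = 0 \<and>
     (0 \<le> Re z \<and> Re z \<le> 1 \<and> Re w = 1 + 2 * Re z \<or>
      1 \<le> Re z \<and> Re z \<le> 3 \<and> Re w = (Re z - 1) / 2 \<or>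
      3 \<le> Re z \<and> Re z \<le> 5 \<and> Re w = (Re z + 7) / 2 \<or>
      5 \<le> Re z \<and> Re z \<le> 6 \<and> Re w = 2 * Re z - 7)"
proof -
  have "(z, w) \<in> disco_glue \<longleftrightarrow>
    Re z = 0 \<and> Re w = 6 \<and> 0 \<le> Im z \<and> Im z \<le> 1 \<and> Im w = Im z \<or>
    (Im z = 1 \<and> Im w = 0 \<and> 0 \<le> Re z \<and> Re z \<le> 1 \<and> Re w = 1 + 2 * Re z) \<or>
    (Im z = 1 \<and> Im w = 0 \<and> 1 \<le> Re z \<and> Re z \<le> 3 \<and> Re w = (Re z - 1) / 2) \<or>
    (Im z = 1 \<and> Im w = 0 \<and> 3 \<le> Re z \<and> Re z \<le> 5 \<and> Re w = (Re z + 7) / 2) \<or>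
    (Im z = 1 \<and> Im w = 0 \<and> 5 \<le> Re z \<and> Re z \<le> 6 \<and> Re w = 2 * Re z - 7)"
    unfolding disco_glue_def Un_iff glue_sides_vertical
      glue_sides_horizontal[OF zero_less_one] 
      glue_sides_horizontal[of 1 3, simplified]
      glue_sides_horizontal[of 3 5, simplified]
      glue_sides_horizontal[of 5 6, simplified]
    by (auto simp: field_simps)
  then show ?thesis by blast
qed

text \<open>The ten corner points fall into two classes of five, those of the points 0 and 1. They
  are the only classes with more than two elements.\<close>

definition sing_a :: "complex set" where
  "sing_a = {Complex 0 0, Complex 6 0, Complex 5 1, Complex 3 0, Complex 1 1}"

definition sing_b :: "complex set" where
  "sing_b = {Complex 0 1, Complex 6 1, Complex 1 0, Complex 3 1, Complex 5 0}"

text \<open>The canonical representative of a point of the rectangle: \<open>0\<close> and \<open>1\<close> for the two singular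
  points, otherwise the point on the bottom or left side.\<close>

definition disco_nf :: "complex \<Rightarrow> complex" where
  "disco_nf z =
    (if z \<in> sing_a then Complex 0 0
     else if z \<in> sing_b then Complex 1 0
     else if Im z = 1 then
       Complex (if Re z \<le> 1 then 1 + 2 * Re z else if Re z \<le> 3 then (Re z - 1) / 2
                else if Re z \<le> 5 then (Re z + 7) / 2 else 2 * Re z - 7) 0
     else if Re z = 6 then Complex 0 (Im z) else z)"

lemma mem_sing_a: "z \<in> sing_a \<longleftrightarrow> Im z = 0 \<and> Re z \<in> {0, 3, 6} \<or> Im z = 1 \<and> Re z \<in> {1, 5}"
  and mem_sing_b: "z \<in> sing_b \<longleftrightarrow> Im z = 1 \<and> Re z \<in> {0, 3, 6} \<or> Im z = 0 \<and> Re z \<in> {1, 5}"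
  by (auto simp: sing_a_def sing_b_def complex_eq_iff)

lemma disco_glue_nf: "(z, w) \<in> disco_glue \<Longrightarrow> disco_nf z = disco_nf w"
  unfolding mem_disco_glue
  by (elim disjE conjE; simp add: disco_nf_def mem_sing_a mem_sing_b complex_eq_iff split: if_splits; argo?)

text \<open>Away from the corner points a class has at most two elements, so equal normal forms cost
  at most one gluing step. The saturation of a set can therefore be computed without iterating the
  gluing.\<close>

lemma disco_nf_eq_cases:
  assumes "disco_nf z = disco_nf w" "z \<in> disco_rect" "w \<in> disco_rect"
  shows "z = w \<or> (z, w) \<in> disco_glue \<or> (w, z) \<in> disco_glue \<or>
    z \<in> sing_a \<and> w \<in> sing_a \<or> z \<in> sing_b \<and> w \<in> sing_b"
proof -
  consider "z \<in> sing_a" | "z \<in> sing_b" "z \<notin> sing_a" | "z \<notin> sing_a" "z \<notin> sing_b" by blast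
  then show ?thesis
  proof cases
    case 1
    then have "disco_nf w = 0" using assms by (simp add: disco_nf_def complex_eq_iff)
    then have "w \<in> sing_a" using assms(3)
      by (auto simp: disco_nf_def mem_sing_a mem_sing_b complex_eq_iff mem_disco_rect split: if_splits,
          (linarith+)?)
    with 1 show ?thesis by blast
  next
    case 2
    then have "disco_nf w = Complex 1 0" using assms by (simp add: disco_nf_def)
    then have "w \<in> sing_b" using assms(3)
      by (auto simp: disco_nf_def mem_sing_a mem_sing_b complex_eq_iff mem_disco_rect split: if_splits,
          (linarith+)?)
    with 2 show ?thesis by blast
  next
    case 3
    have "w \<notin> sing_a" "w \<notin> sing_b"
      using assms 3 by (auto simp: disco_nf_def mem_sing_a mem_sing_b complex_eq_iff mem_disco_rect split:
          if_splits)
    then have nf: "disco_nf w = (if Im w = 1 then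
       Complex (if Re w \<le> 1 then 1 + 2 * Re w else if Re w \<le> 3 then (Re w - 1) / 2
                else if Re w \<le> 5 then (Re w + 7) / 2 else 2 * Re w - 7) 0
     else if Re w = 6 then Complex 0 (Im w) else w)"
     "disco_nf z = (if Im z = 1 then
       Complex (if Re z \<le> 1 then 1 + 2 * Re z else if Re z \<le> 3 then (Re z - 1) / 2
                else if Re z \<le> 5 then (Re z + 7) / 2 else 2 * Re z - 7) 0
     else if Re z = 6 then Complex 0 (Im z) else z)" using 3 by (simp_all add: disco_nf_def)
    show ?thesis
    proof (cases "Im z = 1"; cases "Im w = 1")
      assume "Im z = 1" "Im w = 1"
      moreover from this have "Re z \<notin> {0, 1, 3, 5, 6}" "Re w \<notin> {0, 1, 3, 5, 6}"
        using 3 \<open>w \<notin> sing_a\<close> \<open>w \<notin> sing_b\<close> by (auto simp: mem_sing_a mem_sing_b)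
      ultimately have "z = w"
        using assms unfolding nf mem_disco_rect complex_eq_iff by (simp split: if_splits; linarith)
      then show ?thesis by blast
    next
      assume "Im z = 1" "Im w \<noteq> 1"
      then have "(z, w) \<in> disco_glue"
        using assms unfolding nf mem_disco_rect mem_disco_glue complex_eq_iff by (simp split: if_splits)
      then show ?thesis by blast
    next
      assume "Im z \<noteq> 1" "Im w = 1"
      then have "(w, z) \<in> disco_glue"
        using assms unfolding nf mem_disco_rect mem_disco_glue complex_eq_iff by (simp split: if_splits)
      then show ?thesis by blast
    next
      assume "Im z \<noteq> 1" "Im w \<noteq> 1"
      then have "z = w \<or> (z, w) \<in> disco_glue \<or> (w, z) \<in> disco_glue"
        using assms unfolding nf mem_disco_rect mem_disco_glue complex_eq_iff by (simp split: if_splits)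
      then show ?thesis by blast
    qed
  qed
qed

lemma disco_glue_rtrancl_sym:
  "(z, w) \<in> (disco_glue \<union> disco_glue\<inverse>)\<^sup>* \<Longrightarrow> (w, z) \<in> (disco_glue \<union> disco_glue\<inverse>)\<^sup>*"
  by (meson sym_Un_converse sym_rtrancl symD)

lemma disco_nf_rtrancl:
  assumes "z \<in> disco_rect"
  shows "(z, disco_nf z) \<in> (disco_glue \<union> disco_glue\<inverse>)\<^sup>*" (is "_ \<in> ?E")
proof -
  have tr: "(p, r) \<in> ?E" if "(p, q) \<in> ?E" "(q, r) \<in> ?E" for p q r
    using that by (rule rtrancl_trans)
  have sy: "(p, q) \<in> ?E \<longleftrightarrow> (q, p) \<in> ?E" for p q
    using disco_glue_rtrancl_sym by blast
  have gl: "(p, q) \<in> ?E" if "(p, q) \<in> disco_glue" for p q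
    using that by blast
  note g = gl[unfolded mem_disco_glue]
  \<comment> \<open>Under the gluing the corners form two paths, 0, 6, 5 + i, 3, 1 + i and 6 + i, i,
    1, 3 + i, 5; these are their edges.\<close>
  have a1: "(Complex 0 0, Complex 6 0) \<in> ?E" and a2: "(Complex 5 1, Complex 6 0) \<in> ?E"
    and a3: "(Complex 5 1, Complex 3 0) \<in> ?E" and a4: "(Complex 1 1, Complex 3 0) \<in> ?E"
    and b1: "(Complex 0 1, Complex 6 1) \<in> ?E" and b2: "(Complex 0 1, Complex 1 0) \<in> ?E"
    and b3: "(Complex 3 1, Complex 1 0) \<in> ?E" and b4: "(Complex 3 1, Complex 5 0) \<in> ?E"
    by (rule g, simp)+
  have a: "(p, Complex 0 0) \<in> ?E" if "p \<in> sing_a" for p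
    using that a1 a2 a3 a4 unfolding sing_a_def
        by (elim insertE) (metis tr sy rtrancl.rtrancl_refl empty_iff)+
  have b: "(p, Complex 1 0) \<in> ?E" if "p \<in> sing_b" for p
    using that b1 b2 b3 b4 unfolding sing_b_def
        by (elim insertE) (metis tr sy rtrancl.rtrancl_refl empty_iff)+
  show ?thesis
  proof (cases "z \<in> sing_a \<or> z \<in> sing_b")
    case True
    then show ?thesis using a b by (auto simp: disco_nf_def)
  next
    case False
    show ?thesis
    proof (cases "Im z = 1")
      case True
      with False assms show ?thesis
        by (intro g) (auto simp: disco_nf_def mem_disco_rect)
    next
      case f2: False
      show ?thesis
      proof (cases "Re z = 6")
        case True
        with False f2 assms have "(disco_nf z, z) \<in> ?E"
          by (intro g) (auto simp: disco_nf_def mem_disco_rect)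
        then show ?thesis using sy by blast
      next
        case f3: False
        with False f2 show ?thesis by (simp add: disco_nf_def)
      qed
    qed
  qed
qed

text \<open>\<open>disco_nf\<close> is constant along gluing pairs and every point is linked to its
  own normal form, so the generated equivalence becomes a comparison of two explicit values.\<close>

lemma disco_rel_iff:
  "(z, w) \<in> disco_rel \<longleftrightarrow> z \<in> disco_rect \<and> w \<in> disco_rect \<and> disco_nf z = disco_nf w"
proof
  assume "(z, w) \<in> disco_rel"
  then have r: "z \<in> disco_rect" "w \<in> disco_rect" and E: "(z, w) \<in> (disco_glue \<union> disco_glue\<inverse>)\<^sup>*"
    by (auto simp: disco_rel_def)
  from E have "disco_nf z = disco_nf w"
    by induction (use disco_glue_nf in force)+
  with r show "z \<in> disco_rect \<and> w \<in> disco_rect \<and> disco_nf z = disco_nf w" by blast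
next
  assume a: "z \<in> disco_rect \<and> w \<in> disco_rect \<and> disco_nf z = disco_nf w"
  then have "(z, disco_nf z) \<in> (disco_glue \<union> disco_glue\<inverse>)\<^sup>*"
     "(disco_nf z, w) \<in> (disco_glue \<union> disco_glue\<inverse>)\<^sup>*"
    using disco_nf_rtrancl[of z] disco_glue_rtrancl_sym[OF disco_nf_rtrancl[of w]] by auto
  then show "(z, w) \<in> disco_rel" using a unfolding disco_rel_def by (auto intro: rtrancl_trans)
qed

lemma equiv_disco_rel: "equiv disco_rect disco_rel"
  by (rule equivI) (auto simp: disco_rel_iff refl_on_def sym_def trans_def)

lemma disco_proj_eq_iff:
  "z \<in> disco_rect \<Longrightarrow> w \<in> disco_rect \<Longrightarrow> disco_proj z = disco_proj w \<longleftrightarrow> disco_nf z = disco_nf w"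
  unfolding disco_proj_def eq_equiv_class_iff[OF equiv_disco_rel] by (simp add: disco_rel_iff)

lemma disco_proj_in [simp]: "z \<in> disco_rect \<Longrightarrow> disco_proj z \<in> disco_surface"
  by (simp add: disco_proj_def disco_surface_def quotientI)

lemma disco_surface_cases:
  assumes "p \<in> disco_surface"
  obtains z where "z \<in> disco_rect" "p = disco_proj z"
  using assms by (auto simp: disco_proj_def disco_surface_def elim: quotientE)

lemma disco_proj_sing_a: "z \<in> sing_a \<Longrightarrow> disco_proj z = disco_proj 0"
  and disco_proj_sing_b: "z \<in> sing_b \<Longrightarrow> disco_proj z = disco_proj 1"
  by (subst disco_proj_eq_iff;
      auto simp: mem_disco_rect mem_sing_a mem_sing_b disco_nf_def complex_eq_iff)+

lemma disco_sing_eq: "disco_sing = {disco_proj 0, disco_proj 1}"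
proof
  show "disco_sing \<subseteq> {disco_proj 0, disco_proj 1}"
    unfolding disco_sing_def
  proof
    fix p assume "p \<in> (\<lambda>(x, y). disco_proj (Complex x y)) ` ({0, 1, 3, 5, 6} \<times> {0, 1})"
    then obtain x y :: real where *: "x \<in> {0, 1, 3, 5, 6}" "y \<in> {0, 1}"
        and p: "p = disco_proj (Complex x y)"
      by blast
    from * have "Complex x y \<in> sing_a \<or> Complex x y \<in> sing_b" by (auto simp: mem_sing_a mem_sing_b)
    then show "p \<in> {disco_proj 0, disco_proj 1}"
      using disco_proj_sing_a disco_proj_sing_b p by blast
  qed
  have "disco_proj (Complex 0 0) \<in> disco_sing" "disco_proj (Complex 1 0) \<in> disco_sing"
    unfolding disco_sing_def by force+
  then show "{disco_proj 0, disco_proj 1} \<subseteq> disco_sing"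
    by (simp add: Complex_eq)
qed

lemma disco_proj_in_sing_iff:
  assumes "z \<in> disco_rect"
  shows "disco_proj z \<in> disco_sing \<longleftrightarrow> Im z \<in> {0, 1} \<and> Re z \<in> {0, 1, 3, 5, 6}"
proof
  assume "disco_proj z \<in> disco_sing"
  then have "disco_nf z = disco_nf 0 \<or> disco_nf z = disco_nf 1"
    using disco_proj_eq_iff[OF assms] by (auto simp: disco_sing_eq mem_disco_rect)
  then show "Im z \<in> {0, 1} \<and> Re z \<in> {0, 1, 3, 5, 6}"
    using assms unfolding mem_disco_rect
    by (auto simp: disco_nf_def mem_sing_a mem_sing_b complex_eq_iff split: if_splits, (linarith+)?)
next
  assume "Im z \<in> {0, 1} \<and> Re z \<in> {0, 1, 3, 5, 6}"
  then have "z \<in> sing_a \<or> z \<in> sing_b" by (auto simp: mem_sing_a mem_sing_b)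
  then show "disco_proj z \<in> disco_sing"
    using disco_proj_sing_a disco_proj_sing_b by (auto simp: disco_sing_eq)
qed

lemma disco_sing_subset: "disco_sing \<subseteq> disco_surface"
  by (auto simp: disco_sing_eq mem_disco_rect)

section \<open>The quotient map and separation\<close>

lemma topspace_disco_top [simp]: "topspace disco_top = disco_surface"
proof -
  have "openin disco_top disco_surface"
    by (simp add: openin_disco_top) (metis
        (no_types, lifting) Collect_cong Collect_mem_eq disco_proj_in openin_subtopology_self)
  then show ?thesis
    by (metis openin_disco_top openin_subset openin_topspace subset_antisym)
qed

lemma quotient_map_disco_proj: "quotient_map (top_of_set disco_rect) disco_top disco_proj"
  unfolding quotient_map_def openin_disco_top
  by (auto elim: disco_surface_cases)

lemma continuous_disco_proj: "continuous_map (top_of_set disco_rect) disco_top disco_proj"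
  by (simp add: quotient_imp_continuous_map quotient_map_disco_proj)

lemma continuous_map_disco_proj_comp:
  assumes "continuous_on S f" "f ` S \<subseteq> disco_rect"
  shows "continuous_map (top_of_set S) disco_top (\<lambda>x. disco_proj (f x))"
  using continuous_map_compose[of "top_of_set S" "top_of_set disco_rect" f disco_top disco_proj]
    continuous_disco_proj assms by (auto simp: o_def image_subset_iff)

lemma disco_rect_eq_cbox: "disco_rect = cbox 0 (Complex 6 1)"
  by (auto simp: disco_rect_def in_cbox_complex_iff)

lemma compact_disco_rect: "compact disco_rect"
  by (simp add: disco_rect_eq_cbox)

lemma compact_disco_glue: "compact disco_glue"
  unfolding disco_glue_def glue_sides_def linepath_def
  by (intro compact_Un compact_continuous_image continuous_intros compact_Icc)

text \<open>The saturation of a compact set is compact: the partners of its points under one gluing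
  step are coordinate projections of compact parts of the graph \<open>disco_glue\<close>, and a
  corner class is added whole as soon as it is met.\<close>

lemma closed_map_disco_proj: "closed_map (top_of_set disco_rect) disco_top disco_proj"
proof (unfold closed_map_def, intro allI impI)
  fix C assume "closedin (top_of_set disco_rect) C"
  then have C: "compact C" "C \<subseteq> disco_rect"
    using closedin_compact compact_disco_rect closedin_imp_subset by blast+
  let ?Sa = "if C \<inter> sing_a = {} then {} else sing_a"
  let ?Sb = "if C \<inter> sing_b = {} then {} else sing_b"
  let ?D = "C \<union> snd ` (disco_glue \<inter> C \<times> UNIV) \<union> fst ` (disco_glue \<inter> UNIV \<times> C) \<union> ?Sa \<union> ?Sb"
  have cl: "closed (C \<times> (UNIV::complex set))" "closed ((UNIV::complex set) \<times> C)"
    using C by (simp_all add: closed_Times compact_imp_closed)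
  have "compact ?D"
    by (intro compact_Un compact_continuous_image[OF _ compact_Int_closed[OF compact_disco_glue]]
         continuous_intros C(1) cl finite_imp_compact) (auto simp: sing_a_def sing_b_def)
  moreover have "{z \<in> disco_rect. disco_proj z \<in> disco_proj ` C} = ?D \<inter> disco_rect" (is "?P = ?Q")
  proof (rule equalityI; rule subsetI)
    fix z assume "z \<in> {z \<in> disco_rect. disco_proj z \<in> disco_proj ` C}"
    then obtain w where w: "w \<in> C" "z \<in> disco_rect" "disco_nf z = disco_nf w"
      using C by (auto simp: disco_proj_eq_iff)
    then show "z \<in> ?D \<inter> disco_rect"
    proof -
      have "w \<in> disco_rect" using w C by blast
      from disco_nf_eq_cases[OF w(3) w(2) this] show ?thesis
      proof (elim disjE)
        assume "(z, w) \<in> disco_glue"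
        then have "z \<in> fst ` (disco_glue \<inter> UNIV \<times> C)" using w by (intro image_eqI[of _ _ "(z, w)"]) auto
        then show ?thesis using w by blast
      next
        assume "(w, z) \<in> disco_glue"
        then have "z \<in> snd ` (disco_glue \<inter> C \<times> UNIV)" using w by (intro image_eqI[of _ _ "(w, z)"]) auto
        then show ?thesis using w by blast
      qed (use w in auto)
    qed
  next
    fix z assume z: "z \<in> ?D \<inter> disco_rect"
    have "\<exists>w\<in>C. disco_nf z = disco_nf w"
    proof -
      consider "z \<in> C" | w where "w \<in> C" "(w, z) \<in> disco_glue" | w where "w \<in> C" "(z, w) \<in> disco_glue"
        | w where "w \<in> C" "w \<in> sing_a" "z \<in> sing_a" | w where "w \<in> C" "w \<in> sing_b" "z \<in> sing_b"
        using z by (auto split: if_splits)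
      then show ?thesis
      proof cases
        case 5
        then have "z \<notin> sing_a" "w \<notin> sing_a" by (auto simp: mem_sing_a mem_sing_b)
        with 5 show ?thesis by (auto simp: disco_nf_def)
      next
        case 4
        then show ?thesis by (auto simp: disco_nf_def)
      qed (use disco_glue_nf in \<open>metis+\<close>)
    qed
    then show "z \<in> {z \<in> disco_rect. disco_proj z \<in> disco_proj ` C}"
      using z C by (auto simp: image_iff disco_proj_eq_iff subset_iff)
  qed
  ultimately have "closedin (top_of_set disco_rect) {z \<in> disco_rect. disco_proj z \<in> disco_proj ` C}"
    by (metis (no_types, lifting) closedin_closed compact_imp_closed inf_commute)
  moreover have "disco_proj ` C \<subseteq> disco_surface" using C by auto
  ultimately show "closedin disco_top (disco_proj ` C)"
    using quotient_map_disco_proj unfolding quotient_map_closedin by auto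
qed

text \<open>Makes images of compact segments closed, which traps straight paths on closed curves,
  and later separates a return path from its base point in the holonomy argument.\<close>

lemma Hausdorff_disco_top: "Hausdorff_space disco_top"
proof (rule conjunct2[OF normal_Hausdorff_space_closed_continuous_map_image])
  show "normal_space (top_of_set disco_rect)"
    by (simp add: metrizable_imp_normal_space metrizable_space_subtopology metrizable_space_euclidean)
  show "Hausdorff_space (top_of_set disco_rect)"
    by (simp add: Hausdorff_space_subtopology)
  show "disco_proj ` topspace (top_of_set disco_rect) = topspace disco_top"
    by (auto elim: disco_surface_cases)
qed (fact closed_map_disco_proj continuous_disco_proj)+

section \<open>Cylinder coordinates\<close>

text \<open>Both maps are periodic parametrizations of closed cylinders: \<open>hcyl\<close>, with period \<open>6\<close>, of the whole surface
  by the strip \<open>0 \<le> Im z \<le> 1\<close>, and \<open>vcyl\<close>, with period \<open>3/2 * \<i>\<close>, of the vertical cylinder through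
  \<open>[0,1] \<times> [0,1]\<close> and \<open>[1,3] \<times> [0,1]\<close> by the strip \<open>0 \<le> Re z \<le> 1\<close>. The second rectangle enters scaled by
  \<open>1/2\<close>.\<close>

definition hcyl :: "complex \<Rightarrow> complex set" where
  "hcyl z = disco_proj (Complex (Re z - 6 * of_int \<lfloor>Re z / 6\<rfloor>) (Im z))"

definition vcyl :: "complex \<Rightarrow> complex set" where
  "vcyl z = (let y = Im z - 3/2 * of_int \<lfloor>Im z / (3/2)\<rfloor> in
     if y \<le> 1 then disco_proj (Complex (Re z) y)
     else disco_proj (Complex (1 + 2 * Re z) (2 * y - 2)))"

lemma disco_proj_glue: "(z, w) \<in> disco_glue \<Longrightarrow> disco_proj z = disco_proj w"
proof -
  assume g: "(z, w) \<in> disco_glue"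
  then have "z \<in> disco_rect" "w \<in> disco_rect"
    unfolding mem_disco_glue mem_disco_rect by auto
  then show ?thesis using g disco_glue_nf disco_proj_eq_iff by blast
qed

text \<open>At the right end of the closed period the floor has already jumped and yields the left
  side of the rectangle; the gluing of the two sides gives the same point. Closed periods are what
  the pasting argument for continuity needs.\<close>

lemma hcyl_eq:
  assumes "0 \<le> Im z" "Im z \<le> 1" "6 * of_int k \<le> Re z" "Re z \<le> 6 * of_int k + 6"
  shows "hcyl z = disco_proj (Complex (Re z - 6 * of_int k) (Im z))"
proof (cases "Re z = 6 * of_int k + 6")
  case True
  then have "\<lfloor>Re z / 6\<rfloor> = k + 1" by (simp add: floor_eq_iff)
  then have "hcyl z = disco_proj (Complex 0 (Im z))" using True by (simp add: hcyl_def)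
  also have "\<dots> = disco_proj (Complex 6 (Im z))"
    using assms by (intro disco_proj_glue) (simp add: mem_disco_glue)
  finally show ?thesis using True by simp
next
  case False
  then have "\<lfloor>Re z / 6\<rfloor> = k" using assms by (simp add: floor_eq_iff)
  then show ?thesis by (simp add: hcyl_def)
qed

lemma hcyl_rep:
  obtains k :: int where "6 * of_int k \<le> Re z" "Re z < 6 * of_int k + 6"
proof
  show "6 * of_int \<lfloor>Re z / 6\<rfloor> \<le> Re z" "Re z < 6 * of_int \<lfloor>Re z / 6\<rfloor> + 6"
    by linarith+
qed

lemma hcyl_periodic: "hcyl (z + of_real (6 * of_int n)) = hcyl z"
proof -
  have "\<lfloor>Re z / 6 + of_int n\<rfloor> = \<lfloor>Re z / 6\<rfloor> + n" by simp
  moreover have "(Re z + 6 * of_int n) / 6 = Re z / 6 + of_int n" by simp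
  ultimately have "\<lfloor>(Re z + 6 * of_int n) / 6\<rfloor> = \<lfloor>Re z / 6\<rfloor> + n" by metis
  then show ?thesis by (simp add: hcyl_def algebra_simps)
qed

lemma vcyl_eq1:
  assumes "3/2 * of_int k \<le> Im z" "Im z \<le> 3/2 * of_int k + 1"
  shows "vcyl z = disco_proj (Complex (Re z) (Im z - 3/2 * of_int k))"
proof -
  have "\<lfloor>Im z / (3/2)\<rfloor> = k" using assms by (simp add: floor_eq_iff)
  then show ?thesis using assms by (simp add: vcyl_def Let_def)
qed

text \<open>At both ends of this closed interval of heights the definition uses the other branch.
  The values agree by the gluings of top [0,1] with bottom [1,3] and of top [1,3] with bottom
  [0,1].\<close>

lemma vcyl_eq2:
  assumes "0 \<le> Re z" "Re z \<le> 1" "3/2 * of_int k + 1 \<le> Im z" "Im z \<le> 3/2 * of_int k + 3/2"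
  shows "vcyl z = disco_proj (Complex (1 + 2 * Re z) (2 * (Im z - 3/2 * of_int k) - 2))"
proof -
  consider "Im z = 3/2 * of_int k + 1" | "Im z = 3/2 * of_int k + 3/2"
    | "3/2 * of_int k + 1 < Im z" "Im z < 3/2 * of_int k + 3/2" using assms by linarith
  then show ?thesis
  proof cases
    case 1
    then have "vcyl z = disco_proj (Complex (Re z) 1)" using vcyl_eq1[of k z] by simp
    also have "\<dots> = disco_proj (Complex (1 + 2 * Re z) 0)"
      using assms by (intro disco_proj_glue) (simp add: mem_disco_glue)
    finally show ?thesis using 1 by simp
  next
    case 2
    then have "Im z - 3/2 * of_int (k + 1) = 0" by simp
    moreover from this have "vcyl z = disco_proj (Complex (Re z) (Im z - 3/2 * of_int (k + 1)))"
      by (intro vcyl_eq1) linarith+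
    ultimately have "vcyl z = disco_proj (Complex (Re z) 0)" by metis
    also have "\<dots> = disco_proj (Complex (1 + 2 * Re z) 1)"
      using assms by (intro disco_proj_glue[symmetric]) (simp add: mem_disco_glue)
    finally show ?thesis using 2 by simp
  next
    case 3
    then have "\<lfloor>Im z / (3/2)\<rfloor> = k" by (simp add: floor_eq_iff)
    then show ?thesis using 3 by (simp add: vcyl_def Let_def)
  qed
qed

lemma vcyl_rep:
  obtains k :: int where "3/2 * of_int k \<le> Im z" "Im z < 3/2 * of_int k + 3/2"
proof -
  obtain k :: int where "of_int k \<le> Im z / (3/2)" "Im z / (3/2) < of_int k + 1"
    by (metis of_int_floor_le real_of_int_floor_add_one_gt)
  then have "3/2 * of_int k \<le> Im z" "Im z < 3/2 * of_int k + 3/2" by (simp_all add: field_simps)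
  then show ?thesis by (rule that)
qed

lemma vcyl_periodic: "vcyl (z + \<i> * of_real (3/2 * of_int n)) = vcyl z"
proof -
  have "\<lfloor>Im z / (3/2) + of_int n\<rfloor> = \<lfloor>Im z / (3/2)\<rfloor> + n" by simp
  moreover have "(Im z + 3/2 * of_int n) / (3/2) = Im z / (3/2) + of_int n" by simp
  ultimately have "\<lfloor>(Im z + 3/2 * of_int n) / (3/2)\<rfloor> = \<lfloor>Im z / (3/2)\<rfloor> + n" by metis
  then show ?thesis by (simp add: vcyl_def Let_def algebra_simps)
qed

lemma hcyl_eq_proj_iff:
  assumes "0 < Im z" "Im z < 1" "w \<in> disco_rect"
  shows "hcyl z = disco_proj w \<longleftrightarrow> (\<exists>k::int. z = w + of_real (6 * of_int k))"
proof
  assume eq: "hcyl z = disco_proj w"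
  obtain k :: int where k: "6 * of_int k \<le> Re z" "Re z < 6 * of_int k + 6" by (rule hcyl_rep)
  let ?z = "Complex (Re z - 6 * of_int k) (Im z)"
  have z: "?z \<in> disco_rect" using k assms by (simp add: mem_disco_rect)
  have "disco_nf ?z = disco_nf w"
    using eq hcyl_eq[of z k] k assms disco_proj_eq_iff[OF z assms(3)] by simp
  from disco_nf_eq_cases[OF this z assms(3)]
  have "?z = w \<or> Re w = 6 \<and> Im w = Im z \<and> Re z = 6 * of_int k"
    using assms k by (auto simp: mem_disco_glue mem_sing_a mem_sing_b)
  then show "\<exists>k::int. z = w + of_real (6 * of_int k)"
  proof
    assume "?z = w"
    then have "z = w + of_real (6 * of_int k)" by (auto simp: complex_eq_iff)
    then show ?thesis by blast
  next
    assume "Re w = 6 \<and> Im w = Im z \<and> Re z = 6 * of_int k"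
    then have "z = w + of_real (6 * of_int (k - 1))" by (simp add: complex_eq_iff)
    then show ?thesis by blast
  qed
next
  assume "\<exists>k::int. z = w + of_real (6 * of_int k)"
  then obtain k :: int where "z = w + of_real (6 * of_int k)" by blast
  then show "hcyl z = disco_proj w" using hcyl_eq[of z k] assms by (simp add: mem_disco_rect)
qed

text \<open>The affine expression in the second alternative inverts the pair of coordinates
  \<open>1 + 2 * Re z\<close>, \<open>2 * y - 2\<close> by which \<open>vcyl\<close> enters the
  second rectangle. The bounds on \<open>Re w\<close> are strict because the open strip avoids the
  vertical sides.\<close>

lemma vcyl_eq_proj_iff:
  assumes "0 < Re z" "Re z < 1" "w \<in> disco_rect"
  shows "vcyl z = disco_proj w \<longleftrightarrow>
    0 < Re w \<and> Re w < 1 \<and> (\<exists>k::int. z = w + \<i> * of_real (3/2 * of_int k)) \<or>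
    1 < Re w \<and> Re w < 3 \<and> (\<exists>k::int. z = of_real (1/2) * w + (Complex (-1/2) (1 + 3/2 * of_int k)))"
    (is "_ \<longleftrightarrow> ?R1 \<or> ?R2")
proof
  assume eq: "vcyl z = disco_proj w"
  obtain k :: int where k: "3/2 * of_int k \<le> Im z" "Im z < 3/2 * of_int k + 3/2" by (rule vcyl_rep)
  show "?R1 \<or> ?R2"
  proof (cases "Im z \<le> 3/2 * of_int k + 1")
    case True
    let ?z = "Complex (Re z) (Im z - 3/2 * of_int k)"
    have z: "?z \<in> disco_rect" using k assms True by (simp add: mem_disco_rect)
    have "disco_nf ?z = disco_nf w"
      using eq vcyl_eq1[OF k(1) True] disco_proj_eq_iff[OF z assms(3)] by simp
    from disco_nf_eq_cases[OF this z assms(3)]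
    consider "?z = w" | "Im w = 0" "Re w = 1 + 2 * Re z" "Im z = 3/2 * of_int k + 1"
      | "Im w = 1" "Re w = 1 + 2 * Re z" "Im z = 3/2 * of_int k"
      using assms k by (auto simp: mem_disco_glue mem_sing_a mem_sing_b)
    then show ?thesis
    proof cases
      case 1
      then have "z = w + \<i> * of_real (3/2 * of_int k)" "Re w = Re z" by (auto simp: complex_eq_iff)
      then show ?thesis using assms by metis
    next
      case 2
      then have "z = of_real (1/2) * w + Complex (-1/2) (1 + 3/2 * of_int k)"
          by (simp add: complex_eq_iff field_simps)
      moreover have "1 < Re w" "Re w < 3" using assms 2 by auto
      ultimately show ?thesis by blast
    next
      case 3
      then have "z = of_real (1/2) * w + Complex (-1/2) (1 + 3/2 * of_int (k - 1))"
          by (simp add: complex_eq_iff field_simps)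
      moreover have "1 < Re w" "Re w < 3" using assms 3 by auto
      ultimately show ?thesis by blast
    qed
  next
    case False
    let ?z = "Complex (1 + 2 * Re z) (2 * (Im z - 3/2 * of_int k) - 2)"
    have z: "?z \<in> disco_rect" using k assms False by (simp add: mem_disco_rect)
    have "disco_nf ?z = disco_nf w"
      using eq vcyl_eq2[of z k] disco_proj_eq_iff[OF z assms(3)] k assms False by simp
    from disco_nf_eq_cases[OF this z assms(3)] have "?z = w"
      using assms k False by (auto simp: mem_disco_glue mem_sing_a mem_sing_b)
    then have "z = of_real (1/2) * w + Complex (-1/2) (1 + 3/2 * of_int k)" "Re w = 1 + 2 * Re z"
      by (auto simp: complex_eq_iff field_simps)
    moreover have "1 < Re w" "Re w < 3" using assms calculation(2) by auto
    ultimately show ?thesis by blast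
  qed
next
  assume "?R1 \<or> ?R2"
  then show "vcyl z = disco_proj w"
  proof
    assume ?R1
    then obtain k :: int where "z = w + \<i> * of_real (3/2 * of_int k)" by blast
    then show ?thesis using vcyl_eq1[of k z] assms by (simp add: mem_disco_rect)
  next
    assume ?R2
    then obtain k :: int where "z = of_real (1/2) * w + Complex (-1/2) (1 + 3/2 * of_int k)" by blast
    then have "Re z = (Re w - 1) / 2" "Im z = Im w / 2 + 1 + 3/2 * of_int k"
        by (simp_all add: diff_divide_distrib)
    moreover from this have "Complex (1 + 2 * Re z) (2 * (Im z - 3/2 * of_int k) - 2) = w"
      by (simp add: complex_eq_iff)
    ultimately show ?thesis using vcyl_eq2[of z k] assms by (simp add: mem_disco_rect)
  qed
qed

text \<open>Pasting over infinitely many closed pieces, some for each period; local finiteness takes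
  the place of finiteness.\<close>

lemma continuous_map_to_disco:
  fixes T :: "'i \<Rightarrow> complex set"
  assumes fin: "\<And>x. x \<in> S \<Longrightarrow> finite {i. T i \<inter> ball x 1 \<noteq> {}}"
    and cl: "\<And>i. closed (T i)" and cont: "\<And>i. continuous_on (S \<inter> T i) (f i)"
    and f: "\<And>i x. x \<in> S \<Longrightarrow> x \<in> T i \<Longrightarrow> f i x \<in> disco_rect \<and> g x = disco_proj (f i x)"
    and cov: "\<And>x. x \<in> S \<Longrightarrow> \<exists>i. x \<in> T i"
  shows "continuous_map (top_of_set S) disco_top g"
proof (rule pasting_lemma_locally_finite[where I = UNIV and T = "\<lambda>i. S \<inter> T i"
      and f = "\<lambda>i x. disco_proj (f i x)"])
  fix x assume "x \<in> topspace (top_of_set S)"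
  then have x: "x \<in> S" by simp
  have "finite {i \<in> UNIV. S \<inter> T i \<inter> (S \<inter> ball x 1) \<noteq> {}}"
    by (rule finite_subset[OF _ fin[OF x]]) auto
  then show "\<exists>V. openin (top_of_set S) V \<and> x \<in> V \<and> finite {i \<in> UNIV. S \<inter> T i \<inter> V \<noteq> {}}"
    using x by (intro exI[of _ "S \<inter> ball x 1"]) (auto simp: openin_open_Int)
next
  fix i
  show "closedin (top_of_set S) (S \<inter> T i)" by (simp add: cl closedin_closed_Int)
  have "continuous_map (top_of_set (S \<inter> T i)) disco_top (\<lambda>x. disco_proj (f i x))"
    using f by (intro continuous_map_disco_proj_comp cont) auto
  then show "continuous_map (subtopology (top_of_set S) (S \<inter> T i)) disco_top (\<lambda>x. disco_proj (f i x))"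
    by (simp add: subtopology_subtopology)
next
  fix i j x assume "x \<in> topspace (top_of_set S) \<inter> (S \<inter> T i) \<inter> (S \<inter> T j)"
  then show "disco_proj (f i x) = disco_proj (f j x)" using f[of x i] f[of x j] by simp
next
  fix x assume "x \<in> topspace (top_of_set S)"
  then show "\<exists>j. j \<in> UNIV \<and> x \<in> S \<inter> T j \<and> g x = disco_proj (f j x)" using cov[of x] f by auto
qed

lemma continuous_hcyl: "continuous_map (top_of_set {z. 0 \<le> Im z \<and> Im z \<le> 1}) disco_top hcyl"
proof (rule continuous_map_to_disco[where T = "\<lambda>k::int. {z. 6 * of_int k \<le> Re z \<and> Re z \<le> 6 * of_int k + 6}"
      and f = "\<lambda>k z. Complex (Re z - 6 * of_int k) (Im z)"])
  fix x :: complex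
  have "{k::int. {z. 6 * of_int k \<le> Re z \<and> Re z \<le> 6 * of_int k + 6} \<inter> ball x 1 \<noteq> {}}
    \<subseteq> {\<lfloor>Re x / 6\<rfloor> - 3 .. \<lfloor>Re x / 6\<rfloor> + 3}"
  proof
    fix k :: int assume "k \<in> {k. {z. 6 * of_int k \<le> Re z \<and> Re z \<le> 6 * of_int k + 6} \<inter> ball x 1 \<noteq> {}}"
    then obtain z where "6 * of_int k \<le> Re z" "Re z \<le> 6 * of_int k + 6" "dist x z < 1" by auto
    moreover have "\<bar>Re x - Re z\<bar> < 1"
      using \<open>dist x z < 1\<close> abs_Re_le_cmod[of "x - z"] by (simp add: dist_norm)
    ultimately have "\<lfloor>Re x / 6\<rfloor> \<le> k + 3 \<and> k \<le> \<lfloor>Re x / 6\<rfloor> + 3" by linarith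
    then show "k \<in> {\<lfloor>Re x / 6\<rfloor> - 3 .. \<lfloor>Re x / 6\<rfloor> + 3}" by auto
  qed
  then show "finite {k::int. {z. 6 * of_int k \<le> Re z \<and> Re z \<le> 6 * of_int k + 6} \<inter> ball x 1 \<noteq> {}}"
    by (rule finite_subset) simp
next
  fix k :: int
  show "closed {z. 6 * of_int k \<le> Re z \<and> Re z \<le> 6 * of_int k + 6}"
    by (intro closed_Collect_conj closed_Collect_le continuous_intros)
next
  fix x show "\<exists>i::int. x \<in> {z. 6 * of_int i \<le> Re z \<and> Re z \<le> 6 * of_int i + 6}"
    by (rule hcyl_rep[of x]) force
next
  fix k :: int
  show "continuous_on ({z. 0 \<le> Im z \<and> Im z \<le> 1} \<inter> {z. 6 * of_int k \<le> Re z \<and> Re z \<le> 6 * of_int k + 6})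
    (\<lambda>z. Complex (Re z - 6 * of_int k) (Im z))"
    unfolding Complex_eq by (intro continuous_intros)
next
  fix k :: int and x
  assume "x \<in> {z. 0 \<le> Im z \<and> Im z \<le> 1}" "x \<in> {z. 6 * of_int k \<le> Re z \<and> Re z \<le> 6 * of_int k + 6}"
  then show "Complex (Re x - 6 * of_int k) (Im x) \<in> disco_rect \<and>
      hcyl x = disco_proj (Complex (Re x - 6 * of_int k) (Im x))"
    using hcyl_eq[of x k] by (simp add: mem_disco_rect)
qed

lemma continuous_vcyl: "continuous_map (top_of_set {z. 0 \<le> Re z \<and> Re z \<le> 1}) disco_top vcyl"
proof -
  define T :: "int \<times> bool \<Rightarrow> complex set" where
    "T i = (if snd i then {z. 3/2 * of_int (fst i) \<le> Im z \<and> Im z \<le> 3/2 * of_int (fst i) + 1}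
        else {z. 3/2 * of_int (fst i) + 1 \<le> Im z \<and> Im z \<le> 3/2 * of_int (fst i) + 3/2})" for i
  define f where "f i z = (if snd i then Complex (Re z) (Im z - 3/2 * of_int (fst i))
        else Complex (1 + 2 * Re z) (2 * (Im z - 3/2 * of_int (fst i)) - 2))" for i :: "int \<times> bool" and z
  show ?thesis
  proof (rule continuous_map_to_disco[where T = T and f = f])
    fix x :: complex
    have "{i. T i \<inter> ball x 1 \<noteq> {}} \<subseteq> {\<lfloor>Im x * (2/3)\<rfloor> - 5 .. \<lfloor>Im x * (2/3)\<rfloor> + 5} \<times> UNIV"
    proof
      fix i assume "i \<in> {i. T i \<inter> ball x 1 \<noteq> {}}"
      then obtain z where z: "z \<in> T i" "dist x z < 1" by auto
      then have "3 * of_int (fst i) / 2 \<le> Im z" "Im z \<le> 3 * of_int (fst i) / 2 + 3/2"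
        by (auto simp: T_def split: if_splits)
      moreover have "\<bar>Im x - Im z\<bar> < 1"
        using z(2) abs_Im_le_cmod[of "x - z"] by (simp add: dist_norm)
      ultimately have "\<lfloor>Im x * (2/3)\<rfloor> \<le> fst i + 5 \<and> fst i \<le> \<lfloor>Im x * (2/3)\<rfloor> + 5" by linarith
      then show "i \<in> {\<lfloor>Im x * (2/3)\<rfloor> - 5 .. \<lfloor>Im x * (2/3)\<rfloor> + 5} \<times> UNIV" by (auto simp: mem_Times_iff)
    qed
    then show "finite {i. T i \<inter> ball x 1 \<noteq> {}}" by (rule finite_subset) simp
  next
    fix i
    show "closed (T i)"
      unfolding T_def by (auto intro!: closed_Collect_conj closed_Collect_le continuous_intros)
    show "continuous_on ({z. 0 \<le> Re z \<and> Re z \<le> 1} \<inter> T i) (f i)"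
        unfolding f_def by (cases "snd i") (auto simp: Complex_eq intro!: continuous_intros)
  next
    fix x obtain k :: int where k: "3/2 * of_int k \<le> Im x" "Im x < 3/2 * of_int k + 3/2" by (rule vcyl_rep)
    show "\<exists>i. x \<in> T i"
      using k unfolding T_def by (intro exI[of _ "(k, Im x \<le> 3/2 * of_int k + 1)"]) auto
  next
    fix i x assume "x \<in> {z. 0 \<le> Re z \<and> Re z \<le> 1}" "x \<in> T i"
    then show "f i x \<in> disco_rect \<and> vcyl x = disco_proj (f i x)"
      using vcyl_eq1[of "fst i" x] vcyl_eq2[of x "fst i"]
      by (cases "snd i") (simp_all add: T_def f_def mem_disco_rect)
  qed
qed

text \<open>The quotient topology tests the preimage in the rectangle, which is the union over all
  periods of the translates of \<open>W\<close>.\<close>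

lemma openin_hcyl_image:
  assumes "open W" "W \<subseteq> {z. 0 < Im z \<and> Im z < 1}"
  shows "openin disco_top (hcyl ` W)"
proof -
  have "hcyl ` W \<subseteq> disco_surface"
    using assms(2) continuous_map_image_subset_topspace[OF continuous_hcyl] by fastforce
  moreover have "{z \<in> disco_rect. disco_proj z \<in> hcyl ` W} =
      disco_rect \<inter> (\<Union>k::int. (\<lambda>w. w + of_real (6 * of_int k)) -` W)"
  proof (rule Set.set_eqI)
    fix w
    show "w \<in> {z \<in> disco_rect. disco_proj z \<in> hcyl ` W} \<longleftrightarrow>
      w \<in> disco_rect \<inter> (\<Union>k::int. (\<lambda>w. w + of_real (6 * of_int k)) -` W)"
    proof (cases "w \<in> disco_rect")
      case True
      have "disco_proj w \<in> hcyl ` W \<longleftrightarrow> (\<exists>z\<in>W. hcyl z = disco_proj w)" by (metis imageE imageI)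
      also have "\<dots> \<longleftrightarrow> (\<exists>z\<in>W. \<exists>k::int. z = w + of_real (6 * of_int k))"
        using assms(2) hcyl_eq_proj_iff[OF _ _ True] by (intro bex_cong refl) blast
      also have "\<dots> \<longleftrightarrow> w \<in> (\<Union>k::int. (\<lambda>w. w + of_real (6 * of_int k)) -` W)" by auto
      finally show ?thesis using True by simp
    qed simp
  qed
  moreover have "open (\<Union>k::int. (\<lambda>w. w + of_real (6 * of_int k)) -` W)"
    by (intro open_UN ballI open_vimage assms continuous_intros)
  ultimately show ?thesis by (simp add: openin_disco_top openin_open_Int)
qed

lemma openin_vcyl_image:
  assumes "open W" "W \<subseteq> {z. 0 < Re z \<and> Re z < 1}"
  shows "openin disco_top (vcyl ` W)"
proof -
  let ?P = "\<lambda>k::int. {w. 0 < Re w} \<inter> {w. Re w < 1} \<inter> (\<lambda>w. w + \<i> * of_real (3/2 * of_int k)) -` W"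
  let ?Q = "\<lambda>k::int. {w. 1 < Re w} \<inter> {w. Re w < 3} \<inter>
     (\<lambda>w. of_real (1/2) * w + Complex (-1/2) (1 + 3/2 * of_int k)) -` W"
  have "vcyl ` W \<subseteq> disco_surface"
    using assms(2) continuous_map_image_subset_topspace[OF continuous_vcyl] by fastforce
  moreover have "{z \<in> disco_rect. disco_proj z \<in> vcyl ` W} = disco_rect \<inter> ((\<Union>k. ?P k) \<union> (\<Union>k. ?Q k))"
  proof (rule Set.set_eqI)
    fix w
    show "w \<in> {z \<in> disco_rect. disco_proj z \<in> vcyl ` W} \<longleftrightarrow> w \<in> disco_rect \<inter> ((\<Union>k. ?P k) \<union> (\<Union>k. ?Q k))"
    proof (cases "w \<in> disco_rect")
      case True
      have "disco_proj w \<in> vcyl ` W \<longleftrightarrow> (\<exists>z\<in>W. vcyl z = disco_proj w)" by (metis imageE imageI)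
      also have "\<dots> \<longleftrightarrow> (\<exists>z\<in>W. 0 < Re w \<and> Re w < 1 \<and> (\<exists>k::int. z = w + \<i> * of_real (3/2 * of_int k)) \<or>
    1 < Re w \<and> Re w < 3 \<and> (\<exists>k::int. z = of_real (1/2) * w + (Complex (-1/2) (1 + 3/2 * of_int k))))"
        using assms(2) vcyl_eq_proj_iff[OF _ _ True] by (intro bex_cong refl) blast
      also have "\<dots> \<longleftrightarrow> w \<in> (\<Union>k. ?P k) \<union> (\<Union>k. ?Q k)" by auto
      finally show ?thesis using True by simp
    qed simp
  qed
  moreover have "open ((\<Union>k. ?P k) \<union> (\<Union>k. ?Q k))"
    by (intro open_Un open_UN ballI open_Int open_vimage assms continuous_intros open_halfspace_Re_lt
        open_halfspace_Re_gt)
  ultimately show ?thesis by (simp add: openin_disco_top openin_open_Int)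
qed

lemma hcyl_eq_iff:
  assumes "0 < Im z" "Im z < 1" "0 < Im w" "Im w < 1"
  shows "hcyl z = hcyl w \<longleftrightarrow> (\<exists>k::int. z = w + of_real (6 * of_int k))"
proof -
  obtain k :: int where k: "6 * of_int k \<le> Re w" "Re w < 6 * of_int k + 6" by (rule hcyl_rep)
  let ?w = "Complex (Re w - 6 * of_int k) (Im w)"
  have "?w \<in> disco_rect" using k assms by (simp add: mem_disco_rect)
  from hcyl_eq_proj_iff[OF assms(1,2) this]
  have "hcyl z = hcyl w \<longleftrightarrow> (\<exists>k::int. z = ?w + of_real (6 * of_int k))"
    using hcyl_eq[of w k] k assms by simp
  also have "\<dots> \<longleftrightarrow> (\<exists>k::int. z = w + of_real (6 * of_int k))"
  proof (intro iffI; elim exE)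
    fix j :: int assume "z = ?w + of_real (6 * of_int j)"
    then have "z = w + of_real (6 * of_int (j - k))" by (simp add: complex_eq_iff)
    then show "\<exists>k::int. z = w + of_real (6 * of_int k)" by blast
  next
    fix j :: int assume "z = w + of_real (6 * of_int j)"
    then have "z = ?w + of_real (6 * of_int (j + k))" by (simp add: complex_eq_iff)
    then show "\<exists>k::int. z = ?w + of_real (6 * of_int k)" by blast
  qed
  finally show ?thesis .
qed

lemma vcyl_eq_iff:
  assumes "0 < Re z" "Re z < 1" "0 < Re w" "Re w < 1"
  shows "vcyl z = vcyl w \<longleftrightarrow> (\<exists>k::int. z = w + \<i> * of_real (3/2 * of_int k))"
proof
  assume eq: "vcyl z = vcyl w"
  obtain k :: int where k: "3/2 * of_int k \<le> Im w" "Im w < 3/2 * of_int k + 3/2" by (rule vcyl_rep)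
  show "\<exists>k::int. z = w + \<i> * of_real (3/2 * of_int k)"
  proof (cases "Im w \<le> 3/2 * of_int k + 1")
    case True
    let ?w = "Complex (Re w) (Im w - 3/2 * of_int k)"
    have "?w \<in> disco_rect" using k assms True by (simp add: mem_disco_rect)
    from vcyl_eq_proj_iff[OF assms(1,2) this] obtain j :: int where "z = ?w + \<i> * of_real (3/2 * of_int j)"
      using eq vcyl_eq1[OF k(1) True] assms by auto
    then have "z = w + \<i> * of_real (3/2 * of_int (j - k))" by (simp add: complex_eq_iff field_simps)
    then show ?thesis by blast
  next
    case False
    let ?w = "Complex (1 + 2 * Re w) (2 * (Im w - 3/2 * of_int k) - 2)"
    have "?w \<in> disco_rect" using k assms False by (simp add: mem_disco_rect)
    from vcyl_eq_proj_iff[OF assms(1,2) this]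
    obtain j :: int where "z = of_real (1/2) * ?w + Complex (-1/2) (1 + 3/2 * of_int j)"
      using eq vcyl_eq2[of w k] k assms False by auto
    then have "z = w + \<i> * of_real (3/2 * of_int (j - k))" by (simp add: complex_eq_iff field_simps)
    then show ?thesis by blast
  qed
next
  assume "\<exists>k::int. z = w + \<i> * of_real (3/2 * of_int k)"
  then show "vcyl z = vcyl w" using vcyl_periodic by blast
qed

text \<open>The half turn of the rectangle about its centre; it exchanges the two vertical cylinders.\<close>

definition disco_flip :: "complex set \<Rightarrow> complex set" where
  "disco_flip p = (\<lambda>z. Complex 6 1 - z) ` p"

text \<open>The half turn exchanges top and bottom as well as left and right, so a gluing pair comes
  out reversed: top [0,1] with bottom [1,3] becomes top [3,5] with bottom [5,6].\<close>

lemma disco_glue_flip: "(z, w) \<in> disco_glue \<Longrightarrow> (Complex 6 1 - w, Complex 6 1 - z) \<in> disco_glue"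
  unfolding mem_disco_glue by (elim disjE conjE) (simp_all add: field_simps)

lemma disco_rel_flip:
  assumes "(z, w) \<in> disco_rel"
  shows "(Complex 6 1 - z, Complex 6 1 - w) \<in> disco_rel"
proof -
  have "(z, w) \<in> (disco_glue \<union> disco_glue\<inverse>)\<^sup>*" using assms by (simp add: disco_rel_def)
  then have "(Complex 6 1 - z, Complex 6 1 - w) \<in> (disco_glue \<union> disco_glue\<inverse>)\<^sup>*"
  proof induction
    case (step y x)
    then have "(Complex 6 1 - y, Complex 6 1 - x) \<in> disco_glue \<union> disco_glue\<inverse>"
      using disco_glue_flip by blast
    with step.IH show ?case by (rule rtrancl_into_rtrancl)
  qed simp
  then show ?thesis using assms by (auto simp: disco_rel_def mem_disco_rect)
qed

lemma disco_rect_flip: "Complex 6 1 - z \<in> disco_rect \<longleftrightarrow> z \<in> disco_rect"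
  by (auto simp: mem_disco_rect)

lemma disco_flip_proj: "disco_flip (disco_proj z) = disco_proj (Complex 6 1 - z)"
proof -
  have "w \<in> disco_flip (disco_proj z) \<longleftrightarrow> (z, Complex 6 1 - w) \<in> disco_rel" for w
  proof -
    have e: "w = Complex 6 1 - u \<longleftrightarrow> u = Complex 6 1 - w" for u by auto
    have "w \<in> disco_flip (disco_proj z) \<longleftrightarrow> (\<exists>u. (z, u) \<in> disco_rel \<and> w = Complex 6 1 - u)"
      unfolding disco_flip_def disco_proj_def by blast
    then show ?thesis unfolding e by blast
  qed
  moreover have "(z, Complex 6 1 - w) \<in> disco_rel \<longleftrightarrow> (Complex 6 1 - z, w) \<in> disco_rel" for w
    using disco_rel_flip[of z "Complex 6 1 - w"] disco_rel_flip[of "Complex 6 1 - z" w] by auto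
  ultimately show ?thesis unfolding disco_proj_def by blast
qed

lemma disco_flip_flip [simp]: "disco_flip (disco_flip p) = p"
  by (simp add: disco_flip_def image_image)

lemma disco_flip_surface: "p \<in> disco_surface \<Longrightarrow> disco_flip p \<in> disco_surface"
  by (metis disco_flip_proj disco_proj_in disco_rect_flip disco_surface_cases)

lemma disco_flip_sing_iff [simp]: "disco_flip p \<in> disco_sing \<longleftrightarrow> p \<in> disco_sing"
proof -
  have "disco_flip q \<in> disco_sing" if "q \<in> disco_sing" for q
  proof -
    from that obtain z where z: "q = disco_proj z" "z \<in> disco_rect"
      using disco_sing_subset disco_surface_cases by blast
    with that have "Im z \<in> {0, 1} \<and> Re z \<in> {0, 1, 3, 5, 6}" by (simp add: disco_proj_in_sing_iff)
    then show ?thesis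
      using z by (auto simp: disco_flip_proj disco_proj_in_sing_iff disco_rect_flip)
  qed
  then show ?thesis by (metis disco_flip_flip)
qed

lemma continuous_disco_flip: "continuous_map disco_top disco_top disco_flip"
proof (rule continuous_compose_quotient_map[OF quotient_map_disco_proj])
  have "continuous_map (top_of_set disco_rect) disco_top (\<lambda>z. disco_proj (Complex 6 1 - z))"
    by (rule continuous_map_disco_proj_comp) (auto intro!: continuous_intros simp: disco_rect_flip)
  then show "continuous_map (top_of_set disco_rect) disco_top (disco_flip \<circ> disco_proj)"
    by (simp add: o_def disco_flip_proj)
qed

lemma homeomorphic_disco_flip: "homeomorphic_map disco_top disco_top disco_flip"
  using continuous_disco_flip
  by (auto simp: homeomorphic_map_maps homeomorphic_maps_def intro!: exI[of _ disco_flip])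

lemma openin_disco_flip: "openin disco_top U \<Longrightarrow> openin disco_top (disco_flip ` U)"
  using homeomorphic_disco_flip homeomorphic_imp_open_map open_map_def by blast

lemma disco_flip_hcyl:
  assumes "0 \<le> Im z" "Im z \<le> 1"
  shows "disco_flip (hcyl z) = hcyl (Complex 6 1 - z)"
proof -
  obtain k :: int where k: "6 * of_int k \<le> Re z" "Re z < 6 * of_int k + 6" by (rule hcyl_rep)
  have "disco_flip (hcyl z) = disco_proj (Complex (6 - Re z + 6 * of_int k) (1 - Im z))"
    using hcyl_eq[of z k] k assms by (simp add: disco_flip_proj complex_diff algebra_simps)
  also have "\<dots> = hcyl (Complex 6 1 - z)"
    using hcyl_eq[of "Complex 6 1 - z" "- k"] k assms by simp
  finally show ?thesis .
qed

text \<open>The open horizontal strip misses only the top and bottom sides. A regular point of these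
  is not a corner, so it is interior to one of the two vertical cylinders; three parametrizations
  thus cover the regular part.\<close>

lemma disco_regular_cases:
  assumes "p \<in> disco_surface" "p \<notin> disco_sing"
  obtains (h) z where "0 < Im z" "Im z < 1" "p = hcyl z"
    | (v) z where "0 < Re z" "Re z < 1" "p = vcyl z"
    | (f) z where "0 < Re z" "Re z < 1" "p = disco_flip (vcyl z)"
proof -
  obtain w where w: "w \<in> disco_rect" "p = disco_proj w" using assms(1) by (rule disco_surface_cases)
  have c1: "\<exists>z. 0 < Re z \<and> Re z < 1 \<and> disco_proj u = vcyl z"
    if "u \<in> disco_rect" "0 < Re u" "Re u < 3" "Re u \<noteq> 1" for u
  proof (cases "Re u < 1")
    case True
    then have "vcyl u = disco_proj u" using vcyl_eq_proj_iff[of u u] that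
      by (auto intro!: exI[of _ 0])
    then show ?thesis using True that by metis
  next
    case False
    let ?u = "of_real (1/2) * u + Complex (-1/2) (1 + 3/2 * of_int 0)"
    have "vcyl ?u = disco_proj u" using vcyl_eq_proj_iff[of ?u u] False that by auto
    moreover have "0 < Re ?u" "Re ?u < 1" using False that by auto
    ultimately show ?thesis by metis
  qed
  show ?thesis
  proof (cases "0 < Im w \<and> Im w < 1")
    case True
    then have "hcyl w = p" using w hcyl_eq_proj_iff[of w w] by (auto intro!: exI[of _ 0])
    then show ?thesis using True h by blast
  next
    case False
    then have "Im w \<in> {0, 1}" using w by (auto simp: mem_disco_rect)
    then have "Re w \<notin> {0, 1, 3, 5, 6}" using assms w by (auto simp: disco_proj_in_sing_iff)
    then consider "0 < Re w" "Re w < 3" "Re w \<noteq> 1" | "3 < Re w" "Re w < 6" "Re w \<noteq> 5"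
      using w(1) unfolding mem_disco_rect by (simp, linarith)
    then show ?thesis
    proof cases
      case 1
      then show ?thesis using c1[of w] w v by blast
    next
      case 2
      then obtain z where "0 < Re z \<and> Re z < 1 \<and> disco_proj (Complex 6 1 - w) = vcyl z"
        using c1[of "Complex 6 1 - w"] w by (auto simp: disco_rect_flip)
      then have "0 < Re z" "Re z < 1" "p = disco_flip (vcyl z)"
        using w by (metis disco_flip_flip disco_flip_proj)+
      then show ?thesis by (rule f)
    qed
  qed
qed

text \<open>Near \<open>v\<close>, on either side of a line through \<open>v\<close>, the map \<open>\<psi>\<close> is an affine map into the rectangle followed by
  the projection.\<close>

definition disco_pieces :: "(complex \<Rightarrow> complex set) \<Rightarrow> complex \<Rightarrow> bool" where
  "disco_pieces \<psi> v \<longleftrightarrow> (\<exists>e>0. \<exists>\<alpha>>0. \<exists>\<beta>. \<exists>\<alpha>'>0. \<exists>\<beta>'. \<exists>d. d \<noteq> 0 \<and> (\<forall>u\<in>ball v e.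
     (0 \<le> Re ((u - v) * cnj d) \<longrightarrow> of_real \<alpha> * u + \<beta> \<in> disco_rect \<and> \<psi> u = disco_proj (of_real \<alpha> * u + \<beta>)) \<and>
     (Re ((u - v) * cnj d) \<le> 0 \<longrightarrow> of_real \<alpha>' * u + \<beta>' \<in> disco_rect \<and> \<psi> u = disco_proj
         (of_real \<alpha>' * u + \<beta>'))))"

lemma disco_piecesI:
  assumes "e > 0" "\<alpha> > 0" "\<alpha>' > 0" "d \<noteq> 0"
    and "\<And>u. u \<in> ball v e \<Longrightarrow> 0 \<le> Re ((u - v) * cnj d) \<Longrightarrow>
       of_real \<alpha> * u + \<beta> \<in> disco_rect \<and> \<psi> u = disco_proj (of_real \<alpha> * u + \<beta>)"
    and "\<And>u. u \<in> ball v e \<Longrightarrow> Re ((u - v) * cnj d) \<le> 0 \<Longrightarrow>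
       of_real \<alpha>' * u + \<beta>' \<in> disco_rect \<and> \<psi> u = disco_proj (of_real \<alpha>' * u + \<beta>')"
  shows "disco_pieces \<psi> v"
  unfolding disco_pieces_def
  by (rule exI[of _ e], rule conjI[OF assms(1)], rule exI[of _ \<alpha>], rule conjI[OF assms(2)],
      rule exI[of _ \<beta>], rule exI[of _ \<alpha>'], rule conjI[OF assms(3)], rule exI[of _ \<beta>'],
      rule exI[of _ d], rule conjI[OF assms(4)]) (intro ballI conjI[OF impI impI] assms(5,6))

lemma affine_eq_at_two_points:
  fixes A B A' B' v w :: complex
  assumes "v \<noteq> w" "A * v + B = A' * v + B'" "A * w + B = A' * w + B'"
  shows "A = A' \<and> B = B'"
proof -
  have "(A - A') * (v - w) = 0" using assms(2,3) by algebra
  then show ?thesis using assms by simp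
qed

text \<open>The chart is known to be affine only at each preimage in the rectangle, hence on each
  half disc separately. The half discs share a segment, and affine maps that agree at two points
  coincide; so there is a single formula on the whole disc.\<close>

lemma disco_pieces_chart:
  assumes chart: "disco_chart U \<phi>" and \<psi>: "disco_pieces \<psi> v" and v: "\<psi> v \<in> U"
  shows "\<exists>a>0. \<exists>b. \<exists>e>0. \<forall>u\<in>ball v e. \<psi> u \<in> U \<and> \<phi> (\<psi> u) = of_real a * u + b"
proof -
  from \<psi> obtain e \<alpha> \<beta> \<alpha>' \<beta>' d where e: "e > 0" "\<alpha> > 0" "\<alpha>' > 0" "d \<noteq> 0"
    and P: "\<And>u. u \<in> ball v e \<Longrightarrow> 0 \<le> Re ((u - v) * cnj d) \<Longrightarrow>
       of_real \<alpha> * u + \<beta> \<in> disco_rect \<and> \<psi> u = disco_proj (of_real \<alpha> * u + \<beta>)"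
    and Q: "\<And>u. u \<in> ball v e \<Longrightarrow> Re ((u - v) * cnj d) \<le> 0 \<Longrightarrow>
       of_real \<alpha>' * u + \<beta>' \<in> disco_rect \<and> \<psi> u = disco_proj (of_real \<alpha>' * u + \<beta>')"
    unfolding disco_pieces_def by blast
  have loc: "\<exists>a>0. \<exists>b. \<exists>e>0. \<forall>w\<in>disco_rect \<inter> ball z e. disco_proj w \<in> U \<and>
      \<phi> (disco_proj w) = of_real a * w + b"
    if "z \<in> disco_rect" "disco_proj z \<in> U" for z
    using chart that unfolding disco_chart_def by blast
  obtain a b e1 where 1: "a > 0" "e1 > 0" "\<And>w. w \<in> disco_rect \<inter> ball (of_real \<alpha> * v + \<beta>) e1 \<Longrightarrow>
      disco_proj w \<in> U \<and> \<phi> (disco_proj w) = of_real a * w + b"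
    using loc[of "of_real \<alpha> * v + \<beta>"] P[of v] v e by auto
  obtain a' b' e2 where 2: "a' > 0" "e2 > 0" "\<And>w. w \<in> disco_rect \<inter> ball (of_real \<alpha>' * v + \<beta>') e2 \<Longrightarrow>
      disco_proj w \<in> U \<and> \<phi> (disco_proj w) = of_real a' * w + b'"
    using loc[of "of_real \<alpha>' * v + \<beta>'"] Q[of v] v e by auto
  define r where "r = min e (min (e1 / \<alpha>) (e2 / \<alpha>'))"
  have "r \<le> e1 / \<alpha>" "r \<le> e2 / \<alpha>'" by (simp_all add: r_def)
  then have r: "r > 0" "r \<le> e" "\<alpha> * r \<le> e1" "\<alpha>' * r \<le> e2"
    using e 1(1,2) 2(1,2) by (simp_all add: r_def pos_le_divide_eq mult.commute)
  have sc: "of_real s * u + c \<in> ball (of_real s * v + c) (s * r)" if "s > 0" "u \<in> ball v r" for s u c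
  proof -
    have "dist (of_real s * v + c) (of_real s * u + c) = norm (of_real s * (v - u))"
      by (simp add: dist_norm algebra_simps)
    also have "\<dots> = s * dist v u" using that by (simp only: norm_mult dist_norm) simp
    finally show ?thesis using that by simp
  qed
  have PP: "\<psi> u \<in> U \<and> \<phi> (\<psi> u) = of_real (a * \<alpha>) * u + (of_real a * \<beta> + b)"
    if "u \<in> ball v r" "0 \<le> Re ((u - v) * cnj d)" for u
  proof -
    have "of_real \<alpha> * u + \<beta> \<in> ball (of_real \<alpha> * v + \<beta>) e1" using sc[of \<alpha> u \<beta>] that(1) e r by auto
    then show ?thesis using P[of u] 1(3)[of "of_real \<alpha> * u + \<beta>"] that r by (auto simp: algebra_simps)
  qed
  have QQ: "\<psi> u \<in> U \<and> \<phi> (\<psi> u) = of_real (a' * \<alpha>') * u + (of_real a' * \<beta>' + b')"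
    if "u \<in> ball v r" "Re ((u - v) * cnj d) \<le> 0" for u
  proof -
    have "of_real \<alpha>' * u + \<beta>' \<in> ball (of_real \<alpha>' * v + \<beta>') e2" using sc[of \<alpha>' u \<beta>'] that(1) e r by auto
    then show ?thesis using Q[of u] 2(3)[of "of_real \<alpha>' * u + \<beta>'"] that r by (auto simp: algebra_simps)
  qed
  \<comment> \<open>A second common point of the half discs: \<open>\<i> * d\<close> is orthogonal
    to \<open>d\<close>, and the factor puts \<open>v'\<close> at distance r/2 from
    \<open>v\<close>.\<close>
  define v' where "v' = v + of_real (r / (2 * norm d)) * (\<i> * d)"
  have "norm (v' - v) = r / 2" using e r by (simp add: v'_def norm_mult norm_divide)
  then have v': "v' \<in> ball v r" "v' \<noteq> v" using r by (auto simp: dist_norm norm_minus_commute)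
  have "(v' - v) * cnj d = of_real (r / (2 * norm d)) * \<i> * (d * cnj d)"
    by (simp add: v'_def algebra_simps)
  also have "d * cnj d = of_real ((norm d)\<^sup>2)" by (rule complex_norm_square[symmetric])
  finally have z: "Re ((v' - v) * cnj d) = 0" by simp
  have "of_real (a * \<alpha>) * v + (of_real a * \<beta> + b) = of_real (a' * \<alpha>') * v + (of_real a' * \<beta>' + b')"
    using PP[of v] QQ[of v] r by auto
  moreover have "of_real (a * \<alpha>) * v' + (of_real a * \<beta> + b) =
      of_real (a' * \<alpha>') * v' + (of_real a' * \<beta>' + b')"
    using PP[of v'] QQ[of v'] v' z by simp
  ultimately have "of_real (a * \<alpha>) = (of_real (a' * \<alpha>') :: complex)" and
    eq': "of_real a * \<beta> + b = of_real a' * \<beta>' + b'"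
    using affine_eq_at_two_points[OF v'(2)[symmetric]] by blast+
  then have eq: "a * \<alpha> = a' * \<alpha>'" by (simp only: of_real_eq_iff)
  have "\<psi> u \<in> U \<and> \<phi> (\<psi> u) = of_real (a * \<alpha>) * u + (of_real a * \<beta> + b)" if "u \<in> ball v r" for u
    using PP[OF that] QQ[OF that] eq eq' by (cases "0 \<le> Re ((u - v) * cnj d)") auto
  moreover have "a * \<alpha> > 0" using 1 e by simp
  ultimately show ?thesis using r(1) by blast
qed

lemma disco_pieces_flip:
  assumes "disco_pieces \<psi> v"
  shows "disco_pieces (\<lambda>u. disco_flip (\<psi> (c - u))) (c - v)"
proof -
  from assms obtain e \<alpha> \<beta> \<alpha>' \<beta>' d where e: "e > 0" "\<alpha> > 0" "\<alpha>' > 0" "d \<noteq> 0"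
    and P: "\<And>u. u \<in> ball v e \<Longrightarrow> 0 \<le> Re ((u - v) * cnj d) \<Longrightarrow>
       of_real \<alpha> * u + \<beta> \<in> disco_rect \<and> \<psi> u = disco_proj (of_real \<alpha> * u + \<beta>)"
    and Q: "\<And>u. u \<in> ball v e \<Longrightarrow> Re ((u - v) * cnj d) \<le> 0 \<Longrightarrow>
       of_real \<alpha>' * u + \<beta>' \<in> disco_rect \<and> \<psi> u = disco_proj (of_real \<alpha>' * u + \<beta>')"
    unfolding disco_pieces_def by blast
  have b: "c - u \<in> ball v e" if "u \<in> ball (c - v) e" for u
    using that by (simp add: dist_norm norm_minus_commute algebra_simps)
  have h: "Re ((c - u - v) * cnj d) = Re ((u - (c - v)) * cnj (- d))" for u
    by (simp add: algebra_simps)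
  have f: "of_real s * u + (Complex 6 1 - of_real s * c - t) = Complex 6 1 - (of_real s * (c - u) + t)"
      for s u t
    by (simp add: algebra_simps)
  show ?thesis
  proof (rule disco_piecesI[of e \<alpha> \<alpha>' "- d" _ "Complex 6 1 - of_real \<alpha> * c - \<beta>" _
      "Complex 6 1 - of_real \<alpha>' * c - \<beta>'"])
    fix u assume u: "u \<in> ball (c - v) e" "0 \<le> Re ((u - (c - v)) * cnj (- d))"
    then have "0 \<le> Re ((c - u - v) * cnj d)" using h[of u] by simp
    from P[OF b[OF u(1)] this] show "of_real \<alpha> * u + (Complex 6 1 - of_real \<alpha> * c - \<beta>) \<in> disco_rect \<and>
        disco_flip (\<psi> (c - u)) = disco_proj (of_real \<alpha> * u + (Complex 6 1 - of_real \<alpha> * c - \<beta>))"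
      unfolding f disco_rect_flip by (simp add: disco_flip_proj)
  next
    fix u assume u: "u \<in> ball (c - v) e" "Re ((u - (c - v)) * cnj (- d)) \<le> 0"
    then have "Re ((c - u - v) * cnj d) \<le> 0" using h[of u] by simp
    from Q[OF b[OF u(1)] this] show "of_real \<alpha>' * u + (Complex 6 1 - of_real \<alpha>' * c - \<beta>') \<in> disco_rect \<and>
        disco_flip (\<psi> (c - u)) = disco_proj (of_real \<alpha>' * u + (Complex 6 1 - of_real \<alpha>' * c - \<beta>'))"
      unfolding f disco_rect_flip by (simp add: disco_flip_proj)
  qed (use e in auto)
qed

lemma disco_pieces_hcyl:
  assumes "0 < Im v" "Im v < 1"
  shows "disco_pieces hcyl v"
proof -
  obtain k :: int where k: "6 * of_int k \<le> Re v" "Re v < 6 * of_int k + 6" by (rule hcyl_rep)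
  \<comment> \<open>On the seam \<open>Re v = 6 * of_int k\<close> the left half disc belongs to the
    preceding period; elsewhere both halves use the same one.\<close>
  define j where "j = (if 6 * of_int k = Re v then k - 1 else k)"
  define e where "e = Min ({Im v, 1 - Im v, 6 * of_int k + 6 - Re v} \<union> (if 6 * of_int k =
      Re v then {1} else {Re v - 6 * of_int k}))"
  have e: "e > 0" "e \<le> Im v" "e \<le> 1 - Im v" "e \<le> 6 * of_int k + 6 - Re v"
    "6 * of_int k = Re v \<longrightarrow> e \<le> 1" "6 * of_int k \<noteq> Re v \<longrightarrow> e \<le> Re v - 6 * of_int k"
    using assms k by (auto simp: e_def)
  have eq: "of_real 1 * u + - of_real (6 * of_int i) = Complex (Re u - 6 * of_int i) (Im u)" for u
      and i :: int
    by (simp add: complex_eq_iff)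
  have u: "0 \<le> Im u" "Im u \<le> 1" "Re u \<le> 6 * of_int k + 6" "6 * of_int k - 1 \<le> Re u"
       "6 * of_int k \<noteq> Re v \<longrightarrow> 6 * of_int k \<le> Re u" "6 * of_int k = Re v \<longrightarrow> Re u \<le> 6 * of_int k + 1"
    if "u \<in> ball v e" for u
  proof -
    have "\<bar>Re u - Re v\<bar> < e" "\<bar>Im u - Im v\<bar> < e"
      using that abs_Re_le_cmod[of "u - v"] abs_Im_le_cmod[of "u - v"]
          by (auto simp: dist_norm norm_minus_commute)
    then show "0 \<le> Im u" "Im u \<le> 1" "Re u \<le> 6 * of_int k + 6" "6 * of_int k - 1 \<le> Re u"
       "6 * of_int k \<noteq> Re v \<longrightarrow> 6 * of_int k \<le> Re u" "6 * of_int k = Re v \<longrightarrow> Re u \<le> 6 * of_int k + 1"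
      using e k by linarith+
  qed
  show ?thesis
  proof (rule disco_piecesI[of e 1 1 1 _ "- of_real (6 * of_int k)" _ "- of_real (6 * of_int j)"])
    fix z assume z: "z \<in> ball v e" "0 \<le> Re ((z - v) * cnj 1)"
    then have "6 * of_int k \<le> Re z" using k by simp
    then show "of_real 1 * z + - of_real (6 * of_int k) \<in> disco_rect \<and>
        hcyl z = disco_proj (of_real 1 * z + - of_real (6 * of_int k))"
      unfolding eq using u[OF z(1)] hcyl_eq[of z k] by (auto simp: mem_disco_rect)
  next
    fix z assume z: "z \<in> ball v e" "Re ((z - v) * cnj 1) \<le> 0"
    then have "6 * of_int j \<le> Re z" "Re z \<le> 6 * of_int j + 6" using u[OF z(1)] by (auto simp: j_def)
    then show "of_real 1 * z + - of_real (6 * of_int j) \<in> disco_rect \<and>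
        hcyl z = disco_proj (of_real 1 * z + - of_real (6 * of_int j))"
      unfolding eq using u[OF z(1)] hcyl_eq[of z j] by (auto simp: mem_disco_rect)
  qed (use e in auto)
qed

text \<open>The seams are the heights 3k/2 and 3k/2 + 1, where the factor switches between 1 and 2;
  at other heights both halves use the same affine map. The sign of the normal \<open>\<i>\<close>
  records on which side the factor is 1.\<close>

lemma disco_pieces_vcyl:
  assumes "0 < Re v" "Re v < 1"
  shows "disco_pieces vcyl v"
proof -
  obtain k :: int where k: "3/2 * of_int k \<le> Im v" "Im v < 3/2 * of_int k + 3/2" by (rule vcyl_rep)
  have eq1: "of_real 1 * u + - (\<i> * of_real (3/2 * of_int i)) = Complex (Re u) (Im u - 3/2 * of_int i)"
      for u and i :: int
    by (simp add: complex_eq_iff)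
  have eq2: "of_real 2 * u + Complex 1 (-2 - 3 * of_int i) =
      Complex (1 + 2 * Re u) (2 * (Im u - 3/2 * of_int i) - 2)" for u and i :: int
    by (simp add: complex_eq_iff)
  have P1: "of_real 1 * u + - (\<i> * of_real (3/2 * of_int i)) \<in> disco_rect \<and>
      vcyl u = disco_proj (of_real 1 * u + - (\<i> * of_real (3/2 * of_int i)))"
    if "0 < Re u" "Re u < 1" "3/2 * of_int i \<le> Im u" "Im u \<le> 3/2 * of_int i + 1" for u and i :: int
    unfolding eq1 using vcyl_eq1[of i u] that by (auto simp: mem_disco_rect)
  have P2: "of_real 2 * u + Complex 1 (-2 - 3 * of_int i) \<in> disco_rect \<and>
      vcyl u = disco_proj (of_real 2 * u + Complex 1 (-2 - 3 * of_int i))"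
    if "0 < Re u" "Re u < 1" "3/2 * of_int i + 1 \<le> Im u" "Im u \<le> 3/2 * of_int i + 3/2" for u and i :: int
    unfolding eq2 using vcyl_eq2[of u i] that by (auto simp: mem_disco_rect)
  have ball: "\<bar>Re u - Re v\<bar> < e" "\<bar>Im u - Im v\<bar> < e" if "u \<in> ball v e" for u e
    using that abs_Re_le_cmod[of "u - v"] abs_Im_le_cmod[of "u - v"]
        by (auto simp: dist_norm norm_minus_commute)
  have side: "Re ((u - v) * cnj \<i>) = Im u - Im v" for u by simp
  let ?e0 = "min (Re v) (1 - Re v)"
  consider "Im v = 3/2 * of_int k" | "3/2 * of_int k < Im v" "Im v < 3/2 * of_int k + 1"
    | "Im v = 3/2 * of_int k + 1" | "3/2 * of_int k + 1 < Im v" "Im v < 3/2 * of_int k + 3/2"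
    using k by linarith
  then show ?thesis
  proof cases
    case 1
    define e where "e = min ?e0 (1/2)"
    have "e > 0" using assms by (auto simp: e_def)
    moreover have "(0 \<le> Re ((u - v) * cnj \<i>) \<longrightarrow>
        of_real 1 * u + - (\<i> * of_real (3/2 * of_int k)) \<in> disco_rect \<and>
      vcyl u = disco_proj (of_real 1 * u + - (\<i> * of_real (3/2 * of_int k)))) \<and>
      (Re ((u - v) * cnj \<i>) \<le> 0 \<longrightarrow> of_real 2 * u + Complex 1 (-2 - 3 * of_int (k - 1)) \<in> disco_rect \<and>
      vcyl u = disco_proj (of_real 2 * u + Complex 1 (-2 - 3 * of_int (k - 1))))" if "u \<in> ball v e" for u
      unfolding side using ball[OF that] assms 1
      by (intro conjI[of "_ \<longrightarrow> _"] impI P1 P2) (auto simp: e_def min_less_iff_conj diff_divide_distrib)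
    ultimately show ?thesis
      by (intro disco_piecesI[of e 1 2 "\<i>" v "- (\<i> * of_real (3/2 * of_int k))" vcyl
          "Complex 1 (-2 - 3 * of_int (k - 1))"]) auto
  next
    case 2
    define e where "e = min ?e0 (min (Im v - 3/2 * of_int k) (3/2 * of_int k + 1 - Im v))"
    have "e > 0" using assms 2 by (auto simp: e_def)
    moreover have "of_real 1 * u + - (\<i> * of_real (3/2 * of_int k)) \<in> disco_rect \<and>
      vcyl u = disco_proj (of_real 1 * u + - (\<i> * of_real (3/2 * of_int k)))" if "u \<in> ball v e" for u
      using ball[OF that] assms 2 by (intro P1) (auto simp: e_def min_less_iff_conj)
    ultimately show ?thesis
      by (intro disco_piecesI[of e 1 1 "\<i>" v "- (\<i> * of_real (3/2 * of_int k))" vcyl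
          "- (\<i> * of_real (3/2 * of_int k))"]) auto
  next
    case 3
    define e where "e = min ?e0 (1/2)"
    have "e > 0" using assms by (auto simp: e_def)
    moreover have "(0 \<le> Re ((u - v) * cnj (-\<i>)) \<longrightarrow>
        of_real 1 * u + - (\<i> * of_real (3/2 * of_int k)) \<in> disco_rect \<and>
      vcyl u = disco_proj (of_real 1 * u + - (\<i> * of_real (3/2 * of_int k)))) \<and>
      (Re ((u - v) * cnj (-\<i>)) \<le> 0 \<longrightarrow> of_real 2 * u + Complex 1 (-2 - 3 * of_int k) \<in> disco_rect \<and>
      vcyl u = disco_proj (of_real 2 * u + Complex 1 (-2 - 3 * of_int k)))" if "u \<in> ball v e" for u
      using side[of u] ball[OF that] assms 3
      by (intro conjI[of "_ \<longrightarrow> _"] impI P1 P2) (auto simp: e_def min_less_iff_conj)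
    ultimately show ?thesis
      by (intro disco_piecesI[of e 1 2 "-\<i>" v "- (\<i> * of_real (3/2 * of_int k))" vcyl
          "Complex 1 (-2 - 3 * of_int k)"]) auto
  next
    case 4
    define e where "e = min ?e0 (min (Im v - 3/2 * of_int k - 1) (3/2 * of_int k + 3/2 - Im v))"
    have "e > 0" using assms 4 by (auto simp: e_def)
    moreover have "of_real 2 * u + Complex 1 (-2 - 3 * of_int k) \<in> disco_rect \<and>
      vcyl u = disco_proj (of_real 2 * u + Complex 1 (-2 - 3 * of_int k))" if "u \<in> ball v e" for u
      using ball[OF that] assms 4 by (intro P2) (auto simp: e_def min_less_iff_conj)
    ultimately show ?thesis
      by (intro disco_piecesI[of e 2 2 "\<i>" v "Complex 1 (-2 - 3 * of_int k)" vcyl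
          "Complex 1 (-2 - 3 * of_int k)"]) auto
  qed
qed

section \<open>Locally affine maps into the surface\<close>

text \<open>Maps into the surface play the role of inverse charts: \<open>locally_affine 1 \<psi> u\<close> says that \<open>\<psi>\<close> is,
  near \<open>u\<close>, the inverse of a chart up to \<open>z \<mapsto> a z + b\<close>. A factor \<open>c\<close> turns directions by its argument.\<close>

definition locally_affine :: "complex \<Rightarrow> (complex \<Rightarrow> complex set) \<Rightarrow> complex \<Rightarrow> bool" where
  "locally_affine c \<psi> u \<longleftrightarrow> (\<exists>U \<phi>. disco_chart U \<phi> \<and>
     (\<exists>a>0. \<exists>b. \<exists>e>0. \<forall>w\<in>ball u e. \<psi> w \<in> U \<and> \<phi> (\<psi> w) = of_real a * c * w + b))"

text \<open>Chart-free data from which the local inverses of \<open>\<psi>\<close> become charts.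
  The distance 1 of the injectivity clause lies below both periods, 6 and 3/2. The last clause
  speaks of every preimage in the rectangle because \<open>disco_chart\<close> is tested at each of
  them.\<close>

definition disco_model :: "complex set \<Rightarrow> (complex \<Rightarrow> complex set) \<Rightarrow> bool" where
  "disco_model A \<psi> \<longleftrightarrow> open A \<and> continuous_map (top_of_set A) disco_top \<psi> \<and>
     (\<forall>W. open W \<longrightarrow> W \<subseteq> A \<longrightarrow> openin disco_top (\<psi> ` W)) \<and>
     (\<forall>u\<in>A. \<psi> u \<notin> disco_sing) \<and>
     (\<forall>u\<in>A. \<forall>u'\<in>A. \<psi> u = \<psi> u' \<longrightarrow> dist u u' < 1 \<longrightarrow> u = u') \<and>
     (\<forall>u\<in>A. disco_pieces \<psi> u) \<and>
     (\<forall>u\<in>A. \<forall>z\<in>disco_rect. disco_proj z = \<psi> u \<longrightarrow> (\<exists>a>0. \<exists>b. of_real a * z + b = u \<and>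
        (\<exists>e>0. \<forall>w\<in>disco_rect \<inter> ball z e. disco_proj w = \<psi> (of_real a * w + b))))"

lemma disco_model_hcyl: "disco_model {z. 0 < Im z \<and> Im z < 1} hcyl"
  unfolding disco_model_def
proof (intro conjI allI impI ballI)
  show "open {z. 0 < Im z \<and> Im z < 1}"
    by (intro open_Collect_conj open_Collect_less continuous_intros)
  show "continuous_map (top_of_set {z. 0 < Im z \<and> Im z < 1}) disco_top hcyl"
    by (rule continuous_map_from_subtopology_mono[OF continuous_hcyl]) auto
  fix W :: "complex set" assume "open W" "W \<subseteq> {z. 0 < Im z \<and> Im z < 1}"
  then show "openin disco_top (hcyl ` W)" by (rule openin_hcyl_image)
next
  fix u assume u: "u \<in> {z. 0 < Im z \<and> Im z < 1}"
  then show "disco_pieces hcyl u" by (simp add: disco_pieces_hcyl)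
  obtain k :: int where k: "6 * of_int k \<le> Re u" "Re u < 6 * of_int k + 6" by (rule hcyl_rep)
  then show "hcyl u \<notin> disco_sing"
    using u hcyl_eq[of u k] by (simp add: disco_proj_in_sing_iff mem_disco_rect)
  {
    fix u' assume u': "u' \<in> {z. 0 < Im z \<and> Im z < 1}" "hcyl u = hcyl u'" "dist u u' < 1"
    then obtain j :: int where j: "u = u' + of_real (6 * of_int j)" using hcyl_eq_iff[of u u'] u by auto
    then have "norm (of_real (6 * of_int j) :: complex) < 1" using u'(3) by (simp add: dist_norm)
    then have "\<bar>6 * real_of_int j\<bar> < 1" by (simp only: norm_of_real)
    then have "j = 0" by linarith
    then show "u = u'" using j by simp
  }
  fix z assume z: "z \<in> disco_rect" "disco_proj z = hcyl u"
  then obtain j :: int where j: "u = z + of_real (6 * of_int j)" using hcyl_eq_proj_iff[of u z] u by auto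
  define e where "e = min (Im z) (1 - Im z)"
  have "e > 0" using u j by (auto simp: e_def)
  moreover have "\<forall>w\<in>disco_rect \<inter> ball z e. disco_proj w = hcyl (of_real 1 * w + of_real (6 * of_int j))"
  proof
    fix w assume w: "w \<in> disco_rect \<inter> ball z e"
    then have "\<bar>Im w - Im z\<bar> < e"
      using abs_Im_le_cmod[of "w - z"] by (auto simp: dist_norm norm_minus_commute)
    then have "0 < Im w" "Im w < 1" by (auto simp: e_def)
    then show "disco_proj w = hcyl (of_real 1 * w + of_real (6 * of_int j))"
      using hcyl_eq_proj_iff[of "of_real 1 * w + of_real (6 * of_int j)" w] w by auto
  qed
  moreover have "of_real 1 * z + of_real (6 * of_int j) = u" using j by simp
  ultimately show "\<exists>a>0. \<exists>b. of_real a * z + b = u \<and>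
        (\<exists>e>0. \<forall>w\<in>disco_rect \<inter> ball z e. disco_proj w = hcyl (of_real a * w + b))"
    using zero_less_one by blast
qed

lemma disco_model_vcyl: "disco_model {z. 0 < Re z \<and> Re z < 1} vcyl"
  unfolding disco_model_def
proof (intro conjI allI impI ballI)
  show "open {z. 0 < Re z \<and> Re z < 1}"
    by (intro open_Collect_conj open_Collect_less continuous_intros)
  show "continuous_map (top_of_set {z. 0 < Re z \<and> Re z < 1}) disco_top vcyl"
    by (rule continuous_map_from_subtopology_mono[OF continuous_vcyl]) auto
  fix W :: "complex set" assume "open W" "W \<subseteq> {z. 0 < Re z \<and> Re z < 1}"
  then show "openin disco_top (vcyl ` W)" by (rule openin_vcyl_image)
next
  fix u assume "u \<in> {z. 0 < Re z \<and> Re z < 1}"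
  then have u: "0 < Re u" "Re u < 1" by auto
  then show "disco_pieces vcyl u" by (simp add: disco_pieces_vcyl)
  show "vcyl u \<notin> disco_sing"
  proof
    assume "vcyl u \<in> disco_sing"
    then obtain x y where xy: "vcyl u = disco_proj (Complex x y)" "x \<in> {0, 1, 3, 5, 6}" "y \<in> {0, 1}"
      unfolding disco_sing_def by auto
    then have "Complex x y \<in> disco_rect" by (auto simp: mem_disco_rect)
    from vcyl_eq_proj_iff[OF u this] xy show False by auto
  qed
  {
    fix u' assume u': "u' \<in> {z. 0 < Re z \<and> Re z < 1}" "vcyl u = vcyl u'" "dist u u' < 1"
    then obtain j :: int where j: "u = u' + \<i> * of_real (3/2 * of_int j)" using vcyl_eq_iff[of u u'] u
        by auto
    then have "norm (\<i> * of_real (3/2 * of_int j) :: complex) < 1" using u'(3) by (simp add: dist_norm)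
    then have "\<bar>3/2 * real_of_int j\<bar> < 1" by (simp only: norm_of_real norm_mult norm_ii mult_1)
    then have "j = 0" by linarith
    then show "u = u'" using j by simp
  }
  fix z assume z: "z \<in> disco_rect" "disco_proj z = vcyl u"
  have near: "\<bar>Re w - Re z\<bar> < e" if "w \<in> disco_rect \<inter> ball z e" for w e
    using that abs_Re_le_cmod[of "w - z"] by (auto simp: dist_norm norm_minus_commute)
  from vcyl_eq_proj_iff[OF u z(1)] z(2)
  consider j :: int where "0 < Re z" "Re z < 1" "u = z + \<i> * of_real (3/2 * of_int j)"
    | j :: int where "1 < Re z" "Re z < 3" "u = of_real (1/2) * z + (Complex (-1/2) (1 + 3/2 * of_int j))"
    by auto
  then show "\<exists>a>0. \<exists>b. of_real a * z + b = u \<and>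
        (\<exists>e>0. \<forall>w\<in>disco_rect \<inter> ball z e. disco_proj w = vcyl (of_real a * w + b))"
  proof cases
    case 1
    define e where "e = min (Re z) (1 - Re z)"
    have "e > 0" using 1 by (auto simp: e_def)
    moreover have "\<forall>w\<in>disco_rect \<inter> ball z e. disco_proj w =
        vcyl (of_real 1 * w + \<i> * of_real (3/2 * of_int j))"
    proof
      fix w assume w: "w \<in> disco_rect \<inter> ball z e"
      then have "0 < Re w" "Re w < 1" using near[OF w] by (auto simp: e_def)
      then show "disco_proj w = vcyl (of_real 1 * w + \<i> * of_real (3/2 * of_int j))"
        using vcyl_eq_proj_iff[of "of_real 1 * w + \<i> * of_real (3/2 * of_int j)" w] w by auto
    qed
    moreover have "of_real 1 * z + \<i> * of_real (3/2 * of_int j) = u" using 1 by simp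
    ultimately show ?thesis using zero_less_one by blast
  next
    case 2
    define e where "e = min (Re z - 1) (3 - Re z)"
    have "e > 0" using 2 by (auto simp: e_def)
    moreover have "\<forall>w\<in>disco_rect \<inter> ball z e.
        disco_proj w = vcyl (of_real (1/2) * w + Complex (-1/2) (1 + 3/2 * of_int j))"
    proof
      fix w assume w: "w \<in> disco_rect \<inter> ball z e"
      then have "1 < Re w" "Re w < 3" using near[OF w] by (auto simp: e_def)
      then show "disco_proj w = vcyl (of_real (1/2) * w + Complex (-1/2) (1 + 3/2 * of_int j))"
        using vcyl_eq_proj_iff[of "of_real (1/2) * w + Complex (-1/2) (1 + 3/2 * of_int j)" w] w by auto
    qed
    moreover have "of_real (1/2) * z + Complex (-1/2) (1 + 3/2 * of_int j) = u" using 2 by simp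
    moreover have "(0::real) < 1/2" by simp
    ultimately show ?thesis by blast
  qed
qed

lemma disco_model_flip:
  assumes "disco_model A \<psi>"
  shows "disco_model ((\<lambda>u. c - u) -` A) (\<lambda>u. disco_flip (\<psi> (c - u)))"
proof -
  have A: "open A" and ct: "continuous_map (top_of_set A) disco_top \<psi>"
    and op: "\<And>W. open W \<Longrightarrow> W \<subseteq> A \<Longrightarrow> openin disco_top (\<psi> ` W)"
    and ns: "\<And>u. u \<in> A \<Longrightarrow> \<psi> u \<notin> disco_sing"
    and inj: "\<And>u u'. u \<in> A \<Longrightarrow> u' \<in> A \<Longrightarrow> \<psi> u = \<psi> u' \<Longrightarrow> dist u u' < 1 \<Longrightarrow> u = u'"
    and pc: "\<And>u. u \<in> A \<Longrightarrow> disco_pieces \<psi> u"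
    and loc: "\<And>u z. u \<in> A \<Longrightarrow> z \<in> disco_rect \<Longrightarrow> disco_proj z = \<psi> u \<Longrightarrow> (\<exists>a>0. \<exists>b. of_real a * z + b = u \<and>
        (\<exists>e>0. \<forall>w\<in>disco_rect \<inter> ball z e. disco_proj w = \<psi> (of_real a * w + b)))"
    using assms unfolding disco_model_def by blast+
  let ?A = "(\<lambda>u. c - u) -` A"
  have img: "(\<lambda>u. disco_flip (\<psi> (c - u))) ` W = disco_flip ` \<psi> ` ((\<lambda>u. c - u) ` W)" for W
    by (simp add: image_image)
  show ?thesis
    unfolding disco_model_def
  proof (intro conjI allI impI ballI)
    show "open ?A" by (intro open_vimage A continuous_intros)
    have "continuous_map (top_of_set ?A) (top_of_set A) (\<lambda>u. c - u)"
      by (auto intro!: continuous_intros)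
    from continuous_map_compose[OF continuous_map_compose[OF this ct] continuous_disco_flip]
    show "continuous_map (top_of_set ?A) disco_top (\<lambda>u. disco_flip (\<psi> (c - u)))"
      by (simp add: o_def)
    fix W assume W: "open W" "W \<subseteq> ?A"
    have "(\<lambda>u. c - u) ` W = (\<lambda>u. c - u) -` W"
    proof (rule Set.set_eqI)
      fix x
      have "x = c - u \<longleftrightarrow> u = c - x" for u by auto
      then show "x \<in> (\<lambda>u. c - u) ` W \<longleftrightarrow> x \<in> (\<lambda>u. c - u) -` W" by (simp add: image_iff)
    qed
    moreover have "open ((\<lambda>u. c - u) -` W)" by (intro open_vimage W continuous_intros)
    ultimately have "open ((\<lambda>u. c - u) ` W)" by simp
    then show "openin disco_top ((\<lambda>u. disco_flip (\<psi> (c - u))) ` W)"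
      unfolding img using W(2) by (intro openin_disco_flip op) auto
  next
    fix u assume u: "u \<in> ?A"
    then show "disco_flip (\<psi> (c - u)) \<notin> disco_sing" using ns by simp
    show "disco_pieces (\<lambda>u. disco_flip (\<psi> (c - u))) u"
      using disco_pieces_flip[OF pc[of "c - u"], of c] u by simp
    {
      fix u' assume "u' \<in> ?A" "disco_flip (\<psi> (c - u)) = disco_flip (\<psi> (c - u'))" "dist u u' < 1"
      moreover have "dist (c - u) (c - u') = dist u u'" by (simp add: dist_norm norm_minus_commute)
      ultimately have "c - u = c - u'" using u by (intro inj) (auto dest: arg_cong[of _ _ disco_flip])
      then show "u = u'" by simp
    }
    fix z assume z: "z \<in> disco_rect" "disco_proj z = disco_flip (\<psi> (c - u))"
    then have "disco_proj (Complex 6 1 - z) = \<psi> (c - u)" "Complex 6 1 - z \<in> disco_rect"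
      by (metis disco_flip_flip disco_flip_proj z(2)) (simp add: disco_rect_flip z)
    then obtain a b e where abe: "a > 0" "of_real a * (Complex 6 1 - z) + b = c - u" "e > 0"
      and w: "\<And>w. w \<in> disco_rect \<inter> ball (Complex 6 1 - z) e \<Longrightarrow> disco_proj w = \<psi> (of_real a * w + b)"
      using loc[of "c - u" "Complex 6 1 - z"] u by blast
    have "disco_proj w = disco_flip (\<psi> (c - (of_real a * w + (c - of_real a * Complex 6 1 - b))))"
      if "w \<in> disco_rect \<inter> ball z e" for w
    proof -
      have "Complex 6 1 - w \<in> disco_rect \<inter> ball (Complex 6 1 - z) e"
        using that by (auto simp: disco_rect_flip dist_norm norm_minus_commute)
      from w[OF this] have "disco_flip (disco_proj (Complex 6 1 - w)) =
          disco_flip (\<psi> (of_real a * (Complex 6 1 - w) + b))"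
        by simp
      then show ?thesis by (simp add: disco_flip_proj algebra_simps)
    qed
    moreover have "of_real a * z + (c - of_real a * Complex 6 1 - b) = u"
      using abe(2) by (simp add: algebra_simps)
    ultimately show "\<exists>a>0. \<exists>b. of_real a * z + b = u \<and> (\<exists>e>0. \<forall>w\<in>disco_rect \<inter> ball z e.
        disco_proj w = disco_flip (\<psi> (c - (of_real a * w + b))))"
      using abe by blast
  qed
qed

lemma disco_model_chart:
  assumes model: "disco_model A \<psi>" and u: "u \<in> A"
  obtains r where "r > 0" "ball u r \<subseteq> A" "disco_chart (\<psi> ` ball u r) (inv_into (ball u r) \<psi>)"
      "inj_on \<psi> (ball u r)"
proof -
  have A: "open A" and ct: "continuous_map (top_of_set A) disco_top \<psi>"
    and op: "\<And>W. open W \<Longrightarrow> W \<subseteq> A \<Longrightarrow> openin disco_top (\<psi> ` W)"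
    and ns: "\<And>u. u \<in> A \<Longrightarrow> \<psi> u \<notin> disco_sing"
    and inj: "\<And>u u'. u \<in> A \<Longrightarrow> u' \<in> A \<Longrightarrow> \<psi> u = \<psi> u' \<Longrightarrow> dist u u' < 1 \<Longrightarrow> u = u'"
    and loc: "\<And>u z. u \<in> A \<Longrightarrow> z \<in> disco_rect \<Longrightarrow> disco_proj z = \<psi> u \<Longrightarrow> (\<exists>a>0. \<exists>b. of_real a * z + b = u \<and>
        (\<exists>e>0. \<forall>w\<in>disco_rect \<inter> ball z e. disco_proj w = \<psi> (of_real a * w + b)))"
    using model unfolding disco_model_def by blast+
  obtain r0 where r0: "r0 > 0" "ball u r0 \<subseteq> A" using A u open_contains_ball by blast
  \<comment> \<open>A radius of at most 1/2 keeps distances within the ball below 1, where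
    \<open>\<psi>\<close> is injective.\<close>
  define r where "r = min r0 (1/2)"
  let ?B = "ball u r"
  have r: "r > 0" "?B \<subseteq> A" "r \<le> 1/2" using r0 by (auto simp: r_def)
  have injB: "inj_on \<psi> ?B"
  proof (rule inj_onI)
    fix x y assume xy: "x \<in> ?B" "y \<in> ?B" "\<psi> x = \<psi> y"
    have "dist x y < 1" using xy(1,2) r dist_triangle_half_r[of u x 1 y] by (simp add: mem_ball)
    then show "x = y" using inj xy r by blast
  qed
  let ?U = "\<psi> ` ?B" and ?\<phi> = "inv_into ?B \<psi>"
  have oU: "openin disco_top ?U" using op r by blast
  have im: "?\<phi> ` ?U = ?B" using injB by (rule inv_into_image_cancel) simp
  have hm: "homeomorphic_map (top_of_set ?B) (subtopology disco_top ?U) \<psi>"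
  proof (rule bijective_open_imp_homeomorphic_map)
    show "continuous_map (top_of_set ?B) (subtopology disco_top ?U) \<psi>"
      using continuous_map_from_subtopology_mono[OF ct r(2)] by (intro continuous_map_into_subtopology) auto
    show "open_map (top_of_set ?B) (subtopology disco_top ?U) \<psi>"
      unfolding open_map_def
    proof (intro allI impI)
      fix V assume "openin (top_of_set ?B) V"
      then have "open V" "V \<subseteq> ?B" by (simp_all add: openin_open_eq)
      then show "openin (subtopology disco_top ?U) (\<psi> ` V)"
        using op[of V] r oU by (subst openin_open_subtopology) auto
    qed
    show "\<psi> ` topspace (top_of_set ?B) = topspace (subtopology disco_top ?U)"
      using openin_subset[OF oU] by auto
    show "inj_on \<psi> (topspace (top_of_set ?B))" using injB by simp
  qed
  have hm': "homeomorphic_map (subtopology disco_top ?U) (top_of_set ?B) ?\<phi>"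
  proof -
    obtain g where g: "homeomorphic_maps (top_of_set ?B) (subtopology disco_top ?U) \<psi> g"
      using hm homeomorphic_map_maps by blast
    then have "homeomorphic_map (subtopology disco_top ?U) (top_of_set ?B) g"
      using homeomorphic_maps_map homeomorphic_maps_sym by blast
    moreover have "g q = ?\<phi> q" if "q \<in> topspace (subtopology disco_top ?U)" for q
      using that g injB by (auto simp: homeomorphic_maps_def)
    ultimately show ?thesis by (rule homeomorphic_map_eq)
  qed
  have "disco_chart ?U ?\<phi>"
    unfolding disco_chart_def im
  proof (intro conjI ballI impI oU hm')
    show "?U \<inter> disco_sing = {}" using ns r by blast
    fix z assume z: "z \<in> disco_rect" "disco_proj z \<in> ?U"
    then obtain v where v: "v \<in> ?B" "disco_proj z = \<psi> v" by blast
    then obtain a b e where abe: "a > 0" "of_real a * z + b = v" "e > 0"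
      and w: "\<And>w. w \<in> disco_rect \<inter> ball z e \<Longrightarrow> disco_proj w = \<psi> (of_real a * w + b)"
      using loc[of v z] z r by blast
    define d where "d = min e ((r - dist u v) / a)"
    have d: "d > 0" "d \<le> e" "d \<le> (r - dist u v) / a" using abe v by (auto simp: d_def)
    have "disco_proj w \<in> ?U \<and> ?\<phi> (disco_proj w) = of_real a * w + b" if "w \<in> disco_rect \<inter> ball z d" for w
    proof -
      have "dist v (of_real a * w + b) = norm (of_real a * (z - w))"
        unfolding abe(2)[symmetric] by (simp add: dist_norm algebra_simps)
      also have "\<dots> = a * dist z w" using abe by (simp only: norm_mult dist_norm) simp
      also have "\<dots> < a * ((r - dist u v) / a)" using that d abe by (intro mult_strict_left_mono) auto
      also have "\<dots> = r - dist u v" using abe by simp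
      finally have "of_real a * w + b \<in> ?B"
        using dist_triangle[of u "of_real a * w + b" v] by simp
      moreover have "disco_proj w = \<psi> (of_real a * w + b)" using that d w by auto
      ultimately show ?thesis using injB by simp
    qed
    then show "\<exists>a>0. \<exists>b. \<exists>e>0. \<forall>w\<in>disco_rect \<inter> ball z e. disco_proj w \<in> ?U \<and>
        ?\<phi> (disco_proj w) = of_real a * w + b"
      using abe d by blast
  qed simp
  then show ?thesis using that r injB by blast
qed

lemma disco_model_locally_affine:
  assumes "disco_model A \<psi>" "u \<in> A"
  shows "locally_affine 1 \<psi> u"
proof -
  obtain r where r: "r > 0" "disco_chart (\<psi> ` ball u r) (inv_into (ball u r) \<psi>)" "inj_on \<psi> (ball u r)"
    by (rule disco_model_chart[OF assms]) (rule that; assumption)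
  have "\<forall>w\<in>ball u r. \<psi> w \<in> \<psi> ` ball u r \<and> inv_into (ball u r) \<psi> (\<psi> w) = of_real 1 * 1 * w + 0"
    using r by simp
  then show ?thesis unfolding locally_affine_def using r zero_less_one by blast
qed

lemma disco_regular_model:
  assumes "p \<in> disco_surface" "p \<notin> disco_sing"
  obtains A \<psi> u where "disco_model A \<psi>" "u \<in> A" "\<psi> u = p"
  using assms
proof (cases rule: disco_regular_cases)
  case (h z)
  then show ?thesis using that[OF disco_model_hcyl, of z] by auto
next
  case (v z)
  then show ?thesis using that[OF disco_model_vcyl, of z] by auto
next
  case (f z)
  then show ?thesis using that[OF disco_model_flip[OF disco_model_vcyl, of 1], of "1 - z"] by auto
qed

section \<open>Comparing charts with parametrizations\<close>

lemma disco_chart_inj: "disco_chart U \<phi> \<Longrightarrow> inj_on \<phi> U"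
  unfolding disco_chart_def
  using homeomorphic_imp_injective_map openin_subset
  by (metis (no_types, lifting) inf.absorb2 topspace_subtopology)

lemma disco_chart_open: "disco_chart U \<phi> \<Longrightarrow> openin disco_top U"
  unfolding disco_chart_def by blast

lemma disco_chart_regular: "disco_chart U \<phi> \<Longrightarrow> p \<in> U \<Longrightarrow> p \<in> disco_surface \<and> p \<notin> disco_sing"
  unfolding disco_chart_def using openin_subset by fastforce

lemma disco_chart_open_image:
  assumes "disco_chart U \<phi>" "openin disco_top N" "N \<subseteq> U"
  shows "open (\<phi> ` N)"
proof -
  have "open (\<phi> ` U)" "homeomorphic_map (subtopology disco_top U) (top_of_set (\<phi> ` U)) \<phi>"
      "openin disco_top U"
    using assms(1) unfolding disco_chart_def by auto
  then have "openin (top_of_set (\<phi> ` U)) (\<phi> ` N)"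
    using homeomorphic_imp_open_map assms openin_open_subtopology unfolding open_map_def by blast
  then show ?thesis using \<open>open (\<phi> ` U)\<close> openin_open_eq by blast
qed

lemma disco_chart_continuous:
  assumes "disco_chart U \<phi>" shows "continuous_map (subtopology disco_top U) euclidean \<phi>"
  using assms unfolding disco_chart_def
  by (metis homeomorphic_imp_continuous_map continuous_map_in_subtopology)

text \<open>\<open>disco_chart\<close> relates a chart to the rectangle only, not to other charts.
  Both charts are affine in one common model through the point, so their transition map is affine
  with positive factor.\<close>

lemma disco_chart_compat:
  assumes "disco_chart U \<phi>" "disco_chart U' \<phi>'" "p \<in> U" "p \<in> U'"
  obtains a b N where "a > 0" "openin disco_top N" "p \<in> N" "N \<subseteq> U" "N \<subseteq> U'"
    "\<And>q. q \<in> N \<Longrightarrow> \<phi>' q = of_real a * \<phi> q + b"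
proof -
  obtain A \<psi> u where m: "disco_model A \<psi>" "u \<in> A" "\<psi> u = p"
    using disco_regular_model disco_chart_regular assms by metis
  then have pc: "disco_pieces \<psi> u" and op: "\<And>W. open W \<Longrightarrow> W \<subseteq> A \<Longrightarrow> openin disco_top (\<psi> ` W)" and A: "open A"
    unfolding disco_model_def by blast+
  obtain a b e where 1: "a > 0" "e > 0" "\<And>w. w \<in> ball u e \<Longrightarrow> \<psi> w \<in> U \<and> \<phi> (\<psi> w) = of_real a * w + b"
    using disco_pieces_chart[OF assms(1) pc] assms m by blast
  obtain a' b' e' where 2: "a' > 0" "e' > 0" "\<And>w. w \<in> ball u e' \<Longrightarrow> \<psi> w \<in> U' \<and> \<phi>' (\<psi> w) = of_real a' * w + b'"
    using disco_pieces_chart[OF assms(2) pc] assms m by blast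
  let ?W = "ball u (min e e') \<inter> A"
  show ?thesis
  proof (rule that[of "a' / a" "\<psi> ` ?W" "b' - of_real (a' / a) * b"])
    fix q assume "q \<in> \<psi> ` ?W"
    then obtain w where "w \<in> ball u e" "w \<in> ball u e'" "q = \<psi> w" by auto
    then have "\<phi>' q = of_real a' * w + b'" "\<phi> q = of_real a * w + b" using 1 2 by auto
    then show "\<phi>' q = of_real (a' / a) * \<phi> q + (b' - of_real (a' / a) * b)"
      using 1 by (simp add: field_simps)
  qed (use 1 2 m op[of ?W] A in \<open>auto simp: mem_ball\<close>)
qed

lemma locally_affine_regular: "locally_affine c \<psi> u \<Longrightarrow> \<psi> u \<in> disco_surface \<and> \<psi> u \<notin> disco_sing"
  unfolding locally_affine_def using disco_chart_regular by (metis centre_in_ball)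

text \<open>Continuity is not part of \<open>locally_affine\<close>; it follows because the chart is
  injective and open while its composition with \<open>\<psi>\<close> is affine.\<close>

lemma locally_affine_preimage:
  assumes "locally_affine c \<psi> u" "openin disco_top N" "\<psi> u \<in> N"
  obtains e where "e > 0" "\<And>w. w \<in> ball u e \<Longrightarrow> \<psi> w \<in> N"
proof -
  from assms(1) obtain U \<phi> a b e where ch: "disco_chart U \<phi>" and e: "a > 0" "e > 0"
    and w: "\<And>w. w \<in> ball u e \<Longrightarrow> \<psi> w \<in> U \<and> \<phi> (\<psi> w) = of_real a * c * w + b"
    unfolding locally_affine_def by blast
  have "open (\<phi> ` (N \<inter> U))"
    using disco_chart_open_image[OF ch, of "N \<inter> U"] disco_chart_open[OF ch] assms(2) by blast
  then have "open ((\<lambda>w. of_real a * c * w + b) -` \<phi> ` (N \<inter> U))"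
    by (intro open_vimage continuous_intros)
  moreover have "u \<in> (\<lambda>w. of_real a * c * w + b) -` \<phi> ` (N \<inter> U)"
    using w[of u] e assms(3) by (auto intro!: image_eqI[of _ \<phi> "\<psi> u"])
  ultimately obtain e' where e': "e' > 0" "ball u e' \<subseteq> (\<lambda>w. of_real a * c * w + b) -` \<phi> ` (N \<inter> U)"
    using open_contains_ball by blast
  show ?thesis
  proof (rule that[of "min e e'"])
    fix x assume "x \<in> ball u (min e e')"
    then have "\<phi> (\<psi> x) \<in> \<phi> ` (N \<inter> U)" "\<psi> x \<in> U" using w[of x] e' by auto
    then show "\<psi> x \<in> N" using inj_onD[OF disco_chart_inj[OF ch]] by blast
  qed (use e e' in simp)
qed

text \<open>The chart in the definition of \<open>locally_affine\<close> is existential;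
  compatibility of charts allows any chart at the point, with the same direction factor c.\<close>

lemma locally_affine_chart:
  assumes ch: "disco_chart U \<phi>" and "locally_affine c \<psi> u" and U: "\<psi> u \<in> U"
  shows "\<exists>a>0. \<exists>b. \<exists>e>0. \<forall>w\<in>ball u e. \<psi> w \<in> U \<and> \<phi> (\<psi> w) = of_real a * c * w + b"
proof -
  from assms(2) obtain U' \<phi>' a b e where ch': "disco_chart U' \<phi>'" and e: "a > 0" "e > 0"
    and w: "\<And>w. w \<in> ball u e \<Longrightarrow> \<psi> w \<in> U' \<and> \<phi>' (\<psi> w) = of_real a * c * w + b"
    unfolding locally_affine_def by blast
  have "\<psi> u \<in> U'" using w e by simp
  obtain \<alpha> \<beta> N where N: "\<alpha> > 0" "openin disco_top N" "\<psi> u \<in> N" "N \<subseteq> U'" "N \<subseteq> U"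
    "\<And>q. q \<in> N \<Longrightarrow> \<phi> q = of_real \<alpha> * \<phi>' q + \<beta>"
    by (rule disco_chart_compat[OF ch' ch \<open>\<psi> u \<in> U'\<close> U]) (rule that; assumption)
  obtain e' where e': "e' > 0" "\<And>w. w \<in> ball u e' \<Longrightarrow> \<psi> w \<in> N"
    by (rule locally_affine_preimage[OF assms(2) N(2,3)]) (rule that; assumption)
  have "\<forall>x\<in>ball u (min e e'). \<psi> x \<in> U \<and> \<phi> (\<psi> x) = of_real (\<alpha> * a) * c * x + (of_real \<alpha> * b + \<beta>)"
  proof
    fix x assume "x \<in> ball u (min e e')"
    then have "\<psi> x \<in> N" "\<phi>' (\<psi> x) = of_real a * c * x + b" using e' w by auto
    then show "\<psi> x \<in> U \<and> \<phi> (\<psi> x) = of_real (\<alpha> * a) * c * x + (of_real \<alpha> * b + \<beta>)"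
      using N by (auto simp: algebra_simps)
  qed
  moreover have "\<alpha> * a > 0" "min e e' > 0" using N e e' by auto
  ultimately show ?thesis by blast
qed

lemma locally_affine_cong:
  assumes "locally_affine c \<psi> u" "e > 0" "\<And>w. w \<in> ball u e \<Longrightarrow> \<psi>' w = \<psi> w"
  shows "locally_affine c \<psi>' u"
proof -
  from assms(1) obtain U \<phi> a b e' where ch: "disco_chart U \<phi>" and e: "a > 0" "e' > 0"
    and w: "\<And>w. w \<in> ball u e' \<Longrightarrow> \<psi> w \<in> U \<and> \<phi> (\<psi> w) = of_real a * c * w + b"
    unfolding locally_affine_def by blast
  have "\<forall>w\<in>ball u (min e e'). \<psi>' w \<in> U \<and> \<phi> (\<psi>' w) = of_real a * c * w + b"
    using w assms(3) by auto
  then show ?thesis unfolding locally_affine_def using ch e assms(2) by (metis min_less_iff_conj)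
qed

lemma locally_affine_compose:
  assumes "locally_affine c \<psi> (m * u + d)"
  shows "locally_affine (c * m) (\<lambda>w. \<psi> (m * w + d)) u"
proof -
  from assms(1) obtain U \<phi> a b e where ch: "disco_chart U \<phi>" and e: "a > 0" "e > 0"
    and w: "\<And>w. w \<in> ball (m * u + d) e \<Longrightarrow> \<psi> w \<in> U \<and> \<phi> (\<psi> w) = of_real a * c * w + b"
    unfolding locally_affine_def by blast
  have "open ((\<lambda>w. m * w + d) -` ball (m * u + d) e)" by (intro open_vimage continuous_intros open_ball)
  moreover have "u \<in> (\<lambda>w. m * w + d) -` ball (m * u + d) e" using e by simp
  ultimately obtain e' where e': "e' > 0" "ball u e' \<subseteq> (\<lambda>w. m * w + d) -` ball (m * u + d) e"
    using open_contains_ball by blast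
  have "\<forall>x\<in>ball u e'. \<psi> (m * x + d) \<in> U \<and>
      \<phi> (\<psi> (m * x + d)) = of_real a * (c * m) * x + (of_real a * c * d + b)"
  proof
    fix x assume "x \<in> ball u e'"
    then show "\<psi> (m * x + d) \<in> U \<and> \<phi> (\<psi> (m * x + d)) = of_real a * (c * m) * x + (of_real a * c * d + b)"
      using w[of "m * x + d"] e' by (auto simp: algebra_simps)
  qed
  then show ?thesis unfolding locally_affine_def using ch e e' by blast
qed

lemma locally_affine_scale:
  assumes "locally_affine c \<psi> u" "r > 0" "c = of_real r * c'"
  shows "locally_affine c' \<psi> u"
proof -
  from assms(1) obtain U \<phi> a b e where ch: "disco_chart U \<phi>" and e: "a > 0" "e > 0"
    and w: "\<And>w. w \<in> ball u e \<Longrightarrow> \<psi> w \<in> U \<and> \<phi> (\<psi> w) = of_real a * c * w + b"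
    unfolding locally_affine_def by blast
  have "\<forall>w\<in>ball u e. \<psi> w \<in> U \<and> \<phi> (\<psi> w) = of_real (a * r) * c' * w + b"
    using w assms(3) by (auto simp: algebra_simps)
  moreover have "a * r > 0" using e assms by simp
  ultimately show ?thesis unfolding locally_affine_def using ch e by blast
qed

lemma locally_affine_near:
  assumes "locally_affine c \<psi> u"
  obtains e where "e > 0" "\<And>w. w \<in> ball u e \<Longrightarrow> locally_affine c \<psi> w"
proof -
  from assms(1) obtain U \<phi> a b e where ch: "disco_chart U \<phi>" and e: "a > 0" "e > 0"
    and w: "\<And>w. w \<in> ball u e \<Longrightarrow> \<psi> w \<in> U \<and> \<phi> (\<psi> w) = of_real a * c * w + b"
    unfolding locally_affine_def by blast
  show ?thesis
  proof (rule that[OF e(2)])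
    fix x assume "x \<in> ball u e"
    then obtain e' where "e' > 0" "ball x e' \<subseteq> ball u e" using open_contains_ball open_ball by blast
    then have "\<forall>w\<in>ball x e'. \<psi> w \<in> U \<and> \<phi> (\<psi> w) = of_real a * c * w + b" using w by blast
    then show "locally_affine c \<psi> x" unfolding locally_affine_def using ch e \<open>e' > 0\<close> by blast
  qed
qed

lemma locally_affine_continuous:
  assumes "\<And>u. u \<in> S \<Longrightarrow> locally_affine c \<psi> u"
  shows "continuous_map (top_of_set S) disco_top \<psi>"
  unfolding continuous_map_def
proof (intro conjI allI impI)
  show "\<psi> \<in> topspace (top_of_set S) \<rightarrow> topspace disco_top"
    using assms locally_affine_regular by auto
  fix N assume N: "openin disco_top N"
  show "openin (top_of_set S) {x \<in> topspace (top_of_set S). \<psi> x \<in> N}"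
  proof (subst openin_subopen, intro ballI)
    fix u assume "u \<in> {x \<in> topspace (top_of_set S). \<psi> x \<in> N}"
    then have u: "u \<in> S" "\<psi> u \<in> N" by auto
    then obtain e where "e > 0" "\<And>w. w \<in> ball u e \<Longrightarrow> \<psi> w \<in> N"
      using locally_affine_preimage[OF assms N] by blast
    then show "\<exists>T. openin (top_of_set S) T \<and> u \<in> T \<and> T \<subseteq> {x \<in> topspace (top_of_set S). \<psi> x \<in> N}"
      using u by (intro exI[of _ "S \<inter> ball u e"]) (auto simp: openin_open_Int)
  qed
qed

section \<open>Straight paths\<close>

lemma straight_path_preimage:
  assumes "straight_path \<theta> g" "t \<in> {0..1}" "openin disco_top N" "g t \<in> N"
  obtains e where "e > 0" "\<And>s. s \<in> {0..1} \<inter> ball t e \<Longrightarrow> g s \<in> N"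
proof -
  have "continuous_map (top_of_set {0..1}) disco_top g"
    using assms(1) by (simp add: straight_path_def)
  from openin_continuous_map_preimage[OF this assms(3)]
  have "openin (top_of_set {0..1}) {s \<in> {0..1}. g s \<in> N}" by simp
  then obtain e where "e > 0" "ball t e \<inter> {0..1} \<subseteq> {s \<in> {0..1}. g s \<in> N}"
    unfolding openin_contains_ball using assms by blast
  then show ?thesis using that by blast
qed

lemma pos_multiple_iff:
  assumes "\<theta> \<noteq> 0"
  shows "(\<exists>r>0. w = of_real r * \<theta>) \<longleftrightarrow> 0 < Re (w / \<theta>) \<and> Im (w / \<theta>) = 0"
proof
  assume "\<exists>r>0. w = of_real r * \<theta>"
  then show "0 < Re (w / \<theta>) \<and> Im (w / \<theta>) = 0" using assms by auto
next
  assume *: "0 < Re (w / \<theta>) \<and> Im (w / \<theta>) = 0"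
  then have "w / \<theta> = of_real (Re (w / \<theta>))" by (simp add: complex_eq_iff)
  then have "w = of_real (Re (w / \<theta>)) * \<theta>" using assms by (metis nonzero_divide_eq_eq)
  then show "\<exists>r>0. w = of_real r * \<theta>" using * by blast
qed

lemma continuous_on_Ioo_closed:
  fixes f :: "real \<Rightarrow> complex"
  assumes "a < b" "continuous_on {a..b} f" "closed T" "\<And>x. a < x \<Longrightarrow> x < b \<Longrightarrow> f x \<in> T" "x \<in> {a..b}"
  shows "f x \<in> T"
proof -
  have "f ` closure {a<..<b} \<subseteq> T"
    using assms by (intro image_closure_subset) auto
  then show ?thesis using assms(1,5) by auto
qed

text \<open>The definition shows increments along \<theta> in some chart and at interior times only.
  Transition maps being positive affine, they appear in the given chart near each interior time;
  bisection extends this to a whole interval, continuity to the end times.\<close>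

lemma straight_path_chart:
  assumes g: "straight_path \<theta> g" and \<theta>: "\<theta> \<noteq> 0" and ch: "disco_chart U \<phi>" and t: "t \<in> {0..1}" "g t \<in> U"
  obtains e where "e > 0" "\<And>s. s \<in> {0..1} \<inter> ball t e \<Longrightarrow> g s \<in> U"
    "continuous_on ({0..1} \<inter> ball t e) (\<lambda>s. \<phi> (g s))"
    "\<And>s s'. s \<in> {0..1} \<inter> ball t e \<Longrightarrow> s' \<in> {0..1} \<inter> ball t e \<Longrightarrow> s < s' \<Longrightarrow>
      \<exists>r>0. \<phi> (g s') - \<phi> (g s) = of_real r * \<theta>"
proof -
  obtain e where e: "e > 0" "\<And>s. s \<in> {0..1} \<inter> ball t e \<Longrightarrow> g s \<in> U"
    using straight_path_preimage[OF g t(1) disco_chart_open[OF ch] t(2)] by blast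
  define J where "J = {0..1} \<inter> ball t e"
  have J: "x \<in> J" if "a \<in> J" "b \<in> J" "a \<le> x" "x \<le> b" for a b x
    using that by (auto simp: J_def dist_real_def)
  define k where "k = (\<lambda>s. \<phi> (g s))"
  have cg: "continuous_map (top_of_set J) (subtopology disco_top U) g"
  proof (rule continuous_map_into_subtopology)
    show "continuous_map (top_of_set J) disco_top g"
      using g unfolding straight_path_def J_def by (auto intro: continuous_map_from_subtopology_mono)
    show "g \<in> topspace (top_of_set J) \<rightarrow> U" using e by (auto simp: J_def)
  qed
  have ck: "continuous_on J k"
    using continuous_map_compose[OF cg disco_chart_continuous[OF ch]]
    by (simp add: o_def k_def)
  \<comment> \<open>The premise \<open>a < b\<close> lets the relation hold on degenerate intervals,
    as bisection requires.\<close>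
  have inner: "a < b \<longrightarrow> (\<exists>r>0. k b - k a = of_real r * \<theta>)"
    if ab: "a \<le> b" "a \<in> J" "b \<in> J" "0 < a" "b < 1" for a b
    using ab(1)
  proof (induction rule: Bolzano)
    case (trans x y z)
    show ?case
    proof
      assume "x < z"
      show "\<exists>r>0. k z - k x = of_real r * \<theta>"
      proof (cases "x < y \<and> y < z")
        case True
        then obtain r r' where "r > 0" "r' > 0" "k y - k x = of_real r * \<theta>" "k z - k y = of_real r' * \<theta>"
          using trans by blast
        then have "k z - k x = of_real (r + r') * \<theta>" "r + r' > 0"
          by (simp_all add: algebra_simps)
        then show ?thesis by blast
      next
        case False
        then have "x = y \<or> y = z" using trans by auto
        then show ?thesis using trans \<open>x < z\<close> by auto
      qed
    qed
  next
    case (local x)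
    then have x: "x \<in> J" "0 < x" "x < 1" using J[OF ab(2,3)] ab by auto
    obtain U' \<phi>' e' where ch': "disco_chart U' \<phi>'" and e': "e' > 0"
      and st: "\<And>s s'. s \<in> {0<..<1} \<inter> ball x e' \<Longrightarrow> g s \<in> U' \<and>
         (s' \<in> {0<..<1} \<inter> ball x e' \<longrightarrow> s < s' \<longrightarrow> (\<exists>r>0. \<phi>' (g s') - \<phi>' (g s) = of_real r * \<theta>))"
      using g x unfolding straight_path_def by (metis greaterThanLessThan_iff)
    have "g x \<in> U'" "g x \<in> U" using st[of x] x e' e by (auto simp: J_def)
    from disco_chart_compat[OF ch' ch this]
    obtain \<alpha> \<beta> N where N: "\<alpha> > 0" "openin disco_top N" "g x \<in> N" "\<And>q. q \<in> N \<Longrightarrow> \<phi> q = of_real \<alpha> * \<phi>' q + \<beta>"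
      by metis
    obtain e'' where e'': "e'' > 0" "\<And>s. s \<in> {0..1} \<inter> ball x e'' \<Longrightarrow> g s \<in> N"
      using straight_path_preimage[OF g _ N(2,3)] x by auto
    define d where "d = min (min e' e'') (min x (1 - x))"
    show ?case
    proof (rule exI[of _ d], intro conjI allI impI)
      show "d > 0" using e' e'' x by (auto simp: d_def)
      fix a b assume *: "a \<le> x \<and> x \<le> b \<and> b - a < d" "a < b"
      then have a: "a \<in> {0<..<1} \<inter> ball x e'" "a \<in> {0..1} \<inter> ball x e''"
        and b: "b \<in> {0<..<1} \<inter> ball x e'" "b \<in> {0..1} \<inter> ball x e''"
        by (auto simp: d_def dist_real_def)
      obtain r where "r > 0" "\<phi>' (g b) - \<phi>' (g a) = of_real r * \<theta>" using st[OF a(1), of b] b(1) *(2)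
          by blast
      moreover have "k b - k a = of_real \<alpha> * (\<phi>' (g b) - \<phi>' (g a))"
        using N(4)[OF e''(2)[OF a(2)]] N(4)[OF e''(2)[OF b(2)]] by (simp add: k_def algebra_simps)
      ultimately have "k b - k a = of_real (\<alpha> * r) * \<theta>" "\<alpha> * r > 0" using N by simp_all
      then show "\<exists>r>0. k b - k a = of_real r * \<theta>" by blast
    qed
  qed
  have "\<exists>r>0. k s' - k s = of_real r * \<theta>" if s: "s \<in> J" "s' \<in> J" "s < s'" for s s'
  proof -
    \<comment> \<open>Limits at \<open>s\<close> and \<open>s'\<close> give only nonnegative
      increments on the outer thirds; the middle third keeps the total strictly positive.\<close>
    define m1 where "m1 = s + (s' - s) / 3"
    define m2 where "m2 = s + 2 * (s' - s) / 3"
    have m: "s < m1" "m1 < m2" "m2 < s'" using s by (simp_all add: m1_def m2_def field_simps)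
    have s01: "0 \<le> s" "s' \<le> 1" using s by (auto simp: J_def)
    have pos: "(k y - k x) / \<theta> \<in> \<real>\<^sub>\<ge>\<^sub>0" if "s < x" "x < y" "y < s'" for x y
    proof -
      have "x \<in> J" "y \<in> J" using J[OF s(1,2)] that by auto
      then have "\<exists>r>0. k y - k x = of_real r * \<theta>" using inner[of x y] that s01 by auto
      then show ?thesis unfolding pos_multiple_iff[OF \<theta>] by (simp add: complex_nonneg_Reals_iff)
    qed
    have sub: "{s..m1} \<subseteq> J" "{m2..s'} \<subseteq> J" using J[OF s(1,2)] m by auto
    have "(k m1 - k s) / \<theta> \<in> \<real>\<^sub>\<ge>\<^sub>0"
      by (rule continuous_on_Ioo_closed[of s m1 "\<lambda>x. (k m1 - k x) / \<theta>"])
        (use m pos \<theta> continuous_on_subset[OF ck sub(1)] in \<open>auto intro!: continuous_intros\<close>)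
    moreover have "(k s' - k m2) / \<theta> \<in> \<real>\<^sub>\<ge>\<^sub>0"
      by (rule continuous_on_Ioo_closed[of m2 s' "\<lambda>x. (k x - k m2) / \<theta>"])
        (use m pos \<theta> continuous_on_subset[OF ck sub(2)] in \<open>auto intro!: continuous_intros\<close>)
    moreover have "0 < Re ((k m2 - k m1) / \<theta>) \<and> Im ((k m2 - k m1) / \<theta>) = 0"
      unfolding pos_multiple_iff[OF \<theta>, symmetric] using inner[of m1 m2] m J[OF s(1,2)] s01 by auto
    moreover have "(k s' - k s) / \<theta> = (k s' - k m2) / \<theta> + (k m2 - k m1) / \<theta> + (k m1 - k s) / \<theta>"
      by (simp add: diff_divide_distrib)
    ultimately show ?thesis
      unfolding pos_multiple_iff[OF \<theta>] complex_nonneg_Reals_iff by simp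
  qed
  then show ?thesis using that[OF e] ck unfolding k_def J_def by blast
qed

text \<open>The set of times spent in K is closed since K is closed. It is open since through each
  point of K passes a straight segment inside K, and a straight path read in a chart has to follow
  that segment in both directions.\<close>

lemma straight_path_saturated:
  assumes K: "closedin disco_top K" and \<theta>: "\<theta> \<noteq> 0" and g: "straight_path \<theta> g"
      and t0: "t0 \<in> {0..1}" "g t0 \<in> K"
    and loc: "\<And>p. p \<in> K \<Longrightarrow> \<exists>\<psi>. \<psi> 0 = p \<and> locally_affine 1 \<psi> 0 \<and>
       (\<exists>e>0. \<forall>x. \<bar>x\<bar> < e \<longrightarrow> \<psi> (of_real x * \<theta>) \<in> K)"
  shows "t \<in> {0..1} \<Longrightarrow> g t \<in> K"
proof -
  let ?A = "{t \<in> {0..1}. g t \<in> K}"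
  have ct: "continuous_map (top_of_set {0..1}) disco_top g"
    using g by (simp add: straight_path_def)
  have "closedin (top_of_set {0..1}) ?A"
    using closedin_continuous_map_preimage[OF ct K] by simp
  moreover have "openin (top_of_set {0..1}) ?A"
    unfolding openin_contains_ball
  proof (intro conjI ballI)
    fix t assume "t \<in> ?A"
    then have t: "t \<in> {0..1}" "g t \<in> K" by auto
    obtain \<psi> e where \<psi>: "\<psi> 0 = g t" "locally_affine 1 \<psi> 0" "e > 0" "\<And>x. \<bar>x\<bar> < e \<Longrightarrow> \<psi> (of_real x * \<theta>) \<in> K"
      using loc[OF t(2)] by blast
    obtain U \<phi> a b e' where ch: "disco_chart U \<phi>" and e': "a > 0" "e' > 0"
      and w: "\<And>w. w \<in> ball 0 e' \<Longrightarrow> \<psi> w \<in> U \<and> \<phi> (\<psi> w) = of_real a * w + b"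
      using \<psi>(2) unfolding locally_affine_def by auto
    have gU: "g t \<in> U" "\<phi> (g t) = b" using w[of 0] e' \<psi> by auto
    obtain d where d: "d > 0" and dU: "\<And>s. s \<in> {0..1} \<inter> ball t d \<Longrightarrow> g s \<in> U"
      and dc: "continuous_on ({0..1} \<inter> ball t d) (\<lambda>s. \<phi> (g s))"
      and dr: "\<And>s s'. s \<in> {0..1} \<inter> ball t d \<Longrightarrow> s' \<in> {0..1} \<inter> ball t d \<Longrightarrow> s < s' \<Longrightarrow>
        \<exists>r>0. \<phi> (g s') - \<phi> (g s) = of_real r * \<theta>"
      by (rule straight_path_chart[OF g \<theta> ch t(1) gU(1)]) (rule that; assumption)
    \<comment> \<open>A chart displacement \<open>r * \<theta>\<close> corresponds to the parameter
      r/a; the two bounds, multiplied by the chart factor a, keep it below e and its point within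
      the ball of radius e'.\<close>
    define \<eta> where "\<eta> = a * min (e * norm \<theta>) e'"
    have "\<eta> > 0" using \<theta> \<psi> e' by (simp add: \<eta>_def)
    then obtain d' where d': "d' > 0" "\<And>s. s \<in> {0..1} \<inter> ball t d \<Longrightarrow> dist s t < d' \<Longrightarrow>
        dist (\<phi> (g s)) (\<phi> (g t)) < \<eta>"
      using dc t d unfolding continuous_on_iff by (metis IntI centre_in_ball)
    have "g s \<in> K" if s: "s \<in> {0..1}" "s \<in> ball t (min d d')" for s
    proof -
      have sd: "s \<in> {0..1} \<inter> ball t d" "t \<in> {0..1} \<inter> ball t d" using s t d by auto
      have "\<exists>r. \<phi> (g s) - b = of_real r * \<theta>"
      proof (cases s t rule: linorder_cases)
        case less
        then obtain r where "\<phi> (g t) - \<phi> (g s) = of_real r * \<theta>" using dr[OF sd] by blast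
        then have "\<phi> (g s) - b = of_real (- r) * \<theta>" using gU by (simp add: algebra_simps)
        then show ?thesis by blast
      next
        case equal
        then show ?thesis using gU by (intro exI[of _ 0]) simp
      next
        case greater
        then show ?thesis using dr[OF sd(2,1)] gU by blast
      qed
      then obtain r where r: "\<phi> (g s) - b = of_real r * \<theta>" by blast
      have "dist (\<phi> (g s)) (\<phi> (g t)) < \<eta>" using d'(2)[OF sd(1)] s by (simp add: dist_commute)
      then have "\<bar>r\<bar> * norm \<theta> < a * min (e * norm \<theta>) e'"
        using r gU by (simp add: dist_norm norm_mult \<eta>_def)
      moreover have "a * min (e * norm \<theta>) e' \<le> a * (e * norm \<theta>)" "a * min (e * norm \<theta>) e' \<le> a * e'"
        using e' by (auto intro!: mult_left_mono)
      ultimately have "\<bar>r\<bar> * norm \<theta> < a * (e * norm \<theta>)" "\<bar>r\<bar> * norm \<theta> < a * e'" by linarith+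
      then have "\<bar>r\<bar> < a * e" "\<bar>r\<bar> * norm \<theta> / a < e'" using e' \<theta> by (auto simp: field_simps)
      then have re: "\<bar>r / a\<bar> < e" "of_real (r / a) * \<theta> \<in> ball 0 e'"
        using e' by (auto simp: norm_mult norm_divide field_simps)
      have "\<phi> (\<psi> (of_real (r / a) * \<theta>)) = \<phi> (g s)" "\<psi> (of_real (r / a) * \<theta>) \<in> U"
        using w[OF re(2)] r e' by (auto simp: algebra_simps)
      then have "\<psi> (of_real (r / a) * \<theta>) = g s"
        using inj_onD[OF disco_chart_inj[OF ch]] dU[OF sd(1)] by blast
      then show ?thesis using \<psi>(4)[OF re(1)] by simp
    qed
    then show "\<exists>e>0. ball t e \<inter> {0..1} \<subseteq> ?A" using d d' by (intro exI[of _ "min d d'"]) auto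
  qed auto
  ultimately have "?A = {} \<or> ?A = {0..1}"
    using connected_clopen[of "{0..1::real}"] by (metis connected_Icc)
  then show "t \<in> {0..1} \<Longrightarrow> g t \<in> K" using t0 by blast
qed

text \<open>Affinity is asked at interior times only, so that the segment may end in singular points
  as a saddle connection does; this is why continuity is a separate hypothesis.\<close>

lemma segment_straight_path:
  assumes la: "\<And>t. 0 < t \<Longrightarrow> t < 1 \<Longrightarrow> locally_affine c \<psi> (v + of_real t * w)"
    and cw: "c * w = of_real r * \<theta>" "r > 0"
    and ct: "continuous_map (top_of_set {0..1}) disco_top (\<lambda>t. \<psi> (v + of_real t * w))"
  shows "straight_path \<theta> (\<lambda>t. \<psi> (v + of_real t * w))"
  unfolding straight_path_def
proof (intro conjI ct ballI)
  fix t :: real assume t: "t \<in> {0<..<1}"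
  obtain U \<phi> a b e where ch: "disco_chart U \<phi>" and e: "a > 0" "e > 0"
    and w: "\<And>x. x \<in> ball (v + of_real t * w) e \<Longrightarrow> \<psi> x \<in> U \<and> \<phi> (\<psi> x) = of_real a * c * x + b"
    using la[of t] t unfolding locally_affine_def by auto
  define d where "d = e / (norm w + 1)"
  have d: "d > 0" using e by (simp add: d_def add_nonneg_pos)
  have in_ball: "v + of_real s * w \<in> ball (v + of_real t * w) e" if "s \<in> ball t d" for s
  proof -
    have "dist (v + of_real t * w) (v + of_real s * w) = norm (of_real (t - s) * w)"
      by (simp add: dist_norm algebra_simps)
    also have "\<dots> = dist t s * norm w" by (simp only: norm_mult norm_of_real dist_real_def)
    also have "\<dots> \<le> dist t s * (norm w + 1)" by (simp add: mult_left_mono)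
    also have "\<dots> < d * (norm w + 1)" using that
        by (intro mult_strict_right_mono) (auto simp: add_nonneg_pos)
    also have "\<dots> = e" by (simp add: d_def add_nonneg_eq_0_iff)
    finally show ?thesis by simp
  qed
  show "\<exists>U \<phi>. disco_chart U \<phi> \<and> (\<exists>e>0. \<forall>s\<in>{0<..<1} \<inter> ball t e. \<psi> (v + of_real s * w) \<in> U \<and>
           (\<forall>s'\<in>{0<..<1} \<inter> ball t e. s < s' \<longrightarrow>
              (\<exists>r>0. \<phi> (\<psi> (v + of_real s' * w)) - \<phi> (\<psi> (v + of_real s * w)) = of_real r * \<theta>)))"
  proof (rule exI[of _ U], rule exI[of _ \<phi>], rule conjI[OF ch], rule exI[of _ d], rule conjI[OF d],
      intro ballI conjI impI)
    fix s assume s: "s \<in> {0<..<1} \<inter> ball t d"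
    then show "\<psi> (v + of_real s * w) \<in> U" using w in_ball by blast
    fix s' assume s': "s' \<in> {0<..<1} \<inter> ball t d" "s < s'"
    have "\<phi> (\<psi> (v + of_real s' * w)) - \<phi> (\<psi> (v + of_real s * w)) =
        of_real a * c * (of_real s' * w - of_real s * w)"
      using w[of "v + of_real s * w"] w[of "v + of_real s' * w"] in_ball s s' by (auto simp: algebra_simps)
    also have "\<dots> = of_real (a * (s' - s)) * (c * w)" by (simp add: algebra_simps)
    also have "\<dots> = of_real (a * (s' - s) * r) * \<theta>" unfolding cw by simp
    finally show "\<exists>r>0. \<phi> (\<psi> (v + of_real s' * w)) - \<phi> (\<psi> (v + of_real s * w)) = of_real r * \<theta>"
      using e s' cw(2) by (intro exI[of _ "a * (s' - s) * r"]) auto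
  qed
qed

lemma locally_affine_segment_continuous:
  assumes "\<And>t. t \<in> {0..1} \<Longrightarrow> locally_affine c \<psi> (v + of_real t * w)"
  shows "continuous_map (top_of_set {0..1}) disco_top (\<lambda>t::real. \<psi> (v + of_real t * w))"
proof -
  have "continuous_map (top_of_set {0..1::real}) (top_of_set ((\<lambda>t. v + of_real t * w) ` {0..1})) (\<lambda>t.
      v + of_real t * w)"
    by (auto intro!: continuous_intros)
  moreover have "continuous_map (top_of_set ((\<lambda>t. v + of_real t * w) ` {0..1})) disco_top \<psi>"
    by (rule locally_affine_continuous[of _ c]) (use assms in blast)
  ultimately have "continuous_map (top_of_set {0..1}) disco_top (\<psi> \<circ> (\<lambda>t. v + of_real t * w))"
    by (rule continuous_map_compose)
  then show ?thesis by (simp only: o_def)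
qed

lemma closedin_disco_compact_image:
  assumes "continuous_map (top_of_set S) disco_top f" "compact S"
  shows "closedin disco_top (f ` S)"
proof -
  have "compactin (top_of_set S) S" using assms(2) by (simp add: compactin_subtopology)
  then show ?thesis
    using image_compactin[OF _ assms(1)] compactin_imp_closedin[OF Hausdorff_disco_top] by blast
qed

lemma straight_path_subpath:
  assumes g: "straight_path \<theta> g" and ab: "0 \<le> a" "a < b" "b \<le> 1"
  shows "straight_path \<theta> (\<lambda>s. g (a + (b - a) * s))"
proof -
  have in01: "a + (b - a) * s \<in> {0..1}" if "s \<in> {0..1}" for s
  proof -
    have "0 \<le> (b - a) * s" using that ab by simp
    moreover have "(b - a) * s \<le> b - a" using that ab mult_left_le[of s "b - a"] by simp
    ultimately show ?thesis unfolding atLeastAtMost_iff using ab by linarith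
  qed
  have in01': "a + (b - a) * s \<in> {0<..<1}" if "s \<in> {0<..<1}" for s
  proof -
    have "0 < (b - a) * s" using that ab by simp
    moreover have "(b - a) * s < b - a" using that ab mult_strict_left_mono[of s 1 "b - a"] by simp
    ultimately show ?thesis unfolding greaterThanLessThan_iff using ab by linarith
  qed
  show ?thesis
    unfolding straight_path_def
  proof (intro conjI ballI)
    have "continuous_map (top_of_set {0..1}) (top_of_set {0..1}) (\<lambda>s. a + (b - a) * s)"
      using in01 by (auto intro!: continuous_intros)
    from continuous_map_compose[OF this, of disco_top g] g
    show "continuous_map (top_of_set {0..1}) disco_top (\<lambda>s. g (a + (b - a) * s))"
      by (simp add: straight_path_def o_def)
    fix t :: real assume t: "t \<in> {0<..<1}"
    from g in01'[OF t] obtain U \<phi> e where ch: "disco_chart U \<phi>" and e: "e > 0"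
      and st: "\<forall>s\<in>{0<..<1} \<inter> ball (a + (b - a) * t) e. g s \<in> U \<and>
           (\<forall>s'\<in>{0<..<1} \<inter> ball (a + (b - a) * t) e. s < s' \<longrightarrow> (\<exists>r>0. \<phi> (g s') - \<phi> (g s) = of_real r * \<theta>))"
      unfolding straight_path_def by blast
    have im: "a + (b - a) * s \<in> {0<..<1} \<inter> ball (a + (b - a) * t) e"
      if "s \<in> {0<..<1} \<inter> ball t (e / (b - a))" for s
    proof -
      have "dist (a + (b - a) * t) (a + (b - a) * s) = \<bar>(b - a) * (t - s)\<bar>"
        by (simp add: dist_real_def algebra_simps)
      also have "\<dots> = (b - a) * dist t s" using ab by (simp add: abs_mult dist_real_def)
      also have "\<dots> < e" using that ab by (simp add: field_simps)
      finally show ?thesis using in01' that by auto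
    qed
    have "e / (b - a) > 0" using e ab by simp
    moreover have "g (a + (b - a) * s) \<in> U \<and>
           (\<forall>s'\<in>{0<..<1} \<inter> ball t (e / (b - a)). s < s' \<longrightarrow>
              (\<exists>r>0. \<phi> (g (a + (b - a) * s')) - \<phi> (g (a + (b - a) * s)) = of_real r * \<theta>))"
      if "s \<in> {0<..<1} \<inter> ball t (e / (b - a))" for s
      using bspec[OF st im[OF that]] im ab by (auto simp: mult_strict_left_mono)
    ultimately show "\<exists>U \<phi>. disco_chart U \<phi> \<and> (\<exists>e>0. \<forall>s\<in>{0<..<1} \<inter> ball t e. g (a + (b - a) * s) \<in> U \<and>
           (\<forall>s'\<in>{0<..<1} \<inter> ball t e. s < s' \<longrightarrow>
              (\<exists>r>0. \<phi> (g (a + (b - a) * s')) - \<phi> (g (a + (b - a) * s)) = of_real r * \<theta>)))"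
      using ch by blast
  qed
qed

text \<open>A closed straight curve that continues into itself at both ends is a union of leaves.\<close>

lemma loop_saturated:
  assumes \<theta>: "\<theta> \<noteq> 0"
    and la: "\<And>t. t \<in> {0..1} \<Longrightarrow> locally_affine c \<psi> (v + of_real t * w)"
    and cw: "c * w = of_real r * \<theta>" "r > 0"
    and e: "e > 0" "\<And>x. 0 \<le> x \<Longrightarrow> x < e \<Longrightarrow> \<exists>t\<in>{0..1}. \<psi> (v + of_real (1 + x) * w) = \<psi> (v + of_real t * w)"
      "\<And>x. 0 \<le> x \<Longrightarrow> x < e \<Longrightarrow> \<exists>t\<in>{0..1}. \<psi> (v + of_real (- x) * w) = \<psi> (v + of_real t * w)"
    and g: "straight_path \<theta> g" "t0 \<in> {0..1}" "g t0 \<in> (\<lambda>t. \<psi> (v + of_real t * w)) ` {0..1}"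
  shows "t \<in> {0..1} \<Longrightarrow> g t \<in> (\<lambda>t. \<psi> (v + of_real t * w)) ` {0..1}"
proof -
  let ?K = "(\<lambda>t. \<psi> (v + of_real t * w)) ` {0..1}"
  have c: "c \<noteq> 0" using cw \<theta> by auto
  have K: "closedin disco_top ?K"
    by (rule closedin_disco_compact_image[OF locally_affine_segment_continuous[OF la]]) auto
  show "t \<in> {0..1} \<Longrightarrow> g t \<in> ?K"
  proof (rule straight_path_saturated[OF K \<theta> g])
    fix p assume "p \<in> ?K"
    then obtain s where s: "s \<in> {0..1}" "p = \<psi> (v + of_real s * w)" by blast
    let ?f = "\<lambda>u. \<psi> (1 / c * u + (v + of_real s * w))"
    have "locally_affine (c * (1 / c)) ?f 0"
      by (rule locally_affine_compose) (use la[OF s(1)] in simp)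
    then have "locally_affine 1 ?f 0" using c by simp
    moreover have "?f 0 = p" using s by simp
    moreover have "?f (of_real x * \<theta>) \<in> ?K" if "\<bar>x\<bar> < r * e" for x
    proof -
      have "1 / c * (of_real x * \<theta>) = of_real (x / r) * w"
        using c cw by (simp add: field_simps)
      then have eq: "?f (of_real x * \<theta>) = \<psi> (v + of_real (s + x / r) * w)" by (simp add: algebra_simps)
      have xr: "\<bar>x / r\<bar> < e" using that cw(2) by (simp add: field_simps)
      have s01: "0 \<le> s" "s \<le> 1" using s by auto
      \<comment> \<open>Running past either end by less than e falls back onto the curve by the two
        return hypotheses.\<close>
      consider "s + x / r \<in> {0..1}" | "s + x / r > 1" | "s + x / r < 0" by fastforce
      then show ?thesis
      proof cases
        case 1
        then show ?thesis unfolding eq by blast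
      next
        case 2
        then have "0 \<le> s + x / r - 1" "s + x / r - 1 < e" using xr s01 by linarith+
        from e(2)[OF this] have "\<exists>t\<in>{0..1}. \<psi> (v + of_real (s + x / r) * w) = \<psi> (v + of_real t * w)"
          by (metis add.commute diff_add_cancel)
        then show ?thesis unfolding eq by blast
      next
        case 3
        then have "0 \<le> - (s + x / r)" "- (s + x / r) < e" using xr s01 by linarith+
        from e(3)[OF this] have "\<exists>t\<in>{0..1}. \<psi> (v + of_real (s + x / r) * w) = \<psi> (v + of_real t * w)"
          by (metis minus_minus)
        then show ?thesis unfolding eq by blast
      qed
    qed
    ultimately show "\<exists>\<psi>. \<psi> 0 = p \<and> locally_affine 1 \<psi> 0 \<and> (\<exists>e>0. \<forall>x. \<bar>x\<bar> < e \<longrightarrow> \<psi> (of_real x * \<theta>) \<in> ?K)"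
      using cw(2) e(1) by (intro exI[of _ ?f]) (auto intro!: exI[of _ "r * e"])
  qed
qed

section \<open>Totally periodic directions\<close>

lemma flat_cylinderE:
  assumes "flat_cylinder \<theta> C"
  obtains l h \<Psi> where "l > 0" "h > 0"
    "continuous_map (top_of_set {z. 0 \<le> Im z \<and> Im z \<le> h}) disco_top \<Psi>"
    "C = \<Psi> ` {z. 0 < Im z \<and> Im z < h}"
    "\<Psi> ` {z. Im z = 0 \<or> Im z = h} \<subseteq> saddle_graph \<theta>"
    "\<And>z w. 0 < Im z \<Longrightarrow> Im z < h \<Longrightarrow> 0 < Im w \<Longrightarrow> Im w < h \<Longrightarrow>
       \<Psi> z = \<Psi> w \<longleftrightarrow> (\<exists>n::int. w - z = of_int n * of_real l)"
    "\<And>z. 0 < Im z \<Longrightarrow> Im z < h \<Longrightarrow> locally_affine \<theta> \<Psi> z"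
proof -
  from assms obtain l h \<Psi> where *: "l > 0" "h > 0"
    "continuous_map (top_of_set {z. 0 \<le> Im z \<and> Im z \<le> h}) disco_top \<Psi>"
    "C = \<Psi> ` {z. 0 < Im z \<and> Im z < h}"
    "\<Psi> ` {z. Im z = 0 \<or> Im z = h} \<subseteq> saddle_graph \<theta>"
    "\<forall>z\<in>{z. 0 < Im z \<and> Im z < h}. \<forall>w\<in>{z. 0 < Im z \<and> Im z < h}.
           \<Psi> z = \<Psi> w \<longleftrightarrow> (\<exists>n::int. w - z = of_int n * of_real l)"
    "\<forall>z\<in>{z. 0 < Im z \<and> Im z < h}. locally_affine \<theta> \<Psi> z"
    unfolding flat_cylinder_def locally_affine_def[symmetric] by (elim exE conjE) (rule that; assumption)
  show ?thesis
    by (rule that[OF *(1-5)]) (use *(6,7) in auto)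
qed

lemma flat_cylinderI:
  assumes "l > 0" "h > 0"
    "continuous_map (top_of_set {z. 0 \<le> Im z \<and> Im z \<le> h}) disco_top \<Psi>"
    "C = \<Psi> ` {z. 0 < Im z \<and> Im z < h}"
    "\<Psi> ` {z. Im z = 0 \<or> Im z = h} \<subseteq> saddle_graph \<theta>"
    "\<And>z w. 0 < Im z \<Longrightarrow> Im z < h \<Longrightarrow> 0 < Im w \<Longrightarrow> Im w < h \<Longrightarrow>
       \<Psi> z = \<Psi> w \<longleftrightarrow> (\<exists>n::int. w - z = of_int n * of_real l)"
    "\<And>z. 0 < Im z \<Longrightarrow> Im z < h \<Longrightarrow> locally_affine \<theta> \<Psi> z"
  shows "flat_cylinder \<theta> C"
  unfolding flat_cylinder_def locally_affine_def[symmetric]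
  by (rule exI[of _ l], rule conjI[OF assms(1)], rule exI[of _ h], rule conjI[OF assms(2)],
      rule exI[of _ \<Psi>]) (use assms(3-7) in simp)

text \<open>Shifting by the period gives the return conditions of \<open>loop_saturated\<close> at
  both ends, so a straight path through a point of the cylinder never leaves the core curve at its
  height.\<close>

lemma cylinder_loop:
  assumes l: "l > 0" and z: "0 < Im z" "Im z < h"
    and per: "\<And>z w. 0 < Im z \<Longrightarrow> Im z < h \<Longrightarrow> 0 < Im w \<Longrightarrow> Im w < h \<Longrightarrow>
       \<Psi> z = \<Psi> w \<longleftrightarrow> (\<exists>n::int. w - z = of_int n * of_real l)"
    and la: "\<And>z. 0 < Im z \<Longrightarrow> Im z < h \<Longrightarrow> locally_affine \<theta> \<Psi> z"
    and \<theta>: "\<theta> \<noteq> 0" and g: "straight_path \<theta> g" "t0 \<in> {0..1}" "g t0 = \<Psi> z" and t: "t \<in> {0..1}"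
  shows "g t \<in> (\<lambda>t. \<Psi> (z + of_real t * of_real l)) ` {0..1}"
proof (rule loop_saturated[OF \<theta> _ _ l zero_less_one _ _ g(1,2) _ t])
  have shift: "\<Psi> (z + of_real s * of_real l) = \<Psi> (z + of_real s' * of_real l)" if "s' = s + of_int n"
      for s s' and n :: int
  proof (rule iffD2[OF per])
    have "z + of_real s' * of_real l - (z + of_real s * of_real l) = of_int n * of_real l"
      using that by (simp add: algebra_simps)
    then show "\<exists>n::int. z + of_real s' * of_real l - (z + of_real s * of_real l) = of_int n * of_real l"
        by blast
  qed (use z in simp_all)
  show "locally_affine \<theta> \<Psi> (z + of_real t * of_real l)" for t :: real using z by (intro la) auto
  show "\<theta> * of_real l = of_real l * \<theta>" by simp
  fix x :: real assume x: "0 \<le> x" "x < 1"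
  have "\<Psi> (z + of_real (1 + x) * of_real l) = \<Psi> (z + of_real x * of_real l)"
    by (rule shift[of _ _ "-1"]) simp
  moreover have "x \<in> {0..1}" using x by simp
  ultimately show "\<exists>t\<in>{0..1}. \<Psi> (z + of_real (1 + x) * of_real l) = \<Psi> (z + of_real t * of_real l)" by blast
  have "\<Psi> (z + of_real (- x) * of_real l) = \<Psi> (z + of_real (1 - x) * of_real l)"
    by (rule shift[of _ _ 1]) simp
  moreover have "1 - x \<in> {0..1}" using x by simp
  ultimately show "\<exists>t\<in>{0..1}. \<Psi> (z + of_real (- x) * of_real l) = \<Psi> (z + of_real t * of_real l)" by blast
next
  show "g t0 \<in> (\<lambda>t. \<Psi> (z + of_real t * of_real l)) ` {0..1}"
    unfolding g(3) by (rule image_eqI[of _ _ 0]) simp_all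
qed

lemma leaf_subset:
  assumes "\<And>g t0 t. straight_path \<theta> g \<Longrightarrow> t0 \<in> {0..1} \<Longrightarrow> g t0 = p \<Longrightarrow> t \<in> {0..1} \<Longrightarrow> g t \<in> K" "p \<in> K"
  shows "forward_leaf \<theta> p \<union> backward_leaf \<theta> p \<subseteq> K"
proof
  fix q assume "q \<in> forward_leaf \<theta> p \<union> backward_leaf \<theta> p"
  then consider "q = p" | g where "straight_path \<theta> g" "g 0 = p" "g 1 = q"
    | g where "straight_path \<theta> g" "g 0 = q" "g 1 = p"
    unfolding forward_leaf_def backward_leaf_def by blast
  then show "q \<in> K"
  proof cases
    case (2 g)
    then show ?thesis using assms(1)[of g 0 1] by auto
  next
    case (3 g)
    then show ?thesis using assms(1)[of g 1 0] by auto
  qed (use assms in simp)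
qed

lemma cylinder_closed_leaf:
  assumes C: "flat_cylinder \<theta> C" "p \<in> C" and \<theta>: "\<theta> \<noteq> 0"
  shows "closed_leaf \<theta> (forward_leaf \<theta> p \<union> backward_leaf \<theta> p)"
proof -
  from C(1) obtain l h \<Psi> where l: "l > 0" "h > 0" and Ceq: "C = \<Psi> ` {z. 0 < Im z \<and> Im z < h}"
    and per: "\<And>z w. 0 < Im z \<Longrightarrow> Im z < h \<Longrightarrow> 0 < Im w \<Longrightarrow> Im w < h \<Longrightarrow>
       \<Psi> z = \<Psi> w \<longleftrightarrow> (\<exists>n::int. w - z = of_int n * of_real l)"
    and la: "\<And>z. 0 < Im z \<Longrightarrow> Im z < h \<Longrightarrow> locally_affine \<theta> \<Psi> z"
    by (rule flat_cylinderE) (rule that; assumption)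
  from C(2) Ceq obtain z where z: "0 < Im z" "Im z < h" "p = \<Psi> z" by auto
  let ?g = "\<lambda>t::real. \<Psi> (z + of_real t * of_real l)"
  have laz: "locally_affine \<theta> \<Psi> (z + of_real t * (of_real s * of_real l))" for t s :: real
    using z by (intro la) auto
  \<comment> \<open>Leaves consist of end points of straight paths; the factor s makes each point of
    the core curve such an end point.\<close>
  have sp: "straight_path \<theta> (\<lambda>t. \<Psi> (z + of_real t * (of_real s * of_real l)))" if "s > 0" for s
  proof (rule segment_straight_path)
    show "\<theta> * (of_real s * of_real l) = of_real (s * l) * \<theta>" by simp
    show "s * l > 0" using that l by simp
    show "continuous_map (top_of_set {0..1}) disco_top (\<lambda>t. \<Psi> (z + of_real t * (of_real s * of_real l)))"
      by (rule locally_affine_segment_continuous) (rule laz)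
  qed (rule laz)
  have "forward_leaf \<theta> p \<union> backward_leaf \<theta> p = ?g ` {0..1}"
  proof
    show "forward_leaf \<theta> p \<union> backward_leaf \<theta> p \<subseteq> ?g ` {0..1}"
    proof (rule leaf_subset)
      show "p \<in> ?g ` {0..1}" unfolding z(3) by (intro image_eqI[of _ _ 0]) simp_all
      fix g t0 t assume "straight_path \<theta> g" "t0 \<in> {0..1::real}" "g t0 = p" "t \<in> {0..1::real}"
      then show "g t \<in> ?g ` {0..1}" using cylinder_loop[OF l(1) z(1,2) per la \<theta>] z by blast
    qed
    show "?g ` {0..1} \<subseteq> forward_leaf \<theta> p \<union> backward_leaf \<theta> p"
    proof
      fix q assume "q \<in> ?g ` {0..1}"
      then obtain s where s: "0 \<le> s" "s \<le> 1" "q = ?g s" by auto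
      show "q \<in> forward_leaf \<theta> p \<union> backward_leaf \<theta> p"
      proof (cases "s = 0")
        case True
        then show ?thesis using s z by (simp add: forward_leaf_def)
      next
        case False
        then have "straight_path \<theta> (\<lambda>t. \<Psi> (z + of_real t * (of_real s * of_real l)))" using s sp by simp
        then have "q \<in> forward_leaf \<theta> p"
          unfolding forward_leaf_def s(3) z(3)
          by (intro insertI2 CollectI exI[of _ "\<lambda>t. \<Psi> (z + of_real t * (of_real s * of_real l))"]) simp
        then show ?thesis by blast
      qed
    qed
  qed
  moreover have "?g 0 = ?g 1" by (subst per) (use z in \<open>auto intro!: exI[of _ 1]\<close>)
  moreover have "?g 0 \<notin> disco_sing" using locally_affine_regular[OF la] z by simp
  moreover have "straight_path \<theta> ?g" using sp[of 1] by simp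
  moreover have "p \<in> disco_surface - disco_sing" using locally_affine_regular[OF la] z by auto
  ultimately show ?thesis
    unfolding closed_leaf_def leaves_def by (intro conjI imageI) blast+
qed

text \<open>The rest of a saddle connection beyond p is a straight path into a singular point. Hence
  regular leaves avoid the saddle graph and lie in the cylinders.\<close>

lemma saddle_graph_leaf_singular:
  assumes "p \<in> saddle_graph \<theta>"
  shows "forward_leaf \<theta> p \<inter> disco_sing \<noteq> {}"
proof (cases "p \<in> disco_sing")
  case True
  then show ?thesis by (auto simp: forward_leaf_def)
next
  case False
  with assms obtain g t where g: "straight_path \<theta> g" "g 0 \<in> disco_sing" "g 1 \<in> disco_sing"
      and t: "0 \<le> t" "t \<le> 1" "p = g t"
    unfolding saddle_graph_def saddle_connections_def by auto
  with False have "t < 1" by (cases "t = 1") auto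
  from straight_path_subpath[OF g(1) t(1) this]
  have "straight_path \<theta> (\<lambda>s. g (t + (1 - t) * s))" by simp
  then have "g 1 \<in> forward_leaf \<theta> p"
    unfolding forward_leaf_def using t by (intro insertI2 CollectI exI[of _ "\<lambda>s. g (t + (1 - t) * s)"]) simp
  then show ?thesis using g by blast
qed

text \<open>Closedness of the regular leaves follows from the decomposition, so only cylinders have
  to be constructed or transported.\<close>

lemma totally_periodicI:
  assumes "\<theta> \<noteq> 0" "finite \<C>" "disjoint \<C>" "\<And>C. C \<in> \<C> \<Longrightarrow> flat_cylinder \<theta> C"
    "\<Union>\<C> = disco_surface - saddle_graph \<theta>"
  shows "totally_periodic \<theta>"
  unfolding totally_periodic_def
proof (intro conjI allI impI)
  fix L assume "regular_leaf \<theta> L"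
  then obtain p where p: "p \<in> disco_surface" "L = forward_leaf \<theta> p \<union> backward_leaf \<theta> p"
      "L \<inter> disco_sing = {}"
    unfolding regular_leaf_def leaves_def by blast
  have "p \<notin> saddle_graph \<theta>" using saddle_graph_leaf_singular p by blast
  then obtain C where "C \<in> \<C>" "p \<in> C" using p assms(5) by blast
  then show "closed_leaf \<theta> L" using cylinder_closed_leaf assms p by blast
qed (use assms in blast)

text \<open>\<open>T\<close> is an affine self-map of the surface with linear part \<open>N\<close>, whose inverse is \<open>N'\<close>.\<close>

definition disco_affine :: "(complex set \<Rightarrow> complex set) \<Rightarrow> (complex \<Rightarrow> complex) \<Rightarrow> (complex \<Rightarrow> complex) \<Rightarrow> bool"
    where
  "disco_affine T N N' \<longleftrightarrow> continuous_map disco_top disco_top T \<and> T ` disco_sing \<subseteq> disco_sing \<and>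
     linear N \<and> linear N' \<and> (\<forall>z. N (N' z) = z) \<and> (\<forall>z. N' (N z) = z) \<and>
     (\<forall>\<psi> u. locally_affine 1 \<psi> u \<longrightarrow> locally_affine 1 (\<lambda>w. T (\<psi> (N' w))) (N u))"

section \<open>Transport of paths, saddle graphs and cylinders by affine maps\<close>

lemma locally_affine_inverse_chart:
  assumes ch: "disco_chart U \<phi>" and p: "p \<in> U"
  shows "locally_affine 1 (inv_into U \<phi>) (\<phi> p)"
proof -
  have "open (\<phi> ` U)" using ch by (simp add: disco_chart_def)
  then obtain e where "e > 0" "ball (\<phi> p) e \<subseteq> \<phi> ` U" using p open_contains_ball by blast
  then have "\<forall>w\<in>ball (\<phi> p) e. inv_into U \<phi> w \<in> U \<and> \<phi> (inv_into U \<phi> w) = of_real 1 * 1 * w + 0"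
    by (auto intro: inv_into_into f_inv_into_f)
  then show ?thesis unfolding locally_affine_def using ch \<open>e > 0\<close> zero_less_one by blast
qed

lemma linear_of_real_mult:
  fixes N :: "complex \<Rightarrow> complex"
  assumes "linear N" shows "N (of_real r * z) = of_real r * N z"
  using linear_scale[OF assms, of r z] by (simp add: scaleR_conv_of_real)

text \<open>The last clause of \<open>disco_affine\<close>, applied to an inverse chart, shows that
  T reads in charts as N up to a positive factor and a translation; increments along \<theta> become
  increments along \<open>N \<theta>\<close>.\<close>

lemma disco_affine_straight_path:
  assumes T: "disco_affine T N N'" and g: "straight_path \<theta> g"
  shows "straight_path (N \<theta>) (\<lambda>t. T (g t))"
  unfolding straight_path_def
proof (intro conjI ballI)
  have lin: "linear N" and inv: "\<And>z. N' (N z) = z" and cT: "continuous_map disco_top disco_top T"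
    and aff: "\<And>\<psi> u. locally_affine 1 \<psi> u \<Longrightarrow> locally_affine 1 (\<lambda>w. T (\<psi> (N' w))) (N u)"
    using T unfolding disco_affine_def by blast+
  have cg: "continuous_map (top_of_set {0..1}) disco_top g" using g by (simp add: straight_path_def)
  show "continuous_map (top_of_set {0..1}) disco_top (\<lambda>t. T (g t))"
    using continuous_map_compose[OF cg cT] by (simp add: o_def)
  fix t :: real assume t: "t \<in> {0<..<1}"
  from g t obtain U \<phi> e where ch: "disco_chart U \<phi>" and e: "e > 0"
      and st: "\<And>s s'. s \<in> {0<..<1} \<inter> ball t e \<Longrightarrow> g s \<in> U \<and>
           (s'\<in>{0<..<1} \<inter> ball t e \<longrightarrow> s < s' \<longrightarrow> (\<exists>r>0. \<phi> (g s') - \<phi> (g s) = of_real r * \<theta>))"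
    unfolding straight_path_def by (metis (no_types, lifting))
  have gU: "g t \<in> U" using st[of t] t e by auto
  from aff[OF locally_affine_inverse_chart[OF ch gU]]
  obtain U' \<phi>' a b e' where ch': "disco_chart U' \<phi>'" and e': "a > 0" "e' > 0"
    and w: "\<And>w. w \<in> ball (N (\<phi> (g t))) e' \<Longrightarrow> T (inv_into U \<phi> (N' w)) \<in> U' \<and>
       \<phi>' (T (inv_into U \<phi> (N' w))) = of_real a * w + b"
    unfolding locally_affine_def by auto
  have "continuous_map (subtopology disco_top U) euclidean (\<lambda>q. N (\<phi> q))"
  proof -
    have "continuous_map euclidean euclidean N"
      using lin by (simp add: linear_continuous_on linear_linear)
    from continuous_map_compose[OF disco_chart_continuous[OF ch] this] show ?thesis by (simp add: o_def)
  qed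
  then have "openin (subtopology disco_top U) {q \<in> topspace (subtopology disco_top U). N (\<phi> q) \<in>
      ball (N (\<phi> (g t))) e'}"
    by (rule openin_continuous_map_preimage) simp
  then have "openin disco_top {q \<in> topspace (subtopology disco_top U). N (\<phi> q) \<in> ball (N (\<phi> (g t))) e'}"
    using openin_open_subtopology[OF disco_chart_open[OF ch]] by blast
  moreover have "g t \<in> {q \<in> topspace (subtopology disco_top U). N (\<phi> q) \<in> ball (N (\<phi> (g t))) e'}"
    using gU e' disco_chart_regular[OF ch gU] by auto
  moreover have "t \<in> {0..1}" using t by auto
  ultimately obtain d where d: "d > 0" "\<And>s. s \<in> {0..1} \<inter> ball t d \<Longrightarrow>
      g s \<in> U \<and> N (\<phi> (g s)) \<in> ball (N (\<phi> (g t))) e'"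
    using straight_path_preimage[OF g, of t
        "{q \<in> topspace (subtopology disco_top U). N (\<phi> q) \<in> ball (N (\<phi> (g t))) e'}"]
    by (metis (no_types, lifting) Int_iff mem_Collect_eq topspace_subtopology)
  have P: "T (g s) \<in> U' \<and> \<phi>' (T (g s)) = of_real a * N (\<phi> (g s)) + b" if "s \<in> {0..1} \<inter> ball t d" for s
    using w[of "N (\<phi> (g s))"] d(2)[OF that] inv disco_chart_inj[OF ch] by (simp add: inv_into_f_f)
  have "T (g s) \<in> U' \<and> (\<forall>s'\<in>{0<..<1} \<inter> ball t (min d e). s < s' \<longrightarrow>
              (\<exists>r>0. \<phi>' (T (g s')) - \<phi>' (T (g s)) = of_real r * N \<theta>))"
    if s: "s \<in> {0<..<1} \<inter> ball t (min d e)" for s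
  proof (intro conjI ballI impI)
    show "T (g s) \<in> U'" using P[of s] s by auto
    fix s' assume s': "s' \<in> {0<..<1} \<inter> ball t (min d e)" "s < s'"
    then obtain r where r: "r > 0" "\<phi> (g s') - \<phi> (g s) = of_real r * \<theta>" using st[of s s'] s by auto
    have "\<phi>' (T (g s')) - \<phi>' (T (g s)) = of_real a * (N (\<phi> (g s')) - N (\<phi> (g s)))"
      using P[of s] P[of s'] s s' by (auto simp: algebra_simps)
    also have "N (\<phi> (g s')) - N (\<phi> (g s)) = of_real r * N \<theta>"
      using linear_diff[OF lin, of "\<phi> (g s')" "\<phi> (g s)"] r linear_of_real_mult[OF lin, of r \<theta>] by simp
    finally have "\<phi>' (T (g s')) - \<phi>' (T (g s)) = of_real (a * r) * N \<theta>" by simp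
    then show "\<exists>r>0. \<phi>' (T (g s')) - \<phi>' (T (g s)) = of_real r * N \<theta>" using r e'
        by (intro exI[of _ "a * r"]) simp
  qed
  moreover have "min d e > 0" using d e by simp
  ultimately show "\<exists>U \<phi>. disco_chart U \<phi> \<and> (\<exists>e>0. \<forall>s\<in>{0<..<1} \<inter> ball t e. T (g s) \<in> U \<and>
           (\<forall>s'\<in>{0<..<1} \<inter> ball t e. s < s' \<longrightarrow> (\<exists>r>0. \<phi> (T (g s')) - \<phi> (T (g s)) = of_real r * N \<theta>)))"
    using ch' by blast
qed

lemma disco_affine_saddle_graph:
  assumes "disco_affine T N N'"
  shows "T ` saddle_graph \<theta> \<subseteq> saddle_graph (N \<theta>)"
proof -
  have "T ` \<gamma> \<in> saddle_connections (N \<theta>)" if saddle: "\<gamma> \<in> saddle_connections \<theta>" for \<gamma>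
  proof -
    from saddle obtain g where g: "\<gamma> = g ` {0..1}" "straight_path \<theta> g" "g 0 \<in> disco_sing" "g 1 \<in> disco_sing"
      unfolding saddle_connections_def by blast
    then have "straight_path (N \<theta>) (\<lambda>t. T (g t))" "T (g 0) \<in> disco_sing" "T (g 1) \<in> disco_sing"
      using disco_affine_straight_path[OF assms] assms by (auto simp: disco_affine_def)
    then show ?thesis unfolding saddle_connections_def g(1)
      by (intro CollectI exI[of _ "\<lambda>t. T (g t)"]) (simp add: image_image)
  qed
  moreover have "T ` disco_sing \<subseteq> disco_sing" using assms by (simp add: disco_affine_def)
  ultimately show ?thesis unfolding saddle_graph_def by blast
qed

text \<open>T composed with the parametrization is not conformal, so it is corrected by the real
  linear map \<open>M\<close> from new to old cylinder coordinates. \<open>M\<close> fixes the real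
  axis, which keeps the period l, and multiplies heights by its determinant \<open>q\<close>.
  Positivity of \<open>q\<close> says that the two boundary sides are not exchanged.\<close>

lemma disco_affine_flat_cylinder:
  assumes T: "disco_affine T N N'" and inj: "inj_on T disco_surface" and C: "flat_cylinder \<theta> C"
    and \<theta>: "\<theta> \<noteq> 0" and pos: "0 < Im (N' (\<i> * N \<theta>) / \<theta>)"
  shows "flat_cylinder (N \<theta>) (T ` C)"
proof -
  have lin: "linear N" "linear N'" and inv: "\<And>z. N' (N z) = z" "\<And>z. N (N' z) = z"
    and cT: "continuous_map disco_top disco_top T"
    and aff: "\<And>\<psi> u. locally_affine 1 \<psi> u \<Longrightarrow> locally_affine 1 (\<lambda>w. T (\<psi> (N' w))) (N u)"
    using T unfolding disco_affine_def by blast+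
  from C obtain l h \<Psi> where l: "l > 0" "h > 0"
    and ct: "continuous_map (top_of_set {z. 0 \<le> Im z \<and> Im z \<le> h}) disco_top \<Psi>"
    and Ceq: "C = \<Psi> ` {z. 0 < Im z \<and> Im z < h}"
    and bd: "\<Psi> ` {z. Im z = 0 \<or> Im z = h} \<subseteq> saddle_graph \<theta>"
    and per: "\<And>z w. 0 < Im z \<Longrightarrow> Im z < h \<Longrightarrow> 0 < Im w \<Longrightarrow> Im w < h \<Longrightarrow>
       \<Psi> z = \<Psi> w \<longleftrightarrow> (\<exists>n::int. w - z = of_int n * of_real l)"
    and la: "\<And>z. 0 < Im z \<Longrightarrow> Im z < h \<Longrightarrow> locally_affine \<theta> \<Psi> z"
    by (rule flat_cylinderE) (rule that; assumption)
  define q where "q = Im (N' (\<i> * N \<theta>) / \<theta>)"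
  have q: "q > 0" using pos by (simp add: q_def)
  have N\<theta>: "N \<theta> \<noteq> 0"
    using inv(1)[of \<theta>] \<theta> lin(2) linear_0 by metis
  define M where "M = (\<lambda>w. N' (N \<theta> * w) / \<theta>)"
  define M' where "M' = (\<lambda>z. N (\<theta> * z) / N \<theta>)"
  have MM': "M (M' z) = z" "M' (M z) = z" for z
    using \<theta> N\<theta> inv by (simp_all add: M_def M'_def)
  have linM: "linear M" "linear M'"
    unfolding M_def M'_def using lin
    by (auto intro!: linearI simp: linear_add linear_scale algebra_simps add_divide_distrib)
      (simp_all add: scaleR_conv_of_real)
  have M1: "M (of_real x) = of_real x" for x
  proof -
    have "N' (N \<theta> * of_real x) = N' (N (of_real x * \<theta>))"
      using linear_of_real_mult[OF lin(1), of x \<theta>] by (simp add: mult.commute)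
    then show ?thesis using inv \<theta> by (simp add: M_def)
  qed
  have ImM: "Im (M w) = q * Im w" for w
  proof -
    have "w = of_real (Re w) + Im w *\<^sub>R \<i>" by (simp add: complex_eq_iff)
    then have "M w = M (of_real (Re w)) + Im w *\<^sub>R M \<i>"
      using linM(1) by (metis linear_add linear_scale)
    moreover have "Im (M \<i>) = q" by (simp add: M_def q_def mult.commute)
    ultimately show ?thesis by (simp add: M1)
  qed
  have strip: "0 < Im (M w) \<and> Im (M w) < h \<longleftrightarrow> 0 < Im w \<and> Im w < h / q" for w
    using q by (simp add: ImM field_simps zero_less_mult_iff)
  have surf: "\<Psi> z \<in> disco_surface" if "0 < Im z" "Im z < h" for z
    using locally_affine_regular[OF la[OF that]] by blast
  show ?thesis
  proof (rule flat_cylinderI[of l "h / q" "\<lambda>w. T (\<Psi> (M w))"])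
    show "l > 0" "h / q > 0" using l q by auto
    have "continuous_map (top_of_set {z. 0 \<le> Im z \<and> Im z \<le> h / q}) (top_of_set {z. 0 \<le> Im z \<and> Im z \<le> h}) M"
      using linM q by (auto simp: ImM field_simps linear_continuous_on linear_linear)
    from continuous_map_compose[OF continuous_map_compose[OF this ct] cT]
    show "continuous_map (top_of_set {z. 0 \<le> Im z \<and> Im z \<le> h / q}) disco_top (\<lambda>w. T (\<Psi> (M w)))"
      by (simp add: o_def)
    have img: "M ` {w. 0 < Im w \<and> Im w < h / q} = {z. 0 < Im z \<and> Im z < h}"
    proof
      show "M ` {w. 0 < Im w \<and> Im w < h / q} \<subseteq> {z. 0 < Im z \<and> Im z < h}" using strip by auto
      show "{z. 0 < Im z \<and> Im z < h} \<subseteq> M ` {w. 0 < Im w \<and> Im w < h / q}"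
      proof
        fix z assume "z \<in> {z. 0 < Im z \<and> Im z < h}"
        then show "z \<in> M ` {w. 0 < Im w \<and> Im w < h / q}"
          using strip[of "M' z"] MM' by (intro image_eqI[of _ _ "M' z"]) auto
      qed
    qed
    show "T ` C = (\<lambda>w. T (\<Psi> (M w))) ` {w. 0 < Im w \<and> Im w < h / q}"
      unfolding Ceq img[symmetric] by (simp add: image_image)
    have "\<Psi> (M w) \<in> saddle_graph \<theta>" if "Im w = 0 \<or> Im w = h / q" for w
      using bd that q by (intro subsetD[OF bd imageI]) (auto simp: ImM)
    then show "(\<lambda>w. T (\<Psi> (M w))) ` {w. Im w = 0 \<or> Im w = h / q} \<subseteq> saddle_graph (N \<theta>)"
      using disco_affine_saddle_graph[OF T, of \<theta>] by blast
  next
    fix z w assume zw: "0 < Im z" "Im z < h / q" "0 < Im w" "Im w < h / q"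
    have s: "0 < Im (M z)" "Im (M z) < h" "0 < Im (M w)" "Im (M w) < h" using strip zw by blast+
    have "T (\<Psi> (M z)) = T (\<Psi> (M w)) \<longleftrightarrow> \<Psi> (M z) = \<Psi> (M w)"
      using inj_on_eq_iff[OF inj] surf s by blast
    also have "\<dots> \<longleftrightarrow> (\<exists>n::int. M w - M z = of_int n * of_real l)" using per s by blast
    also have "\<dots> \<longleftrightarrow> (\<exists>n::int. w - z = of_int n * of_real l)"
    proof -
      have "M w - M z = of_int n * of_real l \<longleftrightarrow> w - z = of_int n * of_real l" for n :: int
      proof -
        have "M w - M z = M (w - z)" using linM by (simp add: linear_diff)
        moreover have "of_int n * of_real l = M (of_int n * of_real l)" using M1[of "of_int n * l"] by simp
        ultimately show ?thesis using MM'(2) by metis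
      qed
      then show ?thesis by simp
    qed
    finally show "T (\<Psi> (M z)) = T (\<Psi> (M w)) \<longleftrightarrow> (\<exists>n::int. w - z = of_int n * of_real l)" .
  next
    fix w assume w: "0 < Im w" "Im w < h / q"
    then have "locally_affine \<theta> \<Psi> (M w)" using strip la by blast
    then have "locally_affine \<theta> \<Psi> (1 / \<theta> * N' (N \<theta> * w) + 0)" by (simp add: M_def)
    from locally_affine_compose[OF this] have "locally_affine 1 (\<lambda>x. \<Psi> (1 / \<theta> * x + 0)) (N' (N \<theta> * w))"
      using \<theta> by simp
    from aff[OF this] have "locally_affine 1 (\<lambda>x. T (\<Psi> (1 / \<theta> * N' x + 0))) (N \<theta> * w + 0)" using inv by simp
    from locally_affine_compose[OF this] show "locally_affine (N \<theta>) (\<lambda>w. T (\<Psi> (M w))) w"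
      by (simp add: M_def)
  qed
qed

text \<open>The image of the saddle graph has to be the whole saddle graph of the new direction;
  this uses the inclusion for T and for its inverse.\<close>

lemma disco_affine_totally_periodic:
  assumes T: "disco_affine T N N'" "disco_affine T' N' N"
    and TT': "\<And>p. p \<in> disco_surface \<Longrightarrow> T (T' p) = p" "\<And>p. p \<in> disco_surface \<Longrightarrow> T' (T p) = p"
    and \<theta>: "\<theta> \<noteq> 0" and pos: "0 < Im (N' (\<i> * N \<theta>) / \<theta>)" and per: "totally_periodic \<theta>"
  shows "totally_periodic (N \<theta>)"
proof -
  from per obtain \<C> where \<C>: "finite \<C>" "disjoint \<C>" "\<And>C. C \<in> \<C> \<Longrightarrow> flat_cylinder \<theta> C"
    "\<Union>\<C> = disco_surface - saddle_graph \<theta>"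
    unfolding totally_periodic_def by blast
  have inj: "inj_on T disco_surface" by (metis TT'(2) inj_onI)
  have ct: "continuous_map disco_top disco_top T" "continuous_map disco_top disco_top T'"
    using T unfolding disco_affine_def by blast+
  have surf: "T p \<in> disco_surface" "T' p \<in> disco_surface" if "p \<in> disco_surface" for p
    using continuous_map_image_subset_topspace[OF ct(1)] continuous_map_image_subset_topspace[OF ct(2)] that
        by auto
  have sub: "\<And>C. C \<in> \<C> \<Longrightarrow> C \<subseteq> disco_surface" using \<C>(4) by blast
  have sg: "saddle_graph \<theta> \<subseteq> disco_surface" for \<theta>
  proof
    fix p assume "p \<in> saddle_graph \<theta>"
    then consider "p \<in> disco_sing" | g t where "straight_path \<theta> g" "t \<in> {0..1}" "p = g t"
      unfolding saddle_graph_def saddle_connections_def by auto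
    then show "p \<in> disco_surface"
    proof cases
      case (2 g t)
      then show ?thesis
        using continuous_map_image_subset_topspace[of "top_of_set {0..1}" disco_top g]
        by (auto simp: straight_path_def)
    qed (use disco_sing_subset in blast)
  qed
  have inv: "N' (N \<theta>) = \<theta>" "N (N' 0) = 0" using T unfolding disco_affine_def by blast+
  show ?thesis
  proof (rule totally_periodicI[of _ "(`) T ` \<C>"])
    show "N \<theta> \<noteq> 0"
      using inv \<theta> T unfolding disco_affine_def by (metis linear_0)
    show "finite ((`) T ` \<C>)" using \<C> by simp
    show "disjoint ((`) T ` \<C>)"
    proof (rule disjointI)
      fix A B assume "A \<in> (`) T ` \<C>" "B \<in> (`) T ` \<C>" "A \<noteq> B"
      then obtain C D where CD: "C \<in> \<C>" "D \<in> \<C>" "A = T ` C" "B = T ` D" "C \<noteq> D" by auto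
      then have "C \<inter> D = {}" using \<C>(2) by (simp add: disjointD)
      then have "T ` (C \<inter> D) = {}" by simp
      then show "A \<inter> B = {}" using CD inj_on_image_Int[OF inj sub sub] by simp
    qed
    show "flat_cylinder (N \<theta>) C" if "C \<in> (`) T ` \<C>" for C
      using that disco_affine_flat_cylinder[OF T(1) inj _ \<theta> pos] \<C>(3) by blast
    have "T ` saddle_graph \<theta> = saddle_graph (N \<theta>)"
    proof
      show "T ` saddle_graph \<theta> \<subseteq> saddle_graph (N \<theta>)" by (rule disco_affine_saddle_graph[OF T(1)])
      have "T' ` saddle_graph (N \<theta>) \<subseteq> saddle_graph \<theta>"
        using disco_affine_saddle_graph[OF T(2), of "N \<theta>"] inv by simp
      show "saddle_graph (N \<theta>) \<subseteq> T ` saddle_graph \<theta>"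
      proof
        fix p assume p: "p \<in> saddle_graph (N \<theta>)"
        then have "p = T (T' p)" using TT'(1) sg[of "N \<theta>"] by auto
        moreover have "T' p \<in> saddle_graph \<theta>" using p \<open>T' ` saddle_graph (N \<theta>) \<subseteq> saddle_graph \<theta>\<close> by blast
        ultimately show "p \<in> T ` saddle_graph \<theta>" by (rule image_eqI)
      qed
    qed
    moreover have "T ` disco_surface = disco_surface"
    proof
      show "disco_surface \<subseteq> T ` disco_surface"
      proof
        fix p assume "p \<in> disco_surface"
        then show "p \<in> T ` disco_surface" using TT'(1)[of p] surf(2)[of p]
            by (intro image_eqI[of _ _ "T' p"]) simp_all
      qed
    qed (use surf in blast)
    moreover have "T ` (disco_surface - saddle_graph \<theta>) = T ` disco_surface - T ` saddle_graph \<theta>"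
      by (rule inj_on_image_set_diff[OF inj Diff_subset sg])
    ultimately have "T ` (disco_surface - saddle_graph \<theta>) = disco_surface - saddle_graph (N \<theta>)" by simp
    moreover have "\<Union> ((`) T ` \<C>) = T ` \<Union>\<C>" by blast
    ultimately show "\<Union> ((`) T ` \<C>) = disco_surface - saddle_graph (N \<theta>)"
      unfolding \<C>(4) by simp
  qed
qed

text \<open>Whether a map is affine at a point only needs to be checked in one local parametrization.\<close>

lemma locally_affine_germ:
  assumes lin: "linear N" "linear N'" and inv: "\<And>z. N (N' z) = z" "\<And>z. N' (N z) = z"
    and \<psi>0: "locally_affine 1 \<psi>0 u0" "locally_affine 1 (\<lambda>w. T (\<psi>0 (N' w))) (N u0)"
    and \<psi>: "locally_affine 1 \<psi> u" "\<psi> u = \<psi>0 u0"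
  shows "locally_affine 1 (\<lambda>w. T (\<psi> (N' w))) (N u)"
proof -
  obtain U \<phi> a b e where ch: "disco_chart U \<phi>" and e: "a > 0" "e > 0"
    and w: "\<And>w. w \<in> ball u0 e \<Longrightarrow> \<psi>0 w \<in> U \<and> \<phi> (\<psi>0 w) = of_real a * w + b"
    using \<psi>0(1) unfolding locally_affine_def by auto
  have "\<psi> u \<in> U" using w[of u0] e \<psi>(2) by simp
  from locally_affine_chart[OF ch \<psi>(1) this] obtain a' b' e' where e': "a' > 0" "e' > 0"
    and w': "\<And>w. w \<in> ball u e' \<Longrightarrow> \<psi> w \<in> U \<and> \<phi> (\<psi> w) = of_real a' * w + b'"
    by auto
  \<comment> \<open>Both parametrizations are affine in the same chart, so they differ by the change
    of variable y to m y + d. Linear maps commute with the factor m, so the change of variable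
    passes through N and N'.\<close>
  define m where "m = a' / a"
  define d where "d = (b' - b) / of_real a"
  have m: "m > 0" using e e' by (simp add: m_def)
  have "of_real a' * u + b' = of_real a * u0 + b" using w[of u0] w'[of u] e e' \<psi>(2) by simp
  then have "(of_real a' * u + b' - b) / of_real a = u0" using e by simp
  then have u0: "u0 = of_real m * u + d"
      by (simp add: m_def d_def add_divide_distrib diff_divide_distrib add_diff_eq)
  have eq: "\<psi> y = \<psi>0 (of_real m * y + d)" if "y \<in> ball u e'" "of_real m * y + d \<in> ball u0 e" for y
  proof -
    have "of_real a * (of_real m * y + d) + b = of_real a' * y + b'"
      using e by (simp add: m_def d_def distrib_left)
    then have "\<phi> (\<psi>0 (of_real m * y + d)) = \<phi> (\<psi> y)"
      using w[OF that(2)] w'[OF that(1)] by simp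
    then show ?thesis using inj_onD[OF disco_chart_inj[OF ch]] w[OF that(2)] w'[OF that(1)] by metis
  qed
  have N'd: "N' (of_real m * w + N d) = of_real m * N' w + d" for w
    using lin(2) inv by (simp add: linear_add linear_of_real_mult)
  have "N u0 = of_real m * N u + N d"
    unfolding u0 using lin(1) by (simp add: linear_add linear_of_real_mult)
  with \<psi>0(2) have "locally_affine 1 (\<lambda>w. T (\<psi>0 (N' w))) (of_real m * N u + N d)" by simp
  from locally_affine_compose[OF this]
  have "locally_affine 1 (\<lambda>w. T (\<psi>0 (N' (of_real m * w + N d)))) (N u)"
    by (rule locally_affine_scale[OF _ m]) simp
  then have la: "locally_affine 1 (\<lambda>w. T (\<psi>0 (of_real m * N' w + d))) (N u)" by (simp add: N'd)
  have cN': "continuous_on UNIV N'" using lin(2) by (simp add: linear_continuous_on linear_linear)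
  have "open (N' -` ball u e' \<inter> (\<lambda>w. of_real m * N' w + d) -` ball u0 e)"
    using cN' by (intro open_Int open_vimage open_ball continuous_intros)
  moreover have "N u \<in> N' -` ball u e' \<inter> (\<lambda>w. of_real m * N' w + d) -` ball u0 e"
    using e e' inv u0 by simp
  ultimately obtain r where "r > 0" "ball (N u) r \<subseteq> N' -` ball u e' \<inter> (\<lambda>w.
      of_real m * N' w + d) -` ball u0 e"
    using open_contains_ball by blast
  then have r: "r > 0" "\<And>w. w \<in> ball (N u) r \<Longrightarrow> N' w \<in> ball u e' \<and> of_real m * N' w + d \<in> ball u0 e"
      by blast+
  show ?thesis
  proof (rule locally_affine_cong[OF la r(1)])
    fix w assume "w \<in> ball (N u) r"
    then show "T (\<psi> (N' w)) = T (\<psi>0 (of_real m * N' w + d))" using r(2)[of w] eq[of "N' w"] by simp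
  qed
qed

section \<open>Affine twists\<close>

lemma disco_surface_hcyl:
  assumes "p \<in> disco_surface"
  obtains z where "0 \<le> Im z" "Im z \<le> 1" "p = hcyl z"
proof -
  obtain w where w: "w \<in> disco_rect" "p = disco_proj w" using assms by (rule disco_surface_cases)
  then have "hcyl w = p" using hcyl_eq[of w 0] by (simp add: mem_disco_rect)
  then show ?thesis using that[of w] w by (auto simp: mem_disco_rect)
qed

lemma hcyl_boundary:
  assumes "Im z = 0 \<or> Im z = 1" "0 < Im w" "Im w < 1"
  shows "hcyl z \<noteq> hcyl w"
proof
  assume eq: "hcyl z = hcyl w"
  obtain k :: int where k: "6 * of_int k \<le> Re z" "Re z < 6 * of_int k + 6" by (rule hcyl_rep)
  let ?z = "Complex (Re z - 6 * of_int k) (Im z)"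
  have z: "?z \<in> disco_rect" "hcyl z = disco_proj ?z"
    using assms(1) k hcyl_eq[of z k] by (auto simp: mem_disco_rect)
  from hcyl_eq_proj_iff[OF assms(2,3) z(1)] eq z(2) obtain j :: int where "w = ?z + of_real (6 * of_int j)"
      by auto
  then have "Im w = Im z" by simp
  with assms show False by auto
qed

lemma vcyl_boundary:
  assumes "Re z = 0 \<or> Re z = 1" "0 < Re w" "Re w < 1"
  shows "vcyl z \<noteq> vcyl w"
proof
  assume eq: "vcyl z = vcyl w"
  obtain k :: int where k: "3/2 * of_int k \<le> Im z" "Im z < 3/2 * of_int k + 3/2" by (rule vcyl_rep)
  show False
  proof (cases "Im z \<le> 3/2 * of_int k + 1")
    case True
    let ?z = "Complex (Re z) (Im z - 3/2 * of_int k)"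
    have "?z \<in> disco_rect" using assms(1) k True by (auto simp: mem_disco_rect)
    moreover have "vcyl w = disco_proj ?z" using eq vcyl_eq1[OF k(1) True] by (rule trans[OF sym])
    ultimately have "0 < Re ?z \<and> Re ?z < 1 \<or> 1 < Re ?z \<and> Re ?z < 3"
      using iffD1[OF vcyl_eq_proj_iff[OF assms(2,3)]] by blast
    then show False using assms(1) by auto
  next
    case False
    let ?z = "Complex (1 + 2 * Re z) (2 * (Im z - 3/2 * of_int k) - 2)"
    have "?z \<in> disco_rect" using assms(1) k False by (auto simp: mem_disco_rect)
    moreover have "vcyl z = disco_proj ?z" by (rule vcyl_eq2) (use assms(1) k False in auto)
    with eq have "vcyl w = disco_proj ?z" by (rule trans[OF sym])
    ultimately have "0 < Re ?z \<and> Re ?z < 1 \<or> 1 < Re ?z \<and> Re ?z < 3"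
      using iffD1[OF vcyl_eq_proj_iff[OF assms(2,3)]] by blast
    then show False using assms(1) by auto
  qed
qed

text \<open>The closed flipped cylinder lies over \<open>Re \<ge> 3\<close> in the rectangle, the
  open unflipped one over \<open>Re < 3\<close>.\<close>

lemma vcyl_flip_disjoint:
  assumes "0 \<le> Re z" "Re z \<le> 1" "0 < Re w" "Re w < 1"
  shows "disco_flip (vcyl z) \<noteq> vcyl w"
proof
  assume eq: "disco_flip (vcyl z) = vcyl w"
  obtain k :: int where k: "3/2 * of_int k \<le> Im z" "Im z < 3/2 * of_int k + 3/2" by (rule vcyl_rep)
  show False
  proof (cases "Im z \<le> 3/2 * of_int k + 1")
    case True
    let ?z = "Complex (Re z) (Im z - 3/2 * of_int k)"
    have "Complex 6 1 - ?z \<in> disco_rect" using assms k True by (auto simp: mem_disco_rect)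
    moreover have "vcyl w = disco_proj (Complex 6 1 - ?z)"
      using eq vcyl_eq1[OF k(1) True] disco_flip_proj[of ?z] by metis
    ultimately have "Re (Complex 6 1 - ?z) < 3"
      using iffD1[OF vcyl_eq_proj_iff[OF assms(3,4)]] by fastforce
    then show False using assms(2) by simp
  next
    case False
    let ?z = "Complex (1 + 2 * Re z) (2 * (Im z - 3/2 * of_int k) - 2)"
    have "Complex 6 1 - ?z \<in> disco_rect" using assms k False by (auto simp: mem_disco_rect)
    moreover have "vcyl z = disco_proj ?z" by (rule vcyl_eq2) (use assms k False in auto)
    with eq have "vcyl w = disco_proj (Complex 6 1 - ?z)" using disco_flip_proj[of ?z] by metis
    ultimately have "Re (Complex 6 1 - ?z) < 3"
      using iffD1[OF vcyl_eq_proj_iff[OF assms(3,4)]] by fastforce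
    then show False using assms(2) by simp
  qed
qed

lemma disco_surface_vcyl:
  assumes "p \<in> disco_surface"
  obtains z where "0 \<le> Re z" "Re z \<le> 1" "p = vcyl z \<or> p = disco_flip (vcyl z)"
proof -
  have c: "\<exists>z. 0 \<le> Re z \<and> Re z \<le> 1 \<and> disco_proj w = vcyl z" if "w \<in> disco_rect" "Re w \<le> 3" for w
  proof (cases "Re w \<le> 1")
    case True
    then show ?thesis using that vcyl_eq1[of 0 w] by (intro exI[of _ w]) (simp add: mem_disco_rect)
  next
    case False
    let ?z = "Complex ((Re w - 1) / 2) (Im w / 2 + 1)"
    have "vcyl ?z = disco_proj (Complex (1 + 2 * Re ?z) (2 * (Im ?z - 3/2 * of_int 0) - 2))"
      by (rule vcyl_eq2) (use that False in \<open>simp_all add: mem_disco_rect\<close>)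
    also have "Complex (1 + 2 * Re ?z) (2 * (Im ?z - 3/2 * of_int 0) - 2) = w"
      by (simp add: complex_eq_iff field_simps)
    finally have "vcyl ?z = disco_proj w" .
    then show ?thesis using that False by (intro exI[of _ ?z]) (simp add: mem_disco_rect)
  qed
  obtain w where w: "w \<in> disco_rect" "p = disco_proj w" using assms by (rule disco_surface_cases)
  show ?thesis
  proof (cases "Re w \<le> 3")
    case True
    then show ?thesis using c[of w] w that by auto
  next
    case False
    then obtain z where z: "0 \<le> Re z" "Re z \<le> 1" "disco_proj (Complex 6 1 - w) = vcyl z"
      using c[of "Complex 6 1 - w"] w by (auto simp: disco_rect_flip)
    then have "p = disco_flip (vcyl z)" using w by (metis disco_flip_flip disco_flip_proj)
    then show ?thesis using that z by blast
  qed
qed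

section \<open>Dehn twists along the horizontal and vertical cylinders\<close>

text \<open>Any preimage may be chosen: two of them differ by a multiple of 6 and have equal height.
  On the boundary of the strip the shift, 0 or 6m, is a whole number of periods, so the identity
  there is the continuous extension.\<close>

definition htwist :: "int \<Rightarrow> complex set \<Rightarrow> complex set" where
  "htwist m p = (if \<exists>z. 0 < Im z \<and> Im z < 1 \<and> p = hcyl z
     then let z = SOME z. 0 < Im z \<and> Im z < 1 \<and> p = hcyl z in hcyl (z + of_real (6 * of_int m * Im z))
     else p)"

lemma htwist_hcyl:
  assumes "0 \<le> Im z" "Im z \<le> 1"
  shows "htwist m (hcyl z) = hcyl (z + of_real (6 * of_int m * Im z))"
proof (cases "0 < Im z \<and> Im z < 1")
  case True
  let ?P = "\<lambda>w. 0 < Im w \<and> Im w < 1 \<and> hcyl z = hcyl w"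
  define w where "w = (SOME w. ?P w)"
  have w: "?P w" unfolding w_def by (rule someI[of ?P z]) (use True in simp)
  then obtain k :: int where k: "z = w + of_real (6 * of_int k)" using hcyl_eq_iff[of z w] True by auto
  have "htwist m (hcyl z) = hcyl (w + of_real (6 * of_int m * Im w))"
    using True unfolding htwist_def w_def by (auto simp: Let_def)
  also have "\<dots> = hcyl (w + of_real (6 * of_int m * Im w) + of_real (6 * of_int k))"
    by (rule hcyl_periodic[symmetric])
  also have "w + of_real (6 * of_int m * Im w) + of_real (6 * of_int k) = z + of_real (6 * of_int m * Im z)"
    using k by simp
  finally show ?thesis .
next
  case False
  then have b: "Im z = 0 \<or> Im z = 1" using assms by linarith
  then have "htwist m (hcyl z) = hcyl z" using hcyl_boundary[OF b] unfolding htwist_def by auto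
  moreover have "hcyl (z + of_real (6 * of_int m * Im z)) = hcyl z"
    using b
  proof
    assume "Im z = 1"
    then show ?thesis using hcyl_periodic[of z m] by (simp only: mult_1_right)
  qed simp
  ultimately show ?thesis by simp
qed

lemma htwist_htwist:
  assumes "p \<in> disco_surface" shows "htwist m (htwist n p) = htwist (m + n) p"
proof -
  obtain z where z: "0 \<le> Im z" "Im z \<le> 1" "p = hcyl z" using assms by (rule disco_surface_hcyl)
  then show ?thesis by (simp add: htwist_hcyl algebra_simps)
qed

lemma htwist_0: "p \<in> disco_surface \<Longrightarrow> htwist 0 p = p"
  by (erule disco_surface_hcyl) (simp add: htwist_hcyl)

lemma htwist_flip:
  assumes "p \<in> disco_surface" shows "htwist m (disco_flip p) = disco_flip (htwist m p)"
proof -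
  obtain z where z: "0 \<le> Im z" "Im z \<le> 1" "p = hcyl z" using assms by (rule disco_surface_hcyl)
  have "htwist m (disco_flip p) = hcyl (Complex 6 1 - z + of_real (6 * of_int m * (1 - Im z)))"
    using z by (simp add: disco_flip_hcyl htwist_hcyl)
  also have "\<dots> = hcyl (Complex 6 1 - (z + of_real (6 * of_int m * Im z)) + of_real (6 * of_int m))"
    by (simp add: algebra_simps)
  also have "\<dots> = disco_flip (htwist m p)"
    using z by (simp only: hcyl_periodic htwist_hcyl) (simp add: disco_flip_hcyl)
  finally show ?thesis .
qed

lemma continuous_htwist: "continuous_map disco_top disco_top (htwist m)"
proof (rule continuous_compose_quotient_map[OF quotient_map_disco_proj])
  have "continuous_map (top_of_set disco_rect) (top_of_set {z. 0 \<le> Im z \<and>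
      Im z \<le> 1}) (\<lambda>z. z + of_real (6 * of_int m * Im z))"
    by (auto intro!: continuous_intros simp: mem_disco_rect)
  from continuous_map_compose[OF this continuous_hcyl]
  have "continuous_map (top_of_set disco_rect) disco_top (\<lambda>z. hcyl (z + of_real (6 * of_int m * Im z)))"
    by (simp only: o_def)
  then show "continuous_map (top_of_set disco_rect) disco_top (htwist m \<circ> disco_proj)"
  proof (rule continuous_map_eq)
    fix z assume "z \<in> topspace (top_of_set disco_rect)"
    then have "disco_proj z = hcyl z" "0 \<le> Im z" "Im z \<le> 1" using hcyl_eq[of z 0]
        by (auto simp: mem_disco_rect)
    then show "hcyl (z + of_real (6 * of_int m * Im z)) = (htwist m \<circ> disco_proj) z"
      by (simp add: htwist_hcyl)
  qed
qed

lemma htwist_sing: "p \<in> disco_sing \<Longrightarrow> htwist m p = p"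
proof -
  assume p: "p \<in> disco_sing"
  have "p \<noteq> hcyl z" if "0 < Im z" "Im z < 1" for z
    using p disco_model_hcyl that unfolding disco_model_def by auto
  then show ?thesis unfolding htwist_def by auto
qed

definition vtwist1 :: "int \<Rightarrow> complex set \<Rightarrow> complex set" where
  "vtwist1 m p = (if \<exists>z. 0 < Re z \<and> Re z < 1 \<and> p = vcyl z
     then let z = SOME z. 0 < Re z \<and> Re z < 1 \<and> p = vcyl z in vcyl (z + \<i> * of_real (3/2 * of_int m * Re z))
     else p)"

text \<open>Conjugating \<open>vtwist1\<close> by the half turn twists the other vertical cylinder.
  Both are twisted at once, since only then is the linear part the same everywhere.\<close>

definition vtwist :: "int \<Rightarrow> complex set \<Rightarrow> complex set" where
  "vtwist m p = vtwist1 m (disco_flip (vtwist1 m (disco_flip p)))"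

lemma vtwist1_vcyl:
  assumes "0 \<le> Re z" "Re z \<le> 1"
  shows "vtwist1 m (vcyl z) = vcyl (z + \<i> * of_real (3/2 * of_int m * Re z))"
proof (cases "0 < Re z \<and> Re z < 1")
  case True
  let ?P = "\<lambda>w. 0 < Re w \<and> Re w < 1 \<and> vcyl z = vcyl w"
  define w where "w = (SOME w. ?P w)"
  have w: "?P w" unfolding w_def by (rule someI[of ?P z]) (use True in simp)
  then obtain k :: int where k: "z = w + \<i> * of_real (3/2 * of_int k)" using vcyl_eq_iff[of z w] True
      by auto
  have "vtwist1 m (vcyl z) = vcyl (w + \<i> * of_real (3/2 * of_int m * Re w))"
    using True unfolding vtwist1_def w_def by (auto simp: Let_def)
  also have "\<dots> = vcyl (w + \<i> * of_real (3/2 * of_int m * Re w) + \<i> * of_real (3/2 * of_int k))"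
    by (rule vcyl_periodic[symmetric])
  also have "w + \<i> * of_real (3/2 * of_int m * Re w) + \<i> * of_real (3/2 * of_int k) =
      z + \<i> * of_real (3/2 * of_int m * Re z)"
    using k by simp
  finally show ?thesis .
next
  case False
  then have b: "Re z = 0 \<or> Re z = 1" using assms by linarith
  then have "vtwist1 m (vcyl z) = vcyl z" using vcyl_boundary[OF b] unfolding vtwist1_def by auto
  moreover have "vcyl (z + \<i> * of_real (3/2 * of_int m * Re z)) = vcyl z"
    using b
  proof
    assume "Re z = 1"
    then show ?thesis using vcyl_periodic[of z m] by (simp only: mult_1_right)
  qed simp
  ultimately show ?thesis by simp
qed

lemma vtwist1_flip_vcyl:
  assumes "0 \<le> Re z" "Re z \<le> 1"
  shows "vtwist1 m (disco_flip (vcyl z)) = disco_flip (vcyl z)"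
  unfolding vtwist1_def using vcyl_flip_disjoint[OF assms] by auto

lemma vtwist_vcyl:
  assumes "0 \<le> Re z" "Re z \<le> 1"
  shows "vtwist m (vcyl z) = vcyl (z + \<i> * of_real (3/2 * of_int m * Re z))"
  unfolding vtwist_def vtwist1_flip_vcyl[OF assms] disco_flip_flip vtwist1_vcyl[OF assms] ..

lemma vtwist_flip_vcyl:
  assumes "0 \<le> Re z" "Re z \<le> 1"
  shows "vtwist m (disco_flip (vcyl z)) = disco_flip (vcyl (z + \<i> * of_real (3/2 * of_int m * Re z)))"
  unfolding vtwist_def disco_flip_flip vtwist1_vcyl[OF assms]
  by (rule vtwist1_flip_vcyl) (use assms in auto)

lemma vtwist_flip:
  assumes "p \<in> disco_surface" shows "vtwist m (disco_flip p) = disco_flip (vtwist m p)"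
proof -
  obtain z where z: "0 \<le> Re z" "Re z \<le> 1" "p = vcyl z \<or> p = disco_flip (vcyl z)"
    using assms by (rule disco_surface_vcyl)
  then show ?thesis using vtwist_vcyl[OF z(1,2)] vtwist_flip_vcyl[OF z(1,2)] by auto
qed

lemma vtwist_vtwist:
  assumes "p \<in> disco_surface" shows "vtwist m (vtwist n p) = vtwist (m + n) p"
proof -
  obtain z where z: "0 \<le> Re z" "Re z \<le> 1" "p = vcyl z \<or> p = disco_flip (vcyl z)"
    using assms by (rule disco_surface_vcyl)
  let ?w = "z + \<i> * of_real (3/2 * of_int n * Re z)"
  have w: "0 \<le> Re ?w" "Re ?w \<le> 1" using z by auto
  have e: "?w + \<i> * of_real (3/2 * of_int m * Re ?w) = z + \<i> * of_real (3/2 * of_int (m + n) * Re z)"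
    by (simp add: complex_eq_iff algebra_simps)
  have "vtwist m (vtwist n (vcyl z)) = vtwist (m + n) (vcyl z)"
    unfolding vtwist_vcyl[OF z(1,2)] vtwist_vcyl[OF w] e ..
  moreover have "vtwist m (vtwist n (disco_flip (vcyl z))) = vtwist (m + n) (disco_flip (vcyl z))"
    unfolding vtwist_flip_vcyl[OF z(1,2)] vtwist_flip_vcyl[OF w] e ..
  ultimately show ?thesis using z(3) by auto
qed

lemma vtwist_0:
  assumes "p \<in> disco_surface" shows "vtwist 0 p = p"
proof -
  obtain z where z: "0 \<le> Re z" "Re z \<le> 1" "p = vcyl z \<or> p = disco_flip (vcyl z)"
    using assms by (rule disco_surface_vcyl)
  then show ?thesis using vtwist_vcyl[OF z(1,2), of 0] vtwist_flip_vcyl[OF z(1,2), of 0] by auto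
qed

text \<open>The rectangle is cut at \<open>Re z = 1\<close> and \<open>Re z = 3\<close> into closed
  pieces. The first two enter the cylinder through \<open>h\<close>; the third lies in the flipped
  closed cylinder, where the twist is the identity.\<close>

lemma continuous_vtwist1: "continuous_map disco_top disco_top (vtwist1 m)"
proof (rule continuous_compose_quotient_map[OF quotient_map_disco_proj])
  define T where "T = (\<lambda>i::nat. if i = 0 then {z. Re z \<le> 1} else if i = 1 then {z. 1 \<le> Re z} \<inter> {z. Re z \<le>
      3} else {z. 3 \<le> Re z})"
  define h where "h = (\<lambda>i::nat. \<lambda>z. if i = 0 then z else Complex ((Re z - 1) / 2) (Im z / 2 + 1))"
  define f where "f = (\<lambda>i::nat. \<lambda>z. if i =
      2 then disco_proj z else vcyl (h i z + \<i> * of_real (3/2 * of_int m * Re (h i z))))"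
  have hr: "0 \<le> Re (h i z) \<and> Re (h i z) \<le> 1 \<and> vcyl (h i z) = disco_proj z"
    if "z \<in> disco_rect" "z \<in> T i" "i < 2" for i z
  proof (cases "i = 0")
    case True
    then show ?thesis using that vcyl_eq1[of 0 z] by (simp add: h_def T_def mem_disco_rect)
  next
    case False
    then have i: "i = 1" using that by simp
    have "vcyl (h i z) = disco_proj (Complex (1 + 2 * Re (h i z)) (2 * (Im (h i z) - 3/2 * of_int 0) - 2))"
      by (rule vcyl_eq2) (use that i in \<open>simp_all add: mem_disco_rect h_def T_def\<close>)
    also have "Complex (1 + 2 * Re (h i z)) (2 * (Im (h i z) - 3/2 * of_int 0) - 2) = z"
      using i by (simp add: complex_eq_iff h_def field_simps)
    finally show ?thesis using that i by (simp add: h_def T_def mem_disco_rect)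
  qed
  have ff: "vtwist1 m (disco_proj z) = f i z" if "z \<in> disco_rect" "z \<in> T i" "i \<le> 2" for i z
  proof (cases "i = 2")
    case True
    then have "3 \<le> Re z" using that by (simp add: T_def)
    then have "Re (Complex 6 1 - z) \<le> 3" "Complex 6 1 - z \<in> disco_rect" using that
        by (auto simp: disco_rect_flip)
    define j where "j = (if Re (Complex 6 1 - z) \<le> 1 then 0 else 1 :: nat)"
    let ?w = "h j (Complex 6 1 - z)"
    have "0 \<le> Re ?w \<and> Re ?w \<le> 1 \<and> vcyl ?w = disco_proj (Complex 6 1 - z)"
      using \<open>Re (Complex 6 1 - z) \<le> 3\<close> \<open>Complex 6 1 - z \<in> disco_rect\<close> by (intro hr) (auto simp: T_def j_def)
    then have "disco_proj z = disco_flip (vcyl ?w)" "0 \<le> Re ?w" "Re ?w \<le> 1"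
      by (auto simp: disco_flip_proj)
    then show ?thesis using True vtwist1_flip_vcyl[of ?w m] by (simp add: f_def)
  next
    case False
    then have "i < 2" using that by simp
    from hr[OF that(1,2) this] vtwist1_vcyl[of "h i z" m] False show ?thesis by (simp add: f_def)
  qed
  show "continuous_map (top_of_set disco_rect) disco_top (vtwist1 m \<circ> disco_proj)"
  proof (rule pasting_lemma_closed[where I = "{..2}" and T = "\<lambda>i. disco_rect \<inter> T i" and f = f])
    fix i :: nat assume i: "i \<in> {..2}"
    have "closed (T i)"
      unfolding T_def by (auto intro!: closed_Int closed_Collect_le continuous_intros)
    then show "closedin (top_of_set disco_rect) (disco_rect \<inter> T i)" by (rule closedin_closed_Int)
    show "continuous_map (subtopology (top_of_set disco_rect) (disco_rect \<inter> T i)) disco_top (f i)"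
    proof (cases "i = 2")
      case True
      then show ?thesis unfolding f_def
        by (simp add: subtopology_subtopology continuous_map_from_subtopology_mono[OF
            continuous_disco_proj])
    next
      case False
      then have "i < 2" using i by simp
      then have im: "(\<lambda>z. h i z + \<i> * of_real (3/2 * of_int m * Re (h i z))) ` (disco_rect \<inter> T i) \<subseteq> {z. 0 \<le>
          Re z \<and> Re z \<le> 1}"
        using hr by auto
      have ch: "continuous_on (disco_rect \<inter> T i) (h i)"
        unfolding h_def Complex_eq by (cases "i = 0") (auto intro!: continuous_intros)
      have "continuous_map (top_of_set (disco_rect \<inter> T i)) (top_of_set {z. 0 \<le> Re z \<and>
          Re z \<le> 1}) (\<lambda>z. h i z + \<i> * of_real (3/2 * of_int m * Re (h i z)))"
        using im by (auto intro!: continuous_intros ch)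
      from continuous_map_compose[OF this continuous_vcyl] False
      show ?thesis by (simp add: f_def o_def subtopology_subtopology)
    qed
    fix j x assume "j \<in> {..2::nat}" "x \<in>
        topspace (top_of_set disco_rect) \<inter> (disco_rect \<inter> T i) \<inter> (disco_rect \<inter> T j)"
    then show "f i x = f j x" using ff[of x i] ff[of x j] i by auto
  next
    fix x assume "x \<in> topspace (top_of_set disco_rect)"
    then have x: "x \<in> disco_rect" by simp
    have "x \<in> T 0 \<or> x \<in> T 1 \<or> x \<in> T 2" by (auto simp: T_def)
    then obtain j where "j \<in> {..2::nat}" "x \<in> T j"
        by (metis atMost_iff le_numeral_extra(3) one_le_numeral order_refl zero_le)
    then show "\<exists>j. j \<in> {..2} \<and> x \<in> disco_rect \<inter> T j \<and> (vtwist1 m \<circ> disco_proj) x = f j x"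
      using ff x by auto
  qed simp
qed

lemma continuous_vtwist: "continuous_map disco_top disco_top (vtwist m)"
proof -
  have "vtwist m = vtwist1 m \<circ> (disco_flip \<circ> (vtwist1 m \<circ> disco_flip))"
    by (simp add: vtwist_def fun_eq_iff)
  then show ?thesis
    by (simp only:) (intro continuous_map_compose[OF _ continuous_vtwist1] continuous_map_compose[OF _
        continuous_disco_flip] continuous_disco_flip)
qed

lemma vcyl_regular: "0 < Re z \<Longrightarrow> Re z < 1 \<Longrightarrow> vcyl z \<in> disco_surface \<and> vcyl z \<notin> disco_sing"
  using locally_affine_regular[OF disco_model_locally_affine[OF disco_model_vcyl]] by simp

lemma hcyl_regular: "0 < Im z \<Longrightarrow> Im z < 1 \<Longrightarrow> hcyl z \<in> disco_surface \<and> hcyl z \<notin> disco_sing"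
  using locally_affine_regular[OF disco_model_locally_affine[OF disco_model_hcyl]] by simp

lemma vtwist_sing:
  assumes "p \<in> disco_sing" shows "vtwist m p = p"
proof -
  have "disco_flip p \<in> disco_sing" using assms by simp
  have "vtwist1 m q = q" if "q \<in> disco_sing" for q
  proof -
    have "\<not> (\<exists>z. 0 < Re z \<and> Re z < 1 \<and> q = vcyl z)" using vcyl_regular that by blast
    then show ?thesis unfolding vtwist1_def by (simp only: if_False)
  qed
  then have "vtwist1 m p = p" "vtwist1 m (disco_flip p) = disco_flip p"
    using assms \<open>disco_flip p \<in> disco_sing\<close> by blast+
  then show ?thesis by (simp add: vtwist_def)
qed

lemma disco_flip_surface_iff: "disco_flip p \<in> disco_surface \<longleftrightarrow> p \<in> disco_surface"
  using disco_flip_surface[of p] disco_flip_surface[of "disco_flip p"] by auto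

text \<open>The equation is wanted for arbitrary sets \<open>p\<close>, in the form asked by
  \<open>germ_at_flip\<close>; outside the surface the twist is the identity by its default
  branch.\<close>

lemma htwist_commutes_flip: "htwist m (disco_flip p) = disco_flip (htwist m p)"
proof (cases "p \<in> disco_surface")
  case False
  then have "disco_flip p \<notin> disco_surface" by (simp add: disco_flip_surface_iff)
  have "htwist m q = q" if "q \<notin> disco_surface" for q
  proof -
    have "\<not> (\<exists>z. 0 < Im z \<and> Im z < 1 \<and> q = hcyl z)" using hcyl_regular that by blast
    then show ?thesis unfolding htwist_def by (simp only: if_False)
  qed
  with False \<open>disco_flip p \<notin> disco_surface\<close> show ?thesis by simp
qed (rule htwist_flip)

lemma vtwist_commutes_flip: "vtwist m (disco_flip p) = disco_flip (vtwist m p)"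
proof (cases "p \<in> disco_surface")
  case False
  have "vtwist1 m q = q" if "q \<notin> disco_surface" for q
  proof -
    have "\<not> (\<exists>z. 0 < Re z \<and> Re z < 1 \<and> q = vcyl z)" using vcyl_regular that by blast
    then show ?thesis unfolding vtwist1_def by (simp only: if_False)
  qed
  with False show ?thesis unfolding vtwist_def by (simp add: disco_flip_surface_iff)
qed (rule vtwist_flip)

section \<open>Affinity of the half turn, the homotheties and the twists\<close>

lemma locally_affine_hcyl: "0 < Im z \<Longrightarrow> Im z < 1 \<Longrightarrow> locally_affine 1 hcyl z"
  using disco_model_locally_affine[OF disco_model_hcyl] by simp

lemma locally_affine_vcyl: "0 < Re z \<Longrightarrow> Re z < 1 \<Longrightarrow> locally_affine 1 vcyl z"
  using disco_model_locally_affine[OF disco_model_vcyl] by simp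

text \<open>A flipped model is again a model, which settles one parametrization through the point;
  \<open>locally_affine_germ\<close> passes to all others.\<close>

lemma locally_affine_flip:
  assumes "locally_affine 1 \<psi> u"
  shows "locally_affine 1 (\<lambda>w. disco_flip (\<psi> (- w))) (- u)"
proof -
  obtain A \<psi>0 u0 where m: "disco_model A \<psi>0" "u0 \<in> A" "\<psi>0 u0 = \<psi> u"
    using disco_regular_model locally_affine_regular[OF assms] by metis
  have "locally_affine 1 (\<lambda>u. disco_flip (\<psi>0 (0 - u))) (- u0)"
    by (rule disco_model_locally_affine[OF disco_model_flip[OF m(1)]]) (use m in simp)
  then have "locally_affine 1 (\<lambda>u. disco_flip (\<psi>0 (- u))) (- u0)" by simp
  then show ?thesis
    by (rule locally_affine_germ[of uminus uminus, rotated 5])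
      (use m assms disco_model_locally_affine[OF m(1,2)] in \<open>simp_all add: linear_iff\<close>)
qed

lemma disco_affine_flip: "disco_affine disco_flip uminus uminus"
  unfolding disco_affine_def using continuous_disco_flip locally_affine_flip by (auto simp: linear_iff)

text \<open>The atlas determines lengths only up to positive factors, so the identity of the surface
  has every positive homothety as a linear part. Hence total periodicity depends only on the ray
  spanned by \<theta>.\<close>

lemma disco_affine_scale:
  assumes "r > 0"
  shows "disco_affine (\<lambda>p. p) (\<lambda>z. of_real r * z) (\<lambda>z. of_real (1 / r) * z)"
  unfolding disco_affine_def
proof (intro conjI allI impI)
  fix \<psi> u assume la: "locally_affine 1 \<psi> u"
  then have "locally_affine 1 \<psi> (of_real (1 / r) * (of_real r * u) + 0)" using assms by simp
  from locally_affine_compose[OF this]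
  have "locally_affine (1 * of_real (1 / r)) (\<lambda>w. \<psi> (of_real (1 / r) * w + 0)) (of_real r * u)" .
  then show "locally_affine 1 (\<lambda>w. \<psi> (of_real (1 / r) * w)) (of_real r * u)"
    using locally_affine_scale[of "of_real (1 / r)" _ _ "1 / r" 1] assms by simp
qed (use assms in \<open>auto simp: linear_iff algebra_simps scaleR_conv_of_real add_divide_distrib\<close>)

lemma totally_periodic_scale:
  assumes "totally_periodic \<theta>" "\<theta> \<noteq> 0" "r > 0"
  shows "totally_periodic (of_real r * \<theta>)"
proof (rule disco_affine_totally_periodic[OF disco_affine_scale[OF assms(3)] _ _ _ assms(2) _ assms(1)])
  show "disco_affine (\<lambda>p. p) (\<lambda>z. of_real (1 / r) * z) (\<lambda>z. of_real r * z)"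
    using disco_affine_scale[of "1 / r"] assms by simp
qed (use assms in auto)

lemma totally_periodic_uminus:
  assumes "totally_periodic \<theta>" "\<theta> \<noteq> 0"
  shows "totally_periodic (- \<theta>)"
  by (rule disco_affine_totally_periodic[OF disco_affine_flip disco_affine_flip _ _ assms(2) _ assms(1)])
    (use assms in auto)

lemma locally_affine_transfer:
  fixes N N' :: "complex \<Rightarrow> complex"
  assumes lin: "linear N'" and inv: "\<And>z. N (N' z) = z" "\<And>z. N' (N z) = z"
    and e: "open A" "z \<in> A" "\<And>u. u \<in> A \<Longrightarrow> T (\<psi> u) = \<psi>' (N u)" and la: "locally_affine 1 \<psi>' (N z)"
  shows "locally_affine 1 (\<lambda>w. T (\<psi> (N' w))) (N z)"
proof -
  have "continuous_on UNIV N'" using lin by (simp add: linear_continuous_on linear_linear)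
  then have "open (N' -` A)" by (rule open_vimage[OF e(1)])
  moreover have "N z \<in> N' -` A" using inv e by simp
  ultimately obtain r where r: "r > 0" "ball (N z) r \<subseteq> N' -` A" using open_contains_ball by blast
  show ?thesis
  proof (rule locally_affine_cong[OF la r(1)])
    fix w assume "w \<in> ball (N z) r"
    then have "N' w \<in> A" using r by blast
    then show "T (\<psi> (N' w)) = \<psi>' w" using e(3) inv by simp
  qed
qed

text \<open>A pointwise version of the last clause of \<open>disco_affine\<close>, for a single \<open>\<psi>\<close> through \<open>p\<close>.\<close>

definition germ_at :: "(complex set \<Rightarrow> complex set) \<Rightarrow> (complex \<Rightarrow> complex) \<Rightarrow> (complex \<Rightarrow> complex) \<Rightarrow> complex set
    \<Rightarrow> bool" where
  "germ_at T N N' p \<longleftrightarrow> (\<exists>\<psi> u. \<psi> u = p \<and> locally_affine 1 \<psi> u \<and> locally_affine 1 (\<lambda>w. T (\<psi> (N' w))) (N u))"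

lemma germ_at_flip:
  assumes "\<And>p. T (disco_flip p) = disco_flip (T p)" "linear N" "linear N'" "germ_at T N N' p"
  shows "germ_at T N N' (disco_flip p)"
proof -
  obtain \<psi> u where \<psi>: "\<psi> u = p" "locally_affine 1 \<psi> u" "locally_affine 1 (\<lambda>w. T (\<psi> (N' w))) (N u)"
    using assms(4) unfolding germ_at_def by blast
  have "locally_affine 1 (\<lambda>w. T (disco_flip (\<psi> (- N' w)))) (N (- u))"
    using locally_affine_flip[OF \<psi>(3)] assms(1) linear_neg[OF assms(2), of u] linear_neg[OF assms(3)]
        by simp
  then show ?thesis
    unfolding germ_at_def using locally_affine_flip[OF \<psi>(2)] \<psi>(1)
    by (intro exI[of _ "\<lambda>w. disco_flip (\<psi> (- w))"] exI[of _ "- u"]) simp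
qed

lemma disco_affineI:
  assumes "continuous_map disco_top disco_top T" "\<And>p. p \<in> disco_sing \<Longrightarrow> T p = p"
    and lin: "linear N" "linear N'" and inv: "\<And>z. N (N' z) = z" "\<And>z. N' (N z) = z"
    and germ: "\<And>p. p \<in> disco_surface \<Longrightarrow> p \<notin> disco_sing \<Longrightarrow> germ_at T N N' p"
  shows "disco_affine T N N'"
  unfolding disco_affine_def
proof (intro conjI allI impI)
  show "T ` disco_sing \<subseteq> disco_sing" using assms(2) by auto
  fix \<psi> u assume la: "locally_affine 1 \<psi> u"
  then have "germ_at T N N' (\<psi> u)" using germ locally_affine_regular by blast
  then obtain \<psi>0 u0 where *: "\<psi>0 u0 = \<psi> u" "locally_affine 1 \<psi>0 u0"
      "locally_affine 1 (\<lambda>w. T (\<psi>0 (N' w))) (N u0)"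
    unfolding germ_at_def by blast
  show "locally_affine 1 (\<lambda>w. T (\<psi> (N' w))) (N u)"
    by (rule locally_affine_germ[OF lin inv *(2,3) la *(1)[symmetric]])
qed (use assms in auto)

definition hshear :: "int \<Rightarrow> complex \<Rightarrow> complex" where
  "hshear m z = z + of_real (6 * of_int m * Im z)"

definition vshear :: "int \<Rightarrow> complex \<Rightarrow> complex" where
  "vshear m z = z + \<i> * of_real (3/2 * of_int m * Re z)"

lemma linear_hshear: "linear (hshear m)" and linear_vshear: "linear (vshear m)"
  by (auto intro!: linearI simp: hshear_def vshear_def complex_eq_iff algebra_simps)

lemma hshear_inverse: "hshear m (hshear (- m) z) = z" "hshear (- m) (hshear m z) = z"
  and vshear_inverse: "vshear m (vshear (- m) z) = z" "vshear (- m) (vshear m z) = z"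
  by (simp_all add: hshear_def vshear_def complex_eq_iff)

lemma Re_vshear [simp]: "Re (vshear m z) = Re z" and Im_hshear [simp]: "Im (hshear m z) = Im z"
  and Im_vshear: "Im (vshear m z) = Im z + 3/2 * of_int m * Re z"
  and Re_hshear: "Re (hshear m z) = Re z + 6 * of_int m * Im z"
  by (simp_all add: vshear_def hshear_def)

lemma hcyl_id: "0 \<le> Im z \<Longrightarrow> Im z \<le> 1 \<Longrightarrow> 0 \<le> Re z \<Longrightarrow> Re z \<le> 6 \<Longrightarrow> hcyl z = disco_proj z"
  using hcyl_eq[of z 0] by simp

lemma vcyl_id: "0 \<le> Im z \<Longrightarrow> Im z \<le> 1 \<Longrightarrow> vcyl z = disco_proj z"
  using vcyl_eq1[of 0 z] by simp

lemma vcyl_id2: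
  assumes "0 \<le> Re z" "Re z \<le> 1" "1 \<le> Im z" "Im z \<le> 3/2"
  shows "vcyl z = disco_proj (Complex (1 + 2 * Re z) (2 * Im z - 2))"
  using vcyl_eq2[of z 0] assms by simp

lemma germ_at_htwist_hcyl:
  assumes "0 < Im z" "Im z < 1"
  shows "germ_at (htwist m) (hshear m) (hshear (- m)) (hcyl z)"
  unfolding germ_at_def
proof (rule exI[of _ hcyl], rule exI[of _ z], intro conjI)
  show "locally_affine 1 (\<lambda>w. htwist m (hcyl (hshear (- m) w))) (hshear m z)"
  proof (rule locally_affine_transfer[OF linear_hshear hshear_inverse])
    show "open {z. 0 < Im z \<and> Im z < 1}"
      by (intro open_Collect_conj open_Collect_less continuous_intros)
    show "z \<in> {z. 0 < Im z \<and> Im z < 1}" using assms by simp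
    show "locally_affine 1 hcyl (hshear m z)" using assms by (intro locally_affine_hcyl) auto
    fix u assume "u \<in> {z. 0 < Im z \<and> Im z < 1}"
    then show "htwist m (hcyl u) = hcyl (hshear m u)" by (simp only: hshear_def) (rule htwist_hcyl, auto)
  qed
qed (use assms locally_affine_hcyl in auto)

lemma vcyl_reduce:
  obtains z' where "Re z' = Re z" "0 \<le> Im z'" "Im z' < 3/2" "vcyl z' = vcyl z"
proof -
  obtain k :: int where k: "3/2 * of_int k \<le> Im z" "Im z < 3/2 * of_int k + 3/2" by (rule vcyl_rep)
  show ?thesis
    by (rule that[of "z + \<i> * of_real (3/2 * of_int (- k))"]) (use k vcyl_periodic[of z "- k"] in simp_all)
qed

text \<open>Points of a horizontal side are interior in vertical coordinates only. The two sides of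
  such a line are seen at scales 1 and 2; a shear fixing the line commutes with homotheties centred
  on it, so both give the same shear. The subtracted shift is a multiple of the period 6 and makes
  \<open>z\<close> a fixed point.\<close>

lemma htwist_vcyl_near_side:
  assumes z: "0 < Re z" "Re z < 1" "Im z = 0 \<or> Im z = 1"
  shows "\<exists>A. open A \<and> z \<in> A \<and> (\<forall>u\<in>A. htwist m (vcyl u) = vcyl (hshear m u - of_real (6 * of_int m * Im z)))"
proof -
  let ?v = "\<lambda>u. hshear m u - of_real (6 * of_int m * Im z)"
  let ?A = "{u. 0 < Re u \<and> Re u < 1 \<and> 0 < Re (?v u) \<and> Re (?v u) < 1 \<and> - (1/2) < Im (u - of_real 0) - Im z \<and>
      Im u - Im z < 1/2}"
  have per: "hcyl (?v u + of_real (6 * of_int m * Im z)) = hcyl (?v u)" for u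
    using z(3) hcyl_periodic[of "?v u" m]
        by (elim disjE; simp only: mult_1_right mult_zero_right of_real_0 add_0_right)
  have "open ?A"
    unfolding hshear_def by (intro open_Collect_conj open_Collect_less continuous_intros)
  moreover have "z \<in> ?A" using z by (simp add: Re_hshear)
  moreover have "htwist m (vcyl u) = vcyl (?v u)" if "u \<in> ?A" for u
  proof -
    have u: "0 < Re u" "Re u < 1" "0 < Re (?v u)" "Re (?v u) < 1" "Im z - 1/2 < Im u" "Im u < Im z + 1/2"
      using that by auto
    have Imv: "Im (?v u) = Im u" by simp
    have Rev: "Re (?v u) = Re u + 6 * of_int m * (Im u - Im z)" by (simp add: Re_hshear algebra_simps)
    consider "Im z = 0" "0 \<le> Im u" | "Im z = 1" "Im u \<le> 1" | "Im z = 0" "Im u \<le> 0" | "Im z = 1" "1 \<le> Im u"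
      using z(3) by linarith
    then show ?thesis
    proof cases
      case 1
      then have "htwist m (vcyl u) = htwist m (hcyl u)" using u by (simp add: vcyl_id hcyl_id)
      also have "\<dots> = hcyl (u + of_real (6 * of_int m * Im u))" using u 1 by (intro htwist_hcyl) auto
      also have "\<dots> = hcyl (?v u)" using per[of u] by (simp add: hshear_def)
      also have "\<dots> = vcyl (?v u)" using u 1 by (subst hcyl_id; (subst vcyl_id)?; simp)
      finally show ?thesis .
    next
      case 2
      then have "htwist m (vcyl u) = htwist m (hcyl u)" using u by (simp add: vcyl_id hcyl_id)
      also have "\<dots> = hcyl (u + of_real (6 * of_int m * Im u))" using u 2 by (intro htwist_hcyl) auto
      also have "\<dots> = hcyl (?v u)" using per[of u] by (simp add: hshear_def)
      also have "\<dots> = vcyl (?v u)" using u 2 by (subst hcyl_id; (subst vcyl_id)?; simp)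
      finally show ?thesis .
    next
      case 3
      have A: "vcyl w = disco_proj (Complex (1 + 2 * Re w) (2 * Im w + 1))"
        if "0 < Re w" "Re w < 1" "Im w = Im u" for w
        using vcyl_eq2[of w "-1"] that u 3 by (simp add: algebra_simps)
      let ?w = "Complex (1 + 2 * Re u) (2 * Im u + 1)"
      have "htwist m (vcyl u) = htwist m (hcyl ?w)" using A[of u] u 3 by (simp add: hcyl_id)
      also have "\<dots> = hcyl (?w + of_real (6 * of_int m * Im ?w))" using u 3 by (intro htwist_hcyl) auto
      \<comment> \<open>Doubling about the seam carries the shear to itself; the seam is the top
        side here, at height 1, which contributes the whole shift 6m.\<close>
      also have "?w + of_real (6 * of_int m * Im ?w) =
          Complex (1 + 2 * Re (?v u)) (2 * Im u + 1) + of_real (6 * of_int m)"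
        using 3 unfolding Rev by (simp add: complex_eq_iff algebra_simps)
      also have "hcyl \<dots> = hcyl (Complex (1 + 2 * Re (?v u)) (2 * Im u + 1))" by (rule hcyl_periodic)
      also have "\<dots> = disco_proj (Complex (1 + 2 * Re (?v u)) (2 * Im u + 1))" using u 3
          by (intro hcyl_id) auto
      also have "\<dots> = vcyl (?v u)" using A[of "?v u"] u Imv by simp
      finally show ?thesis .
    next
      case 4
      have A: "vcyl w = disco_proj (Complex (1 + 2 * Re w) (2 * Im w - 2))"
        if "0 < Re w" "Re w < 1" "Im w = Im u" for w
        using vcyl_id2[of w] that u 4 by simp
      let ?w = "Complex (1 + 2 * Re u) (2 * Im u - 2)"
      have "htwist m (vcyl u) = htwist m (hcyl ?w)" using A[of u] u 4 by (simp add: hcyl_id)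
      also have "\<dots> = hcyl (?w + of_real (6 * of_int m * Im ?w))" using u 4 by (intro htwist_hcyl) auto
      also have "?w + of_real (6 * of_int m * Im ?w) = Complex (1 + 2 * Re (?v u)) (2 * Im u - 2)"
        using 4 unfolding Rev by (simp add: complex_eq_iff algebra_simps)
      also have "hcyl \<dots> = disco_proj (Complex (1 + 2 * Re (?v u)) (2 * Im u - 2))" using u 4
          by (intro hcyl_id) auto
      also have "\<dots> = vcyl (?v u)" using A[of "?v u"] u Imv by simp
      finally show ?thesis .
    qed
  qed
  ultimately show ?thesis by blast
qed

lemma germ_at_htwist_vcyl:
  assumes "0 < Re z" "Re z < 1"
  shows "germ_at (htwist m) (hshear m) (hshear (- m)) (vcyl z)"
proof -
  obtain z' where z': "Re z' = Re z" "0 \<le> Im z'" "Im z' < 3/2" "vcyl z' = vcyl z" by (rule vcyl_reduce)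
  consider "0 < Im z'" "Im z' < 1" | "1 < Im z'" | "Im z' = 0 \<or> Im z' = 1" using z' by linarith
  then show ?thesis
  proof cases
    case 1
    then have "vcyl z = hcyl z'" using z' assms
        by (metis hcyl_id vcyl_id less_imp_le one_le_numeral order.trans)
    then show ?thesis using germ_at_htwist_hcyl 1 by simp
  next
    case 2
    let ?w = "Complex (1 + 2 * Re z') (2 * Im z' - 2)"
    have "vcyl z' = disco_proj ?w" using 2 z' assms by (intro vcyl_id2) auto
    also have "\<dots> = hcyl ?w" using 2 z' assms by (intro hcyl_id[symmetric]) auto
    finally show ?thesis using germ_at_htwist_hcyl[of ?w m] 2 z' by simp
  next
    case 3
    have z: "0 < Re z'" "Re z' < 1" using assms z' by auto
    from htwist_vcyl_near_side[OF z 3, of m] obtain A where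
      A: "open A" "z' \<in> A" "\<And>u. u \<in> A \<Longrightarrow> htwist m (vcyl u) =
          vcyl (hshear m u - of_real (6 * of_int m * Im z'))"
      by blast
    have "locally_affine 1 vcyl (1 * hshear m z' + - of_real (6 * of_int m * Im z'))"
      by (rule locally_affine_vcyl) (use z in \<open>simp_all add: Re_hshear\<close>)
    from locally_affine_compose[OF this]
    have la: "locally_affine 1 (\<lambda>w. vcyl (w - of_real (6 * of_int m * Im z'))) (hshear m z')" by simp
    have "locally_affine 1 (\<lambda>w. htwist m (vcyl (hshear (- m) w))) (hshear m z')"
      by (rule locally_affine_transfer[where T = "htwist m" and \<psi> = vcyl
          and \<psi>' = "\<lambda>w. vcyl (w - of_real (6 * of_int m * Im z'))",
            OF linear_hshear hshear_inverse A la])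
    then show ?thesis
      unfolding germ_at_def using z'(4) locally_affine_vcyl[OF z] by blast
  qed
qed

lemma disco_affine_htwist: "disco_affine (htwist m) (hshear m) (hshear (- m))"
proof (rule disco_affineI[OF continuous_htwist htwist_sing linear_hshear linear_hshear hshear_inverse])
  fix p assume "p \<in> disco_surface" "p \<notin> disco_sing"
  then show "germ_at (htwist m) (hshear m) (hshear (- m)) p"
  proof (cases rule: disco_regular_cases)
    case (f z)
    then show ?thesis
      using germ_at_flip[OF htwist_commutes_flip linear_hshear linear_hshear germ_at_htwist_vcyl] by simp
  qed (simp_all add: germ_at_htwist_hcyl germ_at_htwist_vcyl)
qed

lemma totally_periodic_hshear:
  assumes "totally_periodic \<theta>" "\<theta> \<noteq> 0"
  shows "totally_periodic (hshear m \<theta>)"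
proof (rule disco_affine_totally_periodic[OF disco_affine_htwist _ _ _ assms(2) _ assms(1)])
  show "disco_affine (htwist (- m)) (hshear (- m)) (hshear m)" using disco_affine_htwist[of "- m"] by simp
  show "htwist m (htwist (- m) p) = p" "htwist (- m) (htwist m p) = p" if "p \<in> disco_surface" for p
    using that by (simp_all add: htwist_htwist htwist_0)
  \<comment> \<open>The squared norm of \<open>hshear m \<theta>\<close>. Shears preserve the area
    form, so the area spanned by \<theta> and \<open>hshear (- m) (\<i> * hshear m \<theta>)\<close>
    is that spanned by \<open>hshear m \<theta>\<close> and its quarter turn.\<close>
  have "0 < (Re \<theta> + 6 * of_int m * Im \<theta>)\<^sup>2 + (Im \<theta>)\<^sup>2"
    using assms(2) by (cases "Im \<theta> = 0") (auto simp: complex_eq_iff add_nonneg_pos)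
  also have "\<dots> = Im (hshear (- m) (\<i> * hshear m \<theta>)) * Re \<theta> - Re (hshear (- m) (\<i> * hshear m \<theta>)) * Im \<theta>"
    by (simp add: Re_hshear power2_eq_square algebra_simps)
  finally show "0 < Im (hshear (- m) (\<i> * hshear m \<theta>) / \<theta>)"
    using assms(2) by (auto simp: Im_divide sum_power2_gt_zero_iff complex_eq_iff intro!: divide_pos_pos)
qed

text \<open>The shift subtracted at \<open>x0\<close> is zero or a whole number of periods and makes
  the line \<open>Re u = x0\<close> fixed. The last two hypotheses keep the image inside the same
  rectangle, where \<open>vcyl\<close> and \<open>hcyl\<close> agree.\<close>

lemma vtwist_hcyl1:
  assumes "0 \<le> Re u" "Re u \<le> 1" "0 < Im u" "Im u < 1" "x0 = 0 \<or> x0 = 1"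
    and s: "0 < Im u + 3/2 * of_int m * (Re u - x0)" "Im u + 3/2 * of_int m * (Re u - x0) < 1"
  shows "vtwist m (hcyl u) = hcyl (vshear m u - \<i> * of_real (3/2 * of_int m * x0))"
proof -
  let ?v = "vshear m u - \<i> * of_real (3/2 * of_int m * x0)"
  have Im: "Im ?v = Im u + 3/2 * of_int m * (Re u - x0)" and Re: "Re ?v = Re u"
    by (simp_all add: Im_vshear field_simps)
  have "vtwist m (hcyl u) = vtwist m (vcyl u)" using assms by (simp add: hcyl_id vcyl_id)
  also have "\<dots> = vcyl (vshear m u)" unfolding vshear_def using assms by (intro vtwist_vcyl) auto
  also have "\<dots> = vcyl (?v + \<i> * of_real (3/2 * of_int m * x0))" by simp
  also have "\<dots> = vcyl ?v"
    using assms(5) vcyl_periodic[of ?v m]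
        by (elim disjE; simp only: mult_1_right mult_zero_right of_real_0 add_0_right)
  also have "\<dots> = disco_proj ?v" by (rule vcyl_id) (use s Im in linarith)+
  also have "\<dots> = hcyl ?v" by (rule hcyl_id[symmetric]) (use s Im Re assms in linarith)+
  finally show ?thesis .
qed

text \<open>In the second rectangle the line at \<open>x0\<close> has cylinder abscissa (x0 - 1)/2,
  again 0 or 1, and the common factor 1/2 in both coordinates does not change the slope of the
  shear.\<close>

lemma vtwist_hcyl2:
  assumes "1 \<le> Re u" "Re u \<le> 3" "0 < Im u" "Im u < 1" "x0 = 1 \<or> x0 = 3"
    and s: "0 < Im u + 3/2 * of_int m * (Re u - x0)" "Im u + 3/2 * of_int m * (Re u - x0) < 1"
  shows "vtwist m (hcyl u) = hcyl (vshear m u - \<i> * of_real (3/2 * of_int m * x0))"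
proof -
  let ?v = "vshear m u - \<i> * of_real (3/2 * of_int m * x0)"
  have Im: "Im ?v = Im u + 3/2 * of_int m * (Re u - x0)" and Re: "Re ?v = Re u"
    by (simp_all add: Im_vshear field_simps)
  define h where "h = (\<lambda>w. Complex ((Re w - 1) / 2) (Im w / 2 + 1))"
  have h: "vcyl (h w) = hcyl w" if "1 \<le> Re w" "Re w \<le> 3" "0 < Im w" "Im w < 1" for w
  proof -
    have "vcyl (h w) = disco_proj (Complex (1 + 2 * Re (h w)) (2 * Im (h w) - 2))"
      by (rule vcyl_id2) (use that in \<open>auto simp: h_def\<close>)
    also have "Complex (1 + 2 * Re (h w)) (2 * Im (h w) - 2) = w"
      by (simp add: complex_eq_iff h_def field_simps)
    also have "disco_proj w = hcyl w" by (rule hcyl_id[symmetric]) (use that in auto)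
    finally show ?thesis .
  qed
  have "vtwist m (hcyl u) = vtwist m (vcyl (h u))" using assms h[of u] by simp
  also have "\<dots> = vcyl (vshear m (h u))"
    unfolding vshear_def using assms by (intro vtwist_vcyl) (auto simp: h_def)
  also have "vshear m (h u) = h ?v + \<i> * of_real (3/2 * of_int m * ((x0 - 1) / 2))"
    by (simp add: complex_eq_iff h_def Im_vshear field_simps)
  also have "vcyl \<dots> = vcyl (h ?v)"
  proof (cases "x0 = 1")
    case False
    then have "(x0 - 1) / 2 = 1" using assms(5) by auto
    then show ?thesis using vcyl_periodic[of "h ?v" m] by (simp only: mult_1_right)
  qed simp
  also have "\<dots> = hcyl ?v" by (rule h) (use s Im Re assms in linarith)+
  finally show ?thesis .
qed

text \<open>The half turn takes the line at \<open>x0\<close> to the one at \<open>6 - x0\<close>,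
  so formulas for the left half of the rectangle yield those for the right half.\<close>

lemma vtwist_hcyl_flip:
  assumes u: "0 < Im u" "Im u < 1"
    and s: "0 < Im u + 3/2 * of_int m * (Re u - x0)" "Im u + 3/2 * of_int m * (Re u - x0) < 1"
    and eq: "vtwist m (hcyl (Complex 6 1 - u)) =
        hcyl (vshear m (Complex 6 1 - u) - \<i> * of_real (3/2 * of_int m * (6 - x0)))"
  shows "vtwist m (hcyl u) = hcyl (vshear m u - \<i> * of_real (3/2 * of_int m * x0))"
proof -
  have "Im (vshear m (Complex 6 1 - u) - \<i> * of_real (3/2 * of_int m * (6 - x0))) =
      1 - (Im u + 3/2 * of_int m * (Re u - x0))"
    by (simp add: Im_vshear field_simps)
  then have s': "0 \<le> Im (vshear m (Complex 6 1 - u) - \<i> * of_real (3/2 * of_int m * (6 - x0)))"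
    "Im (vshear m (Complex 6 1 - u) - \<i> * of_real (3/2 * of_int m * (6 - x0))) \<le> 1"
    using s by linarith+
  have "hcyl u = disco_flip (hcyl (Complex 6 1 - u))" using u by (simp add: disco_flip_hcyl)
  then have "vtwist m (hcyl u) = disco_flip (vtwist m (hcyl (Complex 6 1 - u)))"
    using vtwist_commutes_flip[of m "hcyl (Complex 6 1 - u)"] by simp
  also have "\<dots> = hcyl (Complex 6 1 - (vshear m (Complex 6 1 - u) - \<i> * of_real (3/2 * of_int m *
      (6 - x0))))"
    unfolding eq by (rule disco_flip_hcyl[OF s'])
  also have "Complex 6 1 - (vshear m (Complex 6 1 - u) - \<i> * of_real (3/2 * of_int m * (6 - x0)))
      = vshear m u - \<i> * of_real (3/2 * of_int m * x0)"
    by (simp add: complex_eq_iff Im_vshear field_simps)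
  finally show ?thesis .
qed

lemma germ_at_vtwist_vcyl:
  assumes "0 < Re z" "Re z < 1"
  shows "germ_at (vtwist m) (vshear m) (vshear (- m)) (vcyl z)"
  unfolding germ_at_def
proof (rule exI[of _ vcyl], rule exI[of _ z], intro conjI)
  show "locally_affine 1 (\<lambda>w. vtwist m (vcyl (vshear (- m) w))) (vshear m z)"
  proof (rule locally_affine_transfer[OF linear_vshear vshear_inverse])
    show "open {z. 0 < Re z \<and> Re z < 1}"
      by (intro open_Collect_conj open_Collect_less continuous_intros)
    show "z \<in> {z. 0 < Re z \<and> Re z < 1}" using assms by simp
    show "locally_affine 1 vcyl (vshear m z)" using assms by (intro locally_affine_vcyl) auto
    fix u assume "u \<in> {z. 0 < Re z \<and> Re z < 1}"
    then show "vtwist m (vcyl u) = vcyl (vshear m u)" by (simp only: vshear_def) (rule vtwist_vcyl, auto)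
  qed
qed (use assms locally_affine_vcyl in auto)

text \<open>The rectangles on the two sides of the line belong to the same cylinder at two scales if
  \<open>x0 = 1\<close>, and to a cylinder and its flip if \<open>x0 = 0\<close> or
  \<open>x0 = 3\<close>. All of them shear by the same slope relative to the fixed line, so the
  formulas match across it.\<close>

lemma germ_at_vtwist_side:
  assumes z: "0 < Im z" "Im z < 1" "Re z = x0" and x0: "x0 = 0 \<or> x0 = 1 \<or> x0 = 3"
  shows "germ_at (vtwist m) (vshear m) (vshear (- m)) (hcyl z)"
  unfolding germ_at_def
proof (rule exI[of _ hcyl], rule exI[of _ z], intro conjI)
  let ?d = "- (\<i> * of_real (3/2 * of_int m * x0))"
  let ?A = "{u. 0 < Im u \<and> Im u < 1 \<and> 0 < Im u + 3/2 * of_int m * (Re u - x0) \<and>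
     Im u + 3/2 * of_int m * (Re u - x0) < 1 \<and> x0 - 1 < Re u \<and> Re u < x0 + 1}"
  show "locally_affine 1 (\<lambda>w. vtwist m (hcyl (vshear (- m) w))) (vshear m z)"
  proof (rule locally_affine_transfer[OF linear_vshear vshear_inverse])
    show "open ?A"
      by (intro open_Collect_conj open_Collect_less continuous_intros)
    show "z \<in> ?A" using z by simp
    have "locally_affine 1 hcyl (1 * vshear m z + ?d)"
      by (rule locally_affine_hcyl) (use z in \<open>simp_all add: Im_vshear\<close>)
    from locally_affine_compose[OF this]
    show "locally_affine 1 (\<lambda>w. hcyl (w + ?d)) (vshear m z)" by simp
    fix u assume "u \<in> ?A"
    then have u: "0 < Im u" "Im u < 1" "0 < Im u + 3/2 * of_int m * (Re u - x0)"
       "Im u + 3/2 * of_int m * (Re u - x0) < 1" "x0 - 1 < Re u" "Re u < x0 + 1" by auto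
    have "Im (Complex 6 1 - u) = 1 - Im u" by simp
    have "3/2 * of_int m * (Re (Complex 6 1 - u) - (6 - x0)) = - (3/2 * of_int m * (Re u - x0))"
      by (simp add: field_simps)
    then have f: "0 < Im (Complex 6 1 - u)" "Im (Complex 6 1 - u) < 1"
      "0 < Im (Complex 6 1 - u) + 3/2 * of_int m * (Re (Complex 6 1 - u) - (6 - x0))"
      "Im (Complex 6 1 - u) + 3/2 * of_int m * (Re (Complex 6 1 - u) - (6 - x0)) < 1"
      using u \<open>Im (Complex 6 1 - u) = 1 - Im u\<close> by linarith+
    have "vtwist m (hcyl u) = hcyl (vshear m u - \<i> * of_real (3/2 * of_int m * x0))"
    proof (cases "Re u < x0")
      case True
      from x0 consider "x0 = 0" | "x0 = 1" | "x0 = 3" by blast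
      then show ?thesis
      proof cases
        case 1
        \<comment> \<open>One period later, points left of 0 lie left of 6, and the half turn takes
          those to points right of 0.\<close>
        let ?u = "u + of_real (6 * of_int 1)"
        have "vtwist m (hcyl ?u) = hcyl (vshear m ?u - \<i> * of_real (3/2 * of_int m * 6))"
        proof (rule vtwist_hcyl_flip)
          show "vtwist m (hcyl (Complex 6 1 - ?u)) =
              hcyl (vshear m (Complex 6 1 - ?u) - \<i> * of_real (3/2 * of_int m * (6 - 6)))"
            by (rule vtwist_hcyl1) (use True 1 u in \<open>auto simp: algebra_simps\<close>)
        qed (use 1 u in \<open>auto simp: algebra_simps\<close>)
        also have "vshear m ?u - \<i> * of_real (3/2 * of_int m * 6) =
            vshear m u - \<i> * of_real (3/2 * of_int m * x0) + of_real (6 * of_int 1)"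
          unfolding 1 by (simp add: complex_eq_iff Im_vshear algebra_simps)
        finally show ?thesis unfolding hcyl_periodic .
      next
        case 2
        then show ?thesis by (intro vtwist_hcyl1) (use True u in auto)
      next
        case 3
        then show ?thesis by (intro vtwist_hcyl2) (use True u in auto)
      qed
    next
      case False
      from x0 consider "x0 = 0" | "x0 = 1" | "x0 = 3" by blast
      then show ?thesis
      proof cases
        case 1
        then show ?thesis by (intro vtwist_hcyl1) (use False u in auto)
      next
        case 2
        then show ?thesis by (intro vtwist_hcyl2) (use False u in auto)
      next
        case 3
        show ?thesis
          by (rule vtwist_hcyl_flip[OF u(1-4)], rule vtwist_hcyl2) (use 3 False u f in auto)
      qed
    qed
    then show "vtwist m (hcyl u) = hcyl (vshear m u + ?d)" by simp
  qed
qed (use z locally_affine_hcyl in auto)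

lemma disco_affine_vtwist: "disco_affine (vtwist m) (vshear m) (vshear (- m))"
proof (rule disco_affineI[OF continuous_vtwist vtwist_sing linear_vshear linear_vshear vshear_inverse])
  fix p assume "p \<in> disco_surface" "p \<notin> disco_sing"
  then obtain z where z: "0 \<le> Re z" "Re z \<le> 1" "p = vcyl z \<or> p = disco_flip (vcyl z)" 
    using disco_surface_vcyl by metis
  note flip = germ_at_flip[of "vtwist m", OF vtwist_commutes_flip linear_vshear linear_vshear, of m "- m"]
  have "vcyl z \<in> disco_surface" "vcyl z \<notin> disco_sing"
    using z(3) \<open>p \<in> disco_surface\<close> \<open>p \<notin> disco_sing\<close> by (auto simp: disco_flip_surface_iff)
  have "germ_at (vtwist m) (vshear m) (vshear (- m)) (vcyl z)"
  proof (cases "0 < Re z \<and> Re z < 1")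
    case True
    then show ?thesis by (simp add: germ_at_vtwist_vcyl)
  next
    case False
    then have b: "Re z = 0 \<or> Re z = 1" using z by linarith
    obtain z' where z': "Re z' = Re z" "0 \<le> Im z'" "Im z' < 3/2" "vcyl z' = vcyl z" by (rule vcyl_reduce)
    have nsing: "vcyl z' \<noteq> disco_proj (Complex x y)" if "x \<in> {0,1,3,5,6}" "y \<in> {0,1}" for x y
    proof -
      have "Complex x y \<in> disco_rect" using that by (auto simp: mem_disco_rect)
      then have "disco_proj (Complex x y) \<in> disco_sing" using that by (simp add: disco_proj_in_sing_iff)
      then show ?thesis using \<open>vcyl z \<notin> disco_sing\<close> z'(4) by metis
    qed
    obtain w where w: "vcyl z' = hcyl w" "Re w = 0 \<or> Re w = 1 \<or> Re w = 3" "0 < Im w" "Im w < 1"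
    proof (cases "Im z' \<le> 1")
      case True
      then have "vcyl z' = disco_proj (Complex (Re z') (Im z'))" using vcyl_id[OF z'(2) True] by simp
      moreover have "Re z' \<in> {0, 1, 3, 5, 6}" using b z'(1) by auto
      ultimately have "Im z' \<notin> {0, 1}" using nsing[of "Re z'" "Im z'"] by blast
      then have "0 < Im z'" "Im z' < 1" using True z'(2) by auto
      moreover have "0 \<le> Re z'" "Re z' \<le> 6" using b z'(1) by auto
      then have "vcyl z' = hcyl z'" using vcyl_id[OF z'(2) True] hcyl_id[OF z'(2) True] by simp
      moreover have "Re z' = 0 \<or> Re z' = 1 \<or> Re z' = 3" using b z'(1) by auto
      ultimately show ?thesis using that[of z'] by blast
    next
      case False
      let ?w = "Complex (1 + 2 * Re z') (2 * Im z' - 2)"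
      have "vcyl z' = disco_proj ?w" by (rule vcyl_id2) (use False z' b in auto)
      also have "\<dots> = hcyl ?w" by (rule hcyl_id[symmetric]) (use False z' b in auto)
      finally have "vcyl z' = hcyl ?w" .
      moreover have "Re ?w = 0 \<or> Re ?w = 1 \<or> Re ?w = 3" using b z'(1) by auto
      moreover have "0 < Im ?w" "Im ?w < 1" using False z'(3) by auto
      ultimately show ?thesis using that[of ?w] by blast
    qed
    then show ?thesis using germ_at_vtwist_side[OF w(3,4) refl w(2), of m] z'(4) by simp
  qed
  then show "germ_at (vtwist m) (vshear m) (vshear (- m)) p" using z(3) flip by auto
qed

lemma totally_periodic_vshear:
  assumes "totally_periodic \<theta>" "\<theta> \<noteq> 0"
  shows "totally_periodic (vshear m \<theta>)"
proof (rule disco_affine_totally_periodic[OF disco_affine_vtwist _ _ _ assms(2) _ assms(1)])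
  show "disco_affine (vtwist (- m)) (vshear (- m)) (vshear m)" using disco_affine_vtwist[of "- m"] by simp
  show "vtwist m (vtwist (- m) p) = p" "vtwist (- m) (vtwist m p) = p" if "p \<in> disco_surface" for p
    using that by (simp_all add: vtwist_vtwist vtwist_0)
  have "0 < (Re \<theta>)\<^sup>2 + (Im \<theta> + 3/2 * of_int m * Re \<theta>)\<^sup>2"
    using assms(2) by (cases "Re \<theta> = 0") (auto simp: complex_eq_iff add_pos_nonneg)
  also have "\<dots> = Im (vshear (- m) (\<i> * vshear m \<theta>)) * Re \<theta> - Re (vshear (- m) (\<i> * vshear m \<theta>)) * Im \<theta>"
    by (simp add: Im_vshear power2_eq_square algebra_simps)
  finally show "0 < Im (vshear (- m) (\<i> * vshear m \<theta>) / \<theta>)"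
    using assms(2) by (auto simp: Im_divide sum_power2_gt_zero_iff complex_eq_iff intro!: divide_pos_pos)
qed

section \<open>The horizontal and vertical directions are totally periodic\<close>

text \<open>A saddle connection through an interior point of the cylinder would stay on a core
  curve, which consists of regular points.\<close>

lemma cylinder_saddle_graph_disjoint:
  assumes l: "l > 0"
    and per: "\<And>z w. 0 < Im z \<Longrightarrow> Im z < h \<Longrightarrow> 0 < Im w \<Longrightarrow> Im w < h \<Longrightarrow>
       \<Psi> z = \<Psi> w \<longleftrightarrow> (\<exists>n::int. w - z = of_int n * of_real l)"
    and la: "\<And>z. 0 < Im z \<Longrightarrow> Im z < h \<Longrightarrow> locally_affine \<theta> \<Psi> z"
    and \<theta>: "\<theta> \<noteq> 0" and z: "0 < Im z" "Im z < h"
  shows "\<Psi> z \<notin> saddle_graph \<theta>"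
proof
  assume "\<Psi> z \<in> saddle_graph \<theta>"
  moreover have "\<Psi> z \<notin> disco_sing" using locally_affine_regular[OF la[OF z]] by blast
  ultimately obtain g t where g: "straight_path \<theta> g" "g 0 \<in> disco_sing" "t \<in> {0..1}" "g t = \<Psi> z"
    unfolding saddle_graph_def saddle_connections_def by auto
  have "0 \<in> {0..1::real}" by simp
  from cylinder_loop[OF l z per la \<theta> g(1,3,4) this]
  obtain s :: real where s: "g 0 = \<Psi> (z + of_real s * of_real l)" by blast
  have "\<Psi> (z + of_real s * of_real l) \<notin> disco_sing"
    using locally_affine_regular[OF la, of "z + of_real s * of_real l"] z by simp
  with s g(2) show False by simp
qed

lemma continuous_map_into_strip:
  assumes "continuous_map (top_of_set S) disco_top f" "continuous_on T k" "k ` T \<subseteq> S"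
  shows "continuous_map (top_of_set T) disco_top (\<lambda>x. f (k x))"
proof -
  have "continuous_map (top_of_set T) (top_of_set S) k" using assms(2,3) by (auto simp: image_subset_iff)
  from continuous_map_compose[OF this assms(1)] show ?thesis by (simp add: o_def)
qed

text \<open>Horizontal sides form the boundary of the strip of \<open>hcyl\<close>, but inside a
  vertical cylinder \<open>vcyl\<close> is locally affine along them; only their ends are
  corners.\<close>

lemma horizontal_saddle_vcyl:
  assumes y: "y = 0 \<or> y = 1" and x: "0 \<le> x" "x \<le> 1"
  shows "vcyl (Complex x y) \<in> saddle_graph 1" "disco_flip (vcyl (Complex x y)) \<in> saddle_graph 1"
proof -
  have sing: "vcyl (Complex 0 y) \<in> disco_sing" "vcyl (Complex 1 y) \<in> disco_sing"
    using y by (auto simp: vcyl_id disco_proj_in_sing_iff mem_disco_rect)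
  let ?g = "\<lambda>t::real. vcyl (Complex 0 y + of_real t * 1)"
  have g: "straight_path 1 ?g"
  proof (rule segment_straight_path[of 1 vcyl "Complex 0 y" 1 1 1])
    show "continuous_map (top_of_set {0..1::real}) disco_top ?g"
      by (rule continuous_map_into_strip[OF continuous_vcyl]) (auto intro!: continuous_intros)
  qed (auto intro: locally_affine_vcyl)
  have gt: "?g t = vcyl (Complex t y)" for t
    by (rule arg_cong[of _ _ vcyl]) (simp add: complex_eq_iff)
  have "?g 0 \<in> disco_sing" "?g 1 \<in> disco_sing" unfolding gt using sing by simp_all
  then have "?g ` {0..1} \<in> saddle_connections 1" unfolding saddle_connections_def using g by blast
  moreover have "vcyl (Complex x y) \<in> ?g ` {0..1}"
    using x by (intro image_eqI[of _ _ x] gt[symmetric]) auto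
  ultimately show "vcyl (Complex x y) \<in> saddle_graph 1" unfolding saddle_graph_def by blast
  \<comment> \<open>The half turn reverses directions; running backwards from 1 in the unflipped
    cylinder restores direction 1.\<close>
  let ?k = "\<lambda>t::real. disco_flip (vcyl (1 - (Complex 0 (- y) + of_real t * 1)))"
  have k: "straight_path 1 ?k"
  proof (rule segment_straight_path[of 1 "\<lambda>u. disco_flip (vcyl (1 - u))" "Complex 0 (- y)" 1 1 1])
    show "continuous_map (top_of_set {0..1::real}) disco_top ?k"
    proof -
      have "continuous_map (top_of_set {0..1::real}) disco_top (\<lambda>t.
          vcyl (1 - (Complex 0 (- y) + of_real t * 1)))"
        by (rule continuous_map_into_strip[OF continuous_vcyl]) (auto intro!: continuous_intros)
      from continuous_map_compose[OF this continuous_disco_flip] show ?thesis by (simp only: o_def)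
    qed
    fix t :: real assume "0 < t" "t < 1"
    then show "locally_affine 1 (\<lambda>u. disco_flip (vcyl (1 - u))) (Complex 0 (- y) + of_real t * 1)"
      by (intro disco_model_locally_affine[OF disco_model_flip[OF disco_model_vcyl]]) simp
  qed auto
  have kt: "?k t = disco_flip (vcyl (Complex (1 - t) y))" for t
    by (rule arg_cong[of _ _ "\<lambda>u. disco_flip (vcyl u)"]) (simp add: complex_eq_iff)
  have "?k 0 \<in> disco_sing" "?k 1 \<in> disco_sing" unfolding kt using sing by simp_all
  then have "?k ` {0..1} \<in> saddle_connections 1" unfolding saddle_connections_def using k by blast
  moreover have "disco_flip (vcyl (Complex x y)) \<in> ?k ` {0..1}"
    using x kt[of "1 - x"] by (intro image_eqI[of _ _ "1 - x"]) auto
  ultimately show "disco_flip (vcyl (Complex x y)) \<in> saddle_graph 1" unfolding saddle_graph_def by blast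
qed

text \<open>Up to the half turn, a point off the open horizontal cylinder has height 0 or 1 modulo
  3/2 in vertical coordinates, so it lies on one of the seams.\<close>

lemma hcyl_complement_saddle:
  assumes p: "p \<in> disco_surface" "\<And>z. 0 < Im z \<Longrightarrow> Im z < 1 \<Longrightarrow> p \<noteq> hcyl z"
  shows "p \<in> saddle_graph 1"
proof -
  obtain z0 where z0: "0 \<le> Re z0" "Re z0 \<le> 1" "p = vcyl z0 \<or> p = disco_flip (vcyl z0)"
    using p(1) by (rule disco_surface_vcyl)
  obtain z where z: "Re z = Re z0" "0 \<le> Im z" "Im z < 3/2" "vcyl z = vcyl z0" by (rule vcyl_reduce)
  have no: "vcyl z \<noteq> hcyl w" if w: "0 < Im w" "Im w < 1" for w
  proof
    assume eq: "vcyl z = hcyl w"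
    have "disco_flip (hcyl w) = hcyl (Complex 6 1 - w)" using w by (intro disco_flip_hcyl) auto
    with z0(3) z(4) eq have "p = hcyl w \<or> p = hcyl (Complex 6 1 - w)" by metis
    moreover have "0 < Im (Complex 6 1 - w)" "Im (Complex 6 1 - w) < 1" using w by auto
    ultimately show False using p(2) w by blast
  qed
  have "Im z = 0 \<or> Im z = 1"
  proof (rule ccontr)
    assume "\<not> (Im z = 0 \<or> Im z = 1)"
    then consider "0 < Im z" "Im z < 1" | "1 < Im z" using z by linarith
    then show False
    proof cases
      case 1
      then have "vcyl z = hcyl z" using z z0 by (simp add: vcyl_id hcyl_id)
      then show False using no 1 by blast
    next
      case 2
      let ?w = "Complex (1 + 2 * Re z) (2 * Im z - 2)"
      have "vcyl z = disco_proj ?w" using 2 z z0 by (intro vcyl_id2) auto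
      also have "\<dots> = hcyl ?w" using 2 z z0 by (intro hcyl_id[symmetric]) auto
      finally have "vcyl z = hcyl ?w" .
      moreover have "0 < Im ?w" "Im ?w < 1" using 2 z by auto
      ultimately show False using no by blast
    qed
  qed
  moreover have "0 \<le> Re z" "Re z \<le> 1" using z z0 by auto
  ultimately have "vcyl (Complex (Re z) (Im z)) \<in> saddle_graph 1"
      "disco_flip (vcyl (Complex (Re z) (Im z))) \<in> saddle_graph 1"
    by (rule horizontal_saddle_vcyl)+
  then have "vcyl z \<in> saddle_graph 1" "disco_flip (vcyl z) \<in> saddle_graph 1" by simp_all
  then show ?thesis using z0(3) z(4) by metis
qed

lemma totally_periodic_horizontal: "totally_periodic 1"
proof -
  let ?C = "hcyl ` {z. 0 < Im z \<and> Im z < 1}"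
  have per: "hcyl z = hcyl w \<longleftrightarrow> (\<exists>n::int. w - z = of_int n * of_real 6)"
    if "0 < Im z" "Im z < 1" "0 < Im w" "Im w < 1" for z w
  proof -
    have "hcyl z = hcyl w \<longleftrightarrow> (\<exists>k::int. w = z + of_real (6 * of_int k))"
      using hcyl_eq_iff[of w z] that by auto
    also have "\<dots> \<longleftrightarrow> (\<exists>n::int. w - z = of_int n * of_real 6)"
      by (intro ex_cong1) (auto simp: algebra_simps)
    finally show ?thesis .
  qed
  have six: "(6::real) > 0" by simp
  have "p \<in> ?C \<longleftrightarrow> p \<notin> saddle_graph 1" if "p \<in> disco_surface" for p
  proof
    assume "p \<in> ?C"
    then obtain z where "p = hcyl z" "0 < Im z" "Im z < 1" by auto
    then show "p \<notin> saddle_graph 1"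
      using cylinder_saddle_graph_disjoint[OF six per locally_affine_hcyl one_neq_zero] by blast
  next
    assume "p \<notin> saddle_graph 1"
    then show "p \<in> ?C" using hcyl_complement_saddle[OF that] by blast
  qed
  moreover have "?C \<subseteq> disco_surface" using hcyl_regular by blast
  ultimately have C: "?C = disco_surface - saddle_graph 1" by blast
  have "flat_cylinder 1 ?C"
  proof (rule flat_cylinderI[OF six zero_less_one continuous_hcyl refl _ per locally_affine_hcyl])
    have "hcyl z \<in> saddle_graph 1" if "Im z = 0 \<or> Im z = 1" for z
    proof (rule hcyl_complement_saddle)
      show "hcyl z \<in> disco_surface"
        using continuous_map_image_subset_topspace[OF continuous_hcyl] that by auto
      show "hcyl z \<noteq> hcyl w" if "0 < Im w" "Im w < 1" for w
        by (rule hcyl_boundary) fact+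
    qed
    then show "hcyl ` {z. Im z = 0 \<or> Im z = 1} \<subseteq> saddle_graph 1" by blast
  qed
  then show ?thesis
    using C by (intro totally_periodicI[of 1 "{?C}"]) (auto simp: pairwise_def)
qed

text \<open>Vertical sides in turn are interior to the horizontal strip, where \<open>hcyl\<close>
  is locally affine along them.\<close>

lemma vertical_saddle_hcyl:
  assumes x: "x \<in> {0, 1, 3, 5, 6}" and y: "0 \<le> y" "y \<le> 1"
  shows "hcyl (Complex x y) \<in> saddle_graph \<i>"
proof -
  let ?g = "\<lambda>t::real. hcyl (Complex x 0 + of_real t * \<i>)"
  have g: "straight_path \<i> ?g"
  proof (rule segment_straight_path[of 1 hcyl "Complex x 0" \<i> 1 \<i>])
    show "continuous_map (top_of_set {0..1::real}) disco_top ?g"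
      by (rule continuous_map_into_strip[OF continuous_hcyl]) (auto intro!: continuous_intros)
  qed (auto intro: locally_affine_hcyl)
  have gt: "?g t = hcyl (Complex x t)" for t
    by (rule arg_cong[of _ _ hcyl]) (simp add: complex_eq_iff)
  have "?g 0 \<in> disco_sing" "?g 1 \<in> disco_sing" unfolding gt
    using x by (auto simp: hcyl_id disco_proj_in_sing_iff mem_disco_rect)
  then have "?g ` {0..1} \<in> saddle_connections \<i>" unfolding saddle_connections_def using g by blast
  moreover have "hcyl (Complex x y) \<in> ?g ` {0..1}"
    using y by (intro image_eqI[of _ _ y] gt[symmetric]) auto
  ultimately show ?thesis unfolding saddle_graph_def by blast
qed

lemma vertical_saddle_vcyl:
  assumes "Re z = 0 \<or> Re z = 1"
  shows "vcyl z \<in> saddle_graph \<i>" "disco_flip (vcyl z) \<in> saddle_graph \<i>"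
proof -
  obtain z' where z': "Re z' = Re z" "0 \<le> Im z'" "Im z' < 3/2" "vcyl z' = vcyl z" by (rule vcyl_reduce)
  obtain x y where xy: "vcyl z' = hcyl (Complex x y)" "x \<in> {0, 1, 3}" "0 \<le> y" "y \<le> 1"
  proof (cases "Im z' \<le> 1")
    case True
    have "0 \<le> Re z'" "Re z' \<le> 6" "Re z' \<in> {0, 1, 3}" using z'(1) assms by auto
    then show ?thesis
      using that[of "Re z'" "Im z'"] vcyl_id[OF z'(2) True] hcyl_id[OF z'(2) True] z'(2) True by simp
  next
    case False
    let ?w = "Complex (1 + 2 * Re z') (2 * Im z' - 2)"
    have "vcyl z' = disco_proj ?w" by (rule vcyl_id2) (use False z' assms in auto)
    also have "\<dots> = hcyl ?w" by (rule hcyl_id[symmetric]) (use False z' assms in auto)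
    finally have "vcyl z' = hcyl ?w" .
    moreover have "1 + 2 * Re z' \<in> {0, 1, 3}" using z'(1) assms by auto
    ultimately show ?thesis using that False z'(3) by simp
  qed
  have "vcyl z = hcyl (Complex x y)" using z' xy by simp
  moreover have "hcyl (Complex x y) \<in> saddle_graph \<i>" using xy by (intro vertical_saddle_hcyl) auto
  moreover have "disco_flip (hcyl (Complex x y)) = hcyl (Complex (6 - x) (1 - y))"
    using disco_flip_hcyl[of "Complex x y"] xy by (simp add: complex_diff)
  moreover have "hcyl (Complex (6 - x) (1 - y)) \<in> saddle_graph \<i>" using xy
      by (intro vertical_saddle_hcyl) auto
  ultimately show "vcyl z \<in> saddle_graph \<i>" "disco_flip (vcyl z) \<in> saddle_graph \<i>" by simp_all
qed

lemma totally_periodic_vertical: "totally_periodic \<i>"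
proof -
  let ?S = "{z. 0 < Im z \<and> Im z < 1}"
  \<comment> \<open>Multiplication by i gives core curves in direction i, and adding 1 moves the
    strip of heights between 0 and 1 to that of abscissas between 0 and 1. In \<open>?Q\<close> the
    reflection compensates the reversal of directions by the half turn.\<close>
  let ?P = "\<lambda>w. vcyl (\<i> * w + 1)" and ?Q = "\<lambda>w. disco_flip (vcyl (1 - (\<i> * w + 1)))"
  let ?c = "{z. 0 \<le> Im z \<and> Im z \<le> 1}"
  have l: "(3/2::real) > 0" by simp
  have perP: "?P z = ?P w \<longleftrightarrow> (\<exists>n::int. w - z = of_int n * of_real (3/2))"
    if "0 < Im z" "Im z < 1" "0 < Im w" "Im w < 1" for z w
  proof -
    have "?P w = ?P z \<longleftrightarrow> (\<exists>k::int. \<i> * w + 1 = \<i> * z + 1 + \<i> * of_real (3/2 * of_int k))"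
      by (rule vcyl_eq_iff) (use that in auto)
    also have "\<dots> \<longleftrightarrow> (\<exists>n::int. w - z = of_int n * of_real (3/2))"
      by (intro ex_cong1) (auto simp: complex_eq_iff)
    finally show ?thesis by metis
  qed
  have perQ: "?Q z = ?Q w \<longleftrightarrow> (\<exists>n::int. w - z = of_int n * of_real (3/2))"
    if "0 < Im z" "Im z < 1" "0 < Im w" "Im w < 1" for z w
  proof -
    have "?Q z = ?Q w \<longleftrightarrow> vcyl (1 - (\<i> * z + 1)) = vcyl (1 - (\<i> * w + 1))"
      by (metis disco_flip_flip)
    also have "\<dots> \<longleftrightarrow> (\<exists>k::int. 1 - (\<i> * z + 1) = 1 - (\<i> * w + 1) + \<i> * of_real (3/2 * of_int k))"
      by (rule vcyl_eq_iff) (use that in auto)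
    also have "\<dots> \<longleftrightarrow> (\<exists>n::int. w - z = of_int n * of_real (3/2))"
      by (intro ex_cong1) (auto simp: complex_eq_iff)
    finally show ?thesis .
  qed
  have laP: "locally_affine \<i> ?P z" if "0 < Im z" "Im z < 1" for z
  proof -
    have "locally_affine 1 vcyl (\<i> * z + 1)" by (rule locally_affine_vcyl) (use that in auto)
    from locally_affine_compose[OF this] show ?thesis by simp
  qed
  have laQ: "locally_affine \<i> ?Q z" if "0 < Im z" "Im z < 1" for z
  proof -
    have "locally_affine 1 (\<lambda>u. disco_flip (vcyl (1 - u))) (\<i> * z + 1)"
      by (rule disco_model_locally_affine[OF disco_model_flip[OF disco_model_vcyl]]) (use that in simp)
    from locally_affine_compose[OF this] show ?thesis by simp
  qed
  have ctP: "continuous_map (top_of_set ?c) disco_top ?P"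
    by (rule continuous_map_into_strip[OF continuous_vcyl]) (auto intro!: continuous_intros)
  have "continuous_map (top_of_set ?c) disco_top (\<lambda>w. vcyl (1 - (\<i> * w + 1)))"
    by (rule continuous_map_into_strip[OF continuous_vcyl]) (auto intro!: continuous_intros)
  from continuous_map_compose[OF this continuous_disco_flip]
  have ctQ: "continuous_map (top_of_set ?c) disco_top ?Q" by (simp only: o_def)
  have bdP: "?P ` {z. Im z = 0 \<or> Im z = 1} \<subseteq> saddle_graph \<i>"
    by (auto intro!: vertical_saddle_vcyl(1))
  have bdQ: "?Q ` {z. Im z = 0 \<or> Im z = 1} \<subseteq> saddle_graph \<i>"
    by (auto intro!: vertical_saddle_vcyl(2))
  have C: "flat_cylinder \<i> (?P ` ?S)"
    by (rule flat_cylinderI[OF l zero_less_one ctP refl bdP perP laP])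
  have D: "flat_cylinder \<i> (?Q ` ?S)"
    by (rule flat_cylinderI[OF l zero_less_one ctQ refl bdQ perQ laQ])
  have nP: "?P z \<notin> saddle_graph \<i>" if "0 < Im z" "Im z < 1" for z
    by (rule cylinder_saddle_graph_disjoint[of "3/2" 1 ?P]) (use l perP laP that in auto)
  have nQ: "?Q z \<notin> saddle_graph \<i>" if "0 < Im z" "Im z < 1" for z
    by (rule cylinder_saddle_graph_disjoint[of "3/2" 1 ?Q]) (use l perQ laQ that in auto)
  have surf: "?P ` ?S \<subseteq> disco_surface" "?Q ` ?S \<subseteq> disco_surface"
    using locally_affine_regular[OF laP] locally_affine_regular[OF laQ] by blast+
  have cov: "p \<in> ?P ` ?S \<union> ?Q ` ?S" if p: "p \<in> disco_surface" "p \<notin> saddle_graph \<i>" for p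
  proof -
    obtain z where z: "0 \<le> Re z" "Re z \<le> 1" "p = vcyl z \<or> p = disco_flip (vcyl z)"
      using p(1) by (rule disco_surface_vcyl)
    have "Re z \<noteq> 0" "Re z \<noteq> 1" using vertical_saddle_vcyl[of z] z(3) p(2) by auto
    then have z': "0 < Re z" "Re z < 1" using z by auto
    let ?w = "- (\<i> * (z - 1))" and ?w' = "\<i> * z"
    have "vcyl z = ?P ?w" by (rule arg_cong[of _ _ vcyl]) (simp add: complex_eq_iff)
    moreover have "?w \<in> ?S" using z' by simp
    moreover have "disco_flip (vcyl z) = ?Q ?w'"
      by (rule arg_cong[of _ _ "\<lambda>u. disco_flip (vcyl u)"]) (simp add: complex_eq_iff)
    moreover have "?w' \<in> ?S" using z' by simp
    ultimately show ?thesis using z(3) by blast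
  qed
  have "\<Union>{?P ` ?S, ?Q ` ?S} = disco_surface - saddle_graph \<i>"
    using cov surf nP nQ by auto
  moreover have "disjoint {?P ` ?S, ?Q ` ?S}"
  proof -
    have "?P ` ?S \<inter> ?Q ` ?S = {}"
    proof (rule ccontr)
      assume "?P ` ?S \<inter> ?Q ` ?S \<noteq> {}"
      then obtain p where p: "p \<in> ?P ` ?S" "p \<in> ?Q ` ?S" by blast
      from p(1) obtain z where z: "z \<in> ?S" "p = ?P z" by (rule imageE)
      from p(2) obtain w where w: "w \<in> ?S" "p = ?Q w" by (rule imageE)
      have "?Q w = ?P z" using z(2) w(2) by simp
      then show False using vcyl_flip_disjoint[of "1 - (\<i> * w + 1)" "\<i> * z + 1"] z(1) w(1) by simp
    qed
    then show ?thesis by (auto simp: pairwise_def disjnt_def)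
  qed
  ultimately show ?thesis using C D by (intro totally_periodicI[of \<i> "{?P ` ?S, ?Q ` ?S}"]) auto
qed

section \<open>Developing an attracting leaf\<close>

text \<open>\<open>\<Delta>\<close> extends \<open>\<psi>0\<close> along the segment from \<open>0\<close> to \<open>l * \<theta>\<close>, which it sends to the path \<open>g\<close> up to time \<open>t\<close>.\<close>

definition developed :: "complex \<Rightarrow> (complex \<Rightarrow> complex set) \<Rightarrow> (real \<Rightarrow> complex set) \<Rightarrow> real \<Rightarrow>
    (complex \<Rightarrow> complex set) \<Rightarrow> real \<Rightarrow> bool" where
  "developed \<theta> \<psi>0 g t \<Delta> l \<longleftrightarrow> 0 \<le> l \<and> (l = 0 \<longleftrightarrow> t = 0) \<and>
     (\<forall>x\<in>{0..l}. locally_affine 1 \<Delta> (of_real x * \<theta>)) \<and>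
     (\<exists>e>0. \<forall>u\<in>ball 0 e. \<Delta> u = \<psi>0 u) \<and> \<Delta> (of_real l * \<theta>) = g t \<and>
     (\<forall>x\<in>{0<..<l}. \<exists>s\<in>{0<..<t}. \<Delta> (of_real x * \<theta>) = g s)"

text \<open>Beyond the line \<open>Re (w / \<theta>) = l\<close> the map becomes the inverse chart,
  precomposed with the affine map by which \<Delta> reads in this chart. The two agree on a ball
  around the old end point, so no seam arises. The segment must lie in the chart image for the
  inverse to be usable along it.\<close>

lemma developed_extend:
  assumes \<theta>: "\<theta> \<noteq> 0" and ch: "disco_chart U \<phi>" and dev: "developed \<theta> \<psi>0 g a \<Delta> l" and ab: "0 \<le> a" "a < b"
    and U: "\<And>s. s \<in> {a..b} \<Longrightarrow> g s \<in> U" and ct: "continuous_on {a..b} (\<lambda>s. \<phi> (g s))"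
    and mono: "\<And>s. a < s \<Longrightarrow> s \<le> b \<Longrightarrow> \<exists>r>0. \<phi> (g s) - \<phi> (g a) = of_real r * \<theta>"
    and seg: "closed_segment (\<phi> (g a)) (\<phi> (g b)) \<subseteq> \<phi> ` U"
  shows "\<exists>\<Delta>' l'. developed \<theta> \<psi>0 g b \<Delta>' l'"
proof -
  have l: "0 \<le> l" "l = 0 \<longleftrightarrow> a = 0" and la: "\<And>x. x \<in> {0..l} \<Longrightarrow> locally_affine 1 \<Delta> (of_real x * \<theta>)"
    and germ: "\<exists>e>0. \<forall>u\<in>ball 0 e. \<Delta> u = \<psi>0 u" and end_a: "\<Delta> (of_real l * \<theta>) = g a"
    and inter: "\<And>x. x \<in> {0<..<l} \<Longrightarrow> \<exists>s\<in>{0<..<a}. \<Delta> (of_real x * \<theta>) = g s"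
    using dev unfolding developed_def by blast+
  have "\<Delta> (of_real l * \<theta>) \<in> U" using end_a U ab by simp
  from locally_affine_chart[OF ch la this] l(1)
  obtain \<alpha> \<beta> e where \<alpha>: "\<alpha> > 0" "e > 0"
    and w: "\<And>w. w \<in> ball (of_real l * \<theta>) e \<Longrightarrow> \<Delta> w \<in> U \<and> \<phi> (\<Delta> w) = of_real \<alpha> * w + \<beta>"
    by auto
  obtain r where r: "r > 0" "\<phi> (g b) - \<phi> (g a) = of_real r * \<theta>" using mono[of b] ab by auto
  have \<phi>a: "\<phi> (g a) = of_real \<alpha> * (of_real l * \<theta>) + \<beta>"
    using w[of "of_real l * \<theta>"] \<alpha> end_a by simp
  define \<psi> where "\<psi> = inv_into U \<phi>"
  have \<psi>\<phi>: "\<psi> (\<phi> q) = q" if "q \<in> U" for q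
    using disco_chart_inj[OF ch] that by (simp add: \<psi>_def inv_into_f_f)
  define \<Delta>' where "\<Delta>' = (\<lambda>w. if Re (w / \<theta>) < l then \<Delta> w else \<psi> (of_real \<alpha> * w + \<beta>))"
  \<comment> \<open>A displacement \<open>r * \<theta>\<close> in the chart amounts to r/\<alpha> in
    developed coordinates.\<close>
  define l' where "l' = l + r / \<alpha>"
  have l': "l' > l" using r \<alpha> by (simp add: l'_def)
  have near: "\<Delta>' w = \<Delta> w" if "w \<in> ball (of_real l * \<theta>) e" for w
    using w[OF that] \<psi>\<phi>[of "\<Delta> w"] by (simp add: \<Delta>'_def)
  have past: "of_real \<alpha> * (of_real x * \<theta>) + \<beta> = \<phi> (g a) + of_real (\<alpha> * (x - l)) * \<theta>" for x
    unfolding \<phi>a by (simp add: algebra_simps)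
  have open_half: "open {w. Re (w / \<theta>) < l}"
    by (intro open_Collect_less continuous_intros) (use \<theta> in auto)
  have "developed \<theta> \<psi>0 g b \<Delta>' l'"
    unfolding developed_def
  proof (intro conjI ballI)
    show "0 \<le> l'" "l' = 0 \<longleftrightarrow> b = 0" using l l' ab by auto
    show "\<exists>e>0. \<forall>u\<in>ball 0 e. \<Delta>' u = \<psi>0 u"
    proof -
      obtain e0 where e0: "e0 > 0" "\<And>u. u \<in> ball 0 e0 \<Longrightarrow> \<Delta> u = \<psi>0 u" using germ by blast
      have "\<exists>e1>0. \<forall>u\<in>ball 0 e1. \<Delta>' u = \<Delta> u"
      proof (cases "l = 0")
        case True
        then show ?thesis using near \<alpha>(2) by auto
      next
        case False
        then have "0 \<in> {w. Re (w / \<theta>) < l}" using l by simp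
        then obtain e1 where "e1 > 0" "ball 0 e1 \<subseteq> {w. Re (w / \<theta>) < l}"
          using open_half open_contains_ball by blast
        then show ?thesis unfolding \<Delta>'_def by (intro exI[of _ e1]) auto
      qed
      then obtain e1 where "e1 > 0" "\<And>u. u \<in> ball 0 e1 \<Longrightarrow> \<Delta>' u = \<Delta> u" by blast
      then show ?thesis using e0 by (intro exI[of _ "min e0 e1"]) auto
    qed
    have "of_real \<alpha> * (of_real l' * \<theta>) + \<beta> = \<phi> (g b)"
      unfolding past using r \<alpha> by (simp add: l'_def algebra_simps)
    moreover have "\<not> Re (of_real l' * \<theta> / \<theta>) < l" using \<theta> l' by simp
    ultimately show "\<Delta>' (of_real l' * \<theta>) = g b" using \<psi>\<phi>[of "g b"] U ab by (simp add: \<Delta>'_def)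
  next
    fix x assume x: "x \<in> {0..l'}"
    have Rex: "Re (of_real x * \<theta> / \<theta>) = x" using \<theta> by simp
    consider "x < l" | "x = l" | "l < x" by linarith
    then show "locally_affine 1 \<Delta>' (of_real x * \<theta>)"
    proof cases
      case 1
      then have "of_real x * \<theta> \<in> {w. Re (w / \<theta>) < l}" using Rex by simp
      then obtain e1 where e1: "e1 > 0" "ball (of_real x * \<theta>) e1 \<subseteq> {w. Re (w / \<theta>) < l}"
        using open_half open_contains_ball by blast
      show ?thesis
        by (rule locally_affine_cong[OF la e1(1)]) (use 1 x e1(2) in \<open>auto simp: \<Delta>'_def\<close>)
    next
      case 2
      show ?thesis
        unfolding 2 by (rule locally_affine_cong[OF la \<alpha>(2) near]) (use l in auto)
    next
      case 3
      have "open {w. l < Re (w / \<theta>)}"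
        by (intro open_Collect_less continuous_intros) (use \<theta> in auto)
      moreover have "of_real x * \<theta> \<in> {w. l < Re (w / \<theta>)}" using Rex 3 by simp
      ultimately obtain e1 where e1: "e1 > 0" "ball (of_real x * \<theta>) e1 \<subseteq> {w. l < Re (w / \<theta>)}"
        using open_contains_ball by blast
      have "\<alpha> * (x - l) \<le> r" using x \<alpha> by (simp add: l'_def field_simps)
      define \<kappa> where "\<kappa> = \<alpha> * (x - l) / r"
      have "0 \<le> \<kappa>" "\<kappa> \<le> 1" using \<open>\<alpha> * (x - l) \<le> r\<close> r(1) 3 \<alpha> by (simp_all add: \<kappa>_def)
      moreover have "of_real (\<alpha> * (x - l)) * \<theta> = of_real \<kappa> * (\<phi> (g b) - \<phi> (g a))"
        using r by (simp add: \<kappa>_def)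
      then have "\<phi> (g a) + of_real (\<alpha> * (x - l)) * \<theta> = (1 - \<kappa>) *\<^sub>R \<phi> (g a) + \<kappa> *\<^sub>R \<phi> (g b)"
        by (simp only: scaleR_conv_of_real of_real_diff of_real_1) (simp add: algebra_simps)
      ultimately have "of_real \<alpha> * (of_real x * \<theta>) + \<beta> \<in> closed_segment (\<phi> (g a)) (\<phi> (g b))"
        unfolding past in_segment by blast
      then obtain q where q: "q \<in> U" "of_real \<alpha> * (of_real x * \<theta>) + \<beta> = \<phi> q" using seg by blast
      have "locally_affine 1 \<psi> (of_real \<alpha> * (of_real x * \<theta>) + \<beta>)"
        unfolding q(2) \<psi>_def by (rule locally_affine_inverse_chart[OF ch q(1)])
      from locally_affine_scale[OF locally_affine_compose[OF this] \<alpha>(1)]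
      have "locally_affine 1 (\<lambda>w. \<psi> (of_real \<alpha> * w + \<beta>)) (of_real x * \<theta>)" by simp
      then show ?thesis
        by (rule locally_affine_cong[OF _ e1(1)]) (use e1(2) in \<open>auto simp: \<Delta>'_def\<close>)
    qed
  next
    fix x assume x: "x \<in> {0<..<l'}"
    have Rex: "Re (of_real x * \<theta> / \<theta>) = x" using \<theta> by simp
    consider "x < l" | "x = l" | "l < x" by linarith
    then show "\<exists>s\<in>{0<..<b}. \<Delta>' (of_real x * \<theta>) = g s"
    proof cases
      case 1
      then obtain s where "s \<in> {0<..<a}" "\<Delta> (of_real x * \<theta>) = g s" using inter[of x] x by auto
      then show ?thesis using 1 Rex ab unfolding \<Delta>'_def by (intro bexI[of _ s]) auto
    next
      case 2
      then have "0 < a" using x l ab by auto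
      then show ?thesis using near[of "of_real l * \<theta>"] \<alpha> end_a ab unfolding 2 by (intro bexI[of _ a]) auto
    next
      case 3
      \<comment> \<open>The path moves monotonically along the segment, so by the intermediate value
        theorem it visits each of its points, at a time strictly between a and b.\<close>
      define k where "k = (\<lambda>s. Re ((\<phi> (g s) - \<phi> (g a)) / \<theta>))"
      have "continuous_on {a..b} k" unfolding k_def using \<theta> ct by (intro continuous_intros) auto
      moreover have "k a \<le> \<alpha> * (x - l)" using 3 \<alpha> by (simp add: k_def)
      moreover have kb: "k b = r" using r \<theta> by (simp add: k_def)
      moreover have xr: "\<alpha> * (x - l) < r" using x \<alpha> by (simp add: l'_def field_simps)
      ultimately obtain s where s: "a \<le> s" "s \<le> b" "k s = \<alpha> * (x - l)"
        using IVT'[of k a "\<alpha> * (x - l)" b] ab by auto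
      have "s \<noteq> a" using s(3) 3 \<alpha> by (auto simp: k_def)
      moreover have "s \<noteq> b" using s(3) kb xr by auto
      ultimately have sab: "a < s" "s < b" using s by auto
      obtain r' where r': "\<phi> (g s) - \<phi> (g a) = of_real r' * \<theta>" using mono[of s] sab by auto
      then have "r' = \<alpha> * (x - l)" using s(3) \<theta> by (simp add: k_def)
      with r' have "of_real (\<alpha> * (x - l)) * \<theta> = \<phi> (g s) - \<phi> (g a)" by simp
      then have "of_real \<alpha> * (of_real x * \<theta>) + \<beta> = \<phi> (g s)" unfolding past
          by (simp only: add_diff_cancel_left' diff_add_cancel add_diff_eq)
      then have "\<Delta>' (of_real x * \<theta>) = g s" using \<psi>\<phi>[of "g s"] U[of s] s 3 Rex by (simp add: \<Delta>'_def)
      then show ?thesis using sab ab by (intro bexI[of _ s]) auto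
    qed
  qed
  then show ?thesis by blast
qed

text \<open>Bisection on the implication that a development up to time a yields one up to time b:
  adjacent implications compose, and on short intervals a single chart suffices.\<close>

lemma straight_path_developed:
  assumes g: "straight_path \<theta> g" and \<theta>: "\<theta> \<noteq> 0" and reg: "\<And>t. t \<in> {0..1} \<Longrightarrow> \<exists>U \<phi>. disco_chart U \<phi> \<and> g t \<in> U"
    and \<psi>0: "locally_affine 1 \<psi>0 0" "\<psi>0 0 = g 0"
  shows "\<exists>\<Delta> l. developed \<theta> \<psi>0 g 1 \<Delta> l"
proof -
  have "0 \<le> (0::real) \<longrightarrow> 1 \<le> (1::real) \<longrightarrow> (\<exists>\<Delta> l. developed \<theta> \<psi>0 g 0 \<Delta> l) \<longrightarrow> (\<exists>\<Delta> l. developed \<theta> \<psi>0 g 1 \<Delta> l)"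
  proof (rule Bolzano[of 0 1 "\<lambda>a b. 0 \<le> a \<longrightarrow> b \<le> 1 \<longrightarrow> (\<exists>\<Delta> l. developed \<theta> \<psi>0 g a \<Delta> l) \<longrightarrow>
      (\<exists>\<Delta> l. developed \<theta> \<psi>0 g b \<Delta> l)"])
    fix t :: real assume t: "0 \<le> t" "t \<le> 1"
    then obtain U \<phi> where ch: "disco_chart U \<phi>" "g t \<in> U" using reg[of t] by auto
    have t01: "t \<in> {0..1}" using t by simp
    obtain e where e: "e > 0" and eU: "\<And>s. s \<in> {0..1} \<inter> ball t e \<Longrightarrow> g s \<in> U"
      and ec: "continuous_on ({0..1} \<inter> ball t e) (\<lambda>s. \<phi> (g s))"
      and em: "\<And>s s'. s \<in> {0..1} \<inter> ball t e \<Longrightarrow> s' \<in> {0..1} \<inter> ball t e \<Longrightarrow> s < s' \<Longrightarrow>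
        \<exists>r>0. \<phi> (g s') - \<phi> (g s) = of_real r * \<theta>"
      by (rule straight_path_chart[OF g \<theta> ch(1) t01 ch(2)]) (rule that; assumption)
    have "open (\<phi> ` U)" using ch by (simp add: disco_chart_def)
    then obtain \<rho> where \<rho>: "\<rho> > 0" "ball (\<phi> (g t)) \<rho> \<subseteq> \<phi> ` U" using ch(2) open_contains_ball by blast
    have "t \<in> {0..1} \<inter> ball t e" using t e by simp
    then obtain e' where e': "e' > 0" "\<And>s. s \<in> {0..1} \<inter> ball t e \<Longrightarrow> dist s t < e' \<Longrightarrow>
        dist (\<phi> (g s)) (\<phi> (g t)) < \<rho>"
      using ec \<rho>(1) unfolding continuous_on_iff by blast
    show "\<exists>d>0. \<forall>a b. a \<le> t \<and> t \<le> b \<and> b - a < d \<longrightarrow> 0 \<le> a \<longrightarrow> b \<le> 1 \<longrightarrow>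
      (\<exists>\<Delta> l. developed \<theta> \<psi>0 g a \<Delta> l) \<longrightarrow> (\<exists>\<Delta> l. developed \<theta> \<psi>0 g b \<Delta> l)"
    proof (rule exI[of _ "min e e'"], intro conjI allI impI)
      show "min e e' > 0" using e e' by simp
      fix a b assume *: "a \<le> t \<and> t \<le> b \<and> b - a < min e e'" "0 \<le> a" "b \<le> 1" "\<exists>\<Delta> l. developed \<theta> \<psi>0 g a \<Delta> l"
      have in_ball: "s \<in> {0..1} \<inter> ball t e \<and> dist s t < e'" if "s \<in> {a..b}" for s
        using that * by (auto simp: dist_real_def)
      show "\<exists>\<Delta> l. developed \<theta> \<psi>0 g b \<Delta> l"
      proof (cases "a = b")
        case False
        then have "a < b" using * by auto
        obtain \<Delta> l where dev: "developed \<theta> \<psi>0 g a \<Delta> l" using * by blast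
        have "\<phi> (g a) \<in> ball (\<phi> (g t)) \<rho>" "\<phi> (g b) \<in> ball (\<phi> (g t)) \<rho>"
          using e'(2)[of a] e'(2)[of b] in_ball[of a] in_ball[of b] \<open>a < b\<close> by (auto simp: dist_commute)
        then have seg: "closed_segment (\<phi> (g a)) (\<phi> (g b)) \<subseteq> \<phi> ` U"
          using closed_segment_subset[OF _ _ convex_ball] \<rho>(2) by blast
        show ?thesis
        proof (rule developed_extend[OF \<theta> ch(1) dev *(2) \<open>a < b\<close> _ _ _ seg])
          show "g s \<in> U" if "s \<in> {a..b}" for s using eU in_ball[OF that] by blast
          show "continuous_on {a..b} (\<lambda>s. \<phi> (g s))" using in_ball
              by (intro continuous_on_subset[OF ec]) auto
          show "\<exists>r>0. \<phi> (g s) - \<phi> (g a) = of_real r * \<theta>" if "a < s" "s \<le> b" for s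
            using em[of a s] in_ball[of a] in_ball[of s] that by auto
        qed
      qed (use * in auto)
    qed
  qed auto
  moreover have "developed \<theta> \<psi>0 g 0 \<psi>0 0"
    unfolding developed_def using \<psi>0 by (auto intro: exI[of _ 1])
  ultimately show ?thesis by auto
qed

text \<open>The points of affinity form an open set and the segment is compact. The tube gives room
  for nearby parallel or slightly turned segments.\<close>

lemma locally_affine_tube:
  assumes "\<And>x. x \<in> {0..l} \<Longrightarrow> locally_affine c \<Delta> (of_real x * \<theta>)"
  shows "\<exists>\<eta>>0. \<forall>x\<in>{0..l}. \<forall>u. norm u < \<eta> \<longrightarrow> locally_affine c \<Delta> (of_real x * \<theta> + u)"
proof -
  let ?O = "{u. locally_affine c \<Delta> u}" and ?S = "(\<lambda>x. of_real x * \<theta>) ` {0..l}"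
  have "open ?O"
    unfolding open_contains_ball using locally_affine_near
        by (metis (no_types, lifting) mem_Collect_eq subsetI)
  moreover have "compact ?S" by (intro compact_continuous_image continuous_intros) auto
  moreover have "?S \<subseteq> ?O" using assms by auto
  ultimately obtain \<eta> where \<eta>: "\<eta> > 0" "(\<Union>x\<in>?S. ball x \<eta>) \<subseteq> ?O"
    using compact_subset_open_imp_ball_epsilon_subset by metis
  show ?thesis
  proof (rule exI[of _ \<eta>], intro conjI \<eta>(1) ballI allI impI)
    fix x and u :: complex assume x: "x \<in> {0..l}" "norm u < \<eta>"
    then have "of_real x * \<theta> + u \<in> ball (of_real x * \<theta>) \<eta>" by (simp add: dist_norm)
    then show "locally_affine c \<Delta> (of_real x * \<theta> + u)" using \<eta>(2) x(1) by blast
  qed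
qed

text \<open>The closed curve \<open>\<Delta>\<close> returns to its starting point with scaling \<open>c\<close>. If \<open>c \<noteq> 1\<close>, every direction close to
  that of the curve has a closed leaf with nontrivial holonomy, which cannot lie in a flat cylinder.\<close>

lemma dilating_loop_not_periodic:
  assumes \<theta>: "\<theta> \<noteq> 0" and l: "l > 0" and c: "c > 0" "c \<noteq> 1"
    and la: "\<And>x. x \<in> {0..l} \<Longrightarrow> locally_affine 1 \<Delta> (of_real x * \<theta>)"
    and ret: "e > 0" "\<And>u. u \<in> ball 0 e \<Longrightarrow> \<Delta> (of_real l * \<theta> + u) = \<Delta> (of_real c * u)"
  shows "\<exists>\<sigma>0>0. \<forall>\<sigma>. \<bar>\<sigma>\<bar> < \<sigma>0 \<longrightarrow> \<not> totally_periodic ((of_real l + \<i> * of_real \<sigma>) * \<theta>)"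
proof -
  obtain \<eta> where \<eta>: "\<eta> > 0" "\<And>x u. x \<in> {0..l} \<Longrightarrow> norm u < \<eta> \<Longrightarrow> locally_affine 1 \<Delta> (of_real x * \<theta> + u)"
    using locally_affine_tube[of l 1 \<Delta> \<theta>, OF la] by blast
  \<comment> \<open>The sizes of the offsets used below per unit of \<sigma>: c/|1 - c| for s, 1/|1
    - c| for s/c, and 1 for \<sigma> itself.\<close>
  define B where "B = (c / \<bar>1 - c\<bar> + 1 / \<bar>1 - c\<bar> + 1) * norm \<theta>"
  have "c / \<bar>1 - c\<bar> > 0" "1 / \<bar>1 - c\<bar> > 0" using c by simp_all
  then have B: "B > 0" using \<theta> by (auto simp: B_def add_pos_pos intro!: mult_pos_pos)
  define \<sigma>0 where "\<sigma>0 = min \<eta> e / (2 * B)"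
  have \<sigma>0: "\<sigma>0 > 0" using \<eta> ret B by (simp add: \<sigma>0_def)
  have "\<not> totally_periodic ((of_real l + \<i> * of_real \<sigma>) * \<theta>)" if \<sigma>: "\<bar>\<sigma>\<bar> < \<sigma>0" for \<sigma>
  proof
    define \<zeta> where "\<zeta> = (of_real l + \<i> * of_real \<sigma>) * \<theta>"
    assume "totally_periodic ((of_real l + \<i> * of_real \<sigma>) * \<theta>)"
    then have tp: "totally_periodic \<zeta>" by (simp add: \<zeta>_def)
    \<comment> \<open>The fixed point of the return map in direction \<zeta>: starting at offset s
      one arrives at offset s + \<sigma>, and returning multiplies by c.\<close>
    define s where "s = \<sigma> * c / (1 - c)"
    have sc: "s + \<sigma> = s / c" using c by (simp add: s_def field_simps)
    define v where "v = \<i> * \<theta> * of_real s"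
    have "of_real l + \<i> * of_real \<sigma> \<noteq> 0" using l by (simp add: complex_eq_iff)
    then have \<zeta>0: "\<zeta> \<noteq> 0" using \<theta> by (simp add: \<zeta>_def)
    have \<sigma>B: "\<bar>\<sigma>\<bar> * B < min \<eta> e / 2" using \<sigma> B by (simp add: \<sigma>0_def field_simps)
    have ns: "\<bar>s\<bar> = \<bar>\<sigma>\<bar> * (c / \<bar>1 - c\<bar>)" using c by (simp add: s_def abs_mult)
    have nsc: "\<bar>s / c\<bar> = \<bar>\<sigma>\<bar> * (1 / \<bar>1 - c\<bar>)" using c by (simp add: s_def abs_mult)
    have bound: "(\<bar>s\<bar> + \<bar>s / c\<bar> + \<bar>\<sigma>\<bar>) * norm \<theta> = \<bar>\<sigma>\<bar> * B"
      unfolding ns nsc B_def by (simp add: algebra_simps)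
    have nn: "0 \<le> \<bar>s\<bar> * norm \<theta>" "0 \<le> \<bar>s / c\<bar> * norm \<theta>" "0 \<le> \<bar>\<sigma>\<bar> * norm \<theta>" by simp_all
    have small: "\<bar>s\<bar> * norm \<theta> + \<bar>\<sigma>\<bar> * norm \<theta> < min \<eta> e / 2" "\<bar>s / c\<bar> * norm \<theta> < min \<eta> e / 2"
      using bound \<sigma>B nn unfolding distrib_right by linarith+
    have mn: "min \<eta> e > 0" "min \<eta> e \<le> \<eta>" "min \<eta> e \<le> e" using \<eta> ret by auto
    have tube: "locally_affine 1 \<Delta> (v + k + of_real t * \<zeta>)" if "t \<in> {0..1}" "norm k < min \<eta> e / 2" for t k
    proof -
      have eqk: "v + k + of_real t * \<zeta> = of_real (t * l) * \<theta> + (\<i> * \<theta> * of_real (s + t * \<sigma>) + k)"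
        by (simp add: v_def \<zeta>_def algebra_simps)
      have nk1: "norm (\<i> * \<theta> * of_real (s + t * \<sigma>) + k) < \<eta>"
      proof -
        have "norm (\<i> * \<theta> * of_real (s + t * \<sigma>)) = \<bar>s + t * \<sigma>\<bar> * norm \<theta>"
          by (simp only: norm_mult norm_of_real norm_ii mult_1 mult.commute)
        also have "\<dots> \<le> (\<bar>s\<bar> + \<bar>\<sigma>\<bar>) * norm \<theta>"
        proof (rule mult_right_mono)
          have "\<bar>t * \<sigma>\<bar> \<le> \<bar>\<sigma>\<bar>" using that(1) by (simp add: abs_mult mult_left_le_one_le)
          then show "\<bar>s + t * \<sigma>\<bar> \<le> \<bar>s\<bar> + \<bar>\<sigma>\<bar>" by linarith
        qed simp
        also have "\<dots> < min \<eta> e / 2" using small(1) by (simp add: distrib_right)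
        finally show ?thesis
          using norm_triangle_ineq[of "\<i> * \<theta> * of_real (s + t * \<sigma>)" k] that(2) mn by linarith
      qed
      have "t * l \<in> {0..l}" using that(1) l by (auto simp: mult_left_le_one_le)
      from \<eta>(2)[OF this nk1] show ?thesis unfolding eqk .
    qed
    have return: "\<Delta> (v + \<zeta> + k) = \<Delta> (v + of_real c * k)" if "norm k < min \<eta> e / 2" for k
    proof -
      have eqk: "v + \<zeta> + k = of_real l * \<theta> + (\<i> * \<theta> * of_real (s / c) + k)"
        unfolding sc[symmetric] by (simp add: v_def \<zeta>_def algebra_simps)
      have "norm (\<i> * \<theta> * of_real (s / c)) = \<bar>s / c\<bar> * norm \<theta>"
        by (simp only: norm_mult norm_of_real norm_ii mult_1 mult.commute)
      then have "\<i> * \<theta> * of_real (s / c) + k \<in> ball 0 e"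
        using norm_triangle_ineq[of "\<i> * \<theta> * of_real (s / c)" k] that small(2) mn
        unfolding mem_ball_0 by linarith
      from ret(2)[OF this] have "\<Delta> (v + \<zeta> + k) = \<Delta> (of_real c * (\<i> * \<theta> * of_real (s / c) + k))"
          unfolding eqk .
      also have "of_real c * (\<i> * \<theta> * of_real (s / c) + k) = v + of_real c * k"
        using c by (simp add: v_def algebra_simps)
      finally show ?thesis .
    qed
    have hm: "0 < min \<eta> e / 2" using mn by simp
    let ?K = "(\<lambda>t::real. \<Delta> (v + of_real t * \<zeta>)) ` {0..1}"
    have laK: "locally_affine 1 \<Delta> (v + of_real t * \<zeta>)" if "t \<in> {0..1}" for t
      using tube[OF that, of 0] hm by simp
    \<comment> \<open>Both c x and x/c must stay in [0,1], and the overshoots x and x/c, times the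
      norm of \<zeta>, below the radius of \<open>return\<close>; c + 1/c + 1 dominates both
      factors.\<close>
    define e1 where "e1 = min (min 1 c) (min (1 / c) (min \<eta> e / (2 * (c + 1 / c + 1) * norm \<zeta>)))"
    have cc: "c + 1 / c + 1 > 0" using c by (simp add: add_pos_pos)
    have e1: "e1 > 0" using c mn \<zeta>0 cc by (simp add: e1_def)
    have e1_le: "e1 \<le> 1" "e1 \<le> c" "e1 \<le> 1 / c" "e1 \<le> min \<eta> e / (2 * (c + 1 / c + 1) * norm \<zeta>)"
      unfolding e1_def by linarith+
    have small_x: "norm (of_real (m * x) * \<zeta>) < min \<eta> e / 2" if "0 \<le> x" "x < e1" "m = 1 \<or> m = 1 / c"
        for x m :: real
    proof -
      have "m \<le> c + 1 / c + 1" "0 < m" using that(3) c by (auto simp: add_nonneg_nonneg)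
      have "norm (of_real (m * x) * \<zeta>) = m * x * norm \<zeta>" using \<open>0 < m\<close> that by (simp add: norm_mult)
      also have "\<dots> \<le> (c + 1 / c + 1) * x * norm \<zeta>"
        using \<open>m \<le> c + 1 / c + 1\<close> that by (intro mult_right_mono) auto
      also have "\<dots> < (c + 1 / c + 1) * (min \<eta> e / (2 * (c + 1 / c + 1) * norm \<zeta>)) * norm \<zeta>"
        using that e1_le cc \<zeta>0 by (intro mult_strict_right_mono mult_strict_left_mono) auto
      also have "\<dots> = min \<eta> e / 2"
      proof -
        have "q * (M / (2 * q * n)) * n = M / 2" if "q > 0" "n > 0" for q M n :: real
          using that by (simp add: field_simps)
        from this[OF cc, of "norm \<zeta>"] show ?thesis using \<zeta>0 by simp
      qed
      finally show ?thesis .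
    qed
    \<comment> \<open>Continued by x past its end, the curve is itself at parameter c x; extended by
      x before its start, it is itself at 1 - x/c. So it closes up as a leaf although its length
      scale changes.\<close>
    have sat: "g t \<in> ?K" if g: "straight_path \<zeta> g" "t0 \<in> {0..1}" "g t0 \<in> ?K" and t: "t \<in> {0..1}" for g t0 t
    proof (rule loop_saturated[OF \<zeta>0 laK _ zero_less_one e1 _ _ g t])
      show "1 * \<zeta> = of_real 1 * \<zeta>" by simp
      fix x :: real assume x: "0 \<le> x" "x < e1"
      have "\<Delta> (v + of_real (1 + x) * \<zeta>) = \<Delta> (v + \<zeta> + of_real (1 * x) * \<zeta>)" by (simp add: algebra_simps)
      also have "\<dots> = \<Delta> (v + of_real c * (of_real (1 * x) * \<zeta>))" by (rule return) (rule small_x[OF x], simp)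
      finally have "\<Delta> (v + of_real (1 + x) * \<zeta>) = \<Delta> (v + of_real (c * x) * \<zeta>)" by (simp add: mult.assoc)
      moreover have "c * x \<in> {0..1}"
      proof -
        have "c * x \<le> c * (1 / c)" using x e1_le c by (intro mult_left_mono) auto
        then show ?thesis using c x by simp
      qed
      ultimately show "\<exists>t\<in>{0..1}. \<Delta> (v + of_real (1 + x) * \<zeta>) = \<Delta> (v + of_real t * \<zeta>)" by blast
      have "\<Delta> (v + \<zeta> + (- (of_real (1 / c * x) * \<zeta>))) = \<Delta> (v + of_real c * (- (of_real (1 / c * x) * \<zeta>)))"
        by (rule return) (use small_x[OF x, of "1 / c"] in \<open>simp only: norm_minus_cancel simp_thms\<close>)
      moreover have "v + \<zeta> + (- (of_real (1 / c * x) * \<zeta>)) = v + of_real (1 - x / c) * \<zeta>"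
          by (simp add: algebra_simps)
      moreover have "v + of_real c * (- (of_real (1 / c * x) * \<zeta>)) = v + of_real (- x) * \<zeta>"
        using c by simp
      moreover have "1 - x / c \<in> {0..1}" using x e1_le c by (simp add: field_simps)
      ultimately show "\<exists>t\<in>{0..1}. \<Delta> (v + of_real (- x) * \<zeta>) = \<Delta> (v + of_real t * \<zeta>)" by metis
    qed
    have la_v: "locally_affine 1 \<Delta> v" using laK[of 0] by simp
    have vK: "\<Delta> v \<in> ?K" by (rule image_eqI[of _ _ 0]) simp_all
    have "\<Delta> v \<notin> saddle_graph \<zeta>"
    proof
      assume "\<Delta> v \<in> saddle_graph \<zeta>"
      then obtain g t where g: "straight_path \<zeta> g" "g 0 \<in> disco_sing" "t \<in> {0..1}" "g t = \<Delta> v"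
        using locally_affine_regular[OF la_v] unfolding saddle_graph_def saddle_connections_def by auto
      have "g 0 \<in> ?K" using sat[OF g(1,3), of 0] g(4) vK by simp
      then obtain x where "x \<in> {0..1}" "g 0 = \<Delta> (v + of_real x * \<zeta>)" by blast
      then show False using locally_affine_regular[OF laK] g(2) by metis
    qed
    then obtain C where C: "flat_cylinder \<zeta> C" "\<Delta> v \<in> C"
      using tp locally_affine_regular[OF la_v] unfolding totally_periodic_def by (metis DiffI UnionE)
    from C(1) obtain L h \<Psi> where L: "L > 0" "h > 0" and Ceq: "C = \<Psi> ` {z. 0 < Im z \<and> Im z < h}"
      and per: "\<And>z w. 0 < Im z \<Longrightarrow> Im z < h \<Longrightarrow> 0 < Im w \<Longrightarrow> Im w < h \<Longrightarrow>
         \<Psi> z = \<Psi> w \<longleftrightarrow> (\<exists>n::int. w - z = of_int n * of_real L)"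
      and la\<Psi>: "\<And>z. 0 < Im z \<Longrightarrow> Im z < h \<Longrightarrow> locally_affine \<zeta> \<Psi> z"
      by (rule flat_cylinderE) (rule that; assumption)
    from C(2) Ceq obtain z where z: "0 < Im z" "Im z < h" "\<Delta> v = \<Psi> z" by auto
    obtain U \<phi> a b r where ch: "disco_chart U \<phi>" and a: "a > 0" "r > 0"
      and A: "\<And>w. w \<in> ball v r \<Longrightarrow> \<Delta> w \<in> U \<and> \<phi> (\<Delta> w) = of_real a * w + b"
      using la_v unfolding locally_affine_def by auto
    have "\<Psi> z \<in> U" using A[of v] a z(3) by simp
    from locally_affine_chart[OF ch la\<Psi>[OF z(1,2)] this] obtain a' b' r' where a': "a' > 0" "r' > 0"
      and A': "\<And>w. w \<in> ball z r' \<Longrightarrow> \<Psi> w \<in> U \<and> \<phi> (\<Psi> w) = of_real a' * \<zeta> * w + b'" by blast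
    \<comment> \<open>The vector which, in the coordinates of \<Delta>, corresponds to a vertical
      unit step in the cylinder.\<close>
    define m where "m = of_real (a' / a) * \<zeta> * \<i>"
    have m: "norm m > 0" using a a' \<zeta>0 by (simp add: m_def norm_mult norm_divide)
    have eqvz: "of_real a * v + b = of_real a' * \<zeta> * z + b'" using A[of v] A'[of z] a a' z(3) by simp
    have \<Psi>\<Delta>: "\<Psi> (z + \<i> * of_real y) = \<Delta> (v + of_real y * m)" if "\<bar>y\<bar> < r'" "\<bar>y\<bar> * norm m < r" for y
    proof -
      have 1: "z + \<i> * of_real y \<in> ball z r'" using that(1) by (simp add: dist_norm norm_mult)
      have 2: "v + of_real y * m \<in> ball v r" using that(2) by (simp add: dist_norm norm_mult)
      have "of_real a * (v + of_real y * m) + b = (of_real a * v + b) + of_real a * of_real y * m"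
        by (simp add: algebra_simps)
      also have "of_real a * of_real y * m = of_real a' * \<zeta> * (\<i> * of_real y)"
        using a by (simp add: m_def)
      finally have "of_real a * (v + of_real y * m) + b = of_real a' * \<zeta> * (z + \<i> * of_real y) + b'"
        unfolding eqvz by (simp add: algebra_simps)
      then have "\<phi> (\<Psi> (z + \<i> * of_real y)) = \<phi> (\<Delta> (v + of_real y * m))" using A[OF 2] A'[OF 1] by simp
      then show ?thesis using inj_onD[OF disco_chart_inj[OF ch]] A[OF 2] A'[OF 1] by blast
    qed
    \<comment> \<open>The heights y and c y must both stay within the cylinder and within the two
      balls on which \<Delta> and \<Psi> read affinely, and y within the return radius; c + 1 bounds
      1 and c together.\<close>
    define y where "y = Min {r' / (2 * (c + 1)), r / (2 * (c + 1) * norm m), min \<eta> e / (4 * norm m),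
        (h - Im z) / (2 * (c + 1))}"
    have y: "y > 0" using a a' m c mn z by (simp add: y_def)
    have c1: "c + 1 > 0" using c by simp
    have "y \<le> r' / (2 * (c + 1))" "y \<le> r / (2 * (c + 1) * norm m)" "y \<le> min \<eta> e / (4 * norm m)"
        "y \<le> (h - Im z) / (2 * (c + 1))"
      by (simp_all add: y_def)
    then have y_le: "y * (2 * (c + 1)) \<le> r'" "y * (2 * (c + 1) * norm m) \<le> r" "y * (4 * norm m) \<le> min \<eta> e"
        "y * (2 * (c + 1)) \<le> h - Im z"
      using c1 m by (simp_all add: pos_le_divide_eq)
    have exp: "y * (2 * (c + 1)) = 2 * (c * y) + 2 * y"
        "y * (2 * (c + 1) * norm m) = 2 * (c * y * norm m) + 2 * (y * norm m)"
      by (simp_all add: algebra_simps)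
    have pos: "0 < c * y" "0 < c * y * norm m" "0 < y * norm m" using c y m by simp_all
    have Y: "y < r'" "c * y < r'" "y * norm m < r" "c * y * norm m < r" "y * norm m < min \<eta> e / 2"
        "Im z + y < h" "Im z + c * y < h"
      using y_le exp pos y a a' mn by linarith+
    \<comment> \<open>This parallel to the closed leaf starts at height y and ends at height c y,
      whereas \<open>cylinder_loop\<close> keeps it at one height.\<close>
    let ?g = "\<lambda>t::real. \<Delta> (v + of_real y * m + of_real t * \<zeta>)"
    have nk: "norm (of_real y * m) < min \<eta> e / 2" using Y(5) y by (simp add: norm_mult)
    have g: "straight_path \<zeta> ?g"
    proof (rule segment_straight_path[of 1 \<Delta> "v + of_real y * m" \<zeta> 1 \<zeta>])
      show "locally_affine 1 \<Delta> (v + of_real y * m + of_real t * \<zeta>)" if "0 < t" "t < 1" for t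
        using tube[OF _ nk] that by simp
      show "continuous_map (top_of_set {0..1}) disco_top ?g"
        by (rule locally_affine_segment_continuous) (rule tube[OF _ nk])
    qed simp_all
    have g0: "?g 0 = \<Psi> (z + \<i> * of_real y)" using \<Psi>\<Delta>[of y] Y y by simp
    have "?g 1 = \<Delta> (v + \<zeta> + of_real y * m)" by (simp add: algebra_simps)
    also have "\<dots> = \<Delta> (v + of_real c * (of_real y * m))" by (rule return[OF nk])
    also have "\<dots> = \<Psi> (z + \<i> * of_real (c * y))"
      using \<Psi>\<Delta>[of "c * y"] Y y pos by (simp add: mult.assoc)
    finally have g1: "?g 1 = \<Psi> (z + \<i> * of_real (c * y))" .
    have zy: "0 < Im (z + \<i> * of_real y)" "Im (z + \<i> * of_real y) < h" using z y Y by simp_all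
    have "(0::real) \<in> {0..1}" "(1::real) \<in> {0..1}" by simp_all
    from cylinder_loop[OF L(1) zy per la\<Psi> \<zeta>0 g this(1) g0 this(2)]
    obtain x :: real where "\<Psi> (z + \<i> * of_real (c * y)) = \<Psi> (z + \<i> * of_real y + of_real x * of_real L)"
      unfolding g1 by blast
    moreover have "0 < Im (z + \<i> * of_real (c * y))" "Im (z + \<i> * of_real (c * y)) < h" using z Y pos
        by simp_all
    moreover have "0 < Im (z + \<i> * of_real y + of_real x * of_real L)"
        "Im (z + \<i> * of_real y + of_real x * of_real L) < h"
      using zy by simp_all
    ultimately obtain n :: int where
      "z + \<i> * of_real y + of_real x * of_real L - (z + \<i> * of_real (c * y)) = of_int n * of_real L"
      using per by blast
    then have "Im (z + \<i> * of_real y + of_real x * of_real L - (z + \<i> * of_real (c * y))) =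
        Im (of_int n * of_real L)"
      by (rule arg_cong)
    then have "y = c * y" by simp
    then show False using y c by simp
  qed
  then show ?thesis using \<sigma>0 by blast
qed

text \<open>Developing the return path of the base point gives a return with some scaling c, and
  \<open>dilating_loop_not_periodic\<close> requires c \<noteq> 1. The derivative d does not reveal
  c directly, since a return from a nearby point may be realised by an unrelated path. Instead c = 1
  is refuted: it would make f the identity near 0 and d equal to 1.\<close>

lemma holonomy_not_periodic:
  assumes \<theta>: "\<theta> \<noteq> 0" and hol: "has_holonomy_derivative \<theta> L d" and d: "d \<noteq> 1"
  shows "\<exists>l>0. \<exists>\<sigma>0>0. \<forall>\<sigma>. \<bar>\<sigma>\<bar> < \<sigma>0 \<longrightarrow> \<not> totally_periodic ((of_real l + \<i> * of_real \<sigma>) * \<theta>)"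
proof -
  from hol obtain U \<phi> \<epsilon> \<tau> f \<delta> where ch: "disco_chart U \<phi>" and \<epsilon>: "0 < \<epsilon>" "0 < \<delta>" "\<delta> \<le> \<epsilon>"
    and \<tau>: "\<And>s. s \<in> {-\<epsilon><..<\<epsilon>} \<Longrightarrow> \<tau> s \<in> U \<and> \<phi> (\<tau> s) = \<phi> (\<tau> 0) + of_real s * (\<i> * \<theta>)"
    and f: "\<And>s. s \<in> {-\<delta><..<\<delta>} \<Longrightarrow> f s \<in> {-\<epsilon><..<\<epsilon>} \<and>
       first_return \<theta> (\<tau> ` {-\<epsilon><..<\<epsilon>}) (\<tau> s) (\<tau> (f s))"
    and f0: "f 0 = 0" and df: "(f has_real_derivative d) (at 0)"
    unfolding has_holonomy_derivative_def by blast
  let ?T = "\<tau> ` {-\<epsilon><..<\<epsilon>}"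
  have \<tau>0: "\<tau> 0 \<in> U" using \<tau>[of 0] \<epsilon> by simp
  have "0 \<in> {-\<delta><..<\<delta>}" using \<epsilon> by simp
  from conjunct2[OF f[OF this]]
  have "\<exists>g. straight_path \<theta> g \<and> g 0 = \<tau> 0 \<and> g 1 = \<tau> 0 \<and> (\<forall>t\<in>{0<..<1}. g t \<notin> ?T)"
    unfolding first_return_def f0 by (elim conjE)
  then obtain g where g: "straight_path \<theta> g" "g 0 = \<tau> 0" "g 1 = \<tau> 0" and gT: "\<And>t. t \<in> {0<..<1} \<Longrightarrow> g t \<notin> ?T"
    by blast
  define \<psi>0 where "\<psi>0 = (\<lambda>u. inv_into U \<phi> (1 * u + \<phi> (\<tau> 0)))"
  have la0: "locally_affine 1 \<psi>0 0"
  proof -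
    have "locally_affine 1 (inv_into U \<phi>) (1 * 0 + \<phi> (\<tau> 0))" using locally_affine_inverse_chart[OF ch \<tau>0]
        by simp
    from locally_affine_compose[OF this] show ?thesis by (simp add: \<psi>0_def)
  qed
  have "\<psi>0 0 = g 0" using disco_chart_inj[OF ch] \<tau>0 g by (simp add: \<psi>0_def inv_into_f_f)
  have reg: "\<exists>U \<phi>. disco_chart U \<phi> \<and> g t \<in> U" if "t \<in> {0..1}" for t
  proof (cases "t \<in> {0<..<1}")
    case True
    then obtain V \<phi>' e where "disco_chart V \<phi>'" "e > 0" "\<forall>s\<in>{0<..<1} \<inter> ball t e. g s \<in> V"
      using g(1) unfolding straight_path_def by blast
    then show ?thesis using True by (intro exI[of _ V] exI[of _ \<phi>']) auto
  next
    case False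
    then have "t = 0 \<or> t = 1" using that by auto
    then show ?thesis using ch \<tau>0 g by auto
  qed
  from straight_path_developed[OF g(1) \<theta> reg la0 \<open>\<psi>0 0 = g 0\<close>]
  obtain \<Delta> l where dev: "developed \<theta> \<psi>0 g 1 \<Delta> l" by blast
  then have l: "l > 0" and la: "\<And>x. x \<in> {0..l} \<Longrightarrow> locally_affine 1 \<Delta> (of_real x * \<theta>)"
    and end_l: "\<Delta> (of_real l * \<theta>) = \<tau> 0"
    and inter: "\<And>x. x \<in> {0<..<l} \<Longrightarrow> \<exists>s\<in>{0<..<1}. \<Delta> (of_real x * \<theta>) = g s"
    using g unfolding developed_def by (auto simp: less_le)
  from dev obtain e0 where e0: "e0 > 0" "\<And>u. u \<in> ball 0 e0 \<Longrightarrow> \<Delta> u = \<psi>0 u"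
    unfolding developed_def by blast
  have "open (\<phi> ` U)" using ch by (simp add: disco_chart_def)
  then obtain \<rho> where \<rho>: "\<rho> > 0" "ball (\<phi> (\<tau> 0)) \<rho> \<subseteq> \<phi> ` U" using \<tau>0 open_contains_ball by blast
  define e1 where "e1 = min e0 \<rho>"
  have e1: "e1 > 0" using e0 \<rho> by (simp add: e1_def)
  have D0: "\<Delta> u \<in> U \<and> \<phi> (\<Delta> u) = \<phi> (\<tau> 0) + u" if "u \<in> ball 0 e1" for u
  proof -
    have "u + \<phi> (\<tau> 0) \<in> \<phi> ` U" using that \<rho>(2) by (auto simp: e1_def dist_norm)
    moreover have "\<Delta> u = inv_into U \<phi> (u + \<phi> (\<tau> 0))" using e0(2)[of u] that by (simp add: e1_def \<psi>0_def)
    ultimately show ?thesis by (simp add: inv_into_into f_inv_into_f add.commute)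
  qed
  have D0_inj: "u = u'" if "u \<in> ball 0 e1" "u' \<in> ball 0 e1" "\<Delta> u = \<Delta> u'" for u u'
  proof -
    have "\<phi> (\<tau> 0) + u = \<phi> (\<Delta> u)" using D0[OF that(1)] by (rule conjunct2[THEN sym])
    also have "\<dots> = \<phi> (\<tau> 0) + u'" unfolding that(3) using D0[OF that(2)] by (rule conjunct2)
    finally show ?thesis by (rule add_left_imp_eq)
  qed
  have "\<Delta> (of_real l * \<theta>) \<in> U" using end_l \<tau>0 by simp
  from locally_affine_chart[OF ch la this] l
  obtain c b e2 where c: "c > 0" "e2 > 0"
    and D1: "\<And>w. w \<in> ball (of_real l * \<theta>) e2 \<Longrightarrow> \<Delta> w \<in> U \<and> \<phi> (\<Delta> w) = of_real c * w + b" by auto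
  have b: "of_real c * (of_real l * \<theta>) + b = \<phi> (\<tau> 0)" using D1[of "of_real l * \<theta>"] c end_l by simp
  define e3 where "e3 = min e2 (e1 / c)"
  have e3: "e3 > 0" "e3 \<le> e2" "e3 \<le> e1 / c" using c e1 by (auto simp: e3_def)
  \<comment> \<open>Past the end of the segment by u, the chart reads
    \<open>\<phi> (\<tau> 0)\<close> plus c u, which is also its reading at c u near the start;
    injectivity of the chart identifies the points.\<close>
  have ret: "\<Delta> (of_real l * \<theta> + u) = \<Delta> (of_real c * u) \<and> of_real c * u \<in> ball 0 e1" if "u \<in> ball 0 e3" for u
  proof -
    have 1: "of_real l * \<theta> + u \<in> ball (of_real l * \<theta>) e2" using that e3 by (simp add: dist_norm)
    have "norm u < e1 / c" using that e3 by simp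
    then have 2: "of_real c * u \<in> ball 0 e1" using c by (simp add: norm_mult field_simps)
    have "\<phi> (\<Delta> (of_real l * \<theta> + u)) = (of_real c * (of_real l * \<theta>) + b) + of_real c * u"
      using D1[OF 1] by (simp add: algebra_simps)
    also have "\<dots> = \<phi> (\<Delta> (of_real c * u))" unfolding b using D0[OF 2] by simp
    finally show ?thesis using inj_onD[OF disco_chart_inj[OF ch]] D1[OF 1] D0[OF 2] 2 by blast
  qed
  have \<tau>\<Delta>: "\<tau> s = \<Delta> (\<i> * \<theta> * of_real s)" if "\<bar>s\<bar> < \<epsilon>" "\<i> * \<theta> * of_real s \<in> ball 0 e1" for s
  proof -
    have "s \<in> {-\<epsilon><..<\<epsilon>}" using that by auto
    from \<tau>[OF this] D0[OF that(2)] show ?thesis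
      using inj_onD[OF disco_chart_inj[OF ch]] by (simp add: mult_ac)
  qed
  \<comment> \<open>If c = 1, parallel segments close up. \<open>loop_saturated\<close> then keeps
    any return path from \<open>\<tau> s\<close> on its closed curve, and that curve meets the
    transversal near its centre only at \<open>\<tau> s\<close>; hence f s = s.\<close>
  have "c \<noteq> 1"
  proof
    assume c1: "c = 1"
    have nrm: "norm (\<i> * \<theta> * of_real s) = \<bar>s\<bar> * norm \<theta>" for s by (simp add: norm_mult)
    have height: "y = s" if "\<i> * \<theta> * of_real y = \<i> * \<theta> * of_real s + of_real t * \<theta>" for y s t
    proof -
      have "\<theta> * (\<i> * of_real y) = \<theta> * (\<i> * of_real s + of_real t)" using that by (simp add: algebra_simps)
      then have "\<i> * of_real y = \<i> * of_real s + of_real t" using \<theta> by simp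
      then show ?thesis by (simp add: complex_eq_iff)
    qed
    \<comment> \<open>For times between a and b, curves close to the leaf meet the transversal near
      its centre only at their own height. The property passes to unions of adjacent intervals, so
      bisection reduces it to short ones.\<close>
    define Q where "Q = (\<lambda>a b. \<exists>e>0. \<forall>s y t. \<bar>s\<bar> < e \<longrightarrow> \<bar>y\<bar> < e \<longrightarrow> a \<le> t \<longrightarrow> t \<le> b \<longrightarrow>
       \<tau> y = \<Delta> (\<i> * \<theta> * of_real s + of_real t * \<theta>) \<longrightarrow> y = s)"
    have "Q 0 l"
    proof (rule Bolzano[of 0 l Q])
      show "0 \<le> l" using l by simp
      fix a b c :: real assume "Q a b" "Q b c"
      then obtain e e' where "e > 0" "e' > 0"
        and 1: "\<And>s y t. \<bar>s\<bar> < e \<Longrightarrow> \<bar>y\<bar> < e \<Longrightarrow> a \<le> t \<Longrightarrow> t \<le> b \<Longrightarrow> \<tau> y = \<Delta> (\<i> * \<theta> * of_real s + of_real t * \<theta>) \<Longrightarrow>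
            y = s"
        and 2: "\<And>s y t. \<bar>s\<bar> < e' \<Longrightarrow> \<bar>y\<bar> < e' \<Longrightarrow> b \<le> t \<Longrightarrow> t \<le> c \<Longrightarrow> \<tau> y = \<Delta> (\<i> * \<theta> * of_real s + of_real t * \<theta>) \<Longrightarrow>
            y = s"
        unfolding Q_def by blast
      show "Q a c" unfolding Q_def
      proof (rule exI[of _ "min e e'"], intro conjI allI impI)
        fix s y t assume "\<bar>s\<bar> < min e e'" "\<bar>y\<bar> < min e e'" "a \<le> t" "t \<le> c"
            "\<tau> y = \<Delta> (\<i> * \<theta> * of_real s + of_real t * \<theta>)"
        then show "y = s" using 1[of s y t] 2[of s y t] by (cases "t \<le> b") auto
      qed (use \<open>e > 0\<close> \<open>e' > 0\<close> in simp)
    next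
      fix x assume x: "0 \<le> x" "x \<le> l"
      have "\<exists>k>0. \<forall>s y t. \<bar>s\<bar> < k \<longrightarrow> \<bar>y\<bar> < k \<longrightarrow> \<bar>t - x\<bar> < k \<longrightarrow> \<tau> y = \<Delta> (\<i> * \<theta> * of_real s + of_real t * \<theta>) \<longrightarrow>
          y = s"
      proof (cases "x = 0 \<or> x = l")
        \<comment> \<open>At both ends one is in the chart of the transversal, at the far end
          through \<open>ret\<close> with c = 1; there \<Delta> is injective and a point of the
          transversal determines its height.\<close>
        case True
        define k where "k = min \<epsilon> (min e1 e3 / (2 * norm \<theta>))"
        have k: "k > 0" using \<epsilon> e1 e3 \<theta> by (simp add: k_def)
        have kb: "\<bar>z\<bar> * norm \<theta> < e1 / 2 \<and> \<bar>z\<bar> * norm \<theta> < e3 / 2" if "\<bar>z\<bar> < k" for z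
        proof -
          have "\<bar>z\<bar> < min e1 e3 / (2 * norm \<theta>)" using that by (simp add: k_def)
          then have "\<bar>z\<bar> * norm \<theta> < min e1 e3 / 2" using \<theta> by (simp add: field_simps)
          then show ?thesis by auto
        qed
        show ?thesis
        proof (rule exI[of _ k], intro conjI k allI impI)
          fix s y t assume *: "\<bar>s\<bar> < k" "\<bar>y\<bar> < k" "\<bar>t - x\<bar> < k"
              "\<tau> y = \<Delta> (\<i> * \<theta> * of_real s + of_real t * \<theta>)"
          have yb: "\<i> * \<theta> * of_real y \<in> ball 0 e1" using kb[OF *(2)] e1 nrm[of y] by simp
          have \<tau>y: "\<tau> y = \<Delta> (\<i> * \<theta> * of_real y)" using \<tau>\<Delta>[OF _ yb] *(2) by (simp add: k_def)
          let ?w = "\<i> * \<theta> * of_real s + of_real (t - x) * \<theta>"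
          have "norm (of_real (t - x) * \<theta>) = \<bar>t - x\<bar> * norm \<theta>" by (simp only: norm_mult norm_of_real)
          then have wb: "?w \<in> ball 0 e1" "?w \<in> ball 0 e3"
            using norm_triangle_ineq[of "\<i> * \<theta> * of_real s"
                "of_real (t - x) * \<theta>"] nrm[of s] kb[OF *(1)] kb[OF *(3)]
            by auto
          have "\<Delta> (\<i> * \<theta> * of_real s + of_real t * \<theta>) = \<Delta> ?w"
          proof (cases "x = 0")
            case False
            then have eq: "\<i> * \<theta> * of_real s + of_real t * \<theta> = of_real l * \<theta> + ?w" using True
                by (simp add: algebra_simps)
            show ?thesis using conjunct1[OF ret[OF wb(2)]] unfolding eq c1 of_real_1 mult_1_left .
          qed simp
          then have "\<Delta> (\<i> * \<theta> * of_real y) = \<Delta> ?w" using \<tau>y *(4) by metis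
          then have "\<i> * \<theta> * of_real y = ?w" by (rule D0_inj[OF yb wb(1)])
          then show "y = s" by (rule height)
        qed
      next
        \<comment> \<open>At an interior time the first return path is off the transversal, in
          particular off its centre. Disjoint neighbourhoods keep nearby curves away from the
          central part of the transversal, so the claim is vacuous.\<close>
        case False
        then have x': "x \<in> {0<..<l}" using x by auto
        then obtain s0 where s0: "s0 \<in> {0<..<1}" "\<Delta> (of_real x * \<theta>) = g s0" using inter by blast
        have "\<tau> 0 \<in> ?T" using \<epsilon> by auto
        then have "g s0 \<noteq> \<tau> 0" using gT[OF s0(1)] by metis
        moreover have "\<Delta> 0 = \<tau> 0" using \<tau>\<Delta>[of 0] \<epsilon> e1 by simp
        ultimately have ne: "\<Delta> (of_real x * \<theta>) \<noteq> \<Delta> 0" using s0 by simp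
        have lx: "locally_affine 1 \<Delta> (of_real x * \<theta>)" "locally_affine 1 \<Delta> 0"
          using la[of x] la[of 0] x' by auto
        obtain V W where VW: "openin disco_top V" "openin disco_top W" "\<Delta> (of_real x * \<theta>) \<in> V" "\<Delta> 0 \<in> W"
            "disjnt V W"
          using Hausdorff_disco_top ne locally_affine_regular[OF lx(1)] locally_affine_regular[OF lx(2)]
          unfolding Hausdorff_space_def by (metis topspace_disco_top)
        obtain r where r: "r > 0" "\<And>w. w \<in> ball (of_real x * \<theta>) r \<Longrightarrow> \<Delta> w \<in> V"
          by (rule locally_affine_preimage[OF lx(1) VW(1,3)]) (rule that; assumption)
        obtain r' where r': "r' > 0" "\<And>w. w \<in> ball 0 r' \<Longrightarrow> \<Delta> w \<in> W"
          by (rule locally_affine_preimage[OF lx(2) VW(2,4)]) (rule that; assumption)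
        define k where "k = min \<epsilon> (min r (min e1 r') / (2 * norm \<theta>))"
        have k: "k > 0" using \<epsilon> e1 r r' \<theta> by (simp add: k_def)
        have kb: "\<bar>z\<bar> * norm \<theta> < r / 2 \<and> \<bar>z\<bar> * norm \<theta> < e1 / 2 \<and> \<bar>z\<bar> * norm \<theta> < r' / 2" if "\<bar>z\<bar> < k" for z
        proof -
          have "\<bar>z\<bar> < min r (min e1 r') / (2 * norm \<theta>)" using that by (simp add: k_def)
          then have "\<bar>z\<bar> * norm \<theta> < min r (min e1 r') / 2" using \<theta> by (simp add: field_simps)
          then show ?thesis by auto
        qed
        show ?thesis
        proof (rule exI[of _ k], intro conjI k allI impI)
          fix s y t assume *: "\<bar>s\<bar> < k" "\<bar>y\<bar> < k" "\<bar>t - x\<bar> < k"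
              "\<tau> y = \<Delta> (\<i> * \<theta> * of_real s + of_real t * \<theta>)"
          have yb: "\<i> * \<theta> * of_real y \<in> ball 0 e1" "\<i> * \<theta> * of_real y \<in> ball 0 r'"
            using kb[OF *(2)] e1 r' nrm[of y] by auto
          have \<tau>y: "\<tau> y = \<Delta> (\<i> * \<theta> * of_real y)" using \<tau>\<Delta>[OF _ yb(1)] *(2) by (simp add: k_def)
          let ?w = "\<i> * \<theta> * of_real s + of_real (t - x) * \<theta>"
          have "norm (of_real (t - x) * \<theta>) = \<bar>t - x\<bar> * norm \<theta>" by (simp only: norm_mult norm_of_real)
          then have "norm ?w < r"
            using norm_triangle_ineq[of "\<i> * \<theta> * of_real s"
                "of_real (t - x) * \<theta>"] nrm[of s] kb[OF *(1)] kb[OF *(3)]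
            by linarith
          moreover have "dist a (a + w) = norm w" for a w :: complex by (simp add: dist_norm)
          ultimately have "of_real x * \<theta> + ?w \<in> ball (of_real x * \<theta>) r" by (simp only: mem_ball)
          moreover have "of_real x * \<theta> + ?w = \<i> * \<theta> * of_real s + of_real t * \<theta>"
              by (simp add: algebra_simps)
          ultimately have "\<tau> y \<in> V" using r(2) *(4) by metis
          moreover have "\<tau> y \<in> W" using r'(2)[OF yb(2)] \<tau>y by simp
          ultimately show "y = s" using VW(5) by (auto simp: disjnt_def)
        qed
      qed
      then obtain k where k: "k > 0" "\<And>s y t. \<bar>s\<bar> < k \<Longrightarrow> \<bar>y\<bar> < k \<Longrightarrow> \<bar>t - x\<bar> < k \<Longrightarrow>
         \<tau> y = \<Delta> (\<i> * \<theta> * of_real s + of_real t * \<theta>) \<Longrightarrow> y = s" by blast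
      show "\<exists>d>0. \<forall>a b. a \<le> x \<and> x \<le> b \<and> b - a < d \<longrightarrow> Q a b"
      proof (rule exI[of _ k], intro conjI k(1) allI impI)
        fix a b assume "a \<le> x \<and> x \<le> b \<and> b - a < k"
        then show "Q a b" unfolding Q_def
          by (intro exI[of _ k] conjI k(1) allI impI) (rule k(2), auto)
      qed
    qed
    then obtain k where k: "k > 0" "\<And>s y t. \<bar>s\<bar> < k \<Longrightarrow> \<bar>y\<bar> < k \<Longrightarrow> 0 \<le> t \<Longrightarrow> t \<le> l \<Longrightarrow>
       \<tau> y = \<Delta> (\<i> * \<theta> * of_real s + of_real t * \<theta>) \<Longrightarrow> y = s" unfolding Q_def by blast
    obtain \<eta> where \<eta>: "\<eta> > 0" "\<And>x u. x \<in> {0..l} \<Longrightarrow> norm u < \<eta> \<Longrightarrow> locally_affine 1 \<Delta> (of_real x * \<theta> + u)"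
      using locally_affine_tube[of l 1 \<Delta> \<theta>, OF la] by blast
    have "isCont f 0" using df DERIV_isCont by blast
    then obtain k' where k': "k' > 0" "\<And>s. \<bar>s\<bar> < k' \<Longrightarrow> \<bar>f s\<bar> < k"
      unfolding continuous_at_eps_delta using k(1) f0 by (auto simp: dist_real_def)
    \<comment> \<open>The bounds put s and f s below k, s into the domain of f, and the parallel
      curve into the tube, the base chart and half the return radius.\<close>
    define r where "r = Min {k, k', \<delta>, \<eta> / norm \<theta>, e1 / norm \<theta>, e3 / (2 * norm \<theta>)}"
    have r: "r > 0" using k k' \<epsilon> \<eta> e1 e3 \<theta> by (simp add: r_def)
    have fs: "f s = s" if s: "\<bar>s\<bar> < r" for s
    proof -
      have sr: "\<bar>s\<bar> < k" "\<bar>s\<bar> < k'" "\<bar>s\<bar> < \<delta>" "\<bar>s\<bar> < \<eta> / norm \<theta>" "\<bar>s\<bar> < e1 / norm \<theta>"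
          "\<bar>s\<bar> < e3 / (2 * norm \<theta>)"
        using s by (simp_all add: r_def)
      then have sb: "\<bar>s\<bar> * norm \<theta> < \<eta>" "\<bar>s\<bar> * norm \<theta> < e1" "\<bar>s\<bar> * norm \<theta> < e3 / 2"
        using \<theta> by (simp_all add: field_simps)
      let ?v = "\<i> * \<theta> * of_real s" and ?w = "of_real l * \<theta>"
      have \<tau>s: "\<tau> s = \<Delta> ?v" using sr \<epsilon> sb nrm by (intro \<tau>\<Delta>) auto
      have "s \<in> {-\<delta><..<\<delta>}" using sr by auto
      from f[OF this] obtain \<gamma> where \<gamma>: "straight_path \<theta> \<gamma>" "\<gamma> 0 = \<tau> s" "\<gamma> 1 = \<tau> (f s)"
        unfolding first_return_def by blast
      let ?K = "(\<lambda>t::real. \<Delta> (?v + of_real t * ?w)) ` {0..1}"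
      have ew: "e3 / (2 * (l * norm \<theta>)) > 0" using e3 l \<theta> by simp
      have laK: "locally_affine 1 \<Delta> (?v + of_real t * ?w)" if "t \<in> {0..1}" for t :: real
      proof -
        have "t * l \<in> {0..l}" using that l by (auto simp: mult_left_le_one_le)
        moreover have "norm ?v < \<eta>" using sb(1) nrm[of s] by linarith
        ultimately have "locally_affine 1 \<Delta> (of_real (t * l) * \<theta> + ?v)" by (rule \<eta>(2))
        moreover have "of_real (t * l) * \<theta> + ?v = ?v + of_real t * ?w" by simp
        ultimately show ?thesis by metis
      qed
      have rt: "\<Delta> (?v + of_real (1 + x) * ?w) = \<Delta> (?v + of_real x * ?w)" if "\<bar>x\<bar> < e3 / (2 * (l * norm \<theta>))"
          for x :: real
      proof -
        have "norm (of_real x * ?w) = \<bar>x\<bar> * (l * norm \<theta>)" using l by (simp add: norm_mult)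
        also have "\<dots> < e3 / 2" using that l \<theta> by (simp add: field_simps)
        finally have "norm (?v + of_real x * ?w) < e3"
          using norm_triangle_ineq[of ?v "of_real x * ?w"] sb(3) nrm[of s] by linarith
        then have "?v + of_real x * ?w \<in> ball 0 e3" unfolding mem_ball_0 .
        from conjunct1[OF ret[OF this]] have "\<Delta> (?w + (?v + of_real x * ?w)) = \<Delta> (?v + of_real x * ?w)"
          unfolding c1 of_real_1 mult_1_left .
        moreover have "?w + (?v + of_real x * ?w) = ?v + of_real (1 + x) * ?w" by (simp add: algebra_simps)
        ultimately show ?thesis by metis
      qed
      \<comment> \<open>This handles every path that could realise the first return from
        \<open>\<tau> s\<close>, however long it is.\<close>
      have "\<gamma> 1 \<in> ?K"
      proof (rule loop_saturated[OF \<theta> laK _ l, of "min 1 (e3 / (2 * (l * norm \<theta>)))"])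
        show "1 * ?w = of_real l * \<theta>" by simp
        show "min 1 (e3 / (2 * (l * norm \<theta>))) > 0" using ew by simp
        show "straight_path \<theta> \<gamma>" "(0::real) \<in> {0..1}" "(1::real) \<in> {0..1}" using \<gamma> by simp_all
        show "\<gamma> 0 \<in> ?K" unfolding \<gamma>(2) \<tau>s by (rule image_eqI[of _ _ 0]) simp_all
        fix x :: real assume x: "0 \<le> x" "x < min 1 (e3 / (2 * (l * norm \<theta>)))"
        have "x \<in> {0..1}" using x by simp
        moreover have "\<Delta> (?v + of_real (1 + x) * ?w) = \<Delta> (?v + of_real x * ?w)" by (rule rt) (use x in simp)
        ultimately show "\<exists>t\<in>{0..1}. \<Delta> (?v + of_real (1 + x) * ?w) = \<Delta> (?v + of_real t * ?w)" by blast
        have "1 + - x \<in> {0..1}" using x by simp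
        moreover have "\<Delta> (?v + of_real (1 + - x) * ?w) = \<Delta> (?v + of_real (- x) * ?w)"
            by (rule rt) (use x in simp)
        ultimately show "\<exists>t\<in>{0..1}. \<Delta> (?v + of_real (- x) * ?w) = \<Delta> (?v + of_real t * ?w)" by metis
      qed
      then obtain t :: real where t: "t \<in> {0..1}" "\<tau> (f s) = \<Delta> (?v + of_real t * ?w)" unfolding \<gamma>(3)
          by blast
      have "\<tau> (f s) = \<Delta> (?v + of_real (t * l) * \<theta>)" using t(2) by (simp add: mult.assoc)
      moreover have "0 \<le> t * l" "t * l \<le> l" using t(1) l by (auto simp: mult_left_le_one_le)
      ultimately show ?thesis using k(2)[OF sr(1) k'(2)[OF sr(2)]] by blast
    qed
    have "(f has_real_derivative 1) (at 0)"
    proof (rule has_field_derivative_transform_within[of "\<lambda>x. x" _ _ _ r])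
      show "((\<lambda>x. x) has_real_derivative 1) (at 0)" by (rule DERIV_ident)
    qed (use r fs in \<open>auto simp: dist_real_def\<close>)
    then show False using DERIV_unique[OF df] d by blast
  qed
  from dilating_loop_not_periodic[OF \<theta> l c(1) this la e3(1)] ret l show ?thesis by blast
qed

section \<open>The group\<close>

fun shear_word :: "bool \<Rightarrow> int list \<Rightarrow> complex \<Rightarrow> complex" where
  "shear_word s [] z = z"
| "shear_word s (m # ms) z = (if s then hshear m else vshear m) (shear_word (\<not> s) ms z)"

text \<open>Reduced words, the Boolean being the kind of the outermost shear. Nonzero exponents are
  what ping-pong demands.\<close>

definition shear_words :: "(complex \<Rightarrow> complex) set" where
  "shear_words = {shear_word s ms |s ms. 0 \<notin> set ms}"

lemma shear_word_in: "0 \<notin> set ms \<Longrightarrow> shear_word s ms \<in> shear_words"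
  by (auto simp: shear_words_def)

lemma shear_word_Nil: "shear_word s [] \<in> shear_words"
  by (rule shear_word_in) simp

lemma hshear_add: "hshear m (hshear n z) = hshear (m + n) z"
  and vshear_add: "vshear m (vshear n z) = vshear (m + n) z"
  by (simp_all add: hshear_def vshear_def complex_eq_iff algebra_simps add_divide_distrib)

lemma hshear_0 [simp]: "hshear 0 z = z" and vshear_0 [simp]: "vshear 0 z = z"
  by (simp_all add: hshear_def vshear_def)

lemma shear_words_step:
  assumes "f \<in> shear_words"
  shows "(\<lambda>z. (if s then hshear m else vshear m) (f z)) \<in> shear_words"
proof -
  from assms obtain t ms where f: "f = shear_word t ms" "0 \<notin> set ms" unfolding shear_words_def by blast
  have mem: "g \<in> shear_words" if "\<And>z. g z = shear_word t' ns z" "0 \<notin> set ns" for g t' ns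
    using that unfolding shear_words_def by blast
  consider "m = 0" | "m \<noteq> 0" "ms = [] \<or> t \<noteq> s" | k ks where "m \<noteq> 0" "t = s" "ms = k # ks" by (cases ms) auto
  then show ?thesis
  proof cases
    case 1
    then show ?thesis using f by (intro mem[of _ t ms]) auto
  next
    case 2
    then show ?thesis using f by (intro mem[of _ s "m # ms"]) auto
  next
    case 3
    show ?thesis
    proof (cases "m + k = 0")
      case True
      then show ?thesis using 3 f by (intro mem[of _ "\<not> s" ks]) (auto simp: hshear_add vshear_add)
    next
      case False
      then show ?thesis using 3 f by (intro mem[of _ s "(m + k) # ks"]) (auto simp: hshear_add vshear_add)
    qed
  qed
qed

lemma shear_words_compose:
  assumes "g \<in> shear_words"
  shows "(\<lambda>z. shear_word s ms (g z)) \<in> shear_words"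
proof (induction ms arbitrary: s)
  case (Cons m ms)
  show ?case using shear_words_step[OF Cons, of s m "\<not> s"] by simp
qed (use assms in simp)

lemma shear_word_append:
  "shear_word s (xs @ ys) z = shear_word s xs (shear_word (if even (length xs) then s else \<not> s) ys z)"
  by (induction xs arbitrary: s) auto

lemma shear_word_uminus: "shear_word s ms (- z) = - shear_word s ms z"
proof (induction ms arbitrary: s)
  case (Cons m ms)
  have "hshear m (- w) = - hshear m w" "vshear m (- w) = - vshear m w" for w
    by (simp_all add: hshear_def vshear_def)
  then show ?case using Cons by simp
qed simp

lemma shear_word_inverse:
  "shear_word (if even (length ms) then \<not> s else s) (rev (map uminus ms)) (shear_word s ms z) = z"
proof (induction ms arbitrary: s)
  case (Cons m ms)
  show ?case
    using Cons[of "\<not> s"]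
    by (cases s; cases "even (length ms)") (simp_all add: shear_word_append hshear_inverse vshear_inverse)
qed simp

section \<open>Ping-pong and fixed directions\<close>

text \<open>The cones about the two axes cover the plane. The slope 1/2 comes from the rescaling x =
  2 x', under which the constants 6 and 3/2 both become 3.\<close>

definition shear_cone :: "bool \<Rightarrow> complex \<Rightarrow> bool" where
  "shear_cone s z \<longleftrightarrow> (if s then 2 * \<bar>Im z\<bar> \<le> \<bar>Re z\<bar> else \<bar>Re z\<bar> \<le> 2 * \<bar>Im z\<bar>)"

definition shear_size :: "bool \<Rightarrow> complex \<Rightarrow> real" where
  "shear_size s z = (if s then \<bar>Re z\<bar> else \<bar>Im z\<bar>)"

text \<open>If |y| is at most |x|/2, the inner shear produces a height of at least (3/2 - 1/2) |x| =
  |x|, and the outer one a width of at least 6 |x| - |x| = 5 |x|. The other cone is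
  symmetric.\<close>

lemma shear_pair_expands:
  assumes "shear_cone s z" "m \<noteq> 0" "n \<noteq> 0"
  shows "shear_cone s (shear_word s [m, n] z)" "5 * shear_size s z \<le> shear_size s (shear_word s [m, n] z)"
proof -
  have A: "6 * \<bar>y\<bar> - \<bar>x\<bar> \<le> \<bar>x + 6 * of_int k * y\<bar>" if "k \<noteq> 0" for k :: int and x y :: real
  proof -
    have "1 * \<bar>y\<bar> \<le> \<bar>of_int k\<bar> * \<bar>y\<bar>" using that by (intro mult_right_mono) auto
    then have "6 * \<bar>y\<bar> \<le> \<bar>6 * of_int k * y\<bar>" by (simp add: abs_mult)
    then show ?thesis by linarith
  qed
  have B: "3/2 * \<bar>x\<bar> - \<bar>y\<bar> \<le> \<bar>y + 3/2 * of_int k * x\<bar>" if "k \<noteq> 0" for k :: int and x y :: real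
  proof -
    have "1 * \<bar>x\<bar> \<le> \<bar>of_int k\<bar> * \<bar>x\<bar>" using that by (intro mult_right_mono) auto
    then have "3/2 * \<bar>x\<bar> \<le> \<bar>3/2 * of_int k * x\<bar>" by (simp add: abs_mult)
    then show ?thesis by linarith
  qed
  have "shear_cone s (shear_word s [m, n] z) \<and> 5 * shear_size s z \<le> shear_size s (shear_word s [m, n] z)"
  proof (cases s)
    case True
    let ?w = "vshear n z"
    have "2 * \<bar>Im z\<bar> \<le> \<bar>Re z\<bar>" using assms True by (simp add: shear_cone_def)
    moreover have "3/2 * \<bar>Re z\<bar> - \<bar>Im z\<bar> \<le> \<bar>Im ?w\<bar>" unfolding Im_vshear by (rule B[OF assms(3)])
    moreover have "6 * \<bar>Im ?w\<bar> - \<bar>Re ?w\<bar> \<le> \<bar>Re (hshear m ?w)\<bar>" unfolding Re_hshear by (rule A[OF assms(2)])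
    moreover have "Re ?w = Re z" "Im (hshear m ?w) = Im ?w" by simp_all
    ultimately have "2 * \<bar>Im (hshear m ?w)\<bar> \<le> \<bar>Re (hshear m ?w)\<bar> \<and> 5 * \<bar>Re z\<bar> \<le> \<bar>Re (hshear m ?w)\<bar>"
        by linarith
    then show ?thesis using True by (simp add: shear_cone_def shear_size_def)
  next
    case False
    let ?w = "hshear n z"
    have "\<bar>Re z\<bar> \<le> 2 * \<bar>Im z\<bar>" using assms False by (simp add: shear_cone_def)
    moreover have "6 * \<bar>Im z\<bar> - \<bar>Re z\<bar> \<le> \<bar>Re ?w\<bar>" unfolding Re_hshear by (rule A[OF assms(3)])
    moreover have "3/2 * \<bar>Re ?w\<bar> - \<bar>Im ?w\<bar> \<le> \<bar>Im (vshear m ?w)\<bar>" unfolding Im_vshear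
        by (rule B[OF assms(2)])
    moreover have "Im ?w = Im z" "Re (vshear m ?w) = Re ?w" by simp_all
    ultimately have "\<bar>Re (vshear m ?w)\<bar> \<le> 2 * \<bar>Im (vshear m ?w)\<bar> \<and> 5 * \<bar>Im z\<bar> \<le> \<bar>Im (vshear m ?w)\<bar>"
        by linarith
    then show ?thesis using False by (simp add: shear_cone_def shear_size_def)
  qed
  then show "shear_cone s (shear_word s [m, n] z)"
      "5 * shear_size s z \<le> shear_size s (shear_word s [m, n] z)" by blast+
qed

lemma shear_word_even_expands:
  assumes "shear_cone s z" "0 \<notin> set ms" "even (length ms)"
  shows "shear_cone s (shear_word s ms z) \<and> (ms \<noteq> [] \<longrightarrow>
      5 * shear_size s z \<le> shear_size s (shear_word s ms z))"
  using assms(2,3)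
proof (induction ms rule: length_induct)
  case (1 ms)
  show ?case
  proof (cases "ms = []")
    case True
    then show ?thesis using assms(1) by simp
  next
    case False
    then obtain m n ks where ms: "ms = m # n # ks" using 1(3) by (cases ms; cases "tl ms") auto
    let ?w = "shear_word s ks z"
    have IH: "shear_cone s ?w \<and> (ks \<noteq> [] \<longrightarrow> 5 * shear_size s z \<le> shear_size s ?w)"
      using 1 ms by auto
    have "shear_size s z \<ge> 0" by (simp add: shear_size_def)
    then have "shear_size s z \<le> shear_size s ?w" using IH by (cases "ks = []") auto
    moreover have e: "shear_word s ms z = shear_word s [m, n] ?w" unfolding ms by simp
    moreover have "m \<noteq> 0" "n \<noteq> 0" using 1(2) ms by auto
    ultimately show ?thesis using shear_pair_expands[of s ?w m n] IH \<open>shear_size s z \<ge> 0\<close> unfolding e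
        by linarith
  qed
qed

text \<open>A vector fixed up to sign keeps its size, against expansion in the cone of kind s. A
  vector outside that cone lies in the other one, and there the inverse word expands, its outermost
  shear being of the other kind because the length is even.\<close>

lemma shear_word_even_no_fixed:
  assumes z: "z \<noteq> 0" and ms: "0 \<notin> set ms" "even (length ms)" "ms \<noteq> []"
      and fx: "shear_word s ms z = z \<or> shear_word s ms z = - z"
  shows False
proof -
  have no: False if "shear_cone t z" "0 \<notin> set ns" "even (length ns)" "ns \<noteq> []"
      "shear_word t ns z = z \<or> shear_word t ns z = - z" for t ns
  proof -
    have "5 * shear_size t z \<le> shear_size t (shear_word t ns z)"
      using shear_word_even_expands[OF that(1-3)] that(4) by blast
    moreover have "shear_size t (shear_word t ns z) = shear_size t z"
      using that(5) by (auto simp: shear_size_def)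
    ultimately have "shear_size t z \<le> 0" by linarith
    then have "z = 0" using that(1) by (auto
        simp: shear_size_def shear_cone_def complex_eq_iff split: if_splits)
    then show False using z by simp
  qed
  show False
  proof (cases "shear_cone s z")
    case True
    then show False using no ms fx by blast
  next
    case False
    then have cone: "shear_cone (\<not> s) z" by (auto simp: shear_cone_def split: if_splits)
    let ?ns = "rev (map uminus ms)"
    have "shear_word (\<not> s) ?ns (shear_word s ms z) = z" using shear_word_inverse[of ms s z] ms(2) by simp
    then have "shear_word (\<not> s) ?ns z = z \<or> shear_word (\<not> s) ?ns z = - z"
      using fx shear_word_uminus[of "\<not> s" ?ns z] by (metis minus_minus)
    then show False using no[OF cone, of ?ns] ms by force
  qed
qed

lemma totally_periodic_shear_word:
  assumes "z \<noteq> 0"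
  shows "shear_word s ms z \<noteq> 0 \<and> (totally_periodic (shear_word s ms z) \<longleftrightarrow> totally_periodic z)"
proof (induction ms arbitrary: s)
  case (Cons m ms)
  let ?w = "shear_word (\<not> s) ms z" and ?L = "if s then hshear m else vshear m"
      and ?L' = "if s then hshear (- m) else vshear (- m)"
  have w: "?w \<noteq> 0" using Cons by blast
  have inv: "?L' (?L ?w) = ?w" by (simp add: hshear_inverse vshear_inverse)
  have z0: "?L' 0 = 0" by (simp add: hshear_def vshear_def)
  have "?L ?w \<noteq> 0" using inv z0 w by metis
  moreover have "totally_periodic (?L ?w)" if "totally_periodic ?w"
    using totally_periodic_hshear[OF that w] totally_periodic_vshear[OF that w] by (cases s) simp_all
  moreover have "totally_periodic (?L' (?L ?w))" if "totally_periodic (?L ?w)"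
    using totally_periodic_hshear[OF that \<open>?L ?w \<noteq> 0\<close>] totally_periodic_vshear[OF that \<open>?L ?w \<noteq> 0\<close>]
        by (cases s) simp_all
  ultimately show ?case using inv Cons by auto
qed (use assms in simp)

lemma totally_periodic_real_scale:
  assumes "totally_periodic z" "z \<noteq> 0" "r \<noteq> 0"
  shows "totally_periodic (of_real r * z)"
proof (cases "r > 0")
  case False
  then have "totally_periodic (of_real (- r) * (- z))"
    using assms by (intro totally_periodic_scale totally_periodic_uminus) auto
  then show ?thesis by simp
qed (use assms totally_periodic_scale in blast)

text \<open>In a word of odd length the outer letters are of the same kind, so conjugating by the
  last one merges them and leaves a shorter word. Even words are excluded by ping-pong, and a single
  shear fixes only its axis. Total periodicity is carried back along the conjugations.\<close>

lemma shear_word_fixed_periodic: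
  assumes "z \<noteq> 0" "0 \<notin> set ms" "ms \<noteq> []" "shear_word s ms z = z \<or> shear_word s ms z = - z"
  shows "totally_periodic z"
  using assms
proof (induction "length ms" arbitrary: ms s z rule: less_induct)
  case less
  consider m where "ms = [m]" | "even (length ms)" | "odd (length ms)" "length ms \<ge> 3"
    using less(4) by (cases ms; cases "tl ms"; cases "tl (tl ms)") auto
  then show ?case
  proof cases
    case 1
    then have m: "m \<noteq> 0" using less by auto
    show ?thesis
    proof (cases s)
      case True
      then have "hshear m z = z \<or> hshear m z = - z" using 1 less by simp
      then have "Im z = 0" using m by (auto simp: complex_eq_iff Re_hshear)
      then have z: "z = of_real (Re z) * 1" "Re z \<noteq> 0" using less(2) by (auto simp: complex_eq_iff)
      show ?thesis by (subst z(1)) (intro totally_periodic_real_scale totally_periodic_horizontal z, simp)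
    next
      case False
      then have "vshear m z = z \<or> vshear m z = - z" using 1 less by simp
      then have "Re z = 0" using m by (auto simp: complex_eq_iff Im_vshear)
      then have z: "z = of_real (Im z) * \<i>" "Im z \<noteq> 0" using less(2) by (auto simp: complex_eq_iff)
      show ?thesis by (subst z(1)) (intro totally_periodic_real_scale totally_periodic_vertical z, simp)
    qed
  next
    case 2
    then show ?thesis using shear_word_even_no_fixed less by blast
  next
    case 3
    then obtain m ns where "ms = m # ns" "length ns \<ge> 2" by (cases ms) auto
    then obtain ks k where ms: "ms = m # ks @ [k]" "ks \<noteq> []" by (cases ns rule: rev_cases) fastforce+
    have ev: "odd (length ks)" using 3 ms by simp
    let ?L = "\<lambda>m. if s then hshear m else vshear m"
    \<comment> \<open>If the word fixes z up to sign, its conjugate by the last letter does the same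
      to z'; its outermost exponent is k + m, and the letter vanishes when this is zero.\<close>
    define z' where "z' = ?L k z"
    have zz': "z' = shear_word s [k] z" by (simp add: z'_def)
    have z': "z' \<noteq> 0" "totally_periodic z' \<longleftrightarrow> totally_periodic z"
      using totally_periodic_shear_word[OF less(2), of s "[k]"] by (simp_all add: zz')
    have w: "shear_word s ms z = ?L m (shear_word (\<not> s) ks z')"
      using ev unfolding ms z'_def by (simp add: shear_word_append)
    have add: "?L a (?L b y) = ?L (a + b) y" for a b y by (simp add: hshear_add vshear_add)
    have neg: "?L k (- z) = - z'" using shear_word_uminus[of s "[k]" z] by (simp add: z'_def)
    have "?L k (shear_word s ms z) = z' \<or> ?L k (shear_word s ms z) = - z'"
      using less(5) neg unfolding z'_def by metis
    then have fx: "?L (k + m) (shear_word (\<not> s) ks z') = z' \<or> ?L (k + m) (shear_word (\<not> s) ks z') = - z'"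
      unfolding w add .
    have "totally_periodic z'"
    proof (cases "k + m = 0")
      case True
      then have "shear_word (\<not> s) ks z' = z' \<or> shear_word (\<not> s) ks z' = - z'"
        using fx by (cases s) simp_all
      then show ?thesis using less(1)[of ks z' "\<not> s"] less(3) ms z' by auto
    next
      case False
      have "shear_word s ((k + m) # ks) z' = z' \<or> shear_word s ((k + m) # ks) z' = - z'" using fx by simp
      then show ?thesis using less(1)[of "(k + m) # ks" z' s] less(3) ms z' False by auto
    qed
    then show ?thesis using z' by blast
  qed
qed

section \<open>Matrices, classes up to sign, and their action by words\<close>

definition cvec :: "complex \<Rightarrow> real^2" where
  "cvec z = vector [Re z, Im z]"

lemma cvec_nth [simp]: "cvec z $ 1 = Re z" "cvec z $ 2 = Im z"
  by (simp_all add: cvec_def)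

lemma direction_line_cvec: "direction_line \<theta> = span {cvec \<theta>}"
  by (simp add: direction_line_def cvec_def)

definition matrix_acts :: "real^2^2 \<Rightarrow> (complex \<Rightarrow> complex) \<Rightarrow> bool" where
  "matrix_acts M f \<longleftrightarrow> (\<forall>z. M *v cvec z = cvec (f z))"

lemma matrix_actsD:
  assumes "matrix_acts M f"
  shows "M $ 1 $ 1 = Re (f 1)" "M $ 2 $ 1 = Im (f 1)" "M $ 1 $ 2 = Re (f \<i>)" "M $ 2 $ 2 = Im (f \<i>)"
proof -
  have "(M *v cvec 1) $ j = cvec (f 1) $ j" "(M *v cvec \<i>) $ j = cvec (f \<i>) $ j" for j
    using assms by (simp_all add: matrix_acts_def)
  from this(1)[of 1] this(1)[of 2] this(2)[of 1] this(2)[of 2]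
  show "M $ 1 $ 1 = Re (f 1)" "M $ 2 $ 1 = Im (f 1)" "M $ 1 $ 2 = Re (f \<i>)" "M $ 2 $ 2 = Im (f \<i>)"
    by (simp_all add: matrix_vector_mult_def sum_2)
qed

lemma matrix_acts_mult: "matrix_acts M f \<Longrightarrow> matrix_acts N g \<Longrightarrow> matrix_acts (M ** N) (\<lambda>z. f (g z))"
  unfolding matrix_acts_def by (simp flip: matrix_vector_mul_assoc)

lemma matrix_uminus_mult: "(- M) ** N = - (M ** N)" "M ** (- N) = - (M ** N)" for M N :: "real^2^2"
  by (simp_all add: vec_eq_iff matrix_matrix_mult_def sum_negf)

lemma psl_class_eq: "psl_class M = {M, - M}"
  unfolding psl_class_def r_coset_def by (auto simp: SL2_def matrix_uminus_mult)

lemma carrier_PSL2: "X \<in> carrier PSL2 \<longleftrightarrow> (\<exists>M. det M = 1 \<and> X = {M, - M})"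
proof -
  have "carrier PSL2 = (\<Union>M\<in>{M. det M = 1}. {psl_class M})"
    unfolding PSL2_def FactGroup_def RCOSETS_def psl_class_def by (simp add: SL2_def)
  then show ?thesis by (auto simp: psl_class_eq)
qed

lemma mult_PSL2: "{M, - M} \<otimes>\<^bsub>PSL2\<^esub> {N, - N} = {M ** N, - (M ** N)}"
  unfolding PSL2_def FactGroup_def set_mult_def by (auto simp: SL2_def matrix_uminus_mult)

lemma one_PSL2: "\<one>\<^bsub>PSL2\<^esub> = {mat 1, - mat 1}"
  by (simp add: PSL2_def FactGroup_def)

lemma inv_PSL2:
  assumes "det M = 1" "M ** M' = mat 1" "M' ** M = mat 1"
  shows "inv\<^bsub>PSL2\<^esub> {M, - M} = {M', - M'}"
  unfolding m_inv_def
proof (rule the_equality)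
  have "det M * det M' = 1" using assms(2) by (metis det_mul det_I)
  then have "det M' = 1" using assms(1) by simp
  then show "{M', - M'} \<in> carrier PSL2 \<and> {M, - M} \<otimes>\<^bsub>PSL2\<^esub> {M', - M'} = \<one>\<^bsub>PSL2\<^esub> \<and>
      {M', - M'} \<otimes>\<^bsub>PSL2\<^esub> {M, - M} = \<one>\<^bsub>PSL2\<^esub>"
    using assms by (auto simp: carrier_PSL2 mult_PSL2 one_PSL2)
next
  fix Y assume Y: "Y \<in> carrier PSL2 \<and> {M, - M} \<otimes>\<^bsub>PSL2\<^esub> Y = \<one>\<^bsub>PSL2\<^esub> \<and> Y \<otimes>\<^bsub>PSL2\<^esub> {M, - M} = \<one>\<^bsub>PSL2\<^esub>"
  then obtain N where N: "Y = {N, - N}" by (auto simp: carrier_PSL2)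
  with Y have "{N ** M, - (N ** M)} = {mat 1, - mat 1}" by (simp add: mult_PSL2 one_PSL2)
  then have "N ** M = mat 1 \<or> N ** M = - mat 1" by blast
  then have "N ** M ** M' = M' \<or> N ** M ** M' = - M'" by (auto simp: matrix_uminus_mult)
  then have "N = M' \<or> N = - M'" using assms by (simp flip: matrix_mul_assoc)
  then show "Y = {M', - M'}" using N by auto
qed

definition hmat :: "int \<Rightarrow> real^2^2" where "hmat m = vector [vector [1, 6 * of_int m], vector [0, 1]]"
definition vmat :: "int \<Rightarrow> real^2^2" where "vmat m = vector [vector [1, 0], vector [3/2 * of_int m, 1]]"

lemma hmat_acts: "matrix_acts (hmat m) (hshear m)" and vmat_acts: "matrix_acts (vmat m) (vshear m)"
  by (simp_all add: matrix_acts_def hmat_def vmat_def vec_eq_iff forall_2 matrix_vector_mult_def sum_2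
      Re_hshear Im_vshear)

lemma det_hmat: "det (hmat m) = 1" and det_vmat: "det (vmat m) = 1"
  by (simp_all add: det_2 hmat_def vmat_def)

lemma hmat_inverse: "hmat m ** hmat (- m) = mat 1" and vmat_inverse: "vmat m ** vmat (- m) = mat 1"
  by (simp_all add: hmat_def vmat_def vec_eq_iff forall_2 matrix_matrix_mult_def sum_2 mat_def)

text \<open>Composites of reduced words reduce again by merging neighbouring shears of one kind, so
  induction over \<open>generate\<close> applies; the pair {M, -M} absorbs the sign.\<close>

lemma disco_group_words:
  assumes "X \<in> disco_group"
  shows "\<exists>M f. X = {M, - M} \<and> det M = 1 \<and> f \<in> shear_words \<and> matrix_acts M f"
proof -
  let ?P = "\<lambda>X. \<exists>M f. X = {M, - M} \<and> det M = 1 \<and> f \<in> shear_words \<and> matrix_acts M f"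
  have gens: "psl_class (vector [vector [1, 6], vector [0, 1]]) = {hmat 1, - hmat 1}"
    "psl_class (vector [vector [1, 0], vector [3/2, 1]]) = {vmat 1, - vmat 1}"
    by (simp_all add: psl_class_eq hmat_def vmat_def)
  have w: "hshear m \<in> shear_words" "vshear m \<in> shear_words" for m
  proof -
    from shear_words_step[OF shear_word_Nil, of True m] shear_words_step[OF shear_word_Nil, of False m]
    show "hshear m \<in> shear_words" "vshear m \<in> shear_words" by simp_all
  qed
  have h: "?P {hmat m, - hmat m}" and v: "?P {vmat m, - vmat m}" for m
    using w hmat_acts vmat_acts det_hmat det_vmat by blast+
  from assms[unfolded disco_group_def gens] show ?thesis
  proof (induction rule: generate.induct)
    case one
    have "matrix_acts (mat 1) (shear_word True [])" by (simp add: matrix_acts_def)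
    then show ?case unfolding one_PSL2 using shear_word_Nil det_I by blast
  next
    case (incl X)
    then show ?case using h[of 1] v[of 1] by blast
  next
    case (inv X)
    have "inv\<^bsub>PSL2\<^esub> {hmat 1, - hmat 1} = {hmat (- 1), - hmat (- 1)}"
      by (rule inv_PSL2) (use hmat_inverse[of 1] hmat_inverse[of "-1"] in \<open>simp_all add: det_hmat\<close>)
    moreover have "inv\<^bsub>PSL2\<^esub> {vmat 1, - vmat 1} = {vmat (- 1), - vmat (- 1)}"
      by (rule inv_PSL2) (use vmat_inverse[of 1] vmat_inverse[of "-1"] in \<open>simp_all add: det_vmat\<close>)
    ultimately show ?case using inv h[of "-1"] v[of "-1"] by auto
  next
    case (eng X Y)
    then obtain M f N g where *: "X = {M, - M}" "det M = 1" "f \<in> shear_words" "matrix_acts M f"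
      "Y = {N, - N}" "det N = 1" "g \<in> shear_words" "matrix_acts N g" by blast
    then have "(\<lambda>z. f (g z)) \<in> shear_words" using shear_words_compose[OF *(7)] unfolding shear_words_def
        by auto
    moreover have "det (M ** N) = 1" using * by (simp add: det_mul)
    ultimately show ?case unfolding *(1,5) mult_PSL2 using matrix_acts_mult[OF *(4,8)] by blast
  qed
qed

lemma disco_group_gens: "{hmat 1, - hmat 1} \<in> disco_group" "{vmat 1, - vmat 1} \<in> disco_group"
  unfolding disco_group_def by (auto intro!: generate.incl simp: psl_class_eq hmat_def vmat_def)

lemma span_singleton_eq_iff:
  fixes v w :: "'a::real_vector"
  assumes "span {v} = span {w}" "w \<noteq> 0"
  obtains r where "r \<noteq> 0" "v = r *\<^sub>R w"
proof -
  have "v \<in> span {w}" using assms(1) span_base[of v "{v}"] by simp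
  then obtain r where r: "v = r *\<^sub>R w" by (auto simp: span_singleton)
  have "r \<noteq> 0"
  proof
    assume "r = 0"
    then have "span {w} = {0}" using assms(1) r by simp
    then show False using assms(2) span_base[of w "{w}"] by simp
  qed
  with r show ?thesis using that by blast
qed

text \<open>Determinant 1 and trace 2 or -2 leave only the eigenvalues 1 and -1, so the word of a
  parabolic element fixes the vector \<theta> up to sign, not merely its line. The word is nonempty
  because a parabolic element is not the identity.\<close>

lemma parabolic_direction_periodic:
  assumes X: "X \<in> disco_group" "parabolic X" "fixes_line X (direction_line \<theta>)" and \<theta>: "\<theta> \<noteq> 0"
  shows "totally_periodic \<theta>"
proof -
  obtain M f where M: "X = {M, - M}" "det M = 1" "f \<in> shear_words" "matrix_acts M f"
    using disco_group_words[OF X(1)] by blast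
  from M(3) obtain s ms where f: "f = shear_word s ms" "0 \<notin> set ms" unfolding shear_words_def by blast
  have "ms \<noteq> []"
  proof
    assume "ms = []"
    then have "f = (\<lambda>z. z)" using f by (simp add: fun_eq_iff)
    then have "M = mat 1"
      using matrix_actsD[OF M(4)] by (simp add: vec_eq_iff forall_2 mat_def)
    then show False using X(2) M(1) unfolding parabolic_def one_PSL2 by blast
  qed
  have "trace (- M) = - trace M" by (simp add: trace_def sum_negf)
  then have tr: "\<bar>trace M\<bar> = 2" using X(2) M(1) unfolding parabolic_def by auto
  obtain N where N: "N \<in> X" "(\<lambda>v. N *v v) ` direction_line \<theta> = direction_line \<theta>"
    using X(3) unfolding fixes_line_def by blast
  have "cvec \<theta> \<in> direction_line \<theta>" by (simp add: direction_line_cvec span_base)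
  then have "N *v cvec \<theta> \<in> direction_line \<theta>" using N(2) by blast
  moreover have "M = N \<or> M = - N" using N(1) M(1) by auto
  moreover have "(- N) *v v = - (N *v v)" for v :: "real^2"
    by (simp add: vec_eq_iff matrix_vector_mult_def sum_negf)
  ultimately have "M *v cvec \<theta> \<in> direction_line \<theta>"
    unfolding direction_line_cvec by (auto intro: span_neg)
  then obtain k where "M *v cvec \<theta> = k *\<^sub>R cvec \<theta>"
    unfolding direction_line_cvec by (auto simp: span_singleton)
  then have fk: "cvec (f \<theta>) = k *\<^sub>R cvec \<theta>" and mk: "M *v cvec \<theta> = k *\<^sub>R cvec \<theta>"
    using M(4) by (simp_all add: matrix_acts_def)
  define a b c d x y where "a = M$1$1" and "b = M$1$2" and "c = M$2$1" and "d = M$2$2" and "x = Re \<theta>"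
      and "y = Im \<theta>"
  have "(M *v cvec \<theta>) $ 1 = k * x" "(M *v cvec \<theta>) $ 2 = k * y" unfolding mk by (simp_all add: x_def y_def)
  then have e: "a * x + b * y = k * x" "c * x + d * y = k * y"
    by (simp_all add: matrix_vector_mult_def sum_2 a_def b_def c_def d_def x_def y_def)
  have dt: "a * d - b * c = 1" using M(2) by (simp add: det_2 a_def b_def c_def d_def)
  have tr2: "\<bar>a + d\<bar> = 2" using tr by (simp add: trace_def sum_2 a_def d_def)
  have "x \<noteq> 0 \<or> y \<noteq> 0" using \<theta> by (auto simp: x_def y_def complex_eq_iff)
  \<comment> \<open>The characteristic polynomial evaluated at the eigenvalue k; for trace 2 or -2
    it is a perfect square.\<close>
  have "(k * k - (a + d) * k + 1) * x = 0" "(k * k - (a + d) * k + 1) * y = 0"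
    using e dt by algebra+
  then have "k * k - (a + d) * k + 1 = 0" using \<open>x \<noteq> 0 \<or> y \<noteq> 0\<close> by auto
  moreover have "a + d = 2 \<or> a + d = - 2" using tr2 by linarith
  ultimately have "k * k - 2 * k + 1 = 0 \<or> k * k - (- 2) * k + 1 = 0" by (elim disjE) simp_all
  then have "(k - 1) * (k - 1) = 0 \<or> (k + 1) * (k + 1) = 0" by (simp add: algebra_simps)
  then have "k = 1 \<or> k = - 1" by auto
  moreover have "Re (f \<theta>) = k * Re \<theta>" "Im (f \<theta>) = k * Im \<theta>"
    using arg_cong[OF fk, of "\<lambda>v. v $ 1"] arg_cong[OF fk, of "\<lambda>v. v $ 2"] by simp_all
  ultimately have "f \<theta> = \<theta> \<or> f \<theta> = - \<theta>" by (auto simp: complex_eq_iff)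
  then show ?thesis using shear_word_fixed_periodic[OF \<theta> f(2) \<open>ms \<noteq> []\<close>] f(1) by simp
qed

text \<open>A point \<open>z = M z0\<close> near the real line has \<open>c z0 + d\<close> large, so \<open>c\<close> or \<open>d\<close> is large, and \<open>z\<close> is close to
  \<open>a / c = M \<infinity>\<close> or to \<open>b / d = M 0\<close>.\<close>

lemma moebius_near_cusp:
  fixes a b c d x0 e :: real
  assumes z0: "Im z0 > 0" and det: "a * d - b * c = 1"
    and z: "z = (of_real a * z0 + of_real b) / (of_real c * z0 + of_real d)"
        and near: "dist z (of_real x0) < e"
  shows "(c \<noteq> 0 \<and> \<bar>a / c - x0\<bar> < e * (1 + 2 * norm z0 / Im z0)) \<or>
      (d \<noteq> 0 \<and> \<bar>b / d - x0\<bar> < e * (1 + 2 * norm z0 / Im z0))"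
proof -
  let ?D = "of_real c * z0 + of_real d"
  define N where "N = norm ?D"
  have "c \<noteq> 0 \<or> d \<noteq> 0" using det by auto
  then have D0: "?D \<noteq> 0" using z0 by (auto simp: complex_eq_iff)
  then have N: "N > 0" by (simp add: N_def)
  have z00: "norm z0 > 0" using z0 by auto
  have N2: "N\<^sup>2 = (c * Re z0 + d)\<^sup>2 + (c * Im z0)\<^sup>2" by (simp add: N_def cmod_power2)
  have "Im z = ((a * Im z0) * (c * Re z0 + d) - (a * Re z0 + b) * (c * Im z0)) / N\<^sup>2"
    unfolding z Im_divide N2 by simp
  also have "(a * Im z0) * (c * Re z0 + d) - (a * Re z0 + b) * (c * Im z0) = (a * d - b * c) * Im z0"
    by (simp add: algebra_simps)
  finally have "Im z = Im z0 / N\<^sup>2" using det by simp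
  moreover have "Im z < e" using near abs_Im_le_cmod[of "z - of_real x0"] by (simp add: dist_norm)
  ultimately have "Im z0 / N\<^sup>2 < e" by simp
  then have inv: "1 / N\<^sup>2 < e / Im z0" using z0 N by (simp add: field_simps)
  have bound: "dist z (of_real q) < e * (2 * norm z0 / Im z0)"
      if "dist z (of_real q) \<le> 2 * norm z0 * (1 / N\<^sup>2)" for q
  proof -
    have "2 * norm z0 * (1 / N\<^sup>2) < 2 * norm z0 * (e / Im z0)" using inv z00
        by (intro mult_strict_left_mono) auto
    with that show ?thesis by (simp add: mult_ac)
  qed
  have fin: "\<bar>q - x0\<bar> < e * (1 + 2 * norm z0 / Im z0)" if "dist z (of_real q) \<le> 2 * norm z0 * (1 / N\<^sup>2)"
      for q
  proof -
    have "dist (of_real q :: complex) (of_real x0) \<le> dist z (of_real q) + dist z (of_real x0)"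
      using dist_triangle3 by (metis dist_commute)
    moreover have "dist (of_real q :: complex) (of_real x0) = \<bar>q - x0\<bar>"
      by (simp add: dist_norm flip: of_real_diff)
    ultimately show ?thesis using bound[OF that] near by (simp add: distrib_left)
  qed
  have "N \<le> \<bar>c\<bar> * norm z0 + \<bar>d\<bar>"
    unfolding N_def using norm_triangle_ineq[of "of_real c * z0" "of_real d"] by (simp add: norm_mult)
  \<comment> \<open>One of the two summands carries at least half of N, which decides between the
    images of infinity and 0.\<close>
  then consider "N / 2 \<le> \<bar>c\<bar> * norm z0" | "N / 2 \<le> \<bar>d\<bar>" by linarith
  then show ?thesis
  proof cases
    case 1
    then have c: "c \<noteq> 0" "\<bar>c\<bar> * norm z0 > 0" using N by auto
    \<comment> \<open>By the determinant this difference is -1/(c D) with D the denominator; as |c|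
      is at least N/(2 |z0|), the error is at most 2 |z0|/N^2, which is comparable to the height of
      z.\<close>
    have "z - of_real (a / c) = (of_real c * (of_real a * z0 + of_real b) - of_real a * ?D) / (of_real c *
        ?D)"
      unfolding z using c D0 by (simp add: diff_frac_eq mult_ac)
    also have "of_real c * (of_real a * z0 + of_real b) - of_real a * ?D = - of_real (a * d - b * c)"
      by (simp add: algebra_simps)
    finally have "dist z (of_real (a / c)) = 1 / (\<bar>c\<bar> * N)"
      unfolding det by (simp add: dist_norm norm_divide norm_mult N_def)
    also have "\<dots> = norm z0 / (\<bar>c\<bar> * norm z0 * N)" using z00 by simp
    also have "\<dots> \<le> norm z0 / (N / 2 * N)"
      using 1 N z00 by (intro divide_left_mono mult_right_mono) (auto intro!: mult_pos_pos c)
    also have "\<dots> = 2 * norm z0 * (1 / N\<^sup>2)" by (simp add: power2_eq_square)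
    finally show ?thesis using fin c by blast
  next
    case 2
    then have d: "d \<noteq> 0" using N by auto
    have "z - of_real (b / d) = (of_real d * (of_real a * z0 + of_real b) - of_real b * ?D) / (of_real d *
        ?D)"
      unfolding z using d D0 by (simp add: diff_frac_eq mult_ac)
    also have "of_real d * (of_real a * z0 + of_real b) - of_real b * ?D = of_real (a * d - b * c) * z0"
      by (simp add: algebra_simps)
    finally have "dist z (of_real (b / d)) = norm z0 / (\<bar>d\<bar> * N)"
      unfolding det by (simp add: dist_norm norm_divide norm_mult N_def)
    also have "\<dots> \<le> norm z0 / (N / 2 * N)"
      using 2 N z00 by (intro divide_left_mono mult_right_mono) (auto intro!: mult_pos_pos simp: d)
    also have "\<dots> = 2 * norm z0 * (1 / N\<^sup>2)" by (simp add: power2_eq_square)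
    finally show ?thesis using fin d by blast
  qed
qed

text \<open>Translates closeness of boundary points x/y into the form of perturbation produced by
  the holonomy argument, where a nearby direction is
  \<open>(of_real l + \<i> * of_real \<sigma>) * \<theta>\<close>.\<close>

lemma direction_perturbation:
  assumes "Im \<theta> \<noteq> 0" "l > 0" "\<sigma>0 > 0"
  shows "\<exists>\<xi>>0. \<forall>x r. \<bar>x - Re \<theta> / Im \<theta>\<bar> < \<xi> \<longrightarrow> r \<noteq> 0 \<longrightarrow>
    (\<exists>\<sigma> k. \<bar>\<sigma>\<bar> < \<sigma>0 \<and> k \<noteq> 0 \<and> (of_real l + \<i> * of_real \<sigma>) * \<theta> = of_real k * (of_real r * (of_real x + \<i>)))"
proof -
  define x0 where "x0 = Re \<theta> / Im \<theta>"
  have \<theta>: "\<theta> = of_real (Im \<theta>) * (of_real x0 + \<i>)" using assms(1) by (simp add: x0_def complex_eq_iff)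
  \<comment> \<open>The first bound keeps p above 1/2; then \<sigma> is at most 2 l |\<delta>| in
    size, which the second bound puts below \<sigma>0.\<close>
  define \<xi> where "\<xi> = min (1 / (2 * (\<bar>x0\<bar> + 1))) (\<sigma>0 / (2 * l))"
  have \<xi>: "\<xi> > 0" using assms by (simp add: \<xi>_def)
  show ?thesis
  proof (rule exI[of _ \<xi>], intro conjI \<xi> allI impI)
    fix x r :: real assume x: "\<bar>x - Re \<theta> / Im \<theta>\<bar> < \<xi>" and r: "r \<noteq> 0"
    define \<delta> where "\<delta> = x - x0"
    have \<delta>: "\<bar>\<delta>\<bar> < 1 / (2 * (\<bar>x0\<bar> + 1))" "\<bar>\<delta>\<bar> < \<sigma>0 / (2 * l)" using x by (simp_all add: \<delta>_def \<xi>_def x0_def)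
    define p where "p = 1 + x * x0"
    have "\<bar>\<delta>\<bar> * (2 * (\<bar>x0\<bar> + 1)) < 1" using \<delta>(1) by (simp add: field_simps)
    then have "2 * (\<bar>\<delta>\<bar> * \<bar>x0\<bar>) < 1" by (simp add: algebra_simps)
    moreover have "\<bar>\<delta> * x0\<bar> = \<bar>\<delta>\<bar> * \<bar>x0\<bar>" by (rule abs_mult)
    ultimately have "- 1 < 2 * (\<delta> * x0)" by linarith
    moreover have "p = 1 + x0 * x0 + \<delta> * x0" by (simp add: p_def \<delta>_def algebra_simps)
    moreover have "0 \<le> x0 * x0" by simp
    ultimately have p: "p > 1/2" by linarith
    \<comment> \<open>\<sigma>/l is the tangent of the angle from the line of \<theta> to that of
      (x, 1), namely (x0 - x)/(1 + x x0).\<close>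
    define \<sigma> where "\<sigma> = - (l * \<delta> / p)"
    have "\<bar>\<sigma>\<bar> = l * \<bar>\<delta>\<bar> / p" using p assms by (simp add: \<sigma>_def abs_mult)
    also have "\<dots> \<le> l * \<bar>\<delta>\<bar> / (1/2)" using p assms by (intro divide_left_mono) auto
    also have "\<dots> < \<sigma>0" using \<delta>(2) assms by (simp add: field_simps)
    finally have \<sigma>: "\<bar>\<sigma>\<bar> < \<sigma>0" .
    define k where "k = l * Im \<theta> * (1 + x0 * x0) / (p * r)"
    have "1 + x0 * x0 > 0" by (simp add: add_pos_nonneg)
    then have k: "k \<noteq> 0" using assms p r by (simp add: k_def)
    have kr: "k * r = l * Im \<theta> * (1 + x0 * x0) / p" using r by (simp add: k_def)
    have "Re ((of_real l + \<i> * of_real \<sigma>) * (of_real x0 + \<i>)) * p = l * (1 + x0 * x0) * x"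
      using p by (simp add: \<sigma>_def left_diff_distrib distrib_right) (simp add: p_def \<delta>_def algebra_simps)
    then have re: "Re ((of_real l + \<i> * of_real \<sigma>) * (of_real x0 + \<i>)) = l * (1 + x0 * x0) / p * x"
      using p by (simp add: field_simps)
    have "Im ((of_real l + \<i> * of_real \<sigma>) * (of_real x0 + \<i>)) * p = l * (1 + x0 * x0)"
      using p by (simp add: \<sigma>_def left_diff_distrib distrib_right) (simp add: p_def \<delta>_def algebra_simps)
    then have im: "Im ((of_real l + \<i> * of_real \<sigma>) * (of_real x0 + \<i>)) = l * (1 + x0 * x0) / p"
      using p by (simp add: field_simps)
    have "(of_real l + \<i> * of_real \<sigma>) * (of_real x0 + \<i>) =
        of_real (l * (1 + x0 * x0) / p) * (of_real x + \<i>)"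
      by (rule complex_eqI; subst re im; simp)
    then have "(of_real l + \<i> * of_real \<sigma>) * \<theta> = of_real (k * r) * (of_real x + \<i>)"
      unfolding kr by (subst \<theta>) (simp add: mult_ac)
    then show "\<exists>\<sigma> k. \<bar>\<sigma>\<bar> < \<sigma>0 \<and> k \<noteq> 0 \<and> (of_real l + \<i> * of_real \<sigma>) * \<theta> =
        of_real k * (of_real r * (of_real x + \<i>))"
      using \<sigma> k by (intro exI[of _ \<sigma>] exI[of _ k]) (simp add: mult.assoc)
  qed
qed

text \<open>Orbit points near the boundary point of \<theta> are exchanged for cusps by
  \<open>moebius_near_cusp\<close>. The cusps are images of the two base directions under a word, so
  no fixed points of group elements have to be located.\<close>

lemma limit_direction_not_trivial:
  assumes z0: "Im z0 > 0" and \<theta>: "\<theta> \<noteq> 0" "direction_line \<theta> \<in> nonparabolic_limit_set disco_group z0"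
  shows "\<not> dynamically_trivial \<theta>"
proof
  assume "dynamically_trivial \<theta>"
  then obtain L d where "has_holonomy_derivative \<theta> L d" "d < 1"
    unfolding dynamically_trivial_def attracting_leaf_def by blast
  then obtain l \<sigma>0 where l: "l > 0" "\<sigma>0 > 0"
    and np: "\<And>\<sigma>. \<bar>\<sigma>\<bar> < \<sigma>0 \<Longrightarrow> \<not> totally_periodic ((of_real l + \<i> * of_real \<sigma>) * \<theta>)"
    using holonomy_not_periodic[OF \<theta>(1), of L d] by auto
  from \<theta>(2) obtain v where v: "direction_line \<theta> = span {v}" "v \<noteq> 0"
      and fr: "\<exists>\<^sub>F z in boundary_filter v. z \<in> hyp_orbit disco_group z0"
      and npar: "\<And>X. X \<in> disco_group \<Longrightarrow> parabolic X \<Longrightarrow> \<not> fixes_line X (direction_line \<theta>)"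
    unfolding nonparabolic_limit_set_def limit_set_def by blast
  have "cvec \<theta> \<noteq> 0" using \<theta>(1) by (auto simp: vec_eq_iff forall_2 complex_eq_iff)
  then obtain r where r: "r \<noteq> 0" "v = r *\<^sub>R cvec \<theta>"
    by (rule span_singleton_eq_iff[OF v(1)[symmetric, unfolded direction_line_cvec]])
  \<comment> \<open>The horizontal line is fixed by the parabolic class of \<open>hmat 1\<close>; so
    \<theta> is not horizontal and its boundary point is finite.\<close>
  have Im: "Im \<theta> \<noteq> 0"
  proof
    assume 0: "Im \<theta> = 0"
    have "parabolic {hmat 1, - hmat 1}"
      unfolding parabolic_def
    proof (intro conjI)
      show "{hmat 1, - hmat 1} \<in> carrier PSL2" using det_hmat by (auto simp: carrier_PSL2)
      have "hmat 1 $ 1 $ 2 = 6" "(mat 1 :: real^2^2) $ 1 $ 2 = 0" "(- mat 1 :: real^2^2) $ 1 $ 2 = 0"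
        by (simp_all add: hmat_def mat_def)
      then have "hmat 1 \<noteq> mat 1" "hmat 1 \<noteq> - mat 1" by (metis zero_neq_numeral)+
      then show "{hmat 1, - hmat 1} \<noteq> \<one>\<^bsub>PSL2\<^esub>" unfolding one_PSL2 by blast
      show "\<exists>M\<in>{hmat 1, - hmat 1}. \<bar>trace M\<bar> = 2" by (simp add: trace_def sum_2 hmat_def)
    qed
    moreover have "fixes_line {hmat 1, - hmat 1} (direction_line \<theta>)"
      unfolding fixes_line_def
    proof (intro bexI)
      have fixp: "hmat 1 *v w = w" if w: "w \<in> direction_line \<theta>" for w
      proof -
        from w obtain k where "w = k *\<^sub>R cvec \<theta>" by (auto simp: direction_line_cvec span_singleton)
        then show ?thesis
          using 0 by (simp add: vec_eq_iff forall_2 matrix_vector_mult_def sum_2 hmat_def)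
      qed
      show "(\<lambda>v. hmat 1 *v v) ` direction_line \<theta> = direction_line \<theta>"
        using fixp by (simp add: image_cong)
    qed simp
    ultimately show False using npar disco_group_gens by blast
  qed
  obtain \<xi> where \<xi>: "\<xi> > 0" "\<And>x r. \<bar>x - Re \<theta> / Im \<theta>\<bar> < \<xi> \<Longrightarrow> r \<noteq> 0 \<Longrightarrow>
    \<exists>\<sigma> k. \<bar>\<sigma>\<bar> < \<sigma>0 \<and> k \<noteq> 0 \<and> (of_real l + \<i> * of_real \<sigma>) * \<theta> = of_real k * (of_real r * (of_real x + \<i>))"
    using direction_perturbation[OF Im l] by blast
  \<comment> \<open>Compensates the factor lost in passing from the orbit point to a cusp.\<close>
  define e where "e = \<xi> / (1 + 2 * norm z0 / Im z0)"
  have K: "1 + 2 * norm z0 / Im z0 > 0" using z0 by (simp add: add_pos_nonneg)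
  then have e: "e > 0" "e * (1 + 2 * norm z0 / Im z0) = \<xi>" using \<xi> by (simp_all add: e_def)
  have "v $ 2 \<noteq> 0" "v $ 1 / v $ 2 = Re \<theta> / Im \<theta>" using r Im by simp_all
  then have "\<exists>\<^sub>F z in at (of_real (Re \<theta> / Im \<theta>)). z \<in> hyp_orbit disco_group z0"
    using fr unfolding boundary_filter_def by (simp only: if_False)
  then obtain z where z: "z \<in> hyp_orbit disco_group z0" "dist z (of_real (Re \<theta> / Im \<theta>)) < e"
    unfolding frequently_at using e(1) by blast
  then obtain M' X where M': "z = moebius M' z0" "X \<in> disco_group" "M' \<in> X" unfolding hyp_orbit_def by blast
  obtain M f where M: "X = {M, - M}" "det M = 1" "f \<in> shear_words" "matrix_acts M f"
    using disco_group_words[OF M'(2)] by blast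
  from M(3) obtain s ms where f: "f = shear_word s ms" unfolding shear_words_def by blast
  have "moebius (- M) z0 = moebius M z0"
  proof -
    have "- p * z0 + - q = - (p * z0 + q)" for p q :: complex by simp
    then show ?thesis unfolding moebius_def
        by (simp only: vector_uminus_component of_real_minus minus_divide_divide)
  qed
  then have zM: "z = moebius M z0" using M' M(1) by auto
  define a b c d where "a = M$1$1" and "b = M$1$2" and "c = M$2$1" and "d = M$2$2"
  have abcd: "f 1 = Complex a c" "f \<i> = Complex b d"
    using matrix_actsD[OF M(4)] by (simp_all add: complex_eq_iff a_def b_def c_def d_def)
  have tp: "totally_periodic (f 1)" "totally_periodic (f \<i>)" "f 1 \<noteq> 0" "f \<i> \<noteq> 0"
    unfolding f using totally_periodic_shear_word[of 1 s ms] totally_periodic_shear_word[of \<i> s ms]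
      totally_periodic_horizontal totally_periodic_vertical by simp_all
  \<comment> \<open>A line this close to that of \<theta> is a real multiple of one of the
    directions already known not to be totally periodic.\<close>
  have contra: False if asm: "r \<noteq> 0" "\<bar>p / r - Re \<theta> / Im \<theta>\<bar> < \<xi>" "totally_periodic (Complex p r)" for p r
  proof -
    obtain \<sigma> k where \<sigma>: "\<bar>\<sigma>\<bar> < \<sigma>0" "k \<noteq> 0"
        "(of_real l + \<i> * of_real \<sigma>) * \<theta> = of_real k * (of_real r * (of_real (p / r) + \<i>))"
      using \<xi>(2)[OF asm(2,1)] by blast
    have "of_real r * (of_real (p / r) + \<i>) = Complex p r" using asm(1) by (simp add: complex_eq_iff)
    moreover have "Complex p r \<noteq> 0" using asm(1) by (simp add: complex_eq_iff)
    ultimately have "totally_periodic ((of_real l + \<i> * of_real \<sigma>) * \<theta>)"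
      unfolding \<sigma>(3) using totally_periodic_real_scale[OF asm(3) _ \<sigma>(2)] by simp
    then show False using np[OF \<sigma>(1)] by blast
  qed
  \<comment> \<open>The cusps a/c and b/d are the lines of \<open>f 1\<close> and
    \<open>f \<i>\<close>, the images of the horizontal and the vertical direction.\<close>
  have "(c \<noteq> 0 \<and> \<bar>a / c - Re \<theta> / Im \<theta>\<bar> < e * (1 + 2 * norm z0 / Im z0)) \<or>
      (d \<noteq> 0 \<and> \<bar>b / d - Re \<theta> / Im \<theta>\<bar> < e * (1 + 2 * norm z0 / Im z0))"
    by (rule moebius_near_cusp[OF z0 _ _ z(2)])
      (use M(2) zM in \<open>simp_all add: det_2 moebius_def a_def b_def c_def d_def\<close>)
  then show False using contra tp(1,2) unfolding e(2) abcd by blast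
qed

theorem theorem4:
  fixes z0 :: complex
  assumes "Im z0 > 0"
  shows "(\<forall>\<theta>. norm \<theta> = 1 \<and> direction_line \<theta> \<in> nonparabolic_limit_set disco_group z0 \<longrightarrow>
            \<not> dynamically_trivial \<theta>) \<and>
         (\<forall>\<theta>. norm \<theta> = 1 \<and>
            direction_line \<theta> \<in> limit_set disco_group z0 - nonparabolic_limit_set disco_group z0 \<longrightarrow>
            totally_periodic \<theta>)"
proof (intro conjI allI impI)
  fix \<theta> assume "norm \<theta> = 1 \<and> direction_line \<theta> \<in> nonparabolic_limit_set disco_group z0"
  then show "\<not> dynamically_trivial \<theta>" using limit_direction_not_trivial[OF assms, of \<theta>] by fastforce
next
  fix \<theta> assume "norm \<theta> = 1 \<and> direction_line \<theta> \<in>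
      limit_set disco_group z0 - nonparabolic_limit_set disco_group z0"
  then obtain X where "X \<in> disco_group" "parabolic X" "fixes_line X (direction_line \<theta>)" "\<theta> \<noteq> 0"
    unfolding nonparabolic_limit_set_def by fastforce
  then show "totally_periodic \<theta>" by (rule parabolic_direction_periodic)
qed

end
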